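(* For each of the three Problem Classes $n=1,2,3$ described in the context, let $y$ be the corresponding remainder function, let $Y$ be the solution of the finite difference scheme on the mesh $\bar Q_n^{N,M}$, and let $\bar Y$ be the global approximation on $\bar Q$ generated from the values of $Y$ on $\bar Q_n^{N,M}$ by bilinear interpolation. Then there is a constant $C$, independent of $\varepsilon$, $N$ and $M$, such that $$\|y-\bar Y\|_{\bar Q}\le\left(CN^{-2}\ln^2N+CM^{-1}\right)\ln M .$$
   Context: Let $T>0$, $Q:=(0,1)\times(0,T]$, and let $0<\varepsilon\le1$ be the singular perturbation parameter. $\|\cdot\|_D$ is the $L_\infty$ norm on $D$. The space $C^{n+\gamma}(\bar Q)$ ($\gamma>0$) is the set of functions $z$ with $\partial^{i+j}z/\partial x^i\partial t^j$ Hölder continuous of degree $\gamma$ on $\bar Q$ for all $0\le i+2j\le n$. Let $Lz:=z_t-\varepsilon z_{xx}+b(t)z$, where $b$ depends only on $t$ and $b(t)\ge0$ for all $t\ge0$. Let $\operatorname{erf}(z)=\frac{2}{\sqrt\pi}\int_0^ze^{-r^2}\,dr$ and $s(x,t):=e^{-b(0)t}\operatorname{erf}\left(\frac{x}{2\sqrt{\varepsilon t}}\right)$ (with $s(x,0)=-1,0,1$ for $x<0$, $x=0$, $x>0$). In all classes $f,b\in C^{4+\gamma}(\bar Q)$. Problem Class 1 (incompatible boundary-initial data). $Lu=f$ in $Q$, $u(0,t)=u(1,t)=0$ for $t\ge0$, $u(x,0)=\phi(x)$ for $0<x<1$, with $\phi\in C^4(0,1)$, $\phi(0^+)\ne0$,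 $\phi(1)=0$, $f(1,0)=-\varepsilon\phi''(1^-)$, $-\varepsilon\phi^{(iv)}(1^-)+b(0)\phi''(1^-)=(f_t+f_{xx})(1,0)$, $f(0,0)=-\varepsilon\phi''(0^+)$. The remainder $y:=u-\phi(0^+)s$ is the solution of $Ly=F:=f-(b(t)-b(0))\phi(0^+)s$ in $Q$, $y(0,t)=0$, $y(1,t)=-\phi(0^+)s(1,t)$, $y(x,0)=\phi(x)-\phi(0^+)$. Problem Class 2 (discontinuous initial condition). Let $0<d<1$. $Lu=f$ in $Q$, $u(0,t)=u(1,t)=0$ for $t\ge0$, $u(x,0)=\phi(x)$ for $0<x<1$, with $\phi\in C^4((0,1)\setminus\{d\})$, $\phi(0)=\phi(1)=0$, $\phi(d^-)\ne\phi(d^+)$, $\phi'(d^-)=\phi'(d^+)$, $\phi''(d^-)=\phi''(d^+)$, $f(0,0)=-\varepsilon\phi''(0^+)$, $-\varepsilon\phi^{(iv)}(0^+)+b(0)\phi''(0^+)=(f_t+f_{xx})(0,0)$, $f(1,0)=-\varepsilon\phi''(1^-)$, $-\varepsilon\phi^{(iv)}(1^-)+b(0)\phi''(1^-)=(f_t+f_{xx})(1,0)$. With $[\phi](d):=\phi(d^+)-\phi(d^-)$, the remainder $y:=u-\frac{[\phi](d)}2s(x-d,t)$ is the solution of $Ly=F:=f-(b(t)-b(0))\frac{[\phi](d)}2s(x-d,t)$ in $Q$, $y(0,t)=-\frac{[\phi](d)}2s(-d,t)$, $y(1,t)=-\frac{[\phi](d)}2s(1-d,t)$, $y(x,0)=\phi(x)-\frac{[\phi](d)}2s(x-d,0)$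 for $x\ne d$, $y(d,0)=\frac12(\phi(d^+)+\phi(d^-))$. Problem Class 3 (discontinuous boundary data). Let $0<d<T$. $Lu=f$ in $Q$, $u(1,t)=0$ for $t\ge0$, $u(x,0)=0$ for $0<x<1$, $u(0,t)=\phi_1(t)$ for $0\le t\le d$ and $u(0,t)=\phi_2(t)$ for $d<t\le T$, with $\phi_1\in C^2(0,d)$, $\phi_2\in C^2(d,T)$, $\phi_1(d^-)\ne\phi_2(d^+)$, $\phi_1'(d^-)=\phi_2'(d^+)$, $\phi_1(0)=0$, $f(0,0)=\phi_1'(0^+)$, $(f_t+f_{xx})(0,0)=\phi_1''(0^+)+b(0)\phi_1'(0^+)$, $f(1,0)=(f_t+f_{xx})(1,0)=0$. Put $[\phi](d):=\phi_2(d^+)-\phi_1(d^-)$, $H(x)=0$ for $x<0$ and $H(x)=1$ for $x\ge0$, and $cs(x,t):=1-s(x,t)$, with $cs(x,0)=0$. The remainder $y$, given by $u=[\phi](d)H(t-d)cs(x,t-d)+y$, is the solution of $Ly=F:=f+(b(d)-b(t))[\phi](d)H(t-d)cs(x,t-d)$ in $Q$, $y(1,t)=-[\phi](d)H(t-d)cs(1,t-d)$ for $t\ge0$, $y(x,0)=\phi(x)$ for $0<x<1$ (where $\phi\equiv0$ is the initial value of $u$), $y(0,t)=u(0,t)-[\phi](d)H(t-d)$. Meshes. $\bar Q_n^{N,M}$ is the tensor product of a spatial mesh $0=x_0<\dots<x_N=1$ and the uniform time mesh $t_j=jT/M$, $0\le j\le M$; $Q_n^{N,M}=\bar Q_n^{N,M}\cap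 Q$ and $\partial Q_n^{N,M}=\bar Q_n^{N,M}\setminus Q_n^{N,M}$. Fix $0<\mu<1$. For $n=1$ and $n=3$: $[0,1]=[0,\sigma]\cup[\sigma,1-\sigma]\cup[1-\sigma,1]$ with $\sigma:=\min\left\{\frac14,\frac4\mu\sqrt{\varepsilon T}\ln N\right\}$, and $N/4,N/2,N/4$ grid points are uniformly distributed in the respective subintervals. For $n=2$: $[0,1]=[0,\tau]\cup[\tau,d-\tau]\cup[d-\tau,d+\tau]\cup[d+\tau,1-\tau]\cup[1-\tau,1]$ with $\tau:=\min\left\{\frac18,\frac4\mu\sqrt{\varepsilon T}\ln N\right\}$, and $N/8,N/4,N/4,N/4,N/8$ grid points are uniformly distributed in the respective subintervals. Scheme. $Y$ is the mesh function on $\bar Q_n^{N,M}$ satisfying $$\left(-\varepsilon\delta_x^2+b(t_j)I+D_t^-\right)Y(x_i,t_j)=F(x_i,t_j),\ (x_i,t_j)\in Q_n^{N,M};\qquad Y(x_i,t_j)=y(x_i,t_j),\ (x_i,t_j)\in\partial Q_n^{N,M},$$ where $F$ is the right-hand side of the equation for $y$ given above for the class, and with $h_i=x_i-x_{i-1}$, $\hbar_i=(h_i+h_{i+1})/2$, $k=t_j-t_{j-1}=T/M$: $$D_x^-U(x_i,t_j)=\frac{U(x_i,t_j)-U(x_{i-1},t_j)}{h_i},\quad D_x^+U(x_i,t_j)=D_x^-U(x_{i+1},t_j),$$ $$\delta_x^2U(x_i,t_j)=\frac{(D_x^+-D_x^-)U(x_i,t_j)}{\hbar_i},\quad D_t^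-U(x_i,t_j)=\frac{U(x_i,t_j)-U(x_i,t_{j-1})}{k}.$$
   Formalization: Derivatives of φ, φ₁, φ₂ up to the stated order are assumed bounded; data may vary with ε within a fixed bound; in Class 3, y is only the solution of its displayed problem (inconsistent with u in general when b≠0), with y(0,d)=φ₁(d); M≥2. *)

theory Defs
  imports "HOL-Analysis.Analysis"
begin

section \<open>The domain and the function spaces\<close>

definition Qbar :: "real \<Rightarrow> (real \<times> real) set" where
  "Qbar T = {0..1} \<times> {0..T}"

text \<open>Extended-real valued, so that an unbounded function has norm \<open>\<infinity>\<close>.\<close>

definition sup_norm :: "'a set \<Rightarrow> ('a \<Rightarrow> real) \<Rightarrow> ereal" where
  "sup_norm D g = (SUP p\<in>D. ereal \<bar>g p\<bar>)"

text \<open>Partial derivatives on the closed rectangle, one-sided on its boundary;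
  \<open>pd T i j z\<close> is \<open>\<partial>\<^sup>i\<^sup>+\<^sup>jz / \<partial>x\<^sup>i\<partial>t\<^sup>j\<close>.\<close>

definition pdx :: "(real \<Rightarrow> real \<Rightarrow> real) \<Rightarrow> real \<Rightarrow> real \<Rightarrow> real" where
  "pdx z x t = vector_derivative (\<lambda>\<xi>. z \<xi> t) (at x within {0..1})"

definition pdt :: "real \<Rightarrow> (real \<Rightarrow> real \<Rightarrow> real) \<Rightarrow> real \<Rightarrow> real \<Rightarrow> real" where
  "pdt T z x t = vector_derivative (\<lambda>\<tau>. z x \<tau>) (at t within {0..T})"

definition pd :: "real \<Rightarrow> nat \<Rightarrow> nat \<Rightarrow> (real \<Rightarrow> real \<Rightarrow> real) \<Rightarrow> real \<Rightarrow> real \<Rightarrow> real" where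
  "pd T i j z = (pdx ^^ i) ((pdt T ^^ j) z)"

text \<open>\<open>holder_space T n \<gamma> K z\<close>: \<open>z\<close> belongs to \<open>C\<^sup>n\<^sup>+\<^sup>\<gamma>(Qbar T)\<close>, and \<open>K\<close> bounds
  the relevant derivatives and their Hoelder constants.  Membership alone is \<open>\<exists>K\<close>.\<close>

definition holder_space ::
    "real \<Rightarrow> nat \<Rightarrow> real \<Rightarrow> real \<Rightarrow> (real \<Rightarrow> real \<Rightarrow> real) \<Rightarrow> bool" where
  "holder_space T n \<gamma> K z \<longleftrightarrow>
     (\<forall>i j. Suc i + 2 * j \<le> n \<longrightarrow> (\<forall>(x, t)\<in>Qbar T.
        (\<lambda>\<xi>. pd T i j z \<xi> t) differentiable (at x within {0..1}))) \<and>
     (\<forall>j. 2 * Suc j \<le> n \<longrightarrow> (\<forall>(x, t)\<in>Qbar T.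
        (\<lambda>\<tau>. pd T 0 j z x \<tau>) differentiable (at t within {0..T}))) \<and>
     (\<forall>i j. i + 2 * j \<le> n \<longrightarrow> (\<forall>(x, t)\<in>Qbar T. \<bar>pd T i j z x t\<bar> \<le> K \<and>
        (\<forall>(x', t')\<in>Qbar T.
           \<bar>pd T i j z x t - pd T i j z x' t'\<bar> \<le> K * dist (x, t) (x', t') powr \<gamma>)))"

text \<open>\<open>C\<^sup>n\<close> on an open set \<open>A\<close>, with \<open>K\<close> bounding the derivatives up to order \<open>n\<close>.\<close>

definition Cn_space :: "nat \<Rightarrow> real set \<Rightarrow> real \<Rightarrow> (real \<Rightarrow> real) \<Rightarrow> bool" where
  "Cn_space n A K g \<longleftrightarrow>
     (\<forall>k<n. \<forall>x\<in>A. ((deriv ^^ k) g) field_differentiable (at x)) \<and>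
     (\<forall>k\<le>n. continuous_on A ((deriv ^^ k) g) \<and> (\<forall>x\<in>A. \<bar>(deriv ^^ k) g x\<bar> \<le> K))"

text \<open>\<open>rlim k g a\<close> is \<open>g\<^sup>(\<^sup>k\<^sup>)(a\<^sup>+)\<close> and \<open>llim k g a\<close> is \<open>g\<^sup>(\<^sup>k\<^sup>)(a\<^sup>-)\<close>; \<open>Lim\<close> is meaningful
  only if the limit exists, which is required separately through the \<open>has_\<close> versions.\<close>

definition rlim :: "nat \<Rightarrow> (real \<Rightarrow> real) \<Rightarrow> real \<Rightarrow> real" where
  "rlim k g a = Lim (at_right a) ((deriv ^^ k) g)"

definition llim :: "nat \<Rightarrow> (real \<Rightarrow> real) \<Rightarrow> real \<Rightarrow> real" where
  "llim k g a = Lim (at_left a) ((deriv ^^ k) g)"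

definition has_rlim :: "nat \<Rightarrow> (real \<Rightarrow> real) \<Rightarrow> real \<Rightarrow> bool" where
  "has_rlim k g a \<longleftrightarrow> (\<exists>l. (((deriv ^^ k) g) \<longlongrightarrow> l) (at_right a))"

definition has_llim :: "nat \<Rightarrow> (real \<Rightarrow> real) \<Rightarrow> real \<Rightarrow> bool" where
  "has_llim k g a \<longleftrightarrow> (\<exists>l. (((deriv ^^ k) g) \<longlongrightarrow> l) (at_left a))"

section \<open>The differential equation and the singular functions\<close>

definition solves_pde ::
    "real \<Rightarrow> real \<Rightarrow> (real \<Rightarrow> real) \<Rightarrow> (real \<Rightarrow> real \<Rightarrow> real) \<Rightarrow> (real \<Rightarrow> real \<Rightarrow> real) \<Rightarrow> bool" where
  "solves_pde T \<epsilon> b z F \<longleftrightarrow> (\<forall>x\<in>{0<..<1}. \<forall>t\<in>{0<..T}. \<exists>zt zx zxx.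
     ((\<lambda>\<tau>. z x \<tau>) has_real_derivative zt) (at t within {0..T}) \<and>
     (\<forall>\<xi>\<in>{0<..<1}. ((\<lambda>\<eta>. z \<eta> t) has_real_derivative zx \<xi>) (at \<xi>)) \<and>
     (zx has_real_derivative zxx) (at x) \<and>
     zt - \<epsilon> * zxx + b t * z x t = F x t)"

text \<open>The interval integral is oriented, so \<open>erf\<close> is also correct at negative arguments.\<close>

definition erf :: "real \<Rightarrow> real" where
  "erf z = 2 / sqrt pi * (LBINT r=0..z. exp (- (r\<^sup>2)))"

text \<open>Here and below \<open>b\<^sub>0\<close> stands for \<open>b(0)\<close>.\<close>

definition sing :: "real \<Rightarrow> real \<Rightarrow> real \<Rightarrow> real \<Rightarrow> real" where
  "sing \<epsilon> b\<^sub>0 x t =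
     (if t = 0 then sgn x else exp (- b\<^sub>0 * t) * erf (x / (2 * sqrt (\<epsilon> * t))))"

definition csing :: "real \<Rightarrow> real \<Rightarrow> real \<Rightarrow> real \<Rightarrow> real" where
  "csing \<epsilon> b\<^sub>0 x t = (if t = 0 then 0 else 1 - sing \<epsilon> b\<^sub>0 x t)"

definition Heav :: "real \<Rightarrow> real" where
  "Heav x = (if x < 0 then 0 else 1)"

section \<open>The three problem classes\<close>

text \<open>The compatibility conditions tie \<open>f\<close> and \<open>\<phi>\<close> to \<open>\<epsilon>\<close>, so the data may
  vary with \<open>\<epsilon>\<close>; the bound \<open>K\<close> on them does not.  For data that do not vary with \<open>\<epsilon>\<close>,
  the bound on \<open>f\<close> only says \<open>f \<in> C\<^sup>4\<^sup>+\<^sup>\<gamma>\<close>.\<close>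

definition problem_class1 ::
    "real \<Rightarrow> (real \<Rightarrow> real) \<Rightarrow> real \<Rightarrow> real \<Rightarrow> real \<Rightarrow> (real \<Rightarrow> real \<Rightarrow> real) \<Rightarrow> (real \<Rightarrow> real) \<Rightarrow> bool" where
  "problem_class1 T b \<gamma> K \<epsilon> f \<phi> \<longleftrightarrow>
     holder_space T 4 \<gamma> K f \<and> Cn_space 4 {0<..<1} K \<phi> \<and>
     has_rlim 0 \<phi> 0 \<and> has_rlim 2 \<phi> 0 \<and> has_llim 0 \<phi> 1 \<and> has_llim 2 \<phi> 1 \<and> has_llim 4 \<phi> 1 \<and>
     rlim 0 \<phi> 0 \<noteq> 0 \<and> llim 0 \<phi> 1 = 0 \<and>
     f 1 0 = - \<epsilon> * llim 2 \<phi> 1 \<and>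
     - \<epsilon> * llim 4 \<phi> 1 + b 0 * llim 2 \<phi> 1 = pd T 0 1 f 1 0 + pd T 2 0 f 1 0 \<and>
     f 0 0 = - \<epsilon> * rlim 2 \<phi> 0"

definition rhs1 ::
    "(real \<Rightarrow> real) \<Rightarrow> real \<Rightarrow> (real \<Rightarrow> real \<Rightarrow> real) \<Rightarrow> (real \<Rightarrow> real) \<Rightarrow> real \<Rightarrow> real \<Rightarrow> real" where
  "rhs1 b \<epsilon> f \<phi> x t = f x t - (b t - b 0) * rlim 0 \<phi> 0 * sing \<epsilon> (b 0) x t"

text \<open>\<open>u\<close> solves the original problem and \<open>y\<close> is its remainder.  The boundary and initial
  values of \<open>y\<close> are those of \<open>u\<close> minus those of the singular part; continuity of \<open>y\<close> up to
  the boundary selects the solution \<open>u\<close> of the problem with discontinuous data.\<close>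

definition remainder1 ::
    "real \<Rightarrow> (real \<Rightarrow> real) \<Rightarrow> real \<Rightarrow> (real \<Rightarrow> real \<Rightarrow> real) \<Rightarrow> (real \<Rightarrow> real) \<Rightarrow>
     (real \<Rightarrow> real \<Rightarrow> real) \<Rightarrow> (real \<Rightarrow> real \<Rightarrow> real) \<Rightarrow> bool" where
  "remainder1 T b \<epsilon> f \<phi> u y \<longleftrightarrow>
     solves_pde T \<epsilon> b u f \<and>
     (\<forall>t\<in>{0..T}. u 0 t = 0 \<and> u 1 t = 0) \<and> (\<forall>x\<in>{0<..<1}. u x 0 = \<phi> x) \<and>
     (\<forall>(x, t)\<in>Qbar T. y x t = u x t - rlim 0 \<phi> 0 * sing \<epsilon> (b 0) x t) \<and>
     continuous_on (Qbar T) (\<lambda>(x, t). y x t) \<and>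
     solves_pde T \<epsilon> b y (rhs1 b \<epsilon> f \<phi>)"

definition problem_class2 ::
    "real \<Rightarrow> (real \<Rightarrow> real) \<Rightarrow> real \<Rightarrow> real \<Rightarrow> real \<Rightarrow> real \<Rightarrow>
     (real \<Rightarrow> real \<Rightarrow> real) \<Rightarrow> (real \<Rightarrow> real) \<Rightarrow> bool" where
  "problem_class2 T b \<gamma> K d \<epsilon> f \<phi> \<longleftrightarrow>
     holder_space T 4 \<gamma> K f \<and> Cn_space 4 ({0<..<1} - {d}) K \<phi> \<and>
     (\<forall>k\<in>{0, 2, 4}. has_rlim k \<phi> 0 \<and> has_llim k \<phi> 1) \<and>
     (\<forall>k\<in>{0, 1, 2}. has_llim k \<phi> d \<and> has_rlim k \<phi> d) \<and>
     rlim 0 \<phi> 0 = 0 \<and> llim 0 \<phi> 1 = 0 \<and>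
     llim 0 \<phi> d \<noteq> rlim 0 \<phi> d \<and> llim 1 \<phi> d = rlim 1 \<phi> d \<and> llim 2 \<phi> d = rlim 2 \<phi> d \<and>
     f 0 0 = - \<epsilon> * rlim 2 \<phi> 0 \<and>
     - \<epsilon> * rlim 4 \<phi> 0 + b 0 * rlim 2 \<phi> 0 = pd T 0 1 f 0 0 + pd T 2 0 f 0 0 \<and>
     f 1 0 = - \<epsilon> * llim 2 \<phi> 1 \<and>
     - \<epsilon> * llim 4 \<phi> 1 + b 0 * llim 2 \<phi> 1 = pd T 0 1 f 1 0 + pd T 2 0 f 1 0"

definition jump2 :: "(real \<Rightarrow> real) \<Rightarrow> real \<Rightarrow> real" where
  "jump2 \<phi> d = rlim 0 \<phi> d - llim 0 \<phi> d"

definition rhs2 ::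
    "(real \<Rightarrow> real) \<Rightarrow> real \<Rightarrow> real \<Rightarrow> (real \<Rightarrow> real \<Rightarrow> real) \<Rightarrow> (real \<Rightarrow> real) \<Rightarrow> real \<Rightarrow> real \<Rightarrow> real" where
  "rhs2 b d \<epsilon> f \<phi> x t = f x t - (b t - b 0) * (jump2 \<phi> d / 2) * sing \<epsilon> (b 0) (x - d) t"

definition remainder2 ::
    "real \<Rightarrow> (real \<Rightarrow> real) \<Rightarrow> real \<Rightarrow> real \<Rightarrow> (real \<Rightarrow> real \<Rightarrow> real) \<Rightarrow> (real \<Rightarrow> real) \<Rightarrow>
     (real \<Rightarrow> real \<Rightarrow> real) \<Rightarrow> (real \<Rightarrow> real \<Rightarrow> real) \<Rightarrow> bool" where
  "remainder2 T b d \<epsilon> f \<phi> u y \<longleftrightarrow>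
     solves_pde T \<epsilon> b u f \<and>
     (\<forall>t\<in>{0..T}. u 0 t = 0 \<and> u 1 t = 0) \<and> (\<forall>x\<in>{0<..<1} - {d}. u x 0 = \<phi> x) \<and>
     (\<forall>(x, t)\<in>Qbar T. y x t = u x t - jump2 \<phi> d / 2 * sing \<epsilon> (b 0) (x - d) t) \<and>
     y d 0 = (rlim 0 \<phi> d + llim 0 \<phi> d) / 2 \<and>
     continuous_on (Qbar T) (\<lambda>(x, t). y x t) \<and>
     solves_pde T \<epsilon> b y (rhs2 b d \<epsilon> f \<phi>)"

definition problem_class3 ::
    "real \<Rightarrow> (real \<Rightarrow> real) \<Rightarrow> real \<Rightarrow> real \<Rightarrow> real \<Rightarrow>
     (real \<Rightarrow> real \<Rightarrow> real) \<Rightarrow> (real \<Rightarrow> real) \<Rightarrow> (real \<Rightarrow> real) \<Rightarrow> bool" where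
  "problem_class3 T b \<gamma> K d f \<phi>\<^sub>1 \<phi>\<^sub>2 \<longleftrightarrow>
     holder_space T 4 \<gamma> K f \<and> Cn_space 2 {0<..<d} K \<phi>\<^sub>1 \<and> Cn_space 2 {d<..<T} K \<phi>\<^sub>2 \<and>
     (\<forall>k\<in>{0, 1, 2}. has_rlim k \<phi>\<^sub>1 0) \<and>
     (\<forall>k\<in>{0, 1}. has_llim k \<phi>\<^sub>1 d \<and> has_rlim k \<phi>\<^sub>2 d) \<and>
     llim 0 \<phi>\<^sub>1 d \<noteq> rlim 0 \<phi>\<^sub>2 d \<and> llim 1 \<phi>\<^sub>1 d = rlim 1 \<phi>\<^sub>2 d \<and>
     \<phi>\<^sub>1 0 = 0 \<and> f 0 0 = rlim 1 \<phi>\<^sub>1 0 \<and>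
     pd T 0 1 f 0 0 + pd T 2 0 f 0 0 = rlim 2 \<phi>\<^sub>1 0 + b 0 * rlim 1 \<phi>\<^sub>1 0 \<and>
     f 1 0 = 0 \<and> pd T 0 1 f 1 0 + pd T 2 0 f 1 0 = 0"

definition jump3 :: "(real \<Rightarrow> real) \<Rightarrow> (real \<Rightarrow> real) \<Rightarrow> real \<Rightarrow> real" where
  "jump3 \<phi>\<^sub>1 \<phi>\<^sub>2 d = rlim 0 \<phi>\<^sub>2 d - llim 0 \<phi>\<^sub>1 d"

definition rhs3 ::
    "(real \<Rightarrow> real) \<Rightarrow> real \<Rightarrow> real \<Rightarrow> (real \<Rightarrow> real \<Rightarrow> real) \<Rightarrow> (real \<Rightarrow> real) \<Rightarrow> (real \<Rightarrow> real) \<Rightarrow>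
     real \<Rightarrow> real \<Rightarrow> real" where
  "rhs3 b d \<epsilon> f \<phi>\<^sub>1 \<phi>\<^sub>2 x t =
     f x t + (b d - b t) * jump3 \<phi>\<^sub>1 \<phi>\<^sub>2 d * Heav (t - d) * csing \<epsilon> (b 0) x (t - d)"

text \<open>Here \<open>y\<close> is characterised by its own initial-boundary value problem only: with
  \<open>s = exp(-b(0)t) erf(x/(2 sqrt(\<epsilon>t)))\<close>, applying the differential operator to
  \<open>u = [\<phi>](d) H(t-d) cs(x,t-d) + y\<close> gives \<open>f\<close> exactly only if \<open>b(d)cs + b(0)s = 0\<close> for
  \<open>t > d\<close>, so \<open>y\<close> cannot in general also be tied to a solution \<open>u\<close> of the original problem.
  At \<open>x = 0\<close> the factor \<open>cs(0,t-d)\<close> equals \<open>1\<close> for \<open>t > d\<close>; at \<open>t = d\<close> the convention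
  \<open>cs(x,0) = 0\<close> makes \<open>y(0,d) = \<phi>\<^sub>1(d)\<close>, which keeps \<open>y\<close> continuous there.\<close>

definition remainder3 ::
    "real \<Rightarrow> (real \<Rightarrow> real) \<Rightarrow> real \<Rightarrow> real \<Rightarrow> (real \<Rightarrow> real \<Rightarrow> real) \<Rightarrow> (real \<Rightarrow> real) \<Rightarrow>
     (real \<Rightarrow> real) \<Rightarrow> (real \<Rightarrow> real \<Rightarrow> real) \<Rightarrow> bool" where
  "remainder3 T b d \<epsilon> f \<phi>\<^sub>1 \<phi>\<^sub>2 y \<longleftrightarrow>
     continuous_on (Qbar T) (\<lambda>(x, t). y x t) \<and>
     solves_pde T \<epsilon> b y (rhs3 b d \<epsilon> f \<phi>\<^sub>1 \<phi>\<^sub>2) \<and>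
     (\<forall>t\<in>{0..T}. y 0 t = (if t \<le> d then \<phi>\<^sub>1 t else \<phi>\<^sub>2 t)
        - jump3 \<phi>\<^sub>1 \<phi>\<^sub>2 d * Heav (t - d) * csing \<epsilon> (b 0) 0 (t - d)) \<and>
     (\<forall>t\<in>{0..T}. y 1 t = - jump3 \<phi>\<^sub>1 \<phi>\<^sub>2 d * Heav (t - d) * csing \<epsilon> (b 0) 1 (t - d)) \<and>
     (\<forall>x\<in>{0<..<1}. y x 0 = 0)"

section \<open>Meshes\<close>

text \<open>\<open>pw_mesh [(p\<^sub>1,m\<^sub>1), (p\<^sub>2,m\<^sub>2), \<dots>] p\<^sub>0 i\<close> is the \<open>i\<close>-th point of the mesh with \<open>m\<^sub>k\<close> uniform
  cells in \<open>[p\<^sub>k\<^sub>-\<^sub>1, p\<^sub>k]\<close>.\<close>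

fun pw_mesh :: "(real \<times> nat) list \<Rightarrow> real \<Rightarrow> nat \<Rightarrow> real" where
  "pw_mesh [] p i = p"
| "pw_mesh ((q, m) # r) p i =
     (if i \<le> m then p + (q - p) * real i / real m else pw_mesh r q (i - m))"

definition trans_width :: "real \<Rightarrow> real \<Rightarrow> real \<Rightarrow> real \<Rightarrow> nat \<Rightarrow> real" where
  "trans_width c \<mu> T \<epsilon> N = min c (4 / \<mu> * sqrt (\<epsilon> * T) * ln (real N))"

definition mesh13 :: "real \<Rightarrow> real \<Rightarrow> real \<Rightarrow> nat \<Rightarrow> nat \<Rightarrow> real" where
  "mesh13 \<mu> T \<epsilon> N =
     (let \<sigma> = trans_width (1/4) \<mu> T \<epsilon> N
      in pw_mesh [(\<sigma>, N div 4), (1 - \<sigma>, N div 2), (1, N div 4)] 0)"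

definition mesh2 :: "real \<Rightarrow> real \<Rightarrow> real \<Rightarrow> real \<Rightarrow> nat \<Rightarrow> nat \<Rightarrow> real" where
  "mesh2 \<mu> T d \<epsilon> N =
     (let \<tau> = trans_width (1/8) \<mu> T \<epsilon> N
      in pw_mesh [(\<tau>, N div 8), (d - \<tau>, N div 4), (d + \<tau>, N div 4), (1 - \<tau>, N div 4),
                  (1, N div 8)] 0)"

definition tmesh :: "real \<Rightarrow> nat \<Rightarrow> nat \<Rightarrow> real" where
  "tmesh T M j = real j * T / real M"

section \<open>The finite difference scheme and the interpolant\<close>

text \<open>A mesh function is indexed by node numbers: \<open>U i j\<close> is its value at \<open>(x\<^sub>i, t\<^sub>j)\<close>.\<close>

definition Dxm :: "(nat \<Rightarrow> real) \<Rightarrow> (nat \<Rightarrow> nat \<Rightarrow> real) \<Rightarrow> nat \<Rightarrow> nat \<Rightarrow> real" where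
  "Dxm xs U i j = (U i j - U (i - 1) j) / (xs i - xs (i - 1))"

definition Dxp :: "(nat \<Rightarrow> real) \<Rightarrow> (nat \<Rightarrow> nat \<Rightarrow> real) \<Rightarrow> nat \<Rightarrow> nat \<Rightarrow> real" where
  "Dxp xs U i j = Dxm xs U (i + 1) j"

definition delta2 :: "(nat \<Rightarrow> real) \<Rightarrow> (nat \<Rightarrow> nat \<Rightarrow> real) \<Rightarrow> nat \<Rightarrow> nat \<Rightarrow> real" where
  "delta2 xs U i j =
     (Dxp xs U i j - Dxm xs U i j) / (((xs i - xs (i - 1)) + (xs (i + 1) - xs i)) / 2)"

definition Dtm :: "(nat \<Rightarrow> real) \<Rightarrow> (nat \<Rightarrow> nat \<Rightarrow> real) \<Rightarrow> nat \<Rightarrow> nat \<Rightarrow> real" where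
  "Dtm ts U i j = (U i j - U i (j - 1)) / (ts j - ts (j - 1))"

definition discrete_solution ::
    "real \<Rightarrow> (real \<Rightarrow> real) \<Rightarrow> nat \<Rightarrow> nat \<Rightarrow> (nat \<Rightarrow> real) \<Rightarrow> (nat \<Rightarrow> real) \<Rightarrow>
     (real \<Rightarrow> real \<Rightarrow> real) \<Rightarrow> (real \<Rightarrow> real \<Rightarrow> real) \<Rightarrow> (nat \<Rightarrow> nat \<Rightarrow> real) \<Rightarrow> bool" where
  "discrete_solution \<epsilon> b N M xs ts F y Y \<longleftrightarrow>
     (\<forall>i\<in>{1..N - 1}. \<forall>j\<in>{1..M}.
        - \<epsilon> * delta2 xs Y i j + b (ts j) * Y i j + Dtm ts Y i j = F (xs i) (ts j)) \<and>
     (\<forall>i\<le>N. \<forall>j\<le>M. i = 0 \<or> i = N \<or> j = 0 \<longrightarrow> Y i j = y (xs i) (ts j))"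

text \<open>\<open>i\<close> and \<open>j\<close> select the cell \<open>[x\<^sub>i\<^sub>-\<^sub>1, x\<^sub>i] \<times> [t\<^sub>j\<^sub>-\<^sub>1, t\<^sub>j]\<close> containing \<open>(x, t)\<close>; neighbouring
  cells agree on common edges.\<close>

definition bilinear_interp ::
    "(nat \<Rightarrow> real) \<Rightarrow> (nat \<Rightarrow> real) \<Rightarrow> (nat \<Rightarrow> nat \<Rightarrow> real) \<Rightarrow> real \<Rightarrow> real \<Rightarrow> real" where
  "bilinear_interp xs ts U x t =
     (let i = (LEAST i. 1 \<le> i \<and> x \<le> xs i);
          j = (LEAST j. 1 \<le> j \<and> t \<le> ts j);
          p = (x - xs (i - 1)) / (xs i - xs (i - 1));
          q = (t - ts (j - 1)) / (ts j - ts (j - 1))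
      in (1 - p) * (1 - q) * U (i - 1) (j - 1) + p * (1 - q) * U i (j - 1)
         + (1 - p) * q * U (i - 1) j + p * q * U i j)"

end

theory Submission
 imports Defs "HOL-Probability.Distributions"
begin

text \<open>Subtracting explicit singular functions, built from the iterated integrals of \<open>erf\<close> with
 coefficients solving \<open>e' + b e = c\<close>, turns the remainder \<open>y\<close> into the solution \<open>w\<close> of a problem
 with \<open>C\<^sup>1\<^sup>,\<^sup>1\<close> boundary data satisfying the compatibility conditions of order zero and one.  The
 maximum principle, applied to differences of \<open>w\<close> (time increments, interpolation errors, second
 differences) instead of its derivatives, yields the bounds on \<open>w\<close> that are needed for the
 consistency error without any Schauder theory.  The singular functions are
 self-similar, so their truncation error in time is \<open>O(k / (k + t - d))\<close>; the discrete maximum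
 principle sums it to \<open>k ln M\<close>.  The remaining error at the transition points of the mesh is
 absorbed by a piecewise linear barrier function.\<close>

text \<open>The equation controls second space derivatives only through
  \<open>eps * wxx = wt + b * w - f\<close>, so two of them cost a factor \<open>1 / eps\<close>,
  which is harmless on fine cells and useless on coarse ones. On coarse cells the truncation error
  is therefore treated as an unknown itself: as \<open>b\<close> depends on \<open>t\<close> alone,
  every fixed combination of space translates solves the same type of problem, and two exponential
  barriers damp the crude bound away from the lateral sides. The singular functions have different
  origins. Since \<open>exp (- b(0) t)\<close> belongs to a frozen coefficient, the source for
  \<open>y\<close> keeps a multiple of \<open>b(t) - b(0)\<close>, or \<open>b(d) - b(t)\<close>,
  times a discontinuous function; an error function whose coefficient vanishes quadratically at the
  singular time removes it. A jump of the third derivative of \<open>\<phi>\<close> at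
  \<open>d\<close> is matched by the heat solution starting from \<open>abs (x - d)^3 / 6\<close>.
  For discontinuous boundary data the trace of \<open>y\<close> at \<open>x = 1\<close> has a kink
  of slope proportional to \<open>b(0)\<close> at time \<open>d\<close>; a function concentrated at
  \<open>x = 1\<close> removes the kink.\<close>

section \<open>The maximum principle\<close>

text \<open>The parabolic operator with its derivatives replaced by a backward difference in time and
 a central difference in space, both with step \<open>h\<close>.  Being defined for every function, it lets
 the maximum principle be applied to differences of solutions without any knowledge of
 their higher derivatives.\<close>

definition parop :: "real => real => (real => real => real) => real => real => real => real" where
 "parop eps \<beta> U h x t = (U x t - U x (t - h)) / h
   - eps * ((U (x + h) t + U (x - h) t - 2 * U x t) / h^2) + \<beta> * U x t"

lemma parop_add:
 "parop eps \<beta> (\<lambda>x t. U x t + V x t) h x t = parop eps \<beta> U h x t + parop eps \<beta> V h x t"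
 by (simp add: parop_def algebra_simps add_divide_distrib diff_divide_distrib)

lemma parop_cmult:
 "parop eps \<beta> (\<lambda>x t. c * U x t) h x t = c * parop eps \<beta> U h x t"
 by (simp add: parop_def algebra_simps add_divide_distrib diff_divide_distrib)

lemma parop_diff:
 "parop eps \<beta> (\<lambda>x t. U x t - V x t) h x t = parop eps \<beta> U h x t - parop eps \<beta> V h x t"
 by (simp add: parop_def algebra_simps add_divide_distrib diff_divide_distrib)

lemma eventually_at_right_less: "0 < (c::real) ==> \<forall>\<^sub>F h in at_right 0. h < c"
 by (rule order_tendstoD(2)[OF tendsto_ident_at])

text \<open>At a positive maximum of \<open>U - \<delta> t\<close> every small step \<open>h\<close>
  gives \<open>parop\<close> a value of at least \<open>\<delta>\<close>, whereas the hypothesis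
  forces at most \<open>\<delta> / 2\<close> for some such \<open>h\<close>. One suitable step
  suffices, so no derivative of \<open>U\<close> appears.\<close>

lemma parabolic_max_principle:
 fixes U :: "real => real => real"
 assumes eps: "0 < eps" and b: "\<And>t. 0 < t ==> t <= T ==> 0 <= b t"
  and cont: "continuous_on ({\<alpha>..\<beta>} \<times> {0..T}) (\<lambda>(x, t). U x t)"
  and sub: "\<And>x t \<delta>. \<alpha> < x ==> x < \<beta> ==> 0 < t ==> t <= T ==> 0 < \<delta> ==>
    \<forall>\<^sub>F h in at_right 0. parop eps (b t) U h x t <= \<delta>"
  and ini: "\<And>x. \<alpha> <= x ==> x <= \<beta> ==> U x 0 <= 0"
  and lft: "\<And>t. 0 <= t ==> t <= T ==> U \<alpha> t <= 0"
  and rgt: "\<And>t. 0 <= t ==> t <= T ==> U \<beta> t <= 0"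
  and x: "\<alpha> <= x" "x <= \<beta>" and t: "0 <= t" "t <= T"
 shows "U x t <= 0"
proof (rule ccontr)
 assume "\<not> U x t <= 0"
 then have pos: "0 < U x t" by simp
 \<comment> \<open>Small enough for \<open>U - \<delta> t\<close> to remain positive at the given
   point; the \<open>+ 1\<close> covers \<open>t = 0\<close>.\<close>
 define \<delta> where "\<delta> = U x t / (2 * (t + 1))"
 have \<delta>: "0 < \<delta>" using pos t by (simp add: \<delta>_def)
 have \<delta>t: "\<delta> * t < U x t"
  using pos t by (simp add: \<delta>_def field_simps add_pos_nonneg add_nonneg_pos)
 define V where "V = (\<lambda>(x, t). U x t - \<delta> * t)"
 have Vc: "continuous_on ({\<alpha>..\<beta>} \<times> {0..T}) V"
 proof -
  have "continuous_on ({\<alpha>..\<beta>} \<times> {0..T}) (\<lambda>p. (\<lambda>(x, t). U x t) p - \<delta> * snd p)"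
   by (intro continuous_intros cont)
  then show ?thesis by (simp add: V_def case_prod_beta)
 qed
 have "compact ({\<alpha>..\<beta>} \<times> {0..T})" by (intro compact_Times compact_Icc)
 moreover have "{\<alpha>..\<beta>} \<times> {0..T} \<noteq> {}" using x t by auto
 ultimately obtain p where p: "p \<in> {\<alpha>..\<beta>} \<times> {0..T}"
  and mx: "\<forall>q\<in>{\<alpha>..\<beta>} \<times> {0..T}. V q <= V p"
  using continuous_attains_sup[OF _ _ Vc] by blast
 obtain x1 t1 where p_eq: "p = (x1, t1)" by (cases p)
 have r1: "\<alpha> <= x1" "x1 <= \<beta>" "0 <= t1" "t1 <= T" using p p_eq by auto
 have "V (x, t) <= V p" using mx x t by auto
 then have V1: "0 < U x1 t1 - \<delta> * t1" using \<delta>t by (simp add: V_def p_eq)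
 have U1: "0 < U x1 t1" using V1 \<delta> r1 by (smt (verit) mult_nonneg_nonneg)
 have t1: "0 < t1" using U1 ini[of x1] r1 by (cases "t1 = 0") auto
 have x1: "\<alpha> < x1" "x1 < \<beta>"
  using U1 lft[of t1] rgt[of t1] r1 by (cases "x1 = \<alpha>"; cases "x1 = \<beta>"; auto)+
 have "\<forall>\<^sub>F h in at_right 0. parop eps (b t1) U h x1 t1 <= \<delta> / 2"
  using sub[of x1 t1 "\<delta>/2"] x1 t1 r1 \<delta> by auto
 moreover have "\<forall>\<^sub>F h in at_right 0. h < min (min (x1 - \<alpha>) (\<beta> - x1)) t1"
  by (rule eventually_at_right_less) (use x1 t1 in auto)
 moreover have "\<forall>\<^sub>F h in at_right 0. (0::real) < h"
  by (simp add: eventually_at_filter)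
 ultimately have "\<forall>\<^sub>F h in at_right 0. parop eps (b t1) U h x1 t1 <= \<delta> / 2 \<and>
   h < min (min (x1 - \<alpha>) (\<beta> - x1)) t1 \<and> 0 < h"
  by eventually_elim auto
 then obtain h where h: "parop eps (b t1) U h x1 t1 <= \<delta> / 2"
   "h < min (min (x1 - \<alpha>) (\<beta> - x1)) t1" "0 < h"
  using eventually_happens'[OF trivial_limit_at_right_real] by auto
 have "V (x1, t1 - h) <= V p" "V (x1 + h, t1) <= V p" "V (x1 - h, t1) <= V p"
  using mx h r1 by auto
 then have "\<delta> * h <= U x1 t1 - U x1 (t1 - h)" "U (x1 + h) t1 <= U x1 t1" "U (x1 - h) t1 <= U x1 t1"
  by (simp_all add: V_def p_eq algebra_simps)
 then have "\<delta> <= (U x1 t1 - U x1 (t1 - h)) / h"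
  "(U (x1 + h) t1 + U (x1 - h) t1 - 2 * U x1 t1) / h^2 <= 0"
  using h by (simp_all add: pos_le_divide_eq divide_nonpos_nonneg)
 moreover have "0 <= b t1 * U x1 t1" using b[of t1] U1 t1 r1 by simp
 ultimately have "\<delta> <= parop eps (b t1) U h x1 t1"
  unfolding parop_def using eps by (smt (verit) mult_nonneg_nonpos)
 with h \<delta> show False by simp
qed

text \<open>The second derivative is known at \<open>x\<close> alone, so Taylor's formula with a
  second-order remainder is not at hand. The symmetric function \<open>q\<close> removes the
  expected limit, one mean value step turns it into values of \<open>g1\<close>, and the
  linearisation of \<open>g1\<close> at \<open>x\<close> does the rest.\<close>

lemma second_difference_tendsto:
 fixes g :: "real => real"
 assumes g1: "\<And>xi. a < xi ==> xi < c ==> (g has_real_derivative g1 xi) (at xi)"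
  and g2: "(g1 has_real_derivative g2) (at x)" and x: "a < x" "x < c"
 shows "((\<lambda>h. (g (x + h) + g (x - h) - 2 * g x) / h^2) \<longlongrightarrow> g2) (at_right 0)"
proof (rule tendstoI)
 fix e :: real assume e: "0 < e"
 have "((\<lambda>y. (g1 y - g1 x) / (y - x)) \<longlongrightarrow> g2) (at x)"
  using g2 by (simp add: has_field_derivative_iff)
 then have "\<forall>\<^sub>F y in at x. dist ((g1 y - g1 x) / (y - x)) g2 < e / 3"
  using e by (intro tendstoD) auto
 then obtain d where d: "0 < d"
  "\<And>y. y \<noteq> x ==> dist y x < d ==> dist ((g1 y - g1 x) / (y - x)) g2 < e / 3"
  by (auto simp: eventually_at)
 have lin: "abs (g1 y - g1 x - g2 * (y - x)) <= e / 3 * abs (y - x)" if "dist y x < d" for y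
 proof (cases "y = x")
  case False
  have "g1 y - g1 x - g2 * (y - x) = ((g1 y - g1 x) / (y - x) - g2) * (y - x)"
   using False by (simp add: field_simps)
  then show ?thesis
   using mult_right_mono[OF less_imp_le[OF d(2)[OF False that]], of "abs (y - x)"]
   by (simp only: dist_real_def abs_mult)
 qed simp
 have "\<forall>\<^sub>F h in at_right 0. h < min d (min (x - a) (c - x))"
  by (rule eventually_at_right_less) (use d x in auto)
 moreover have "\<forall>\<^sub>F h in at_right 0. (0::real) < h"
  by (simp add: eventually_at_filter)
 ultimately show "\<forall>\<^sub>F h in at_right 0. dist ((g (x + h) + g (x - h) - 2 * g x) / h^2) g2 < e"
 proof eventually_elim
  case (elim h)
  define q where "q = (\<lambda>s. g (x + s) + g (x - s) - s^2 * g2)"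
  have "(q has_real_derivative (g1 (x + s) - g1 (x - s) - 2 * s * g2)) (at s)"
   if s: "0 <= s" "s <= h" for s
  proof -
   have d1: "((\<lambda>s. g (x + s)) has_real_derivative g1 (x + s) * 1) (at s)"
    by (rule DERIV_chain2[OF g1]) (use elim s x in \<open>auto intro!: derivative_eq_intros\<close>)
   have d2: "((\<lambda>s. g (x - s)) has_real_derivative g1 (x - s) * (-1)) (at s)"
    by (rule DERIV_chain2[OF g1]) (use elim s x in \<open>auto intro!: derivative_eq_intros\<close>)
   have d3: "((\<lambda>s. s^2 * g2) has_real_derivative 2 * s * g2) (at s)"
    by (auto intro!: derivative_eq_intros)
   from DERIV_diff[OF DERIV_add[OF d1 d2] d3] show ?thesis by (simp add: q_def)
  qed
  then obtain z where z: "0 < z" "z < h"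
   "q h - q 0 = (h - 0) * (g1 (x + z) - g1 (x - z) - 2 * z * g2)"
   using MVT2[of 0 h q "\<lambda>s. g1 (x + s) - g1 (x - s) - 2 * s * g2"] elim by auto
  have "abs (g1 (x + z) - g1 x - g2 * z) <= e / 3 * z" "abs (g1 (x - z) - g1 x + g2 * z) <= e / 3 * z"
   using lin[of "x + z"] lin[of "x - z"] z elim by (auto simp: dist_real_def)
  then have "abs (g1 (x + z) - g1 (x - z) - 2 * z * g2) <= e / 3 * z + e / 3 * z"
   by (simp only: mult.assoc mult.commute[of z g2])
  also have "\<dots> <= 2 * e / 3 * h" using mult_left_mono[of z h "2 * e / 3"] z e by simp
  finally have "abs (q h - q 0) <= h * (2 * e / 3 * h)"
   unfolding z(3) using elim by (simp add: abs_mult)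
  then have "abs ((g (x + h) + g (x - h) - 2 * g x) - g2 * h^2) <= 2 * e / 3 * h^2"
   by (simp add: q_def power2_eq_square algebra_simps)
  moreover have "(g (x + h) + g (x - h) - 2 * g x) / h^2 - g2
    = ((g (x + h) + g (x - h) - 2 * g x) - g2 * h^2) / h^2"
   using elim by (simp add: field_simps)
  ultimately have "abs ((g (x + h) + g (x - h) - 2 * g x) / h^2 - g2) <= 2 * e / 3"
   using elim by (simp add: abs_divide pos_divide_le_eq)
  then show ?case using e by (simp add: dist_real_def)
 qed
qed

text \<open>The derivative within \<open>{0..T}\<close> is one-sided at \<open>t = T\<close>, and
  the backward quotient stays in the interval, so the last time level is covered as well.\<close>

lemma left_difference_tendsto:
 fixes g :: "real => real"
 assumes "(g has_real_derivative D) (at t within {0..T})" "0 < t" "t <= T"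
 shows "((\<lambda>h. (g t - g (t - h)) / h) \<longlongrightarrow> D) (at_right 0)"
proof -
 have "((\<lambda>y. (g y - g t) / (y - t)) \<longlongrightarrow> D) (at t within {0..T})"
  using assms by (simp add: has_field_derivative_iff)
 moreover have "filterlim (\<lambda>h. t - h) (at t within {0..T}) (at_right 0)"
  unfolding filterlim_at
 proof
  have "\<forall>\<^sub>F h in at_right 0. h < t" by (rule eventually_at_right_less) fact
  moreover have "\<forall>\<^sub>F h in at_right 0. (0::real) < h" by (simp add: eventually_at_filter)
  ultimately show "\<forall>\<^sub>F h in at_right 0. t - h \<in> {0..T} \<and> t - h \<noteq> t"
   by eventually_elim (use assms in auto)
 next
  have "((\<lambda>h. t - h) \<longlongrightarrow> t - 0) (at_right 0)" by (intro tendsto_intros)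
  then show "((\<lambda>h. t - h) \<longlongrightarrow> t) (at_right 0)" by simp
 qed
 ultimately have "((\<lambda>h. (g (t - h) - g t) / ((t - h) - t)) \<longlongrightarrow> D) (at_right 0)"
  by (rule filterlim_compose)
 moreover have "(g (t - h) - g t) / ((t - h) - t) = (g t - g (t - h)) / h" for h
  by (simp add: minus_divide_left[symmetric] diff_divide_distrib)
 ultimately show ?thesis by simp
qed

lemma parop_tendsto:
 assumes "((\<lambda>\<tau>. U x \<tau>) has_real_derivative Ut) (at t within {0..T})" "0 < t" "t <= T"
  and "\<And>xi. a < xi ==> xi < c ==> ((\<lambda>\<eta>. U \<eta> t) has_real_derivative Ux xi) (at xi)"
  and "(Ux has_real_derivative Uxx) (at x)" "a < x" "x < c"
 shows "((\<lambda>h. parop eps \<beta> U h x t) \<longlongrightarrow> Ut - eps * Uxx + \<beta> * U x t) (at_right 0)"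
 unfolding parop_def
 by (intro tendsto_intros left_difference_tendsto[OF assms(1-3)]
   second_difference_tendsto[OF assms(4-7)])

lemma abs_le_of_tendsto_diff:
 fixes u :: "real => real"
 assumes "(u \<longlongrightarrow> l) F" "abs l <= A" "0 < \<delta>"
 shows "\<forall>\<^sub>F h in F. (abs (u h)) <= A + \<delta>"
 using tendstoD[OF assms(1,3)] by eventually_elim (use assms(2) in \<open>auto simp: dist_real_def\<close>)

text \<open>The exponentials are supersolutions for every \<open>m\<close>; they carry boundary values of size
 \<open>P\<close> that only matter within a distance \<open>O(sqrt eps)\<close> of the boundary.\<close>

lemma parabolic_bound:
 fixes U :: "real => real => real"
 assumes eps: "0 < eps" and b: "\<And>t. 0 < t ==> t <= T ==> 0 <= b t"
  and cont: "continuous_on ({\<alpha>..\<beta>} \<times> {0..T}) (\<lambda>(x, t). U x t)"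
  and sub: "\<And>x t \<delta>. \<alpha> < x ==> x < \<beta> ==> 0 < t ==> t <= T ==> 0 < \<delta> ==>
    \<forall>\<^sub>F h in at_right 0. (abs (parop eps (b t) U h x t)) <= A + \<delta>"
  and nn: "0 <= A" "0 <= D" "0 <= P" 
  and ini: "\<And>x. \<alpha> <= x ==> x <= \<beta> ==> abs (U x 0) <= D"
  and lft: "\<And>t. 0 <= t ==> t <= T ==> abs (U \<alpha> t) <= D + P"
  and rgt: "\<And>t. 0 <= t ==> t <= T ==> abs (U \<beta> t) <= D + P"
  and x: "\<alpha> <= x" "x <= \<beta>" and t: "0 <= t" "t <= T"
 shows "abs (U x t) <= D + A * t
   + P * (exp (m^2 * t - m * (x - \<alpha>) / sqrt eps) + exp (m^2 * t - m * (\<beta> - x) / sqrt eps))"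
proof -
 define c where "c = m / sqrt eps"
 define E1 where "E1 = (\<lambda>x t. exp (m^2 * t - c * (x - \<alpha>)))"
 define E2 where "E2 = (\<lambda>x t. exp (m^2 * t - c * (\<beta> - x)))"
 define V where "V = (\<lambda>x t. D + A * t + P * (E1 x t + E2 x t))"
 have Vlim: "((\<lambda>h. parop eps (b t) V h x t) \<longlongrightarrow> A + b t * V x t) (at_right 0)"
  if "\<alpha> < x" "x < \<beta>" "0 < t" "t <= T" for x t
 proof -
  \<comment> \<open>With the rate \<open>c = m / sqrt eps\<close> the time derivative of each
    exponential cancels its diffusion term exactly; only the nonnegative potential term
    remains.\<close>
  have q: "c * c * eps = m^2"
   using eps by (simp add: c_def power2_eq_square field_simps)
  have "((\<lambda>h. parop eps (b t) V h x t) \<longlongrightarrow> (A + P * m^2 * (E1 x t + E2 x t))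
    - eps * (P * (c * c * (E1 x t + E2 x t))) + b t * V x t) (at_right 0)"
  proof (rule parop_tendsto[where T=T and a=\<alpha> and c=\<beta> and
     Ux="\<lambda>x. P * (c * (E2 x t - E1 x t))"])
   show "((\<lambda>\<tau>. V x \<tau>) has_real_derivative (A + P * m^2 * (E1 x t + E2 x t))) (at t within {0..T})"
    unfolding V_def E1_def E2_def
    by (rule derivative_eq_intros refl | simp)+ (simp add: algebra_simps)
   show "((\<lambda>\<eta>. V \<eta> t) has_real_derivative P * (c * (E2 xi t - E1 xi t))) (at xi)" for xi
    unfolding V_def E1_def E2_def
    by (rule derivative_eq_intros refl | simp)+ (simp add: algebra_simps)
   show "((\<lambda>x. P * (c * (E2 x t - E1 x t))) has_real_derivative
     P * (c * c * (E1 x t + E2 x t))) (at x)"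
    unfolding V_def E1_def E2_def
    by (rule derivative_eq_intros refl | simp)+ (simp add: algebra_simps)
  qed (use that in auto)
  moreover have "eps * (P * (c * c * (E1 x t + E2 x t)))
    = P * (c * c * eps) * (E1 x t + E2 x t)" by (simp add: algebra_simps)
  ultimately show ?thesis by (simp add: q)
 qed
 have Vpos: "0 <= V x t" if "0 <= t" for x t
  unfolding V_def E1_def E2_def using nn that by (auto intro!: add_nonneg_nonneg mult_nonneg_nonneg)
 have Vc: "continuous_on ({\<alpha>..\<beta>} \<times> {0..T}) (\<lambda>(x, t). V x t)"
  unfolding V_def E1_def E2_def case_prod_beta by (intro continuous_intros)
 \<comment> \<open>On each lateral side one of the exponentials has exponent \<open>m^2 * t\<close>,
   hence is at least 1 and dominates the extra boundary value \<open>P\<close>.\<close>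
 have P1: "P <= P * (E1 x t + E2 x t)" if "0 <= t" "x = \<alpha> \<or> x = \<beta>" for x t
 proof -
  have "1 <= E1 x t \<or> 1 <= E2 x t" "0 <= E1 x t" "0 <= E2 x t"
   using that by (auto simp: E1_def E2_def)
  then have "1 <= E1 x t + E2 x t" by linarith
  then show ?thesis using mult_left_mono[OF _ nn(3), of 1 "E1 x t + E2 x t"] by simp
 qed
 have key: "s * U x t - V x t <= 0" if s: "s = 1 \<or> s = -1" for s
 proof (rule parabolic_max_principle[where U="\<lambda>x t. s * U x t - V x t" and b=b, OF eps b _ _ _ _ _ x t])
  show "continuous_on ({\<alpha>..\<beta>} \<times> {0..T}) (\<lambda>(x, t). s * U x t - V x t)"
   using continuous_on_diff[OF continuous_on_mult[OF continuous_on_const cont] Vc, of s]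
   by (simp add: case_prod_beta)
  fix x t \<delta> :: real assume xt: "\<alpha> < x" "x < \<beta>" "0 < t" "t <= T" "0 < \<delta>"
  have "\<forall>\<^sub>F h in at_right 0. (abs (parop eps (b t) U h x t)) <= A + \<delta> / 2" using sub[of x t "\<delta>/2"] xt by simp
  moreover have "\<forall>\<^sub>F h in at_right 0. dist (parop eps (b t) V h x t) (A + b t * V x t) < \<delta> / 2"
   by (rule tendstoD[OF Vlim[OF xt(1-4)]]) (use xt in simp)
  ultimately show "\<forall>\<^sub>F h in at_right 0. parop eps (b t) (\<lambda>x t. s * U x t - V x t) h x t <= \<delta>"
  proof eventually_elim
   case (elim h)
   have "0 <= b t * V x t" using b Vpos xt by simp
   moreover have "A + b t * V x t - \<delta> / 2 < parop eps (b t) V h x t"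
    using elim(2) unfolding dist_real_def by linarith
   moreover have "s * parop eps (b t) U h x t <= A + \<delta> / 2" using elim(1) s by auto
   ultimately show ?case
    unfolding parop_diff[where U="\<lambda>x t. s * U x t" and V=V] parop_cmult by linarith
  qed
 next
  fix x assume "\<alpha> <= x" "x <= \<beta>"
  then have "abs (U x 0) <= D" by (rule ini)
  moreover have "D <= V x 0" using nn by (simp add: V_def E1_def E2_def)
  ultimately show "s * U x 0 - V x 0 <= 0" using s by auto
 next
  fix t assume t: "0 <= t" "t <= T"
  have "D + P <= V \<alpha> t" "D + P <= V \<beta> t"
   using P1[OF t(1), of \<alpha>] P1[OF t(1), of \<beta>] mult_nonneg_nonneg[OF nn(1) t(1)]
   by (simp_all add: V_def)
  then show "s * U \<alpha> t - V \<alpha> t <= 0" "s * U \<beta> t - V \<beta> t <= 0"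
   using lft[OF t] rgt[OF t] s by auto
 qed
 show ?thesis using key[of 1] key[of "-1"] unfolding V_def E1_def E2_def c_def by auto
qed

section \<open>Taylor estimates and difference quotients\<close>

lemma mvt_between:
 fixes g :: "real => real"
 assumes ne: "x \<noteq> y" and cont: "continuous_on {a..c} g"
  and d: "\<And>z. a < z ==> z < c ==> (g has_real_derivative g1 z) (at z)"
  and x: "a <= x" "x <= c" and y: "a <= y" "y <= c"
 obtains z where "min x y < z" "z < max x y" "g y - g x = g1 z * (y - x)"
proof -
 define l u where "l = min x y" and "u = max x y"
 have lu: "l < u" "a <= l" "u <= c" using ne x y by (auto simp: l_def u_def)
 have "\<exists>l' z. l < z \<and> z < u \<and> (g has_real_derivative l') (at z) \<and> g u - g l = (u - l) * l'"
 proof (rule MVT)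
  show "continuous_on {l..u} g" by (rule continuous_on_subset[OF cont]) (use lu in auto)
  show "g differentiable at z" if "l < z" "z < u" for z
   using d[of z] lu that real_differentiable_def by force
 qed fact
 then obtain l' z where z: "l < z" "z < u" "(g has_real_derivative l') (at z)" "g u - g l = (u - l) * l'"
  by blast
 have "l' = g1 z" using DERIV_unique[OF z(3) d[of z]] z lu by auto
 then have "g y - g x = g1 z * (y - x)"
  using z(4) by (cases "x < y") (auto simp: l_def u_def min_def max_def algebra_simps split: if_splits)
 with z show thesis using that[of z] by (auto simp: l_def u_def)
qed

text \<open>The point \<open>y\<close> may be an end of the interval, where only continuity is
  known. Two mean value steps replace the Lagrange remainder, which costs the factor 1/2, and
  \<open>g2\<close> is inspected only within distance \<open>abs (y - x)\<close> of
  \<open>x\<close>.\<close>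

lemma taylor_remainder:
 fixes g :: "real => real"
 assumes cont: "continuous_on {a..c} g"
  and d1: "\<And>z. a < z ==> z < c ==> (g has_real_derivative g1 z) (at z)"
  and d2: "\<And>z. a < z ==> z < c ==> (g1 has_real_derivative g2 z) (at z)"
  and x: "a < x" "x < c" and y: "a <= y" "y <= c"
  and B: "\<And>z. a < z ==> z < c ==> abs (z - x) <= abs (y - x) ==> abs (g2 z) <= B"
 shows "abs (g y - g x - g1 x * (y - x)) <= B * (y - x)^2"
proof (cases "x = y")
 case False
 obtain z where z: "min x y < z" "z < max x y" "g y - g x = g1 z * (y - x)"
  by (rule mvt_between[OF False cont d1 less_imp_le[OF x(1)] less_imp_le[OF x(2)] y])
 have zr: "a < z" "z < c" "x \<noteq> z" using z x y by auto
 have zx: "abs (z - x) <= abs (y - x)" using z by auto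
 define l u where "l = min x z" and "u = max x z"
 have "continuous_on {l..u} g1"
  by (rule DERIV_continuous_on, rule DERIV_subset[OF d2]) (use x zr in \<open>auto simp: l_def u_def\<close>)
 then obtain v where v: "min x z < v" "v < max x z" "g1 z - g1 x = g2 v * (z - x)"
  using mvt_between[OF zr(3), of l u g1 g2] d2 x zr by (auto simp: l_def u_def)
 have "abs (g2 v) <= B" using B[of v] v x zr zx by auto
 moreover have "g y - g x - g1 x * (y - x) = (g1 z - g1 x) * (y - x)"
  using z by (simp add: algebra_simps)
 moreover have "abs (g1 z - g1 x) = abs (g2 v) * abs (z - x)" using v by (simp add: abs_mult)
 ultimately have "abs (g y - g x - g1 x * (y - x)) <= B * abs (y - x) * abs (y - x)"
  using zx by (simp only: abs_mult) (intro mult_right_mono mult_mono; simp)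
 then show ?thesis by (simp add: power2_eq_square mult.assoc)
qed simp

lemma abs_lincomb_le:
 fixes u v :: real
 assumes "0 <= c" "0 <= a" "abs u <= U" "abs v <= V"
 shows "abs (c * u + a * v) <= c * U + a * V"
 using mult_left_mono[OF assms(3,1)] mult_left_mono[OF assms(4,2)]
  abs_triangle_ineq[of "c * u" "a * v"] assms(1,2) by (simp add: abs_mult)

text \<open>The error of linear interpolation at \<open>x\<close> from the nodes \<open>x - a\<close> and \<open>x + c\<close>; the
 divided second difference on these three points is \<open>2 / (a * c)\<close> times it.\<close>

definition interp_err :: "real => real => (real => real) => real => real" where
 "interp_err a c g x = (c * g (x - a) + a * g (x + c)) / (a + c) - g x"

definition divdiff2 :: "real => real => (real => real) => real => real" where
 "divdiff2 a c g x = 2 / (a * c) * interp_err a c g x"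

lemma divdiff2_equal: "0 < h ==> divdiff2 h h g x = (g (x + h) + g (x - h) - 2 * g x) / h^2"
 by (simp add: divdiff2_def interp_err_def field_simps power2_eq_square)

lemma interp_err_add: "interp_err a c (\<lambda>x. g x + k x) x = interp_err a c g x + interp_err a c k x"
 by (simp add: interp_err_def algebra_simps add_divide_distrib)

lemma interp_err_cmult: "interp_err a c (\<lambda>x. r * g x) x = r * interp_err a c g x"
 by (simp add: interp_err_def algebra_simps add_divide_distrib)

lemma divdiff2_add: "divdiff2 a c (\<lambda>x. g x + k x) x = divdiff2 a c g x + divdiff2 a c k x"
 by (simp add: divdiff2_def interp_err_add algebra_simps)

lemma divdiff2_cmult: "divdiff2 a c (\<lambda>x. r * g x) x = r * divdiff2 a c g x"
 by (simp add: divdiff2_def interp_err_cmult)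

text \<open>Linear interpolation is exact on affine functions, so the slope \<open>D\<close> drops
  out and only the two quadratic remainders are averaged.\<close>

lemma interp_err_bound:
 assumes "0 < a" "0 < c" and "abs (g (x - a) - g x + D * a) <= B * a^2" "abs (g (x + c) - g x - D * c) <= B * c^2"
 shows "abs (interp_err a c g x) <= B * (a * c)"
proof -
 have "interp_err a c g x = (c * (g (x - a) - g x + D * a) + a * (g (x + c) - g x - D * c)) / (a + c)"
  using assms by (simp add: interp_err_def field_simps)
 moreover have "abs (c * (g (x - a) - g x + D * a) + a * (g (x + c) - g x - D * c))
   <= c * (B * a^2) + a * (B * c^2)"
  by (rule abs_lincomb_le) (use assms in auto)
 moreover have "c * (B * a^2) + a * (B * c^2) = B * (a * c) * (a + c)"
  by (simp add: algebra_simps power2_eq_square)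
 ultimately show ?thesis using assms by (simp add: abs_divide pos_divide_le_eq)
qed

text \<open>Slope and curvature are reproduced exactly. The cubic remainders at the two sides do not
  cancel when \<open>a\<close> and \<open>c\<close> differ, which leaves first order in the stencil
  width.\<close>

lemma divdiff2_bound:
 assumes ac: "0 < a" "0 < c" and B: "0 <= B"
  and l: "abs (g (x - a) - g x + D * a - S / 2 * a^2) <= B * a^3"
  and r: "abs (g (x + c) - g x - D * c - S / 2 * c^2) <= B * c^3"
 shows "abs (divdiff2 a c g x - S) <= 2 * B * (a + c)"
proof -
 let ?L = "g (x - a) - g x + D * a - S / 2 * a^2" and ?R = "g (x + c) - g x - D * c - S / 2 * c^2"
 have "divdiff2 a c g x - S = 2 / (a * c) * ((c * ?L + a * ?R) / (a + c))"
  using ac by (simp add: divdiff2_def interp_err_def divide_simps)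
   (simp add: algebra_simps power2_eq_square)
 moreover have "abs (c * ?L + a * ?R) <= c * (B * a^3) + a * (B * c^3)"
  by (rule abs_lincomb_le[OF _ _ l r]) (use ac in auto)
 moreover have "c * (B * a^3) + a * (B * c^3) <= B * (a + c) * (a * c) * (a + c)"
  using ac B by (simp add: algebra_simps power3_eq_cube)
 ultimately have e: "divdiff2 a c g x - S = 2 / (a * c) * ((c * ?L + a * ?R) / (a + c))"
  and le: "abs (c * ?L + a * ?R) <= B * (a + c) * (a * c) * (a + c)" by linarith+
 have "abs ((c * ?L + a * ?R) / (a + c)) <= B * (a + c) * (a * c) * (a + c) / (a + c)"
  unfolding abs_divide using divide_right_mono[OF le, of "a + c"] ac by simp
 from mult_left_mono[OF this, of "abs (2 / (a * c))"]
 have "abs (divdiff2 a c g x - S) <= abs (2 / (a * c)) * ((B * (a + c) * (a * c) * (a + c)) / (a + c))"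
  unfolding e abs_mult by simp
 also have "\<dots> = 2 * B * (a + c)"
 proof -
  have "a + c \<noteq> 0" "a * c \<noteq> 0" "abs (a * c) = a * c" using ac by auto
  then show ?thesis by (simp add: abs_divide)
 qed
 finally show ?thesis .
qed

lemma interp_err_le:
 fixes g :: "real => real"
 assumes cont: "continuous_on {u..v} g"
  and d1: "\<And>z. u < z ==> z < v ==> (g has_real_derivative g1 z) (at z)"
  and d2: "\<And>z. u < z ==> z < v ==> (g1 has_real_derivative g2 z) (at z)"
  and B: "\<And>z. u < z ==> z < v ==> x - a <= z ==> z <= x + c ==> abs (g2 z) <= B"
  and ac: "0 < a" "0 < c" and x: "u <= x - a" "x + c <= v"
 shows "abs (interp_err a c g x) <= B * (a * c)"
proof (rule interp_err_bound[OF ac, where D="g1 x"])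
 have "continuous_on {x-a..x+c} g" by (rule continuous_on_subset[OF cont]) (use x in auto)
 note t = taylor_remainder[OF this, of g1 g2 x _ B] 
 show "abs (g (x - a) - g x + g1 x * a) <= B * a^2"
  using t[of "x - a"] d1 d2 B ac x by auto
 show "abs (g (x + c) - g x - g1 x * c) <= B * c^2"
  using t[of "x + c"] d1 d2 B ac x by auto
qed

lemma divdiff2_le:
 assumes "abs (interp_err a c g x) <= B * (a * c)" "0 < a" "0 < c"
 shows "abs (divdiff2 a c g x) <= 2 * B"
 using mult_left_mono[OF assms(1), of "2 / (a * c)"] assms(2,3)
 by (simp add: divdiff2_def abs_mult)

text \<open>After subtraction of the quadratic with curvature \<open>g2 x\<close>, the second
  derivative that is left is at most \<open>L * abs (z - x)\<close>, and Taylor's formula yields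
  cubic remainders at both nodes.\<close>

lemma divdiff2_err:
 fixes g :: "real => real"
 assumes cont: "continuous_on {u..v} g"
  and d1: "\<And>z. u < z ==> z < v ==> (g has_real_derivative g1 z) (at z)"
  and d2: "\<And>z. u < z ==> z < v ==> (g1 has_real_derivative g2 z) (at z)"
  and L: "\<And>z. u < z ==> z < v ==> x - a <= z ==> z <= x + c ==> abs (g2 z - g2 x) <= L * abs (z - x)"
  and ac: "0 < a" "0 < c" and x: "u <= x - a" "x + c <= v" and L0: "0 <= L"
 shows "abs (divdiff2 a c g x - g2 x) <= 2 * L * (a + c)"
proof (rule divdiff2_bound[OF ac L0, where D="g1 x"])
 define k where "k = (\<lambda>z. g z - g2 x / 2 * (z - x)^2)"
 have kc: "continuous_on {x-a..x+c} k"
  unfolding k_def by (intro continuous_intros continuous_on_subset[OF cont]) (use x in auto)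
 have k1: "(k has_real_derivative (g1 z - g2 x * (z - x))) (at z)" if "x - a < z" "z < x + c" for z
  unfolding k_def by (rule derivative_eq_intros d1 refl | use that x in simp)+
 have k2: "((\<lambda>z. g1 z - g2 x * (z - x)) has_real_derivative (g2 z - g2 x)) (at z)"
  if "x - a < z" "z < x + c" for z
  by (rule derivative_eq_intros d2 refl | use that x in simp)+
 have t: "abs (k y - k x - (g1 x - g2 x * (x - x)) * (y - x)) <= L * abs (y - x) * (y - x)^2"
  if y: "x - a <= y" "y <= x + c" for y
 proof (rule taylor_remainder[OF kc k1 k2])
  fix z assume z: "x - a < z" "z < x + c" "abs (z - x) <= abs (y - x)"
  have "abs (g2 z - g2 x) <= L * abs (z - x)" using L[of z] z x by auto
  also have "\<dots> <= L * abs (y - x)" using z L0 by (intro mult_left_mono)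
  finally show "abs (g2 z - g2 x) <= L * abs (y - x)" .
 qed (use ac y in auto)
 have kx: "k x = g x" "k (x - a) = g (x - a) - g2 x / 2 * a^2" "k (x + c) = g (x + c) - g2 x / 2 * c^2"
  by (simp_all add: k_def)
 show "abs (g (x - a) - g x + g1 x * a - g2 x / 2 * a^2) <= L * a ^ 3"
  using t[of "x - a", unfolded kx] ac by (simp add: power3_eq_cube power2_eq_square algebra_simps)
 show "abs (g (x + c) - g x - g1 x * c - g2 x / 2 * c^2) <= L * c ^ 3"
  using t[of "x + c", unfolded kx] ac by (simp add: power3_eq_cube power2_eq_square algebra_simps)
qed

text \<open>Folding the function about \<open>x\<close> gives \<open>q\<close>, whose second
  derivative is the symmetric second difference of \<open>g2\<close>. Second order thus follows from
  second differences of \<open>g2\<close> without a third or fourth derivative.\<close>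

lemma divdiff2_equal_err:
 fixes g :: "real => real"
 assumes cont: "continuous_on {u..v} g"
  and d1: "\<And>z. u < z ==> z < v ==> (g has_real_derivative g1 z) (at z)"
  and d2: "\<And>z. u < z ==> z < v ==> (g1 has_real_derivative g2 z) (at z)"
  and S: "\<And>s. 0 < s ==> s < h ==> abs (g2 (x + s) + g2 (x - s) - 2 * g2 x) <= B * s^2"
  and h: "0 < h" and x: "u <= x - h" "x + h <= v" and B0: "0 <= B"
 shows "abs (divdiff2 h h g x - g2 x) <= B * h^2"
proof -
 define q where "q = (\<lambda>s. g (x + s) + g (x - s) - g2 x * s^2)"
 define q1 where "q1 = (\<lambda>s. g1 (x + s) - g1 (x - s) - 2 * g2 x * s)"
 define q2 where "q2 = (\<lambda>s. g2 (x + s) + g2 (x - s) - 2 * g2 x)"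
 have c1: "continuous_on {-h..h} q"
  unfolding q_def by (intro continuous_intros continuous_on_compose2[OF cont]) (use x in auto)
 have sh: "((\<lambda>s. k (x + s)) has_real_derivative k') (at s)"
   "((\<lambda>s. k (x - s)) has_real_derivative - k'') (at s)"
  if "(k has_real_derivative k') (at (x + s))" "(k has_real_derivative k'') (at (x - s))"
  for k k' k'' s
 proof -
  have a: "((\<lambda>s. x + s) has_real_derivative 1) (at s)" "((\<lambda>s. x - s) has_real_derivative -1) (at s)"
   by (auto intro!: derivative_eq_intros)
  show "((\<lambda>s. k (x + s)) has_real_derivative k') (at s)"
    "((\<lambda>s. k (x - s)) has_real_derivative - k'') (at s)"
   using DERIV_chain2[where f=k, OF that(1) a(1)] DERIV_chain2[where f=k, OF that(2) a(2)] by simp_all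
 qed
 have r: "u < x + s" "x + s < v" "u < x - s" "x - s < v" if "- h < s" "s < h" for s
  using that x by auto
 have d1': "(q has_real_derivative q1 s) (at s)" if s: "- h < s" "s < h" for s
 proof -
  have "((\<lambda>s. g2 x * s^2) has_real_derivative 2 * g2 x * s) (at s)"
   by (auto intro!: derivative_eq_intros)
  from DERIV_diff[OF DERIV_add[OF sh[OF d1[OF r(1,2)[OF s]] d1[OF r(3,4)[OF s]]]] this]
  show ?thesis by (simp add: q_def q1_def)
 qed
 have d2': "(q1 has_real_derivative q2 s) (at s)" if s: "- h < s" "s < h" for s
 proof -
  have "((\<lambda>s. 2 * g2 x * s) has_real_derivative 2 * g2 x) (at s)"
   by (auto intro!: derivative_eq_intros)
  from DERIV_diff[OF DERIV_diff[OF sh[OF d2[OF r(1,2)[OF s]] d2[OF r(3,4)[OF s]]]] this]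
  show ?thesis by (simp add: q1_def q2_def)
 qed
 have B2: "abs (q2 s) <= B * h^2" if s: "- h < s" "s < h" for s
 proof (cases "s = 0")
  case True then show ?thesis using B0 by (simp add: q2_def)
 next
  case False
  have "abs (q2 s) <= B * abs s^2"
   using S[of "abs s"] s False by (cases "0 < s") (auto simp: q2_def algebra_simps)
  also have "\<dots> <= B * h^2" using s B0 by (intro mult_left_mono power_mono) auto
  finally show ?thesis .
 qed
 have "abs (q h - q 0 - q1 0 * (h - 0)) <= B * h^2 * (h - 0)^2"
  using taylor_remainder[OF c1 d1' d2', of 0 h] h B2 by auto
 then have "abs ((g (x + h) + g (x - h) - 2 * g x) - g2 x * h^2) <= B * h^2 * h^2"
  by (simp add: q_def q1_def algebra_simps)
 moreover have "divdiff2 h h g x - g2 x = ((g (x + h) + g (x - h) - 2 * g x) - g2 x * h^2) / h^2"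
  using h by (simp add: divdiff2_equal diff_divide_distrib)
 ultimately show ?thesis using h by (simp add: abs_divide pos_divide_le_eq)
qed

text \<open>\<open>C\<^sup>1\<^sup>,\<^sup>1\<close> with constant \<open>K\<close>, in a form that is closed under gluing.\<close>

definition tay :: "real => real set => (real => real) => (real => real) => bool" where
 "tay K S g g' \<longleftrightarrow> (\<forall>s\<in>S. (abs (g' s)) <= K \<and> (\<forall>t\<in>S. (abs (g t - g s - (t - s) * g' s)) <= K * (t - s)^2))"

lemma tayD:
 assumes "tay K S g g'" "s \<in> S"
 shows "abs (g' s) <= K" "t \<in> S ==> abs (g t - g s - (t - s) * g' s) <= K * (t - s)^2"
 using assms by (auto simp: tay_def)

lemma tay_lipschitz:
 assumes "tay K {0..T} g g'" "s \<in> {0..T}" "t \<in> {0..T}"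
 shows "abs (g t - g s) <= K * (1 + T) * abs (t - s)"
proof -
 have K: "0 <= K" using tayD(1)[OF assms(1,2)] by linarith
 have "abs (g t - g s) <= K * (t - s)^2 + abs ((t - s) * g' s)"
  using tayD(2)[OF assms(1-3)] by linarith
 also have "\<dots> <= K * (T * abs (t - s)) + abs (t - s) * K"
 proof (rule add_mono)
  have "(t - s)^2 = abs (t - s) * abs (t - s)" by (simp add: power2_eq_square)
  also have "\<dots> <= T * abs (t - s)" using assms by (intro mult_right_mono) auto
  finally show "K * (t - s)^2 <= K * (T * abs (t - s))" using K by (rule mult_left_mono)
  show "abs ((t - s) * g' s) <= abs (t - s) * K"
   using tayD(1)[OF assms(1,2)] by (simp add: abs_mult mult_left_mono)
 qed
 finally show ?thesis by (simp add: algebra_simps)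
qed

lemma tay_second_difference:
 assumes "tay K {0..T} g g'" "0 <= t" "t + 2 * k <= T" "0 <= k"
 shows "abs (g (t + 2 * k) - 2 * g (t + k) + g t) <= 2 * K * k^2"
 using tayD(2)[OF assms(1), of "t + k" "t + 2 * k"] tayD(2)[OF assms(1), of "t + k" t] assms(2-)
 by (simp add: abs_le_iff algebra_simps)

lemma tay_mono: "tay K S g g' ==> K <= K' ==> S' \<subseteq> S ==> tay K' S' g g'"
 unfolding tay_def by (meson mult_right_mono order_trans subsetD zero_le_power2)

lemma tay_add:
 assumes "tay K S g g'" "tay L S k k'"
 shows "tay (K + L) S (\<lambda>t. g t + k t) (\<lambda>t. g' t + k' t)"
 unfolding tay_def
proof (intro ballI conjI)
 fix s assume s: "s \<in> S"
 show "abs (g' s + k' s) <= K + L" using tayD(1)[OF assms(1) s] tayD(1)[OF assms(2) s] by linarith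
 fix t assume t: "t \<in> S"
 have "abs ((g t - g s - (t - s) * g' s) + (k t - k s - (t - s) * k' s)) <= K * (t - s)^2 + L * (t - s)^2"
  using tayD(2)[OF assms(1) s t] tayD(2)[OF assms(2) s t] by linarith
 then show "abs (g t + k t - (g s + k s) - (t - s) * (g' s + k' s)) <= (K + L) * (t - s)^2"
  by (simp add: algebra_simps)
qed

lemma tay_cmult:
 assumes "tay K S g g'"
 shows "tay (abs c * K) S (\<lambda>t. c * g t) (\<lambda>t. c * g' t)"
 unfolding tay_def
proof (intro ballI conjI)
 fix s assume s: "s \<in> S"
 show "abs (c * g' s) <= abs c * K" using tayD(1)[OF assms s] by (simp add: abs_mult mult_left_mono)
 fix t assume t: "t \<in> S"
 have "c * g t - c * g s - (t - s) * (c * g' s) = c * (g t - g s - (t - s) * g' s)"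
  by (simp add: algebra_simps)
 then show "abs (c * g t - c * g s - (t - s) * (c * g' s)) <= abs c * K * (t - s)^2"
  using mult_left_mono[OF tayD(2)[OF assms s t], of "abs c"] by (simp add: abs_mult mult.assoc)
qed

lemma tay_cong:
 assumes "tay K S g g'" "\<And>s. s \<in> S ==> k s = g s" "\<And>s. s \<in> S ==> k' s = g' s"
 shows "tay K S k k'"
 using assms by (simp add: tay_def)

text \<open>The smoothness of data in \<open>x\<close>, expressed through differences: \<open>g\<^sub>2\<close> is the second
 derivative of \<open>g\<close>, and the fourth one is bounded in the weak sense that \<open>g\<^sub>2\<close> has
 second differences of order \<open>h^2\<close>.\<close>

definition smooth_data :: "real => (real => real) => (real => real) => bool" where
 "smooth_data K g g\<^sub>2 \<longleftrightarrow> continuous_on {0..1} g \<and> continuous_on {0..1} g\<^sub>2 \<and>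
   (\<forall>x\<in>{0..1}. (abs (g x)) <= K \<and> abs (g\<^sub>2 x) <= K \<and> (\<forall>y\<in>{0..1}. (abs (g x - g y)) <= K * abs (x - y))) \<and>
   (\<forall>x a c. 0 < a \<and> 0 < c \<and> 0 <= x - a \<and> x + c <= 1 \<longrightarrow>
    abs (interp_err a c g x) <= K * (a * c) \<and> abs (divdiff2 a c g x - g\<^sub>2 x) <= K * (a + c)) \<and>
   (\<forall>x h. 0 < h \<and> 0 <= x - h \<and> x + h <= 1 \<longrightarrow>
    abs (divdiff2 h h g x - g\<^sub>2 x) <= K * h^2 \<and> abs (divdiff2 h h g\<^sub>2 x) <= K)"

lemma smooth_dataD:
 assumes "smooth_data K g g\<^sub>2"
 shows "continuous_on {0..1} g" "continuous_on {0..1} g\<^sub>2"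
  and "x \<in> {0..1} ==> abs (g x) <= K" "x \<in> {0..1} ==> abs (g\<^sub>2 x) <= K"
  and "x \<in> {0..1} ==> y \<in> {0..1} ==> abs (g x - g y) <= K * abs (x - y)"
  and "0 < a ==> 0 < c ==> 0 <= x - a ==> x + c <= 1 ==> abs (interp_err a c g x) <= K * (a * c)"
  and "0 < a ==> 0 < c ==> 0 <= x - a ==> x + c <= 1 ==> abs (divdiff2 a c g x - g\<^sub>2 x) <= K * (a + c)"
  and "0 < h ==> 0 <= x - h ==> x + h <= 1 ==> abs (divdiff2 h h g x - g\<^sub>2 x) <= K * h^2"
  and "0 < h ==> 0 <= x - h ==> x + h <= 1 ==> abs (divdiff2 h h g\<^sub>2 x) <= K"
 using assms unfolding smooth_data_def by blast+

section \<open>Solutions with compatible data\<close>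

lemma continuous_on_shift:
 fixes w :: "real => real => real"
 assumes "continuous_on ({a..c} \<times> {p..q}) (\<lambda>(x, t). w x t)"
  and "a <= a' + u" "c' + u <= c" "p <= p' + v" "q' + v <= q"
 shows "continuous_on ({a'..c'} \<times> {p'..q'}) (\<lambda>(x, t). w (x + u) (t + v))"
proof -
 have "continuous_on ({a'..c'} \<times> {p'..q'}) (\<lambda>y. (\<lambda>(x, t). w x t) (fst y + u, snd y + v))"
  by (rule continuous_on_compose2[OF assms(1)]) (use assms in \<open>auto intro!: continuous_intros\<close>)
 then show ?thesis by (simp add: case_prod_beta)
qed

lemma parop_shift: "parop eps \<beta> (\<lambda>x t. U (x + u) (t + v)) h x t = parop eps \<beta> U h (x + u) (t + v)"
proof -
 have "x + h + u = x + u + h" "x - h + u = x + u - h" "t - h + v = t + v - h" by auto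
 then show ?thesis by (simp only: parop_def)
qed

text \<open>The interpolation error is a combination of space translates with constant coefficients,
  and the operator commutes with translations because its potential is a single number
  \<open>\<beta>\<close>. For a potential varying in \<open>x\<close> this identity would fail; it
  is what lets truncation errors solve the original equation.\<close>

lemma parop_interp_err:
 "parop eps \<beta> (\<lambda>x t. interp_err a c (\<lambda>y. U y t) x) h x t = interp_err a c (\<lambda>y. parop eps \<beta> U h y t) x"
proof -
 have eq: "(\<lambda>x t. interp_err a c (\<lambda>y. U y t) x)
   = (\<lambda>x t. c / (a + c) * U (x + - a) (t + 0) + a / (a + c) * U (x + c) (t + 0) - U x t)"
  by (intro ext) (simp add: interp_err_def add_divide_distrib)
 show ?thesis
  unfolding eq parop_diff parop_add parop_cmult parop_shift
  by (simp add: interp_err_def add_divide_distrib)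
qed

text \<open>Used to send the auxiliary step, which stands in for a derivative, to zero after the
  maximum principle has been applied.\<close>

lemma le_of_le_add_small:
 fixes X Y :: real
 assumes "0 < d" "\<And>\<eta>. 0 < \<eta> ==> \<eta> < d ==> X <= Y + C * \<eta>^2"
 shows "X <= Y"
proof (rule tendsto_lowerbound[where F="at_right 0"])
 have "((\<lambda>\<eta>. Y + C * \<eta>^2) \<longlongrightarrow> Y + C * 0^2) (at_right (0::real))" by (intro tendsto_intros)
 then show "((\<lambda>\<eta>. Y + C * \<eta>^2) \<longlongrightarrow> Y) (at_right (0::real))" by simp
 have "\<forall>\<^sub>F h in at_right 0. h < d" by (rule eventually_at_right_less) fact
 moreover have "\<forall>\<^sub>F h in at_right 0. (0::real) < h" by (simp add: eventually_at_filter)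
 ultimately show "\<forall>\<^sub>F \<eta> in at_right 0. X <= Y + C * \<eta>^2" by eventually_elim (use assms in auto)
qed simp

text \<open>An interpolation inequality: a bound on the function and one on its second derivative
  control the slope, through a Taylor step of fixed length 1/2. No boundary information on the slope
  is needed.\<close>

lemma lipschitz_of_second_derivative:
 fixes g :: "real => real"
 assumes cont: "continuous_on {0..1} g"
  and d1: "\<And>z. 0 < z ==> z < 1 ==> (g has_real_derivative g1 z) (at z)"
  and d2: "\<And>z. 0 < z ==> z < 1 ==> (g1 has_real_derivative g2 z) (at z)"
  and A: "\<And>z. 0 <= z ==> z <= 1 ==> abs (g z) <= A" and B: "\<And>z. 0 < z ==> z < 1 ==> abs (g2 z) <= B"
  and x: "0 <= x" "x <= 1" and y: "0 <= y" "y <= 1"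
 shows "abs (g x - g y) <= (4 * A + B) * abs (x - y)"
proof (cases "y = x")
 case False
 have d1b: "abs (g1 z) <= 4 * A + B" if z: "0 < z" "z < 1" for z
 proof -
  \<comment> \<open>A point of \<open>{0..1}\<close> at distance exactly 1/2 from \<open>z\<close>,
    on whichever side there is room.\<close>
  define v where "v = (if z < 1/2 then z + 1/2 else z - 1/2)"
  have v: "0 <= v" "v <= 1" "abs (v - z) = 1/2" "(v - z)^2 = 1/4" using z by (auto simp: v_def power2_eq_square)
  have "abs (g v - g z - g1 z * (v - z)) <= B * (v - z)^2"
   by (rule taylor_remainder[OF cont d1 d2]) (use z v B in auto)
  then have "abs ((g v - g z) - g1 z * (v - z)) <= B / 4" unfolding v(4) by simp
  moreover have "abs (g v) <= A" "abs (g z) <= A" using A z v by auto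
  ultimately have "abs (g1 z * (v - z)) <= B / 4 + 2 * A" by linarith
  then show ?thesis using v A[of z] B[OF z] z by (simp add: abs_mult)
 qed
 obtain z where z: "min y x < z" "z < max y x" "g x - g y = g1 z * (x - y)"
  by (rule mvt_between[OF False cont d1 y x])
 have "abs (g1 z) <= 4 * A + B" using d1b[of z] z x y by auto
 then show ?thesis unfolding z(3) abs_mult by (rule mult_right_mono) simp
qed simp

section \<open>A priori bounds for the regularised remainder\<close>

text \<open>Here \<open>w\<close> is the remainder after removal of the singular parts.
  Compatibility of order zero is contained in \<open>w\<close> being a single function with
  prescribed traces; \<open>compat0\<close> and \<open>compat1\<close> say that the boundary data
  start with the slope that the equation forces at the corner. Everything is bounded by the one
  number \<open>K\<close>, which keeps the constants below free of \<open>eps\<close>.\<close>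

locale regular =
 fixes T eps K :: real and b b' :: "real => real" and f f\<^sub>2 ft w wt wx wxx :: "real => real => real"
  and \<psi> \<psi>\<^sub>2 g\<^sub>0 g\<^sub>1 :: "real => real"
 assumes T: "0 < T" and eps: "0 < eps" "eps <= 1" and K: "1 <= K"
  and b: "\<And>t. 0 <= t ==> t <= T ==> 0 <= b t \<and> b t <= K" and b_tay: "tay K {0..T} b b'"
  and f_time: "\<And>x. 0 <= x ==> x <= 1 ==> tay K {0..T} (f x) (ft x)"
  and f_space: "\<And>t. 0 <= t ==> t <= T ==> smooth_data K (\<lambda>x. f x t) (\<lambda>x. f\<^sub>2 x t)"
  and psi: "smooth_data K \<psi> \<psi>\<^sub>2"
  and w_cont: "continuous_on ({0..1} \<times> {0..T}) (\<lambda>(x, t). w x t)"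
  and w_init: "\<And>x. 0 <= x ==> x <= 1 ==> w x 0 = \<psi> x"
  and w_t: "\<And>x t. 0 < x ==> x < 1 ==> 0 < t ==> t <= T ==>
    (w x has_real_derivative wt x t) (at t within {0..T})"
  and w_x: "\<And>x t. 0 < x ==> x < 1 ==> 0 < t ==> t <= T ==>
    ((\<lambda>x. w x t) has_real_derivative wx x t) (at x)"
  and w_xx: "\<And>x t. 0 < x ==> x < 1 ==> 0 < t ==> t <= T ==>
    ((\<lambda>x. wx x t) has_real_derivative wxx x t) (at x)"
  and pde: "\<And>x t. 0 < x ==> x < 1 ==> 0 < t ==> t <= T ==>
    wt x t - eps * wxx x t + b t * w x t = f x t"
  and bd0: "tay K {0..T} (w 0) g\<^sub>0" and bd1: "tay K {0..T} (w 1) g\<^sub>1"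
  and compat0: "g\<^sub>0 0 = eps * \<psi>\<^sub>2 0 - b 0 * \<psi> 0 + f 0 0"
  and compat1: "g\<^sub>1 0 = eps * \<psi>\<^sub>2 1 - b 0 * \<psi> 1 + f 1 0"
begin

text \<open>The potential \<open>\<beta>\<close> is left free because a time increment is tested
  with the coefficient at time \<open>t\<close>, while the shifted solution obeys the equation with
  the coefficient at a later time; the mismatch becomes a source term.\<close>

lemma w_parop:
 assumes "0 < x" "x < 1" "0 < t" "t <= T"
 shows "((\<lambda>h. parop eps \<beta> w h x t) \<longlongrightarrow> f x t + (\<beta> - b t) * w x t) (at_right 0)"
proof -
 have "((\<lambda>h. parop eps \<beta> w h x t) \<longlongrightarrow> wt x t - eps * wxx x t + \<beta> * w x t) (at_right 0)"
  by (rule parop_tendsto[where a=0 and c=1 and Ux="\<lambda>x. wx x t"]) (use assms w_t w_x w_xx in auto)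
 moreover have "wt x t - eps * wxx x t + \<beta> * w x t = f x t + (\<beta> - b t) * w x t"
  using pde[OF assms] by (simp add: algebra_simps)
 ultimately show ?thesis by simp
qed

lemma w_cont_x: "0 <= t ==> t <= T ==> continuous_on {0..1} (\<lambda>x. w x t)"
proof -
 assume t: "0 <= t" "t <= T"
 have "continuous_on {0..1} (\<lambda>x. (\<lambda>(x, t). w x t) (x, t))"
  by (rule continuous_on_compose2[OF w_cont]) (use t in \<open>auto intro!: continuous_intros\<close>)
 then show ?thesis by simp
qed

definition "c\<^sub>0 = K * (1 + T)^2 + K * T"

lemma c0: "1 <= c\<^sub>0"
proof -
 have "1 * 1 <= K * (1 + T)^2" using K T by (intro mult_mono) (auto simp: power2_eq_square algebra_simps)
 then show ?thesis using K T by (simp add: c\<^sub>0_def add_increasing2)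
qed

lemma w_bound: 
 assumes x: "0 <= x" "x <= 1" and t: "0 <= t" "t <= T"
 shows "abs (w x t) <= c\<^sub>0"
proof -
 have bd: "abs (g t) <= K * (1 + T)^2" if g: "tay K {0..T} g g'" "g 0 = \<psi> e" "e \<in> {0..1}" and t: "0 <= t" "t <= T" for g g' e t
 proof -
  have "abs (g t - g 0) <= K * (1 + T) * t" using tay_lipschitz[OF g(1), of 0 t] t T by auto
  also have "\<dots> <= K * (1 + T) * T" using t T K by (intro mult_left_mono) auto
  finally have "abs (g t) <= K + K * (1 + T) * T" using smooth_dataD(3)[OF psi g(3)] g(2) by linarith
  also have "\<dots> <= K * (1 + T)^2" using T K by (simp add: power2_eq_square algebra_simps)
  finally show ?thesis .
 qed
 \<comment> \<open>Taking \<open>P = 0\<close> and \<open>m = 0\<close> in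
   \<open>parabolic_bound\<close> switches the exponential barrier off; the same device recurs in
   the estimates that follow.\<close>
 have "abs (w x t) <= K * (1 + T)^2 + K * t + 0 * (exp (0^2 * t - 0 * (x - 0) / sqrt eps) + exp (0^2 * t - 0 * (1 - x) / sqrt eps))"
 proof (rule parabolic_bound[OF eps(1) _ w_cont _ _ _ _ _ _ _ x t])
  fix x t \<delta> :: real assume xt: "0 < x" "x < 1" "0 < t" "t <= T" "0 < \<delta>"
  show "\<forall>\<^sub>F h in at_right 0. (abs (parop eps (b t) w h x t)) <= K + \<delta>"
   by (rule abs_le_of_tendsto_diff[OF w_parop]) (use xt smooth_dataD(3)[OF f_space[of t], of x] in auto)
 next
  fix x :: real assume x: "0 <= x" "x <= 1"
  have "abs (w x 0) <= K" using smooth_dataD(3)[OF psi, of x] w_init x by auto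
  also have "K * 1 <= K * (1 + T)^2" using K T by (intro mult_left_mono) (auto simp: power2_eq_square algebra_simps)
  finally show "abs (w x 0) <= K * (1 + T)^2" by simp
 qed (use b K T bd[OF bd0, of 0] bd[OF bd1, of 1] w_init in auto)
 also have "\<dots> <= c\<^sub>0" using K t by (simp add: c\<^sub>0_def)
 finally show ?thesis .
qed

text \<open>The time derivative at \<open>t = 0\<close> dictated by the equation. By
  \<open>compat0\<close> and \<open>compat1\<close> it agrees at both ends with the initial slope of
  the boundary data.\<close>

definition "p x = eps * \<psi>\<^sub>2 x - b 0 * \<psi> x + f x 0"

lemma p_bound: "0 <= x ==> x <= 1 ==> abs (p x) <= 3 * K^2"
proof -
 assume x: "0 <= x" "x <= 1"
 have "abs (eps * \<psi>\<^sub>2 x) <= 1 * K"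
  unfolding abs_mult using smooth_dataD(4)[OF psi, of x] x eps by (intro mult_mono) auto
 moreover have "abs (b 0 * \<psi> x) <= K * K"
  unfolding abs_mult using smooth_dataD(3)[OF psi, of x] x b[of 0] T by (intro mult_mono) auto
 moreover have "abs (f x 0) <= K" using smooth_dataD(3)[OF f_space[of 0], of x] x T by auto
 moreover have "K <= K * K" using K by simp
 ultimately show ?thesis unfolding p_def by (simp add: power2_eq_square)
qed

text \<open>This is where the weak fourth derivative of the initial data enters: \<open>p\<close>
  contains \<open>eps * \<psi>\<^sub>2\<close>, whose second differences are controlled only through
  \<open>smooth_data\<close>.\<close>

lemma p_divdiff:
 assumes h: "0 < h" "0 <= x - h" "x + h <= 1"
 shows "abs (divdiff2 h h p x) <= 5 * K^2"
proof -
 have f0: "smooth_data K (\<lambda>x. f x 0) (\<lambda>x. f\<^sub>2 x 0)" using f_space[of 0] T by simp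
 have "abs (eps * divdiff2 h h \<psi>\<^sub>2 x) <= 1 * K"
  unfolding abs_mult using smooth_dataD(9)[OF psi h] eps by (intro mult_mono) auto
 moreover have "abs (b 0 * divdiff2 h h \<psi> x) <= K * (2 * K)"
  unfolding abs_mult using divdiff2_le[OF smooth_dataD(6)[OF psi h(1) h(1) h(2,3)] h(1) h(1)] b[of 0] T
  by (intro mult_mono) auto
 moreover have "abs (divdiff2 h h (\<lambda>x. f x 0) x) <= 2 * K"
  using divdiff2_le[OF smooth_dataD(6)[OF f0 h(1) h(1) h(2,3)] h(1) h(1)] .
 moreover have "divdiff2 h h p x = eps * divdiff2 h h \<psi>\<^sub>2 x + (- b 0) * divdiff2 h h \<psi> x + divdiff2 h h (\<lambda>x. f x 0) x"
  unfolding divdiff2_cmult[symmetric] divdiff2_add[symmetric] by (simp add: p_def[abs_def])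
 moreover have "K <= K * K" using K by simp
 ultimately show ?thesis by (simp add: power2_eq_square)
qed

text \<open>Near \<open>t = 0\<close> the solution is compared with \<open>\<psi> + t p\<close>.\<close>

definition "ci = K + K^3 * (10 + 2 * T)"

lemma w_initial:
 assumes x: "0 <= x" "x <= 1" and t: "0 <= t" "t <= T"
 shows "abs (w x t - \<psi> x - t * p x) <= ci * t^2"
proof -
 define A where "A = K^3 * (10 + 2 * T)"
 have A0: "0 <= A" using K T by (simp add: A_def)
 have f0: "smooth_data K (\<lambda>x. f x 0) (\<lambda>x. f\<^sub>2 x 0)" using f_space[of 0] T by simp
 define V where "V = (\<lambda>x t. \<psi> x + t * p x)"
 have pc: "continuous_on {0..1} p"
  unfolding p_def[abs_def] by (intro continuous_intros smooth_dataD(1,2)[OF psi] smooth_dataD(1)[OF f0])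
 have Vc: "continuous_on ({0..1} \<times> {0..t}) (\<lambda>(x, t). V x t)"
  unfolding V_def case_prod_beta
  by (intro continuous_intros continuous_on_compose2[OF smooth_dataD(1)[OF psi]] continuous_on_compose2[OF pc])
   (auto intro!: continuous_intros)
 have bd: "abs (g s - (\<psi> e + s * p e)) <= K * t^2 + 0" if "tay K {0..T} g g'" "g 0 = \<psi> e" "g' 0 = p e" "0 <= s" "s <= t" for g g' e s
 proof -
  have "abs (g s - (\<psi> e + s * p e)) <= K * s^2" using tayD(2)[OF that(1), of 0 s] that t T by (auto simp: algebra_simps)
  also have "\<dots> <= K * t^2" using that K by (intro mult_left_mono power_mono) auto
  finally show ?thesis by simp
 qed
 have "abs (w x t - V x t) <= K * t^2 + A * t * t + 0 * (exp (0^2 * t - 0 * (x - 0) / sqrt eps) + exp (0^2 * t - 0 * (1 - x) / sqrt eps))"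
 proof (rule parabolic_bound[where T=t and b=b, OF eps(1) _ _ _ _ _ _ _ _ _ x t(1) order_refl])
  show "continuous_on ({0..1} \<times> {0..t}) (\<lambda>(x, t). w x t - V x t)"
   using continuous_on_diff[OF continuous_on_subset[OF w_cont, of "{0..1} \<times> {0..t}"] Vc] t
   by (simp add: case_prod_beta Sigma_mono)
  fix x s \<delta> :: real assume xs: "0 < x" "x < 1" "0 < s" "s <= t" "0 < \<delta>"
  have sT: "s <= T" using xs t by simp
  define \<eta> where "\<eta> = min x (1 - x)"
  have "\<forall>\<^sub>F h in at_right 0. h < \<eta>" by (rule eventually_at_right_less) (use xs in \<open>auto simp: \<eta>_def\<close>)
  moreover have "\<forall>\<^sub>F h in at_right 0. h < min 1 (\<delta> / (2 * K))" by (rule eventually_at_right_less) (use xs K in auto)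
  moreover have "\<forall>\<^sub>F h in at_right 0. (0::real) < h" by (simp add: eventually_at_filter)
  moreover have "\<forall>\<^sub>F h in at_right 0. dist (parop eps (b s) w h x s) (f x s) < \<delta> / 2"
  proof (rule tendstoD)
   show "((\<lambda>h. parop eps (b s) w h x s) \<longlongrightarrow> f x s) (at_right 0)"
    using w_parop[of x s "b s"] xs sT by simp
  qed (use xs in simp)
  ultimately show "\<forall>\<^sub>F h in at_right 0. (abs (parop eps (b s) (\<lambda>x t. w x t - V x t) h x s)) <= A * t + \<delta>"
  proof eventually_elim
   case (elim h)
   have h: "0 < h" "0 <= x - h" "x + h <= 1" using elim xs by (auto simp: \<eta>_def)
   have e1: "parop eps (b s) V h x s = p x - eps * (divdiff2 h h \<psi> x + s * divdiff2 h h p x) + b s * (\<psi> x + s * p x)"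
    unfolding divdiff2_equal[OF h(1)] V_def parop_def using h by (simp add: field_simps power2_eq_square)
   \<comment> \<open>Every term of the residual carries a factor \<open>s\<close>, except the
     consistency error of the initial data, which vanishes with \<open>h\<close>. Integration in
     time then gives order \<open>t^2\<close>.\<close>
   have "f x s - parop eps (b s) V h x s
     = (f x s - f x 0) + eps * (divdiff2 h h \<psi> x - \<psi>\<^sub>2 x) - (b s - b 0) * \<psi> x + eps * (s * divdiff2 h h p x) - b s * (s * p x)"
    unfolding e1 p_def by (simp add: algebra_simps)
   moreover have "abs (f x s - f x 0) <= K * (1 + T) * s"
    using tay_lipschitz[OF f_time[of x], of 0 s] xs sT T by auto
   moreover have "abs (eps * (divdiff2 h h \<psi> x - \<psi>\<^sub>2 x)) <= \<delta> / 2"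
   proof -
    have "abs (divdiff2 h h \<psi> x - \<psi>\<^sub>2 x) <= K * h^2" by (rule smooth_dataD(8)[OF psi h])
    also have "\<dots> <= K * h" using h K xs by (intro mult_left_mono) (auto simp: power2_eq_square mult_left_le)
    also have "\<dots> <= \<delta> / 2" using elim(2) K by (simp add: field_simps)
    finally show ?thesis
     unfolding abs_mult using eps mult_mono[of "abs eps" 1 "abs (divdiff2 h h \<psi> x - \<psi>\<^sub>2 x)" "\<delta>/2"] by simp
   qed
   moreover have "abs ((b s - b 0) * \<psi> x) <= (K * (1 + T) * s) * K"
    unfolding abs_mult using tay_lipschitz[OF b_tay, of 0 s] smooth_dataD(3)[OF psi, of x] xs sT T
    by (intro mult_mono) auto
   moreover have "abs (eps * (s * divdiff2 h h p x)) <= 1 * (s * (5 * K^2))"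
    unfolding abs_mult using p_divdiff[OF h] eps xs by (intro mult_mono) auto
   moreover have "abs (b s * (s * p x)) <= K * (s * (3 * K^2))"
    unfolding abs_mult using p_bound[of x] b[of s] xs sT by (intro mult_mono) auto
   moreover have "K * (1 + T) * s + (K * (1 + T) * s) * K + 1 * (s * (5 * K^2)) + K * (s * (3 * K^2)) <= A * t"
   proof -
    have k: "K <= K^3" "K * K <= K^3" "K^2 <= K^3" "K * K^2 = K^3"
     using K by (auto simp: power2_eq_square power3_eq_cube intro: mult_left_le[of K])
      (metis mult.right_neutral mult_le_cancel_left_pos mult_mono' zero_less_one_class.zero_le_one order_trans less_le_trans zero_less_one)+
    have "K * (1 + T) + (K * K) * (1 + T) + 5 * K^2 + 3 * (K * K^2) <= K^3 * (1 + T) + K^3 * (1 + T) + 5 * K^3 + 3 * K^3"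
     using k T by (intro add_mono mult_right_mono) auto
    then have "(K * (1 + T) + (K * K) * (1 + T) + 5 * K^2 + 3 * (K * K^2)) * s <= A * s"
     using xs K by (intro mult_right_mono) (auto simp: A_def algebra_simps)
    also have "\<dots> <= A * t" using A0 xs by (intro mult_left_mono) auto
    finally show ?thesis by (simp add: algebra_simps)
   qed
   moreover have "abs (parop eps (b s) w h x s - f x s) <= \<delta> / 2" using elim(4) by (simp add: dist_real_def)
   ultimately show ?case unfolding parop_diff by linarith
  qed
 qed (use b K T t A0 bd[OF bd0, of 0] bd[OF bd1, of 1] compat0 compat1 w_init in \<open>auto simp: V_def p_def\<close>)
 also have "\<dots> = ci * t^2" by (simp add: ci_def A_def power2_eq_square algebra_simps)
 finally show ?thesis by (simp add: V_def algebra_simps)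
qed

lemma ci: "0 <= ci" using K T by (simp add: ci_def)

definition "c\<^sub>1 = (ci * T + 3 * K^2 + K * (1 + T)) + K * (1 + T) * (1 + c\<^sub>0) * T"

lemma c1: "0 <= c\<^sub>1" using K T ci c0 by (simp add: c\<^sub>1_def)

lemma lip_nonneg: "0 <= K * (1 + T)" using K T by simp

text \<open>The increment is \<open>O(k)\<close> on all of the parabolic boundary, initially by
  \<open>w_initial\<close> and laterally by the Lipschitz traces, and its source is
  \<open>O(k)\<close> because \<open>f\<close> and \<open>b\<close> are Lipschitz in time.\<close>

lemma w_diff:
 assumes x: "0 <= x" "x <= 1" and t: "0 <= t" "t + k <= T" and k: "0 <= k"
 shows "abs (w x (t + k) - w x t) <= c\<^sub>1 * k"
proof -
 let ?D = "(ci * T + 3 * K^2 + K * (1 + T)) * k" and ?A = "K * (1 + T) * (1 + c\<^sub>0) * k"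
 have nn: "0 <= ?D" "0 <= ?A" using K T ci c0 k by simp_all
 have kT: "k <= T" using t by simp
 have "abs (w x (t + k) - w x t) <= ?D + ?A * t + 0 * (exp (0^2 * t - 0 * (x - 0) / sqrt eps) + exp (0^2 * t - 0 * (1 - x) / sqrt eps))"
 proof (rule parabolic_bound[where T="T - k" and b=b, OF eps(1) _ _ _ _ _ _ _ _ _ x t(1)])
  show "continuous_on ({0..1} \<times> {0..T - k}) (\<lambda>(x, t). w x (t + k) - w x t)"
   using continuous_on_diff[OF continuous_on_shift[OF w_cont, of 0 0 1 0 k "T - k"]
     continuous_on_shift[OF w_cont, of 0 0 1 0 0 "T - k"]] k kT
   by (auto simp: case_prod_beta)
  fix x t \<delta> :: real assume xt: "0 < x" "x < 1" "0 < t" "t <= T - k" "0 < \<delta>"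
  have "((\<lambda>h. parop eps (b t) (\<lambda>x t. w (x + 0) (t + k) - w x t) h x t) \<longlongrightarrow>
    (f (x + 0) (t + k) + (b t - b (t + k)) * w (x + 0) (t + k)) - (f x t + (b t - b t) * w x t)) (at_right 0)"
   unfolding parop_diff parop_shift by (intro tendsto_diff w_parop) (use xt k in auto)
  then have lim: "((\<lambda>h. parop eps (b t) (\<lambda>x t. w x (t + k) - w x t) h x t) \<longlongrightarrow>
    (f x (t + k) - f x t) - (b (t + k) - b t) * w x (t + k)) (at_right 0)"
   by (simp add: algebra_simps)
  have "abs (f x (t + k) - f x t) <= K * (1 + T) * k"
   using tay_lipschitz[OF f_time[of x], of t "t + k"] xt k by auto
  moreover have "abs ((b (t + k) - b t) * w x (t + k)) <= K * (1 + T) * k * c\<^sub>0"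
   unfolding abs_mult using tay_lipschitz[OF b_tay, of t "t + k"] w_bound[of x "t + k"] xt k lip_nonneg
   by (intro mult_mono) auto
  ultimately have "abs ((f x (t + k) - f x t) - (b (t + k) - b t) * w x (t + k)) <= ?A"
   by (simp add: algebra_simps)
  then show "\<forall>\<^sub>F h in at_right 0. (abs (parop eps (b t) (\<lambda>x t. w x (t + k) - w x t) h x t)) <= ?A + \<delta>"
   by (rule abs_le_of_tendsto_diff[OF lim]) fact
 next
  fix x :: real assume x: "0 <= x" "x <= 1"
  have "abs (w x k - \<psi> x - k * p x) <= ci * k^2" using w_initial[OF x k kT] .
  also have "\<dots> <= ci * (T * k)" using ci k kT by (intro mult_left_mono) (auto simp: power2_eq_square intro: mult_right_mono)
  finally have "abs (w x k - \<psi> x - k * p x) <= ci * (T * k)" .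
  moreover have "abs (k * p x) <= k * (3 * K^2)" unfolding abs_mult using k p_bound[OF x] by (intro mult_mono) auto
  moreover have "0 <= K * (1 + T) * k" using lip_nonneg k by simp
  ultimately show "abs (w x (0 + k) - w x 0) <= ?D" unfolding w_init[OF x] by (simp add: algebra_simps)
 next
  fix t assume t: "0 <= t" "t <= T - k"
  have "0 <= (ci * T + 3 * K^2) * k" using ci T k by simp
  then show "abs (w 0 (t + k) - w 0 t) <= ?D + 0" "abs (w 1 (t + k) - w 1 t) <= ?D + 0"
   using tay_lipschitz[OF bd0, of t "t + k"] tay_lipschitz[OF bd1, of t "t + k"] t k
   by (auto simp: algebra_simps)
 qed (use b nn t k in auto)
 also have "\<dots> <= ?D + ?A * T" using nn t k mult_left_mono[of t T ?A] by simp
 also have "\<dots> = c\<^sub>1 * k" by (simp add: c\<^sub>1_def algebra_simps)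
 finally show ?thesis .
qed

lemma w_lipschitz_t:
 assumes "0 <= x" "x <= 1" "0 <= s" "s <= T" "0 <= t" "t <= T"
 shows "abs (w x t - w x s) <= c\<^sub>1 * abs (t - s)"
 using w_diff[of x s "t - s"] w_diff[of x t "s - t"] assms by (cases "s <= t") auto

definition "c\<^sub>2 = (6 * ci + 2 * K) + (2 * K + 2 * K * c\<^sub>0 + 2 * (K * (1 + T)) * c\<^sub>1) * T"

lemma c2: "0 <= c\<^sub>2" using K T ci c0 c1 by (simp add: c\<^sub>2_def)

text \<open>A second difference annihilates the affine comparison function
  \<open>\<psi> + t * p\<close>, so the initial values are \<open>O(k^2)\<close>; the traces
  contribute the same order since they are of class \<open>C^(1,1)\<close>. This replaces a bound on
  the second time derivative.\<close>

lemma w_second_diff: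
 assumes x: "0 <= x" "x <= 1" and t: "0 <= t" "t + 2 * k <= T" and k: "0 <= k"
 shows "abs (w x (t + 2 * k) - 2 * w x (t + k) + w x t) <= c\<^sub>2 * k^2"
proof -
 let ?D = "(6 * ci + 2 * K) * k^2" and ?A = "(2 * K + 2 * K * c\<^sub>0 + 2 * (K * (1 + T)) * c\<^sub>1) * k^2"
 have nn: "0 <= ?D" "0 <= ?A" using K T ci c0 c1 by simp_all
 let ?z = "\<lambda>x t. w x (t + 2 * k) - 2 * w x (t + k) + w x t"
 have "abs (?z x t) <= ?D + ?A * t + 0 * (exp (0^2 * t - 0 * (x - 0) / sqrt eps) + exp (0^2 * t - 0 * (1 - x) / sqrt eps))"
 proof (rule parabolic_bound[where T="T - 2 * k" and b=b, OF eps(1) _ _ _ _ _ _ _ _ _ x t(1)])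
  show "continuous_on ({0..1} \<times> {0..T - 2 * k}) (\<lambda>(x, t). ?z x t)"
   using continuous_on_add[OF continuous_on_diff[OF continuous_on_shift[OF w_cont, of 0 0 1 0 "2 * k" "T - 2 * k"]
    continuous_on_mult[OF continuous_on_const continuous_on_shift[OF w_cont, of 0 0 1 0 k "T - 2 * k"]]]
     continuous_on_shift[OF w_cont, of 0 0 1 0 0 "T - 2 * k"], of 2] k t
   by (auto simp: case_prod_beta)
  fix x t \<delta> :: real assume xt: "0 < x" "x < 1" "0 < t" "t <= T - 2 * k" "0 < \<delta>"
  have lim0: "((\<lambda>h. parop eps (b t) (\<lambda>x t. w (x + 0) (t + 2 * k) - 2 * w (x + 0) (t + k) + w x t) h x t) \<longlongrightarrow>
    (f (x + 0) (t + 2 * k) + (b t - b (t + 2 * k)) * w (x + 0) (t + 2 * k))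
    - 2 * (f (x + 0) (t + k) + (b t - b (t + k)) * w (x + 0) (t + k))
    + (f x t + (b t - b t) * w x t)) (at_right 0)"
   unfolding parop_diff parop_add parop_cmult parop_shift
   by (intro tendsto_diff tendsto_add tendsto_mult tendsto_const w_parop) (use xt k in auto)
  \<comment> \<open>A discrete product rule for \<open>b * w\<close>: what survives is a second
    difference of \<open>b\<close> and a product of two first increments, all of order
    \<open>k^2\<close>.\<close>
  have eq: "(f (x + 0) (t + 2 * k) + (b t - b (t + 2 * k)) * w (x + 0) (t + 2 * k))
    - 2 * (f (x + 0) (t + k) + (b t - b (t + k)) * w (x + 0) (t + k)) + (f x t + (b t - b t) * w x t)
   = (f x (t + 2 * k) - 2 * f x (t + k) + f x t) - (b (t + 2 * k) - 2 * b (t + k) + b t) * w x (t + 2 * k)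
    - 2 * ((b (t + k) - b t) * (w x ((t + k) + k) - w x (t + k)))"
   by (simp add: algebra_simps)
  from lim0[unfolded eq] have lim: "((\<lambda>h. parop eps (b t) ?z h x t) \<longlongrightarrow>
    (f x (t + 2 * k) - 2 * f x (t + k) + f x t) - (b (t + 2 * k) - 2 * b (t + k) + b t) * w x (t + 2 * k)
    - 2 * ((b (t + k) - b t) * (w x ((t + k) + k) - w x (t + k)))) (at_right 0)"
   by (simp only: add_0_right)
  have "abs (f x (t + 2 * k) - 2 * f x (t + k) + f x t) <= 2 * K * k^2"
   by (rule tay_second_difference[OF f_time]) (use xt k in auto)
  moreover have "abs ((b (t + 2 * k) - 2 * b (t + k) + b t) * w x (t + 2 * k)) <= (2 * K * k^2) * c\<^sub>0"
   unfolding abs_mult using tay_second_difference[OF b_tay, of t k] w_bound[of x "t + 2 * k"] xt k K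
   by (intro mult_mono) auto
  moreover have "abs ((b (t + k) - b t) * (w x ((t + k) + k) - w x (t + k))) <= (K * (1 + T) * k) * (c\<^sub>1 * k)"
   unfolding abs_mult using tay_lipschitz[OF b_tay, of t "t + k"] w_diff[of x "t + k" k] xt k lip_nonneg
   by (intro mult_mono) auto
  ultimately have "abs ((f x (t + 2 * k) - 2 * f x (t + k) + f x t) - (b (t + 2 * k) - 2 * b (t + k) + b t) * w x (t + 2 * k)
    - 2 * ((b (t + k) - b t) * (w x ((t + k) + k) - w x (t + k))))
    <= 2 * K * k^2 + (2 * K * k^2) * c\<^sub>0 + 2 * ((K * (1 + T) * k) * (c\<^sub>1 * k))" by linarith
  also have "\<dots> = ?A" by (simp add: algebra_simps power2_eq_square)
  finally show "\<forall>\<^sub>F h in at_right 0. (abs (parop eps (b t) ?z h x t)) <= ?A + \<delta>"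
   by (rule abs_le_of_tendsto_diff[OF lim]) fact
 next
  fix x :: real assume x: "0 <= x" "x <= 1"
  \<comment> \<open>The steps \<open>k\<close>, counted twice, and \<open>2 * k\<close> contribute
    \<open>2 * ci * k^2 + 4 * ci * k^2\<close>, the origin of the factor 6.\<close>
  have "abs (w x k - \<psi> x - k * p x) <= ci * k^2" "abs (w x (2 * k) - \<psi> x - (2 * k) * p x) <= ci * (2 * k)^2"
   using w_initial[OF x, of k] w_initial[OF x, of "2 * k"] k t by auto
  moreover have "w x (2 * k) - 2 * w x k + \<psi> x = (w x (2 * k) - \<psi> x - (2 * k) * p x) - 2 * (w x k - \<psi> x - k * p x)"
   by (simp add: algebra_simps)
  moreover have "0 <= K * k^2" using K by simp
  ultimately show "abs (w x (0 + 2 * k) - 2 * w x (0 + k) + w x 0) <= ?D"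
   unfolding w_init[OF x] by (simp add: algebra_simps)
 next
  fix t assume t: "0 <= t" "t <= T - 2 * k"
  have "0 <= ci * k^2" using ci by simp
  then show "abs (w 0 (t + 2 * k) - 2 * w 0 (t + k) + w 0 t) <= ?D + 0"
    "abs (w 1 (t + 2 * k) - 2 * w 1 (t + k) + w 1 t) <= ?D + 0"
   using tay_second_difference[OF bd0, of t k] tay_second_difference[OF bd1, of t k] t k
   by (auto simp: algebra_simps)
 qed (use b nn t k in auto)
 also have "\<dots> <= ?D + ?A * T" using nn t k mult_left_mono[of t T ?A] by simp
 also have "\<dots> = c\<^sub>2 * k^2" by (simp add: c\<^sub>2_def algebra_simps)
 finally show ?thesis .
qed

end

section \<open>Derivatives of the regularised remainder recovered from its differences\<close>

lemma right_difference_tendsto: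
 fixes g :: "real => real"
 assumes "(g has_real_derivative D) (at t within {0..T})" "0 <= t" "t < T"
 shows "((\<lambda>h. (g (t + h) - g t) / h) \<longlongrightarrow> D) (at_right 0)"
proof -
 have "((\<lambda>y. (g y - g t) / (y - t)) \<longlongrightarrow> D) (at t within {0..T})"
  using assms by (simp add: has_field_derivative_iff)
 moreover have "filterlim (\<lambda>h. t + h) (at t within {0..T}) (at_right 0)"
  unfolding filterlim_at
 proof
  have "\<forall>\<^sub>F h in at_right 0. h < T - t" by (rule eventually_at_right_less) (use assms in simp)
  moreover have "\<forall>\<^sub>F h in at_right 0. (0::real) < h" by (simp add: eventually_at_filter)
  ultimately show "\<forall>\<^sub>F h in at_right 0. t + h \<in> {0..T} \<and> t + h \<noteq> t"
   by eventually_elim (use assms in auto)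
 next
  have "((\<lambda>h. t + h) \<longlongrightarrow> t + 0) (at_right 0)" by (intro tendsto_intros)
  then show "((\<lambda>h. t + h) \<longlongrightarrow> t) (at_right 0)" by simp
 qed
 ultimately have "((\<lambda>h. (g (t + h) - g t) / ((t + h) - t)) \<longlongrightarrow> D) (at_right 0)"
  by (rule filterlim_compose)
 then show ?thesis by simp
qed

lemma abs_le_of_tendsto:
 fixes u :: "'a => real"
 assumes "(u \<longlongrightarrow> l) F" "\<forall>\<^sub>F h in F. (abs (u h)) <= A" "F \<noteq> bot"
 shows "abs l <= A"
 by (rule tendsto_upperbound[OF tendsto_rabs[OF assms(1)] assms(2,3)])

text \<open>Successively halving the step: if second differences are of order \<open>h^2\<close>, then
 one-sided difference quotients are within \<open>O(h)\<close> of the one-sided derivative.\<close>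

lemma one_sided_derivative_err:
 fixes q :: "real => real"
 assumes sd: "\<And>j. 0 < j ==> 2 * j <= k ==> abs (q (2 * j) - 2 * q j + q 0) <= C * j^2"
  and D: "((\<lambda>h. (q h - q 0) / h) \<longlongrightarrow> D) (at_right 0)" and k: "0 < k"
 shows "abs ((q k - q 0) / k - D) <= C * k"
proof -
 define h where "h = (\<lambda>n. k / 2 ^ n)"
 define a where "a = (\<lambda>n. (q (h n) - q 0) / h n)"
 have h0: "0 < h n" "h n <= k" for n using k by (auto simp: h_def divide_le_eq_1 field_simps)
 have C: "0 <= C"
 proof -
  have "0 <= C * (k/2)^2" by (rule order_trans[OF abs_ge_zero sd]) (use k in auto)
  moreover have "0 < (k/2)^2" using k by simp
  ultimately show ?thesis by (simp only: zero_le_mult_iff) linarith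
 qed
 have step: "abs (a n - a (Suc n)) <= C * k / 2 ^ Suc n" for n
 proof -
  define j where "j = h (Suc n)"
  have j: "0 < j" "h n = 2 * j" using h0[of "Suc n"] by (auto simp: j_def h_def)
  have "a n - a (Suc n) = (q (2 * j) - 2 * q j + q 0) / (2 * j)"
   using j unfolding a_def j_def[symmetric] by (simp add: field_simps)
  then have "abs (a n - a (Suc n)) <= C * j^2 / (2 * j)"
   using sd[OF j(1)] h0(2)[of n] j by (simp add: abs_divide divide_right_mono)
  also have "\<dots> <= C * j" using j C by (simp add: power2_eq_square)
  also have "\<dots> = C * k / 2 ^ Suc n" by (simp add: j_def h_def)
  finally show ?thesis .
 qed
 have tele: "abs (a 0 - a n) <= C * k * (1 - 1 / 2 ^ n)" for n
 proof (induction n)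
  case (Suc n)
  have "abs (a 0 - a (Suc n)) <= C * k * (1 - 1 / 2 ^ n) + C * k / 2 ^ Suc n"
   using Suc step[of n] by linarith
  also have "\<dots> = C * k * (1 - 1 / 2 ^ Suc n)" by (simp add: field_simps)
  finally show ?case .
 qed simp
 have "filterlim h (at_right 0) sequentially"
  unfolding filterlim_at
 proof
  show "\<forall>\<^sub>F n in sequentially. h n \<in> {0<..} \<and> h n \<noteq> 0" using h0(1) by (auto intro!: always_eventually less_imp_neq[symmetric])
  have "(\<lambda>n. k * (1 / 2) ^ n) \<longlonglongrightarrow> k * 0"
   by (intro tendsto_intros LIMSEQ_realpow_zero) auto
  then show "h \<longlonglongrightarrow> 0" by (simp add: h_def power_divide)
 qed
 from filterlim_compose[OF D this] have "a \<longlonglongrightarrow> D" by (simp add: a_def)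
 then have "(\<lambda>n. a 0 - a n) \<longlonglongrightarrow> a 0 - D" by (intro tendsto_intros)
 moreover have "abs (a 0 - a n) <= C * k" for n
 proof -
  have "C * k * (1 - 1 / 2 ^ n) <= C * k * 1" using C k by (intro mult_left_mono) auto
  then show ?thesis using tele[of n] by simp
 qed
 ultimately have "abs (a 0 - D) <= C * k" by (intro abs_le_of_tendsto) auto
 then show ?thesis by (simp add: a_def h_def)
qed

lemma tendsto_interp_err:
 assumes "((\<lambda>h. u h (x - a)) \<longlongrightarrow> v (x - a)) F" "((\<lambda>h. u h x) \<longlongrightarrow> v x) F"
  "((\<lambda>h. u h (x + c)) \<longlongrightarrow> v (x + c)) F" "0 < a" "0 < c"
 shows "((\<lambda>h. interp_err a c (u h) x) \<longlongrightarrow> interp_err a c v x) F"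
 unfolding interp_err_def by (intro tendsto_intros assms) (use assms in auto)

lemma tendsto_divdiff2:
 assumes "((\<lambda>h. u h (x - a)) \<longlongrightarrow> v (x - a)) F" "((\<lambda>h. u h x) \<longlongrightarrow> v x) F"
  "((\<lambda>h. u h (x + c)) \<longlongrightarrow> v (x + c)) F" "0 < a" "0 < c"
 shows "((\<lambda>h. divdiff2 a c (u h) x) \<longlongrightarrow> divdiff2 a c v x) F"
 unfolding divdiff2_def by (intro tendsto_mult tendsto_const tendsto_interp_err assms)

lemma parop_divdiff2:
 "parop eps \<beta> (\<lambda>x t. divdiff2 a c (\<lambda>y. U y t) x) h x t = divdiff2 a c (\<lambda>y. parop eps \<beta> U h y t) x"
 unfolding divdiff2_def parop_cmult parop_interp_err ..

context regular
begin

lemma w_left_err: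
 assumes x: "0 < x" "x < 1" and t: "0 <= t - k" "t <= T" and k: "0 < k"
 shows "abs ((w x t - w x (t - k)) / k - wt x t) <= c\<^sub>2 * k"
proof -
 have tt: "0 < t" using t k by linarith
 have lim: "((\<lambda>h. (w x t - w x (t - h)) / h) \<longlongrightarrow> wt x t) (at_right 0)"
  by (rule left_difference_tendsto[OF w_t]) (use x t tt in auto)
 have "abs (((- w x (t - k)) - (- w x (t - 0))) / k - wt x t) <= c\<^sub>2 * k"
 proof (rule one_sided_derivative_err[OF _ _ k])
  show "((\<lambda>h. (- w x (t - h) - - w x (t - 0)) / h) \<longlongrightarrow> wt x t) (at_right 0)" using lim by simp
  fix j assume j: "0 < j" "2 * j <= k"
  show "abs (- w x (t - 2 * j) - 2 * - w x (t - j) + - w x (t - 0)) <= c\<^sub>2 * j^2"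
   using w_second_diff[of x "t - 2 * j" j] x t j by (simp add: algebra_simps abs_minus_commute abs_le_iff)
 qed
 then show ?thesis by simp
qed

lemma w_right_err:
 assumes x: "0 < x" "x < 1" and t: "0 < t" "t + k <= T" and k: "0 < k"
 shows "abs ((w x (t + k) - w x t) / k - wt x t) <= c\<^sub>2 * k"
proof -
 have tt: "t < T" using t k by linarith
 have lim: "((\<lambda>h. (w x (t + h) - w x t) / h) \<longlongrightarrow> wt x t) (at_right 0)"
  by (rule right_difference_tendsto[OF w_t]) (use x t tt in auto)
 have "abs ((w x (t + k) - w x (t + 0)) / k - wt x t) <= c\<^sub>2 * k"
 proof (rule one_sided_derivative_err[OF _ _ k])
  show "((\<lambda>h. (w x (t + h) - w x (t + 0)) / h) \<longlongrightarrow> wt x t) (at_right 0)" using lim by simp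
  fix j assume j: "0 < j" "2 * j <= k"
  show "abs (w x (t + 2 * j) - 2 * w x (t + j) + w x (t + 0)) <= c\<^sub>2 * j^2"
   using w_second_diff[of x t j] x t j by simp
 qed
 then show ?thesis by simp
qed

text \<open>The forward quotient at \<open>s\<close> and the backward quotient at \<open>t\<close>
  over the whole interval are the same number, and each lies within
  \<open>c\<^sub>2 * (t - s)\<close> of the derivative at its base point.\<close>

lemma wt_lipschitz_t:
 assumes x: "0 < x" "x < 1" and t: "0 < s" "s < t" "t <= T"
 shows "abs (wt x t - wt x s) <= 2 * c\<^sub>2 * (t - s)"
 using w_left_err[OF x, of t "t - s"] w_right_err[OF x, of s "t - s"] t by simp

lemma wt_bound:
 assumes x: "0 < x" "x < 1" and t: "0 < t" "t <= T"
 shows "abs (wt x t) <= c\<^sub>1"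
proof (rule abs_le_of_tendsto[OF left_difference_tendsto[OF w_t[OF x t] t]])
 have "\<forall>\<^sub>F h in at_right 0. h < t" by (rule eventually_at_right_less) fact
 moreover have "\<forall>\<^sub>F h in at_right 0. (0::real) < h" by (simp add: eventually_at_filter)
 ultimately show "\<forall>\<^sub>F h in at_right 0. (abs ((w x t - w x (t - h)) / h)) <= c\<^sub>1"
 proof eventually_elim
  case (elim h)
  then show ?case using w_diff[of x "t - h" h] x t by (simp add: abs_divide pos_divide_le_eq)
 qed
qed simp

definition "c\<^sub>3 = c\<^sub>1 + K * c\<^sub>0 + K"

lemma c3: "0 <= c\<^sub>3" using c1 c0 K by (simp add: c\<^sub>3_def)

lemma eps_wxx: "0 < x ==> x < 1 ==> 0 < t ==> t <= T ==> eps * wxx x t = wt x t + b t * w x t - f x t"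
 using pde[of x t] by linarith

lemma f_bound: "0 <= x ==> x <= 1 ==> 0 <= t ==> t <= T ==> abs (f x t) <= K"
 using smooth_dataD(3)[OF f_space[of t], of x] by simp

text \<open>Read off from the equation, once \<open>wt\<close> and \<open>w\<close> are bounded;
  hence the weight \<open>eps\<close> in front.\<close>

lemma wxx_bound:
 assumes "0 < x" "x < 1" "0 < t" "t <= T"
 shows "eps * abs (wxx x t) <= c\<^sub>3"
proof -
 have "abs (b t * w x t) <= K * c\<^sub>0" unfolding abs_mult using b[of t] w_bound[of x t] assms
  by (intro mult_mono) auto
 then have "abs (eps * wxx x t) <= c\<^sub>3"
  unfolding eps_wxx[OF assms] c\<^sub>3_def using wt_bound[OF assms] f_bound[of x t] assms by linarith
 then show ?thesis using eps by (simp add: abs_mult)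
qed

lemma wxx_bound': "0 < x ==> x < 1 ==> 0 < t ==> t <= T ==> abs (wxx x t) <= c\<^sub>3 / eps"
 using wxx_bound[of x t] eps by (simp add: pos_le_divide_eq mult.commute)

lemma w_interp_err:
 assumes "0 < a" "0 < c" "0 <= x - a" "x + c <= 1" "0 < t" "t <= T"
 shows "abs (interp_err a c (\<lambda>x. w x t) x) <= c\<^sub>3 / eps * (a * c)"
 by (rule interp_err_le[OF w_cont_x w_x w_xx wxx_bound']) (use assms in auto)

definition "c\<^sub>4 = 2 * c\<^sub>2 + K * c\<^sub>1 + K * (1 + T) * c\<^sub>0 + K * (1 + T)"

lemma c4: "0 <= c\<^sub>4" using c1 c0 K T c2 by (simp add: c\<^sub>4_def)

text \<open>Space derivatives of \<open>wt\<close> are not available; its difference quotients in time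
 play its part.\<close>

definition "dq k t x = (w x t - w x (t - k)) / k"

text \<open>None of the bounds depends on \<open>k\<close>, so they survive the limit in which
  \<open>dq k t x\<close> tends to \<open>wt x t\<close>. The bound on the second derivative comes
  from subtracting the equations at the times \<open>t\<close> and \<open>t - k\<close>.\<close>

lemma dq_props:
 assumes t: "0 < t - k" "t <= T" and k: "0 < k"
 shows "continuous_on {0..1} (dq k t)"
  and "0 < x ==> x < 1 ==> (dq k t has_real_derivative (wx x t - wx x (t - k)) / k) (at x)"
  and "0 < x ==> x < 1 ==> ((\<lambda>x. (wx x t - wx x (t - k)) / k) has_real_derivative
    (wxx x t - wxx x (t - k)) / k) (at x)"
  and "0 <= x ==> x <= 1 ==> abs (dq k t x) <= c\<^sub>1"
  and "0 < x ==> x < 1 ==> abs ((wxx x t - wxx x (t - k)) / k) <= c\<^sub>4 / eps"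
proof -
 show "continuous_on {0..1} (dq k t)"
  unfolding dq_def[abs_def] by (intro continuous_intros w_cont_x) (use t k in auto)
 show "0 < x ==> x < 1 ==> (dq k t has_real_derivative (wx x t - wx x (t - k)) / k) (at x)"
  unfolding dq_def[abs_def] by (intro DERIV_cdivide DERIV_diff w_x) (use t k in auto)
 show "0 < x ==> x < 1 ==> ((\<lambda>x. (wx x t - wx x (t - k)) / k) has_real_derivative
    (wxx x t - wxx x (t - k)) / k) (at x)"
  by (intro DERIV_cdivide DERIV_diff w_xx) (use t k in auto)
 show "0 <= x ==> x <= 1 ==> abs (dq k t x) <= c\<^sub>1"
  using w_diff[of x "t - k" k] t k by (simp add: dq_def abs_divide pos_divide_le_eq)
 assume x: "0 < x" "x < 1"
 have "eps * (wxx x t - wxx x (t - k)) = (wt x t - wt x (t - k)) + b t * (w x t - w x (t - k))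
   + (b t - b (t - k)) * w x (t - k) - (f x t - f x (t - k))"
  using eps_wxx[OF x, of t] eps_wxx[OF x, of "t - k"] t k by (simp add: algebra_simps)
 moreover have "abs (wt x t - wt x (t - k)) <= 2 * c\<^sub>2 * k"
  using wt_lipschitz_t[OF x, of "t - k" t] t k by simp
 moreover have "abs (b t * (w x t - w x (t - k))) <= K * (c\<^sub>1 * k)"
  unfolding abs_mult using b[of t] w_diff[of x "t - k" k] x t k by (intro mult_mono) auto
 moreover have "abs ((b t - b (t - k)) * w x (t - k)) <= (K * (1 + T) * k) * c\<^sub>0"
  unfolding abs_mult using tay_lipschitz[OF b_tay, of "t - k" t] w_bound[of x "t - k"] x t k lip_nonneg
  by (intro mult_mono) auto
 moreover have "abs (f x t - f x (t - k)) <= K * (1 + T) * k"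
  using tay_lipschitz[OF f_time[of x], of "t - k" t] x t k by auto
 ultimately have "abs (eps * (wxx x t - wxx x (t - k))) <= c\<^sub>4 * k"
  unfolding c\<^sub>4_def by (simp add: algebra_simps)
 then have "eps * abs (wxx x t - wxx x (t - k)) <= c\<^sub>4 * k" using eps by (simp only: abs_mult)
 then show "abs ((wxx x t - wxx x (t - k)) / k) <= c\<^sub>4 / eps"
  using eps k by (simp add: abs_mult abs_divide field_simps)
qed

lemma dq_tendsto:
 "0 < x ==> x < 1 ==> 0 < t ==> t <= T ==> ((\<lambda>k. dq k t x) \<longlongrightarrow> wt x t) (at_right 0)"
 unfolding dq_def by (intro left_difference_tendsto[OF w_t]) auto

lemma wt_lipschitz_x:
 assumes x: "0 < x" "x < 1" and y: "0 < y" "y < 1" and t: "0 < t" "t <= T"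
 shows "abs (wt x t - wt y t) <= (4 * c\<^sub>1 + c\<^sub>4 / eps) * abs (x - y)"
proof (rule abs_le_of_tendsto[OF tendsto_diff[OF dq_tendsto[OF x t] dq_tendsto[OF y t]]])
 have "\<forall>\<^sub>F h in at_right 0. h < t" by (rule eventually_at_right_less) fact
 moreover have "\<forall>\<^sub>F h in at_right 0. (0::real) < h" by (simp add: eventually_at_filter)
 ultimately show "\<forall>\<^sub>F h in at_right 0. (abs (dq h t x - dq h t y)) <= (4 * c\<^sub>1 + c\<^sub>4 / eps) * abs (x - y)"
 proof eventually_elim
  case (elim h)
  have p: "0 < t - h" "t <= T" "0 < h" using elim t by auto
  show ?case by (rule lipschitz_of_second_derivative[OF dq_props[OF p]]) (use x y in auto)
 qed
qed simp

lemma wt_interp_err: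
 assumes ac: "0 < a" "0 < c" and x: "0 < x - a" "x + c < 1" and t: "0 < t" "t <= T"
 shows "abs (interp_err a c (\<lambda>x. wt x t) x) <= c\<^sub>4 / eps * (a * c)"
proof (rule abs_le_of_tendsto)
 show "((\<lambda>k. interp_err a c (dq k t) x) \<longlongrightarrow> interp_err a c (\<lambda>x. wt x t) x) (at_right 0)"
  by (intro tendsto_interp_err dq_tendsto) (use ac x t in auto)
 have "\<forall>\<^sub>F h in at_right 0. h < t" by (rule eventually_at_right_less) fact
 moreover have "\<forall>\<^sub>F h in at_right 0. (0::real) < h" by (simp add: eventually_at_filter)
 ultimately show "\<forall>\<^sub>F h in at_right 0. (abs (interp_err a c (dq h t) x)) <= c\<^sub>4 / eps * (a * c)"
 proof eventually_elim
  case (elim h)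
  have p: "0 < t - h" "t <= T" "0 < h" using elim t by auto
  show ?case by (rule interp_err_le[OF dq_props(1-3)[OF p]]) (use dq_props(5)[OF p] ac x in auto)
 qed
qed simp

definition "c\<^sub>5 = (4 * c\<^sub>1 + c\<^sub>4) + K * (4 * c\<^sub>0 + c\<^sub>3) + K"

lemma c5: "0 <= c\<^sub>5" using c0 c1 c3 c4 K by (simp add: c\<^sub>5_def)

text \<open>The equation expresses \<open>eps * wxx\<close> by \<open>wt\<close>, \<open>w\<close>
  and \<open>f\<close>. The first two have Lipschitz constants of order \<open>1 / eps\<close>,
  which gives \<open>1 / eps^2\<close> altogether; terms without such a factor are absorbed using
  \<open>eps <= 1\<close>.\<close>

lemma wxx_lipschitz_x:
 assumes x: "0 < x" "x < 1" and y: "0 < y" "y < 1" and t: "0 < t" "t <= T"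
 shows "abs (wxx x t - wxx y t) <= c\<^sub>5 / eps^2 * abs (x - y)"
proof -
 have A: "abs (w x t - w y t) <= (4 * c\<^sub>0 + c\<^sub>3 / eps) * abs (x - y)"
  by (rule lipschitz_of_second_derivative[OF w_cont_x w_x w_xx]) (use x y t w_bound wxx_bound' in auto)
 have e: "c <= c / eps" if "0 <= c" for c using eps that by (simp add: pos_le_divide_eq mult_left_le)
 have "eps * (wxx x t - wxx y t) = (wt x t - wt y t) + b t * (w x t - w y t) - (f x t - f y t)"
  using eps_wxx[OF x t] eps_wxx[OF y t] by (simp add: algebra_simps)
 moreover have "abs (wt x t - wt y t) <= (4 * c\<^sub>1 + c\<^sub>4 / eps) * abs (x - y)" by (rule wt_lipschitz_x[OF x y t])
 moreover have "abs (b t * (w x t - w y t)) <= K * ((4 * c\<^sub>0 + c\<^sub>3 / eps) * abs (x - y))"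
  unfolding abs_mult using b[of t] t A K by (intro mult_mono) auto
 moreover have "abs (f x t - f y t) <= K * abs (x - y)"
  using smooth_dataD(5)[OF f_space[of t], of x y] x y t by auto
 ultimately have "abs (eps * (wxx x t - wxx y t))
   <= (4 * c\<^sub>1 + c\<^sub>4 / eps) * abs (x - y) + K * ((4 * c\<^sub>0 + c\<^sub>3 / eps) * abs (x - y)) + K * abs (x - y)" by linarith
 also have "\<dots> = ((4 * c\<^sub>1 + c\<^sub>4 / eps) + K * (4 * c\<^sub>0 + c\<^sub>3 / eps) + K) * abs (x - y)" by (simp add: algebra_simps)
 also have "\<dots> <= (c\<^sub>5 / eps) * abs (x - y)"
 proof (rule mult_right_mono)
  have "4 * c\<^sub>1 + K * (4 * c\<^sub>0) + K <= (4 * c\<^sub>1 + K * (4 * c\<^sub>0) + K) / eps" using c0 c1 K by (intro e) simp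
  then show "(4 * c\<^sub>1 + c\<^sub>4 / eps) + K * (4 * c\<^sub>0 + c\<^sub>3 / eps) + K <= c\<^sub>5 / eps"
   by (simp add: c\<^sub>5_def add_divide_distrib algebra_simps)
 qed simp
 finally have "eps * abs (wxx x t - wxx y t) <= (c\<^sub>5 / eps) * abs (x - y)" using eps by (simp only: abs_mult)
 then show ?thesis using eps by (simp add: power2_eq_square field_simps)
qed

definition "c\<^sub>6 = 2 * (c\<^sub>4 + K * c\<^sub>3 + K)"

lemma c6: "0 <= c\<^sub>6" using c3 c4 K by (simp add: c\<^sub>6_def)

text \<open>Plays the part of a bound \<open>c / eps^2\<close> for the fourth space derivative: the
  interpolation errors of \<open>wt\<close> and \<open>w\<close> are inserted into the
  equation.\<close>

lemma wxx_second_diff: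
 assumes s: "0 < s" "0 < x - s" "x + s < 1" and t: "0 < t" "t <= T"
 shows "abs (wxx (x + s) t + wxx (x - s) t - 2 * wxx x t) <= c\<^sub>6 / eps^2 * s^2"
proof -
 let ?I = "interp_err s s"
 have I: "?I g x = (g (x + s) + g (x - s) - 2 * g x) / 2" for g
  using s by (simp add: interp_err_def field_simps)
 have e: "c <= c / eps" if "0 <= c" for c using eps that by (simp add: pos_le_divide_eq mult_left_le)
 have eq: "eps * ?I (\<lambda>x. wxx x t) x = ?I (\<lambda>x. wt x t) x + b t * ?I (\<lambda>x. w x t) x - ?I (\<lambda>x. f x t) x"
  using eps_wxx[of "x + s" t] eps_wxx[of "x - s" t] eps_wxx[of x t] s t
  unfolding I by (simp add: field_simps)
 have "abs (?I (\<lambda>x. wt x t) x) <= c\<^sub>4 / eps * (s * s)" by (rule wt_interp_err) (use s t in auto)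
 moreover have "abs (b t * ?I (\<lambda>x. w x t) x) <= K * (c\<^sub>3 / eps * (s * s))"
  unfolding abs_mult using b[of t] t w_interp_err[of s s x t] s K by (intro mult_mono) auto
 moreover have "abs (?I (\<lambda>x. f x t) x) <= K * (s * s)"
  using smooth_dataD(6)[OF f_space[of t], of s s x] s t by auto
 moreover have "K * (s * s) <= K / eps * (s * s)" using e[of K] K by (intro mult_right_mono) auto
 ultimately have "abs (eps * ?I (\<lambda>x. wxx x t) x) <= c\<^sub>4 / eps * (s * s) + K * (c\<^sub>3 / eps * (s * s)) + K / eps * (s * s)"
  unfolding eq by linarith
 also have "\<dots> = c\<^sub>6 / eps * s^2 / 2"
  by (simp add: c\<^sub>6_def power2_eq_square add_divide_distrib algebra_simps)
 finally have "eps * abs (2 * ?I (\<lambda>x. wxx x t) x) <= c\<^sub>6 / eps * s^2"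
  using eps by (simp add: abs_mult)
 moreover have "2 * ?I (\<lambda>x. wxx x t) x = wxx (x + s) t + wxx (x - s) t - 2 * wxx x t" by (simp add: I)
 ultimately have "eps * abs (wxx (x + s) t + wxx (x - s) t - 2 * wxx x t) <= c\<^sub>6 / eps * s^2" by simp
 then show ?thesis using eps by (simp add: power2_eq_square field_simps)
qed

section \<open>Truncation and interpolation errors of the regularised remainder\<close>

lemma w_fine:
 assumes h: "0 < h" "0 <= x - h" "x + h <= 1" and t: "0 < t" "t <= T"
 shows "abs (divdiff2 h h (\<lambda>x. w x t) x - wxx x t) <= c\<^sub>6 / eps^2 * h^2"
 by (rule divdiff2_equal_err[OF w_cont_x w_x w_xx wxx_second_diff]) (use h t eps c6 in auto)

lemma w_trans:
 assumes ac: "0 < a" "0 < c" and x: "0 <= x - a" "x + c <= 1" and t: "0 < t" "t <= T"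
 shows "abs (divdiff2 a c (\<lambda>x. w x t) x - wxx x t) <= 2 * (c\<^sub>5 / eps^2) * (a + c)"
 by (rule divdiff2_err[OF w_cont_x w_x w_xx wxx_lipschitz_x]) (use ac x t eps c5 in auto)

lemma w_crude:
 assumes ac: "0 < a" "0 < c" and x: "0 <= x - a" "x + c <= 1" and t: "0 < t" "t <= T"
 shows "abs (divdiff2 a c (\<lambda>x. w x t) x - wxx x t) <= 3 * c\<^sub>3 / eps"
 using divdiff2_le[OF w_interp_err[OF ac x t] ac] wxx_bound'[of x t] ac x t by auto

text \<open>Away from the boundary the \<open>eps\<close>-dependence of the truncation error is damped: the
 truncation error of \<open>w\<close>, with \<open>wxx\<close> replaced by a second difference, itself solves
 the equation, with the truncation error of \<open>f\<close> as right-hand side.\<close>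

lemma w_outer:
 assumes ac: "0 < a" "0 < c" and x: "0 <= x - a" "x + c <= 1" and t: "0 < t" "t <= T"
  and ord: "\<And>g g\<^sub>2 x. smooth_data K g g\<^sub>2 ==> 0 <= x - a ==> x + c <= 1 ==> abs (divdiff2 a c g x - g\<^sub>2 x) <= R"
  and B: "\<And>x t. 0 <= x - a ==> x + c <= 1 ==> 0 < t ==> t <= T ==>
    abs (divdiff2 a c (\<lambda>x. w x t) x - wxx x t) <= B"
 shows "abs (divdiff2 a c (\<lambda>x. w x t) x - wxx x t) <= R * (1 + T)
   + B * (exp (m^2 * t - m * (x - a) / sqrt eps) + exp (m^2 * t - m * (1 - c - x) / sqrt eps))"
proof (rule le_of_le_add_small)
 let ?E = "exp (m^2 * t - m * (x - a) / sqrt eps) + exp (m^2 * t - m * (1 - c - x) / sqrt eps)"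
 have R0: "0 <= R" and B0: "0 <= B" using ord[OF psi x] B[OF x t] by linarith+
 show "0 < min a c" using ac by simp
 fix \<eta> :: real assume \<eta>: "0 < \<eta>" "\<eta> < min a c"
 \<comment> \<open>The derivative \<open>wxx\<close> need not extend to the sides and has no
   equation of its own, so it is represented by a symmetric quotient with a tiny step
   \<open>\<eta>\<close>, whose error is governed by \<open>w_fine\<close>.\<close>
 let ?d = "\<lambda>g x. divdiff2 a c g x - divdiff2 \<eta> \<eta> g x"
 let ?A = "R + K * \<eta>^2" and ?P = "B + c\<^sub>6 / eps^2 * \<eta>^2"
 have sm: "abs (?d g x) <= ?A" if "smooth_data K g g\<^sub>2" "0 <= x - a" "x + c <= 1" for g g\<^sub>2 x
  using ord[OF that] smooth_dataD(8)[OF that(1), of \<eta> x] \<eta> that by simp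
 have A0: "0 <= ?A" "0 <= ?P" using R0 B0 K c6 by simp_all
 have bdry: "abs (?d (\<lambda>x. w x t) x) <= ?A + ?P" if "0 <= x - a" "x + c <= 1" "0 <= t" "t <= T" for x t
 proof (cases "t = 0")
  case True
  have "?d (\<lambda>x. w x t) x = ?d \<psi> x"
   using True that ac \<eta> by (simp add: divdiff2_def interp_err_def w_init)
  then show ?thesis using sm[OF psi that(1,2)] A0 by simp
 next
  case False
  then show ?thesis using B[OF that(1,2), of t] w_fine[of \<eta> x t] that \<eta> A0 by simp
 qed
 \<comment> \<open>The rectangle is shrunk to \<open>a <= x <= 1 - c\<close> so that the stencil
   stays inside. On its new sides only the crude bound is known, and there the exponential barrier
   takes over.\<close>
 have "abs (?d (\<lambda>x. w x t) x) <= ?A + ?A * t + ?P * ?E"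
 proof (rule parabolic_bound[where b=b and U="\<lambda>x t. ?d (\<lambda>x. w x t) x", OF eps(1) _ _ _ A0(1) A0(1) A0(2)])
  have shc: "continuous_on ({a..1 - c} \<times> {0..T}) (\<lambda>(x, t). w (x + u) (t + 0))" if "- a <= u" "u <= c" for u
   by (rule continuous_on_shift[OF w_cont]) (use that in auto)
  show "continuous_on ({a..1 - c} \<times> {0..T}) (\<lambda>(x, t). ?d (\<lambda>x. w x t) x)"
   using shc[of "- a"] shc[of c] shc[of "- \<eta>"] shc[of \<eta>] shc[of 0] ac \<eta>
   unfolding divdiff2_def interp_err_def case_prod_beta
   by (intro continuous_intros) auto
  fix x t \<delta> :: real assume xt: "a < x" "x < 1 - c" "0 < t" "t <= T" "0 < \<delta>"
  have w: "((\<lambda>h. parop eps (b t) w h y t) \<longlongrightarrow> f y t) (at_right 0)" if "0 < y" "y < 1" for y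
   using w_parop[OF that xt(3,4), of "b t"] by simp
  have lim: "((\<lambda>h. parop eps (b t) (\<lambda>x t. ?d (\<lambda>x. w x t) x) h x t) \<longlongrightarrow> ?d (\<lambda>x. f x t) x) (at_right 0)"
   unfolding parop_diff parop_divdiff2
   by (intro tendsto_diff tendsto_divdiff2 w) (use xt ac \<eta> in auto)
  show "\<forall>\<^sub>F h in at_right 0. (abs (parop eps (b t) (\<lambda>x t. ?d (\<lambda>x. w x t) x) h x t)) <= ?A + \<delta>"
   by (rule abs_le_of_tendsto_diff[OF lim sm[OF f_space]]) (use xt in auto)
 next
  fix x assume x: "a <= x" "x <= 1 - c"
  have "?d (\<lambda>x. w x 0) x = ?d \<psi> x"
   using x ac \<eta> by (simp add: divdiff2_def interp_err_def w_init)
  then show "abs (?d (\<lambda>x. w x 0) x) <= ?A" using sm[OF psi, of x] x by simp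
 qed (use b bdry x t ac in auto)
 also have "\<dots> <= ?A + ?A * T + ?P * ?E" using mult_left_mono[OF t(2) A0(1)] by simp
 finally have "abs (divdiff2 a c (\<lambda>x. w x t) x - wxx x t) <= ?A + ?A * T + ?P * ?E + c\<^sub>6 / eps^2 * \<eta>^2"
  using w_fine[of \<eta> x t] x t \<eta> by simp
 also have "\<dots> = (R * (1 + T) + B * ?E) + (K * (1 + T) + c\<^sub>6 / eps^2 * (?E + 1)) * \<eta>^2"
  by (simp add: algebra_simps)
 finally show "abs (divdiff2 a c (\<lambda>x. w x t) x - wxx x t)
  <= (R * (1 + T) + B * ?E) + (K * (1 + T) + c\<^sub>6 / eps^2 * (?E + 1)) * \<eta>^2" .
qed

text \<open>The comparison of \<open>w_outer\<close> for the interpolation error. This error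
  contains no derivative, so no auxiliary step is needed, and \<open>2 * c\<^sub>0\<close> bounds it
  crudely on the sides.\<close>

lemma w_interp_outer:
 assumes ac: "0 < a" "0 < c" and x: "0 <= x - a" "x + c <= 1" and t: "0 <= t" "t <= T"
 shows "abs (interp_err a c (\<lambda>x. w x t) x) <= K * (1 + T) * (a * c)
   + 2 * c\<^sub>0 * (exp (m^2 * t - m * (x - a) / sqrt eps) + exp (m^2 * t - m * (1 - c - x) / sqrt eps))"
proof -
 let ?E = "exp (m^2 * t - m * (x - a) / sqrt eps) + exp (m^2 * t - m * (1 - c - x) / sqrt eps)"
 let ?d = "interp_err a c"
 let ?A = "K * (a * c)"
 have A0: "0 <= ?A" "0 <= 2 * c\<^sub>0" using K c0 ac by simp_all
 have bdry: "abs (?d (\<lambda>x. w x t) x) <= ?A + 2 * c\<^sub>0" if "0 <= x - a" "x + c <= 1" "0 <= t" "t <= T" for x t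
 proof -
  have "abs (c * w (x - a) t + a * w (x + c) t) <= c * c\<^sub>0 + a * c\<^sub>0"
   by (rule abs_lincomb_le) (use ac that w_bound in auto)
  then have "abs ((c * w (x - a) t + a * w (x + c) t) / (a + c)) <= c\<^sub>0"
   using ac by (simp add: abs_divide pos_divide_le_eq algebra_simps)
  moreover have "abs (w x t) <= c\<^sub>0" using w_bound[of x t] that ac by auto
  ultimately show ?thesis using A0 unfolding interp_err_def by linarith
 qed
 have "abs (?d (\<lambda>x. w x t) x) <= ?A + ?A * t + 2 * c\<^sub>0 * ?E"
 proof (rule parabolic_bound[where b=b and U="\<lambda>x t. ?d (\<lambda>x. w x t) x", OF eps(1) _ _ _ A0(1) A0(1) A0(2)])
  have shc: "continuous_on ({a..1 - c} \<times> {0..T}) (\<lambda>(x, t). w (x + u) (t + 0))" if "- a <= u" "u <= c" for u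
   by (rule continuous_on_shift[OF w_cont]) (use that in auto)
  show "continuous_on ({a..1 - c} \<times> {0..T}) (\<lambda>(x, t). ?d (\<lambda>x. w x t) x)"
   using shc[of "- a"] shc[of c] shc[of 0] ac
   unfolding interp_err_def case_prod_beta by (intro continuous_intros) auto
  fix x t \<delta> :: real assume xt: "a < x" "x < 1 - c" "0 < t" "t <= T" "0 < \<delta>"
  have w: "((\<lambda>h. parop eps (b t) w h y t) \<longlongrightarrow> f y t) (at_right 0)" if "0 < y" "y < 1" for y
   using w_parop[OF that xt(3,4), of "b t"] by simp
  have lim: "((\<lambda>h. parop eps (b t) (\<lambda>x t. ?d (\<lambda>x. w x t) x) h x t) \<longlongrightarrow> ?d (\<lambda>x. f x t) x) (at_right 0)"
   unfolding parop_interp_err by (intro tendsto_interp_err w) (use xt ac in auto)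
  show "\<forall>\<^sub>F h in at_right 0. (abs (parop eps (b t) (\<lambda>x t. ?d (\<lambda>x. w x t) x) h x t)) <= ?A + \<delta>"
   by (rule abs_le_of_tendsto_diff[OF lim smooth_dataD(6)[OF f_space]]) (use xt ac in auto)
 next
  fix x assume x: "a <= x" "x <= 1 - c"
  have "?d (\<lambda>x. w x 0) x = ?d \<psi> x" using x ac by (simp add: interp_err_def w_init)
  then show "abs (?d (\<lambda>x. w x 0) x) <= ?A" using smooth_dataD(6)[OF psi ac, of x] x by simp
 qed (use b bdry x t ac in auto)
 also have "\<dots> <= ?A + ?A * T + 2 * c\<^sub>0 * ?E" using mult_left_mono[OF t(2) A0(1)] by simp
 also have "\<dots> = K * (1 + T) * (a * c) + 2 * c\<^sub>0 * ?E" by (simp add: algebra_simps)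
 finally show ?thesis .
qed

end

section \<open>The error function and its primitives\<close>

lemma erf_deriv: "(erf has_real_derivative (2 / sqrt pi * exp (- (z^2)))) (at z)"
proof -
 define L where "L = abs z + 1"
 have L: "- L < z" "z < L" "- L <= 0" "0 <= L" by (auto simp: L_def)
 have "((\<lambda>u. LBINT r=ereal 0..ereal u. exp (- (r^2))) has_vector_derivative exp (- (z^2))) (at z within {- L..L})"
  by (rule interval_integral_FTC2) (use L in \<open>auto intro!: continuous_intros\<close>)
 then have "((\<lambda>u. LBINT r=ereal 0..ereal u. exp (- (r^2))) has_real_derivative exp (- (z^2))) (at z)"
  using L by (simp add: has_real_derivative_iff_has_vector_derivative at_within_Icc_at)
 from DERIV_cmult[OF this, of "2 / sqrt pi"] show ?thesis
  by (simp add: erf_def[abs_def] zero_ereal_def[symmetric] flip: zero_ereal_def)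
qed

lemma erf_0 [simp]: "erf 0 = 0"
 by (simp add: erf_def zero_ereal_def[symmetric])

lemma erf_minus: "erf (- z) = - erf z"
proof -
 have "((\<lambda>z. erf z + erf (- z)) has_real_derivative 0) (at z)" for z
 proof -
  have "((\<lambda>z. erf (- z)) has_real_derivative (2 / sqrt pi * exp (- ((- z)^2))) * -1) (at z)"
   by (rule DERIV_chain2[OF erf_deriv]) (auto intro!: derivative_eq_intros)
  from DERIV_add[OF erf_deriv this] show ?thesis by simp
 qed
 then have "erf z + erf (- z) = erf 0 + erf (- 0)"
  by (intro DERIV_isconst_all) auto
 then show ?thesis by simp
qed

lemma erf_tendsto: "(erf \<longlongrightarrow> 1) at_top"
proof -
 define g where "g = (\<lambda>x::real. indicator {0..} x *\<^sub>R exp (- (x^2)))"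
 have g: "integrable lborel g" "(\<integral>x. g x \<partial>lborel) = sqrt pi / 2"
  using gaussian_moment_0 unfolding g_def by (auto simp: has_bochner_integral_iff)
 have lim: "((\<lambda>t. \<integral>x. indicator {..t} x *\<^sub>R g x \<partial>lborel) \<longlongrightarrow> sqrt pi / 2) at_top"
  using tendsto_integral_at_top[OF _ g(1)] g(2) by simp
 have "\<forall>\<^sub>F t in at_top. 2 / sqrt pi * (\<integral>x. indicator {..t} x *\<^sub>R g x \<partial>lborel) = erf t"
  using eventually_ge_at_top[of "0::real"]
 proof eventually_elim
  case (elim t)
  have "(LBINT r=0..t. exp (- (r^2))) = (LBINT r:{0..t}. exp (- (r^2)))"
   using elim by (simp add: interval_integral_Icc zero_ereal_def)
  also have "\<dots> = (\<integral>x. indicator {..t} x *\<^sub>R g x \<partial>lborel)"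
   unfolding set_lebesgue_integral_def g_def
   by (intro Bochner_Integration.integral_cong) (auto simp: indicator_def)
  finally show ?case by (simp add: erf_def)
 qed
 moreover have "((\<lambda>t. 2 / sqrt pi * (\<integral>x. indicator {..t} x *\<^sub>R g x \<partial>lborel)) \<longlongrightarrow> 2 / sqrt pi * (sqrt pi / 2)) at_top"
  by (intro tendsto_intros lim)
 ultimately show ?thesis by (simp add: tendsto_cong)
qed

text \<open>A Gaussian beats every exponential rate: \<open>r ^ n\<close> is bounded by
  \<open>exp (n * r)\<close>, and the remaining comparison of exponents is the square of
  \<open>r / 2 - (\<nu> + n)\<close>.\<close>

lemma gauss_le:
 fixes r \<nu> :: real
 assumes "0 <= r"
 shows "r ^ n * exp (- (r^2 / 4)) <= exp ((\<nu> + n)^2) * exp (- (\<nu> * r))"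
proof -
 have "r <= exp r" using exp_ge_add_one_self[of r] by linarith
 then have "r ^ n <= exp (n * r)" using assms power_mono[of r "exp r" n] by (simp add: exp_of_nat_mult)
 then have "r ^ n * exp (- (r^2 / 4)) <= exp (n * r) * exp (- (r^2 / 4))" by (rule mult_right_mono) simp
 also have "\<dots> <= exp ((\<nu> + n)^2) * exp (- (\<nu> * r))"
 proof -
  have "0 <= (r / 2 - (\<nu> + n))^2" by simp
  then have "n * r - r^2 / 4 <= (\<nu> + n)^2 - \<nu> * r" by (simp add: power2_eq_square field_simps)
  then show ?thesis by (simp add: exp_add[symmetric])
 qed
 finally show ?thesis .
qed

text \<open>Both facts come from monotonicity and the limit at infinity. For the upper bound the
  difference \<open>h\<close> of the two sides is nonincreasing, by \<open>gauss_le\<close>, and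
  tends to 0, so it is nonnegative everywhere.\<close>

lemma erfc_nonneg: "0 <= 1 - erf z"
 and erfc_le: "0 <= r ==> 1 <= \<nu> ==> 1 - erf (r / 2) <= exp (\<nu>^2) * exp (- (\<nu> * r))"
proof -
 have "erf z <= erf y" if "z <= y" for z y
  by (rule DERIV_nonneg_imp_nondecreasing[OF that]) (use erf_deriv in \<open>auto intro!: exI\<close>)
 from eventually_mono[OF eventually_ge_at_top this] have "\<forall>\<^sub>F y in at_top. erf z <= erf y" .
 then show "0 <= 1 - erf z"
  using tendsto_lowerbound[OF erf_tendsto] by simp
 assume r: "0 <= r" and l: "1 <= \<nu>"
 define h where "h = (\<lambda>r. exp (\<nu>^2) * exp (- (\<nu> * r)) - (1 - erf (r / 2)))"
 have d: "(h has_real_derivative (1 / sqrt pi * exp (- (s^2 / 4)) - \<nu> * (exp (\<nu>^2) * exp (- (\<nu> * s))))) (at s)" for s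
 proof -
  have "((\<lambda>r. erf (r / 2)) has_real_derivative (2 / sqrt pi * exp (- ((s / 2)^2))) * (1 / 2)) (at s)"
   by (rule DERIV_chain2[OF erf_deriv]) (auto intro!: derivative_eq_intros)
  moreover have "((\<lambda>r. exp (\<nu>^2) * exp (- (\<nu> * r))) has_real_derivative - (\<nu> * (exp (\<nu>^2) * exp (- (\<nu> * s))))) (at s)"
   by (auto intro!: derivative_eq_intros)
  ultimately show ?thesis
   unfolding h_def by (auto intro!: derivative_eq_intros simp: power_divide)
 qed
 have "h y <= h r" if "r <= y" for y
 proof (rule DERIV_nonpos_imp_nonincreasing[OF that], intro exI conjI)
  fix s assume s: "r <= s" "s <= y"
  show "(h has_real_derivative (1 / sqrt pi * exp (- (s^2 / 4)) - \<nu> * (exp (\<nu>^2) * exp (- (\<nu> * s))))) (at s)"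
   by (rule d)
  have "1 / sqrt pi * exp (- (s^2 / 4)) <= 1 * exp (- (s^2 / 4))"
   using pi_gt3 by (intro mult_right_mono) (auto simp: divide_le_eq_1)
  also have "\<dots> <= exp (\<nu>^2) * exp (- (\<nu> * s))" using gauss_le[of s 0 \<nu>] s r by simp
  also have "1 * \<dots> <= \<nu> * \<dots>" using l by (intro mult_right_mono) auto
  finally show "1 / sqrt pi * exp (- (s^2 / 4)) - \<nu> * (exp (\<nu>^2) * exp (- (\<nu> * s))) <= 0" by simp
 qed
 from eventually_mono[OF eventually_ge_at_top this] have "\<forall>\<^sub>F y in at_top. h y <= h r" .
 moreover have "(h \<longlongrightarrow> exp (\<nu>^2) * 0 - (1 - 1)) at_top"
  unfolding h_def
 proof (intro tendsto_intros)
  show "((\<lambda>y. exp (- (\<nu> * y))) \<longlongrightarrow> 0) at_top"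
  proof (rule filterlim_compose[OF exp_at_bot])
   have "filterlim (\<lambda>y. \<nu> * y) at_top at_top"
    by (rule filterlim_tendsto_pos_mult_at_top[OF tendsto_const _ filterlim_ident]) (use l in auto)
   then show "filterlim (\<lambda>y. - (\<nu> * y)) at_bot at_top" by (simp add: filterlim_uminus_at_top)
  qed
  show "((\<lambda>y. erf (y / 2)) \<longlongrightarrow> 1) at_top"
   by (rule filterlim_compose[OF erf_tendsto])
    (use filterlim_tendsto_pos_mult_at_top[OF tendsto_const[of "1/2"] _ filterlim_ident] in auto)
 qed
 ultimately have "0 <= h r" using tendsto_upperbound[of h _ at_top] by simp
 then show "1 - erf (r / 2) <= exp (\<nu>^2) * exp (- (\<nu> * r))" by (simp add: h_def)
qed

text \<open>All of the following functions of \<open>xi\<close> and \<open>t > 0\<close> solve the heat equation.  Each is the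
 \<open>xi\<close>-derivative of its successor, so a time derivative shifts the index by two.\<close>

definition "gk xi t = exp (- (xi^2 / (4 * t))) / (sqrt pi * sqrt t)"
definition "km4 xi t = (3 * xi / (4 * t^2) - xi^3 / (8 * t^3)) * gk xi t"
definition "km3 xi t = (xi^2 / (4 * t^2) - 1 / (2 * t)) * gk xi t"
definition "km2 xi t = - (xi / (2 * t)) * gk xi t"
definition "k0 xi t = erf (xi / (2 * sqrt t))"
definition "k1 xi t = xi * k0 xi t + 2 * t * gk xi t"
definition "k2 xi t = (t + xi^2 / 2) * k0 xi t + xi * t * gk xi t"
definition "k3 xi t = (xi^3 / 6 + xi * t) * k0 xi t + (xi^2 + 4 * t) / 3 * t * gk xi t"

lemma kernel_deriv_space:
 assumes t: "0 < t"
 shows gk_x: "((\<lambda>xi. gk xi t) has_real_derivative km2 xi t) (at xi)"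
  and km2_x: "((\<lambda>xi. km2 xi t) has_real_derivative km3 xi t) (at xi)"
  and km3_x: "((\<lambda>xi. km3 xi t) has_real_derivative km4 xi t) (at xi)"
  and k0_x: "((\<lambda>xi. k0 xi t) has_real_derivative gk xi t) (at xi)"
  and k1_x: "((\<lambda>xi. k1 xi t) has_real_derivative k0 xi t) (at xi)"
  and k2_x: "((\<lambda>xi. k2 xi t) has_real_derivative k1 xi t) (at xi)"
  and k3_x: "((\<lambda>xi. k3 xi t) has_real_derivative k2 xi t) (at xi)"
proof -
 have t0 [simp]: "t \<noteq> 0" using t by simp
 show g: "((\<lambda>xi. gk xi t) has_real_derivative km2 xi t) (at xi)"
  unfolding gk_def km2_def by (rule derivative_eq_intros refl t0 | simp)+ (use t in \<open>simp add: field_simps\<close>)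
 show "((\<lambda>xi. km2 xi t) has_real_derivative km3 xi t) (at xi)"
  unfolding km2_def[abs_def] km3_def
  by (rule derivative_eq_intros g refl t0 | simp)+
   (use t in \<open>simp add: km2_def field_simps power2_eq_square\<close>)
 show "((\<lambda>xi. km3 xi t) has_real_derivative km4 xi t) (at xi)"
  unfolding km3_def[abs_def] km4_def
  by (rule derivative_eq_intros g refl t0 | simp)+
   (use t in \<open>simp add: km2_def field_simps power2_eq_square power3_eq_cube power4_eq_xxxx\<close>)
 have "((\<lambda>xi. k0 xi t) has_real_derivative (2 / sqrt pi * exp (- ((xi / (2 * sqrt t))^2))) * (1 / (2 * sqrt t))) (at xi)"
  unfolding k0_def by (rule DERIV_chain2[OF erf_deriv DERIV_cdivide[OF DERIV_ident]])
 then show e: "((\<lambda>xi. k0 xi t) has_real_derivative gk xi t) (at xi)"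
  using t by (simp add: gk_def power_divide power_mult_distrib)
 show "((\<lambda>xi. k1 xi t) has_real_derivative k0 xi t) (at xi)"
  unfolding k1_def[abs_def]
  by (rule derivative_eq_intros g e refl t0 | simp)+ (use t in \<open>simp add: km2_def field_simps\<close>)
 show "((\<lambda>xi. k2 xi t) has_real_derivative k1 xi t) (at xi)"
  unfolding k2_def[abs_def] k1_def
  by (rule derivative_eq_intros g e refl t0 | simp)+
   (use t in \<open>simp add: km2_def field_simps power2_eq_square\<close>)
 show "((\<lambda>xi. k3 xi t) has_real_derivative k2 xi t) (at xi)"
  unfolding k3_def[abs_def] k2_def
  by (rule derivative_eq_intros g e refl t0 | simp)+
   (use t in \<open>simp add: km2_def field_simps power2_eq_square power3_eq_cube power4_eq_xxxx\<close>)
qed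

lemma kernel_deriv_time:
 assumes t: "0 < t"
 shows gk_t: "((\<lambda>t. gk xi t) has_real_derivative km3 xi t) (at t within S)"
  and km2_t: "((\<lambda>t. km2 xi t) has_real_derivative km4 xi t) (at t within S)"
  and k0_t: "((\<lambda>t. k0 xi t) has_real_derivative km2 xi t) (at t within S)"
  and k1_t: "((\<lambda>t. k1 xi t) has_real_derivative gk xi t) (at t within S)"
  and k2_t: "((\<lambda>t. k2 xi t) has_real_derivative k0 xi t) (at t within S)"
  and k3_t: "((\<lambda>t. k3 xi t) has_real_derivative k1 xi t) (at t within S)"
proof -
 have t0 [simp]: "t \<noteq> 0" using t by simp
 have st: "sqrt t * sqrt t = t" "sqrt t \<noteq> 0" using t by auto
 have "((\<lambda>t. gk xi t) has_real_derivative
   (exp (- (xi^2 / (4 * t))) * (xi^2 / (4 * t^2)) * (sqrt pi * sqrt t)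
    - exp (- (xi^2 / (4 * t))) * (sqrt pi * (inverse (sqrt t) / 2))) / ((sqrt pi * sqrt t) * (sqrt pi * sqrt t))) (at t)" (is "(_ has_real_derivative ?D) _")
  unfolding gk_def
 proof (rule DERIV_divide)
  show "((\<lambda>t. exp (- (xi^2 / (4 * t)))) has_real_derivative exp (- (xi^2 / (4 * t))) * (xi^2 / (4 * t^2))) (at t)"
   by (rule derivative_eq_intros refl t0 | simp)+ (use t in \<open>simp add: field_simps power2_eq_square\<close>)
  show "((\<lambda>t. sqrt pi * sqrt t) has_real_derivative sqrt pi * (inverse (sqrt t) / 2)) (at t)"
   by (intro DERIV_cmult DERIV_real_sqrt t)
 qed (use t in simp)
 moreover have "?D = km3 xi t"
  using t st unfolding km3_def gk_def by (simp add: divide_simps) (simp add: algebra_simps power2_eq_square)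
 ultimately have g: "((\<lambda>t. gk xi t) has_real_derivative km3 xi t) (at t)" by simp
 show "((\<lambda>t. gk xi t) has_real_derivative km3 xi t) (at t within S)" by (rule has_field_derivative_at_within[OF g])
 have "((\<lambda>t. km2 xi t) has_real_derivative km4 xi t) (at t)"
  unfolding km2_def[abs_def] km4_def
  by (rule derivative_eq_intros g refl t0 | simp)+
   (use t in \<open>simp add: km3_def field_simps power2_eq_square power3_eq_cube power4_eq_xxxx\<close>)
 then show "((\<lambda>t. km2 xi t) has_real_derivative km4 xi t) (at t within S)" by (rule has_field_derivative_at_within)
 have "((\<lambda>t. xi / (2 * sqrt t)) has_real_derivative - (xi / (4 * t * sqrt t))) (at t)"
 proof -
  have "((\<lambda>t. xi / (2 * sqrt t)) has_real_derivative (0 * (2 * sqrt t) - xi * (2 * (inverse (sqrt t) / 2))) / ((2 * sqrt t) * (2 * sqrt t))) (at t)"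
   by (intro DERIV_divide DERIV_cmult DERIV_real_sqrt t DERIV_const) (use t in simp)
  moreover have "(0 * (2 * sqrt t) - xi * (2 * (inverse (sqrt t) / 2))) / ((2 * sqrt t) * (2 * sqrt t)) = - (xi / (4 * t * sqrt t))"
   using t st by (simp add: divide_simps)
  ultimately show ?thesis by simp
 qed
 from DERIV_chain2[OF erf_deriv this]
 have "((\<lambda>t. k0 xi t) has_real_derivative (2 / sqrt pi * exp (- ((xi / (2 * sqrt t))^2))) * - (xi / (4 * t * sqrt t))) (at t)"
  by (simp add: k0_def[abs_def])
 then have e: "((\<lambda>t. k0 xi t) has_real_derivative km2 xi t) (at t)"
  using t by (simp add: km2_def gk_def power_divide power_mult_distrib field_simps)
 then show "((\<lambda>t. k0 xi t) has_real_derivative km2 xi t) (at t within S)" by (rule has_field_derivative_at_within)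
 have "((\<lambda>t. k1 xi t) has_real_derivative gk xi t) (at t)"
  unfolding k1_def[abs_def]
  by (rule derivative_eq_intros g e refl t0 | simp)+
   (use t in \<open>simp add: km2_def km3_def field_simps power2_eq_square\<close>)
 then show "((\<lambda>t. k1 xi t) has_real_derivative gk xi t) (at t within S)" by (rule has_field_derivative_at_within)
 have "((\<lambda>t. k2 xi t) has_real_derivative k0 xi t) (at t)"
  unfolding k2_def[abs_def]
  by (rule derivative_eq_intros g e refl t0 | simp)+
   (use t in \<open>simp add: km2_def km3_def field_simps power2_eq_square power3_eq_cube\<close>)
 then show "((\<lambda>t. k2 xi t) has_real_derivative k0 xi t) (at t within S)" by (rule has_field_derivative_at_within)
 have "((\<lambda>t. k3 xi t) has_real_derivative k1 xi t) (at t)"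
  unfolding k3_def[abs_def] k1_def
  by (rule derivative_eq_intros g e refl t0 | simp)+
   (use t in \<open>simp add: km2_def km3_def field_simps power2_eq_square power3_eq_cube\<close>)
 then show "((\<lambda>t. k3 xi t) has_real_derivative k1 xi t) (at t within S)" by (rule has_field_derivative_at_within)
qed

lemma gk_pos: "0 < t ==> 0 < gk xi t" by (simp add: gk_def)

lemma gk_minus: "gk (- xi) t = gk xi t" by (simp add: gk_def)
lemma k0_minus: "k0 (- xi) t = - k0 xi t" by (simp add: k0_def erf_minus)

section \<open>Decay of the kernels, uniform in time\<close>

text \<open>In the similarity variable \<open>abs xi / sqrt t\<close> the kernel is a pure Gaussian
  divided by \<open>sqrt t\<close>; the exponential rate \<open>\<nu>\<close> is kept free and fixed
  later.\<close>

lemma gk_scaled: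
 assumes t: "0 < t" and nu: "0 <= \<nu>"
 shows "abs xi ^ n * gk xi t * sqrt t <= exp ((\<nu> + n)^2) * sqrt t ^ n * exp (- (\<nu> * (abs xi / sqrt t)))"
proof -
 define r where "r = abs xi / sqrt t"
 have r: "0 <= r" "abs xi = r * sqrt t" "xi^2 / (4 * t) = r^2 / 4"
  using t by (auto simp: r_def power_divide)
 have "abs xi ^ n * gk xi t * sqrt t = sqrt t ^ n * (r ^ n * exp (- (r^2 / 4))) * (1 / sqrt pi)"
  unfolding gk_def r(3) unfolding r(2) using t by (simp add: power_mult_distrib)
 also have "\<dots> <= sqrt t ^ n * (r ^ n * exp (- (r^2 / 4))) * 1"
  using t r pi_gt3 by (intro mult_left_mono) (auto simp: divide_le_eq_1)
 also have "\<dots> <= sqrt t ^ n * (exp ((\<nu> + n)^2) * exp (- (\<nu> * r)))"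
  using gauss_le[OF r(1), of n \<nu>] t by (simp add: mult_left_mono)
 finally show ?thesis by (simp add: r_def algebra_simps)
qed

lemma k0_abs_le: "abs (k0 xi t) <= 1"
 using erfc_nonneg[of "xi / (2 * sqrt t)"] erfc_nonneg[of "- (xi / (2 * sqrt t))"]
 by (simp add: k0_def erf_minus abs_le_iff)

lemma erfc_scaled:
 assumes t: "0 < t" and nu: "1 <= \<nu>" and xi: "0 <= xi"
 shows "0 <= 1 - k0 xi t" "1 - k0 xi t <= exp (\<nu>^2) * exp (- (\<nu> * (xi / sqrt t)))"
 using erfc_nonneg erfc_le[of "xi / sqrt t" \<nu>] assms by (simp_all add: k0_def mult.commute)

text \<open>\<open>rk\<close> is the solution for \<open>xi > 0\<close> with initial values \<open>0\<close> and boundary values \<open>t\<close>.\<close>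

definition "rk xi t = t + xi^2 / 2 - k2 xi t"

lemma rk_0: "rk 0 t = t" by (simp add: rk_def k2_def k0_def)

lemma rk_scaled:
 assumes t: "0 < t" and nu: "0 <= \<nu>" and xi: "0 <= xi"
 shows "abs (rk xi t) <= 2 * exp ((\<nu> + 1)^2) * t * exp (- (\<nu> * (xi / sqrt t)))"
proof -
 define r where "r = xi / sqrt t"
 have r: "0 <= r" "xi = r * sqrt t" "xi^2 = r^2 * t"
  using t xi by (auto simp: r_def power_divide)
 \<comment> \<open>The quadratic prefactor is swallowed by \<open>exp r\<close>, which uses up one
   unit of the rate; therefore the complementary error function is estimated with the rate
   \<open>\<nu> + 1\<close>.\<close>
 have "(t + xi^2 / 2) * (1 - k0 xi t) <= (t * exp r) * (exp ((\<nu> + 1)^2) * exp (- ((\<nu> + 1) * r)))"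
 proof (rule mult_mono)
  have "1 + r^2 / 2 <= exp r" using exp_lower_Taylor_quadratic[OF r(1)] r(1) by linarith
  from mult_left_mono[OF this, of t] show "t + xi^2 / 2 <= t * exp r" using t by (simp add: r(3) algebra_simps)
 qed (use erfc_scaled[OF t _ xi, of "\<nu> + 1"] nu t in \<open>auto simp: r_def\<close>)
 also have "\<dots> = exp ((\<nu> + 1)^2) * t * (exp r * exp (- ((\<nu> + 1) * r)))" by (simp only: mult_ac)
 also have "exp r * exp (- ((\<nu> + 1) * r)) = exp (- (\<nu> * r))" by (simp add: exp_add[symmetric] algebra_simps)
 finally have 1: "(t + xi^2 / 2) * (1 - k0 xi t) <= exp ((\<nu> + 1)^2) * t * exp (- (\<nu> * r))" .
 have "xi * t * gk xi t = (abs xi ^ 1 * gk xi t * sqrt t) * sqrt t" using t xi by simp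
 also have "\<dots> <= (exp ((\<nu> + 1)^2) * sqrt t ^ 1 * exp (- (\<nu> * r))) * sqrt t"
  using gk_scaled[OF t nu, of xi 1] xi t by (intro mult_right_mono) (auto simp: r_def)
 also have "\<dots> = exp ((\<nu> + 1)^2) * t * exp (- (\<nu> * r))" using t by simp
 finally have 2: "xi * t * gk xi t <= exp ((\<nu> + 1)^2) * t * exp (- (\<nu> * r))" .
 have "0 <= (t + xi^2 / 2) * (1 - k0 xi t)" "0 <= xi * t * gk xi t"
  using t xi erfc_scaled(1)[OF t _ xi, of 1] gk_pos[OF t, of xi] by auto
 moreover have "rk xi t = (t + xi^2 / 2) * (1 - k0 xi t) - xi * t * gk xi t"
  by (simp add: rk_def k2_def field_simps)
 ultimately show ?thesis using 1 2 by (simp add: r_def)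
qed

text \<open>The rate \<open>m * sqrt T\<close> in \<open>abs xi / sqrt t\<close> becomes the rate
  \<open>m\<close> in \<open>abs xi\<close> for all \<open>t <= T\<close>. The summand 3 covers the
  highest power of \<open>abs xi\<close> occurring with \<open>gk\<close> and the rate reserves
  above, so a single constant serves all kernels.\<close>

definition kc :: "real => real => real" where "kc m T = 2 * exp ((m * sqrt T + 3)^2)"

lemma kc_ge: "0 <= m ==> 0 <= T ==> 0 <= x ==> x <= 3 ==> 2 * exp ((m * sqrt T + x)^2) <= kc m T"
 by (simp add: kc_def power_mono)

lemma kc_1: "1 <= kc m T"
proof -
 have "1 <= exp ((m * sqrt T + 3)^2)" by simp
 then show ?thesis unfolding kc_def by linarith
qed

context
 fixes m T t :: real
 assumes m: "0 <= m" and t: "0 < t" "t <= T"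
begin

lemma exp_scaled_le: "exp (- (m * sqrt T * (abs xi / sqrt t))) <= exp (- (m * abs xi))"
proof -
 have "sqrt t <= sqrt T" using t by simp
 then have "abs xi * sqrt t <= abs xi * sqrt T" by (intro mult_left_mono) auto
 then have "abs xi <= sqrt T * (abs xi / sqrt t)" using t by (simp add: field_simps)
 from mult_left_mono[OF this m] show ?thesis by (simp add: mult.assoc)
qed

lemma gk_le: "n <= 3 ==> abs xi ^ n * gk xi t <= kc m T / 2 * (sqrt t ^ n / sqrt t) * exp (- (m * abs xi))"
proof -
 assume n: "n <= 3"
 have "abs xi ^ n * gk xi t * sqrt t <= exp ((m * sqrt T + n)^2) * sqrt t ^ n * exp (- (m * sqrt T * (abs xi / sqrt t)))"
  by (rule gk_scaled) (use m t in auto)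
 also have "\<dots> <= kc m T / 2 * sqrt t ^ n * exp (- (m * abs xi))"
  using kc_ge[of m T "real n"] exp_scaled_le[of xi] n m t kc_1[of m T] by (intro mult_mono) auto
 finally show ?thesis using t by (simp add: field_simps)
qed

lemma km2_le: "abs (km2 xi t) <= kc m T / t * exp (- (m * abs xi))"
proof -
 have "abs (km2 xi t) = (abs xi ^ 1 * gk xi t) / (2 * t)"
  using t gk_pos[of t xi] by (simp add: km2_def abs_mult)
 also have "\<dots> <= (kc m T / 2 * (sqrt t ^ 1 / sqrt t) * exp (- (m * abs xi))) / (2 * t)"
  using t by (intro divide_right_mono gk_le) auto
 also have "\<dots> <= kc m T / t * exp (- (m * abs xi))"
  using t kc_1[of m T] by (simp add: field_simps)
 finally show ?thesis .
qed

text \<open>On its own \<open>km3\<close> is of order \<open>t^(-3/2)\<close>; the factor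
  \<open>abs xi\<close> is worth one \<open>sqrt t\<close>, which brings the bound to order
  \<open>1 / t\<close>.\<close>

lemma xi_km3_le: "abs xi * abs (km3 xi t) <= kc m T / t * exp (- (m * abs xi))"
proof -
 have s: "sqrt t ^ 3 / sqrt t = t" using t by (simp add: power3_eq_cube)
 have "abs (km3 xi t) <= (abs xi^2 / (4 * t^2) + 1 / (2 * t)) * gk xi t"
 proof -
  have "abs (xi^2 / (4 * t^2) - 1 / (2 * t)) <= abs xi^2 / (4 * t^2) + 1 / (2 * t)"
   using t abs_triangle_ineq4[of "xi^2 / (4 * t^2)" "1 / (2 * t)"] by simp
  then show ?thesis using t gk_pos[of t xi] unfolding km3_def abs_mult by (intro mult_mono) auto
 qed
 from mult_left_mono[OF this, of "abs xi"]
 have "abs xi * abs (km3 xi t) <= (abs xi ^ 3 * gk xi t) / (4 * t^2) + (abs xi ^ 1 * gk xi t) / (2 * t)"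
  by (simp add: algebra_simps power2_eq_square power3_eq_cube)
 also have "\<dots> <= (kc m T / 2 * (sqrt t ^ 3 / sqrt t) * exp (- (m * abs xi))) / (4 * t^2)
   + (kc m T / 2 * (sqrt t ^ 1 / sqrt t) * exp (- (m * abs xi))) / (2 * t)"
  using t by (intro add_mono divide_right_mono gk_le) auto
 also have "\<dots> <= kc m T / t * exp (- (m * abs xi))"
  unfolding s using t kc_1[of m T] by (simp add: field_simps power2_eq_square)
 finally show ?thesis .
qed

lemma km4_le: "abs (km4 xi t) <= kc m T / t^2 * exp (- (m * abs xi))"
proof -
 have s: "sqrt t ^ 3 / sqrt t = t" using t by (simp add: power3_eq_cube)
 have "abs (3 * xi / (4 * t^2) - xi^3 / (8 * t^3)) <= 3 * abs xi / (4 * t^2) + abs xi^3 / (8 * t^3)"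
  using t abs_triangle_ineq4[of "3 * xi / (4 * t^2)" "xi^3 / (8 * t^3)"] by (simp add: abs_mult power_abs)
 then have "abs (km4 xi t) <= (3 * abs xi / (4 * t^2) + abs xi^3 / (8 * t^3)) * gk xi t"
  using t gk_pos[of t xi] unfolding km4_def abs_mult by (intro mult_mono) auto
 also have "\<dots> = 3 * (abs xi ^ 1 * gk xi t) / (4 * t^2) + (abs xi ^ 3 * gk xi t) / (8 * t^3)"
  by (simp add: algebra_simps)
 also have "\<dots> <= 3 * (kc m T / 2 * (sqrt t ^ 1 / sqrt t) * exp (- (m * abs xi))) / (4 * t^2)
   + (kc m T / 2 * (sqrt t ^ 3 / sqrt t) * exp (- (m * abs xi))) / (8 * t^3)"
  using t by (intro add_mono divide_right_mono mult_left_mono gk_le) auto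
 also have "\<dots> <= kc m T / t^2 * exp (- (m * abs xi))"
  unfolding s using t kc_1[of m T] by (simp add: field_simps power2_eq_square power3_eq_cube)
 finally show ?thesis .
qed

lemma t_gk_le: "t * gk xi t <= kc m T * sqrt t"
proof -
 have "t * gk xi t <= t * (kc m T / 2 * (sqrt t ^ 0 / sqrt t) * exp (- (m * abs xi)))"
  using gk_le[of 0 xi] t by (intro mult_left_mono) auto
 also have "\<dots> <= t * (kc m T / 2 * (sqrt t ^ 0 / sqrt t) * 1)"
  using t m kc_1[of m T] by (intro mult_left_mono) auto
 also have "\<dots> = kc m T / 2 * sqrt t" using t real_sqrt_mult_self[of t] by (simp add: field_simps)
 finally have "t * gk xi t <= kc m T / 2 * sqrt t" .
 moreover have "0 <= kc m T * sqrt t" using kc_1[of m T] t by simp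
 ultimately show ?thesis by linarith
qed

lemma sgn_k0_le:
 assumes "xi \<noteq> 0" shows "abs (k0 xi t - sgn xi) <= kc m T * exp (- (m * abs xi))"
proof -
 have *: "abs (k0 xi t - 1) <= kc m T * exp (- (m * abs xi))" if xi: "0 <= xi" for xi
 proof -
  have "1 - k0 xi t <= exp ((m * sqrt T + 1)^2) * exp (- ((m * sqrt T + 1) * (xi / sqrt t)))"
   by (rule erfc_scaled) (use m t xi in auto)
  also have "\<dots> <= kc m T * exp (- (m * abs xi))"
  proof (rule mult_mono)
   have "exp (- ((m * sqrt T + 1) * (xi / sqrt t))) <= exp (- (m * sqrt T * (abs xi / sqrt t)))"
    using xi t by (simp add: algebra_simps)
   also have "\<dots> <= exp (- (m * abs xi))" by (rule exp_scaled_le)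
   finally show "exp (- ((m * sqrt T + 1) * (xi / sqrt t))) <= exp (- (m * abs xi))" .
   have "0 < exp ((m * sqrt T + 1)^2)" by simp
   then show "exp ((m * sqrt T + 1)^2) <= kc m T" using kc_ge[of m T 1] m t by linarith
  qed (use kc_1[of m T] in auto)
  finally show ?thesis using erfc_scaled(1)[OF t(1) _ xi, of 1] by simp
 qed
 show ?thesis
 proof (cases "0 < xi")
  case True then show ?thesis using *[of xi] by simp
 next
  case False then show ?thesis using *[of "- xi"] assms by (simp add: k0_minus)
 qed
qed

lemma rk_le: "0 <= xi ==> abs (rk xi t) <= kc m T * t * exp (- (m * abs xi))"
proof -
 assume xi: "0 <= xi"
 have "abs (rk xi t) <= 2 * exp ((m * sqrt T + 1)^2) * t * exp (- (m * sqrt T * (xi / sqrt t)))"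
  by (rule rk_scaled) (use m t xi in auto)
 also have "\<dots> <= kc m T * t * exp (- (m * abs xi))"
  using exp_scaled_le[of xi] kc_ge[of m T 1] xi m t kc_1[of m T] by (intro mult_mono) auto
 finally show ?thesis .
qed

lemma k1_le: "abs (k1 xi t) <= abs xi + 2 * kc m T * sqrt t"
proof -
 have "abs (xi * k0 xi t) <= abs xi * 1" unfolding abs_mult by (intro mult_left_mono k0_abs_le) simp
 moreover have "abs (2 * t * gk xi t) <= 2 * kc m T * sqrt t"
  using t_gk_le[of xi] gk_pos[OF t(1), of xi] t by (simp add: abs_mult)
 ultimately show ?thesis unfolding k1_def by linarith
qed

text \<open>The limit of \<open>k3\<close> for \<open>t\<close> tending to 0 is
  \<open>abs xi^3 / 6\<close>. It is approached at a linear rate with a slope growing like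
  \<open>abs xi\<close>, plus a term of order \<open>t * sqrt t\<close> that does not grow.\<close>

lemma k3_le: "abs (k3 xi t - abs xi^3 / 6) <= t * abs xi + 4 * (kc m T * (t * sqrt t))"
proof -
 have *: "abs (k3 xi t - xi^3 / 6) <= t * xi + 4 * (kc m T * (t * sqrt t))" if xi: "0 <= xi" for xi
 proof -
  define r where "r = xi / sqrt t"
  have r: "0 <= r" "xi = r * sqrt t" using t xi by (auto simp: r_def)
  \<comment> \<open>The rate 3 matches \<open>r <= exp r\<close> raised to the third power, so that
    the exponentials cancel exactly.\<close>
  have "xi^3 * (1 - k0 xi t) <= (exp r * sqrt t) ^ 3 * (exp (3^2) * exp (- (3 * r)))"
  proof (rule mult_mono)
   have "r <= exp r" using exp_ge_add_one_self[of r] by linarith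
   then show "xi^3 <= (exp r * sqrt t) ^ 3" unfolding r(2) using r t by (intro power_mono mult_right_mono) auto
  qed (use erfc_scaled[OF t(1) _ xi, of 3] t xi in \<open>auto simp: r_def\<close>)
  also have "\<dots> = exp (3^2) * (t * sqrt t)"
  proof -
   have "exp r ^ 3 * exp (- (3 * r)) = 1" using exp_of_nat_mult[of 3 r] by (simp add: exp_minus)
   then have "(exp r ^ 3 * exp (- (3 * r))) * (exp (3^2) * (t * sqrt t)) = exp (3^2) * (t * sqrt t)" by simp
   moreover have "sqrt t ^ 3 = t * sqrt t" using t by (simp add: power3_eq_cube)
   ultimately show ?thesis unfolding power_mult_distrib by (simp add: mult_ac)
  qed
  also have "exp (3^2) <= kc m T" 
  proof -
   have "exp (3^2) <= exp ((m * sqrt T + 3)^2)" using m t by (intro exp_mono power_mono) auto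
   then show ?thesis using exp_ge_zero[of "(3::real)^2"] unfolding kc_def by linarith
  qed
  finally have 1: "xi^3 * (1 - k0 xi t) <= kc m T * (t * sqrt t)" using t by (simp add: mult_right_mono)
  have "xi^2 * gk xi t <= kc m T / 2 * (sqrt t ^ 2 / sqrt t) * exp (- (m * abs xi))"
   using gk_le[of 2 xi] by simp
  also have "\<dots> <= kc m T / 2 * (sqrt t ^ 2 / sqrt t) * 1"
   using t m kc_1[of m T] by (intro mult_left_mono) auto
  also have "\<dots> = kc m T / 2 * sqrt t" using t real_sqrt_mult_self[of t] by (simp add: field_simps)
  finally have "xi^2 * gk xi t <= kc m T / 2 * sqrt t" .
  from mult_left_mono[OF this, of t]
  have 2: "t * (xi^2 * gk xi t) <= kc m T / 2 * (t * sqrt t)" using t by (simp add: mult_ac)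
  from mult_left_mono[OF t_gk_le[of xi], of t]
  have 3: "t * (t * gk xi t) <= kc m T * (t * sqrt t)" using t by (simp add: mult_ac)
  have "abs (xi * t * k0 xi t) <= xi * t * 1"
   unfolding abs_mult using xi t by (intro mult_mono k0_abs_le) auto
  moreover have "0 <= xi^3 * (1 - k0 xi t)" "0 <= t * (xi^2 * gk xi t)" "0 <= t * (t * gk xi t)"
   using xi erfc_scaled(1)[OF t(1) _ xi, of 1] t gk_pos[OF t(1), of xi] by auto
  moreover have "k3 xi t - xi^3 / 6 = xi * t * k0 xi t - xi^3 * (1 - k0 xi t) / 6
    + t * (xi^2 * gk xi t) / 3 + 4 / 3 * (t * (t * gk xi t))"
   by (simp add: k3_def field_simps)
  moreover have "0 <= kc m T * (t * sqrt t)" using kc_1[of m T] t by simp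
  moreover have "xi * t * 1 = t * xi" by simp
  ultimately show ?thesis using 1 2 3 by linarith
 qed
 show ?thesis
 proof (cases "0 <= xi")
  case True then show ?thesis using *[of xi] by simp
 next
  case False
  have "k3 (- xi) t = k3 xi t" by (simp add: k3_def k0_minus gk_minus algebra_simps)
  then show ?thesis using *[of "- xi"] False by simp
 qed
qed

end

section \<open>Approximability on mesh stencils\<close>

definition small_layer :: "real => real set => real => real => real => real => bool" where
 "small_layer m P eps \<nu> l r \<longleftrightarrow> (\<forall>p\<in>P. \<forall>z\<in>{l..r}. exp (- (m * (abs (z - p) / sqrt eps))) <= \<nu>)"

text \<open>At this fixed distance a layer function is \<open>O(eps^2)\<close>, enough to pay for
  derivative bounds of order \<open>eps^(-2)\<close>. The number 1/16 is half of the largest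
  transition width 1/8 of the mesh with an interior layer.\<close>

definition far_from :: "real set => real => real => bool" where
 "far_from P l r \<longleftrightarrow> (\<forall>p\<in>P. \<forall>z\<in>{l..r}. 1 / 16 <= abs (z - p))"

text \<open>A singular function has its second time derivative bounded by a multiple of
  \<open>1 / (t - d)\<close>. The added \<open>k\<close> keeps the weight meaningful in the first
  steps after \<open>d\<close>, where only Lipschitz continuity helps.\<close>

definition weight :: "real => real => real => real" where
 "weight k d t = (if t <= d then 0 else 1 / (k + (t - d)))"

lemma weight_nonneg: "0 < k ==> 0 <= weight k d t"
 by (simp add: weight_def)

text \<open>\<open>P\<close> is the set of layer positions and \<open>d\<close> the time of a possible singularity,
 \<open>\<nu>\<close> is the order of the error in space and \<open>k\<close> the time step.  The three cases in
 space are a uniform stencil that is fine or lies outside the layers, a nonuniform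
 stencil, and interpolation.\<close>

definition approx_ok ::
  "real => real => real => real set => real => real => (real => real => real) =>
   (real => real => real) => (real => real => real) => bool" where
 "approx_ok T eps m P d C U Ut Uxx \<longleftrightarrow>
   (\<forall>x\<in>{0..1}. \<forall>s\<in>{0..T}. \<forall>t\<in>{0..T}. (abs (U x t - U x s)) <= C * abs (t - s)) \<and>
   (\<forall>x t k. 0 < x \<and> x < 1 \<and> 0 < k \<and> k <= t \<and> t <= T \<longrightarrow>
    abs ((U x t - U x (t - k)) / k - Ut x t) <= C * k * (1 + weight k d t)) \<and>
   (\<forall>x a c t k \<nu>. 0 < a \<and> 0 < c \<and> 0 <= x - a \<and> x + c <= 1 \<and> 0 < k \<and> k <= t \<and> t <= T \<and> 0 <= \<nu> \<longrightarrow>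
    (a = c \<and> (a^2 <= eps * \<nu> \<or> a^2 <= \<nu> \<and> small_layer m P eps \<nu> (x - a) (x + c)) \<longrightarrow>
      eps * abs (divdiff2 a c (\<lambda>x. U x t) x - Uxx x t) <= C * (\<nu> + k) * (1 + weight k d t)) \<and>
    (small_layer m P eps \<nu> (x - a) (x + c) \<or> far_from P (x - a) (x + c) \<longrightarrow>
      eps * abs (divdiff2 a c (\<lambda>x. U x t) x - Uxx x t) <= C * (\<nu> + k) * (1 + weight k d t) + C * eps * (a + c)) \<and>
    (a * c <= eps * \<nu> \<or> a * c <= \<nu> \<and> small_layer m P eps \<nu> (x - a) (x + c) \<longrightarrow>
      abs (interp_err a c (\<lambda>x. U x t) x) <= C * \<nu>))"

lemma approx_okD:
 assumes "approx_ok T eps m P d C U Ut Uxx"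
 shows "x \<in> {0..1} ==> s \<in> {0..T} ==> t \<in> {0..T} ==> abs (U x t - U x s) <= C * abs (t - s)"
  and "0 < x ==> x < 1 ==> 0 < k ==> k <= t ==> t <= T ==>
    abs ((U x t - U x (t - k)) / k - Ut x t) <= C * k * (1 + weight k d t)"
  and "0 < a ==> 0 <= x - a ==> x + a <= 1 ==> 0 < k ==> k <= t ==> t <= T ==> 0 <= \<nu> ==>
    a^2 <= eps * \<nu> \<or> a^2 <= \<nu> \<and> small_layer m P eps \<nu> (x - a) (x + a) ==>
    eps * abs (divdiff2 a a (\<lambda>x. U x t) x - Uxx x t) <= C * (\<nu> + k) * (1 + weight k d t)"
  and "0 < a ==> 0 < c ==> 0 <= x - a ==> x + c <= 1 ==> 0 < k ==> k <= t ==> t <= T ==> 0 <= \<nu> ==>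
    small_layer m P eps \<nu> (x - a) (x + c) \<or> far_from P (x - a) (x + c) ==>
    eps * abs (divdiff2 a c (\<lambda>x. U x t) x - Uxx x t) <= C * (\<nu> + k) * (1 + weight k d t) + C * eps * (a + c)"
  and "0 < a ==> 0 < c ==> 0 <= x - a ==> x + c <= 1 ==> 0 < t ==> t <= T ==> 0 <= \<nu> ==>
    a * c <= eps * \<nu> \<or> a * c <= \<nu> \<and> small_layer m P eps \<nu> (x - a) (x + c) ==>
    abs (interp_err a c (\<lambda>x. U x t) x) <= C * \<nu>"
 using assms unfolding approx_ok_def by (blast+)

lemma approx_ok_add:
 assumes U: "approx_ok T eps m P d C U Ut Uxx" and V: "approx_ok T eps m P d D V Vt Vxx" and e: "0 < eps"
 shows "approx_ok T eps m P d (C + D) (\<lambda>x t. U x t + V x t) (\<lambda>x t. Ut x t + Vt x t) (\<lambda>x t. Uxx x t + Vxx x t)"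
proof -
 have tri: "abs ((u + v) - (u' + v')) <= abs (u - u') + abs (v - v')" for u v u' v' :: real by linarith
 have e3: "eps * abs (u + v - (u' + v')) <= eps * abs (u - u') + eps * abs (v - v')" for u v u' v' :: real
  using mult_left_mono[OF tri, of eps] e by (simp add: algebra_simps)
 show ?thesis
  unfolding approx_ok_def divdiff2_add interp_err_add
 proof (intro conjI ballI allI impI; (elim conjE)?)
  fix x s t :: real assume "x \<in> {0..1}" "s \<in> {0..T}" "t \<in> {0..T}"
  then show "abs (U x t + V x t - (U x s + V x s)) <= (C + D) * abs (t - s)"
   using approx_okD(1)[OF U, of x s t] approx_okD(1)[OF V, of x s t] by (simp add: distrib_right)
 next
  fix x t k :: real assume *: "0 < x" "x < 1" "0 < k" "k <= t" "t <= T"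
  have "(U x t + V x t - (U x (t - k) + V x (t - k))) / k - (Ut x t + Vt x t)
    = ((U x t - U x (t - k)) / k - Ut x t) + ((V x t - V x (t - k)) / k - Vt x t)"
   by (simp add: diff_divide_distrib add_divide_distrib)
  moreover have "(C + D) * k * (1 + weight k d t) = C * k * (1 + weight k d t) + D * k * (1 + weight k d t)"
   by (simp add: algebra_simps)
  ultimately show "abs ((U x t + V x t - (U x (t - k) + V x (t - k))) / k - (Ut x t + Vt x t))
    <= (C + D) * k * (1 + weight k d t)"
   using approx_okD(2)[OF U *] approx_okD(2)[OF V *] by linarith
 next
  fix x a c t k \<nu> :: real
  assume *: "0 < a" "0 < c" "0 <= x - a" "x + c <= 1" "0 < k" "k <= t" "t <= T" "0 <= \<nu>"
  {
   assume **: "a = c" "a^2 <= eps * \<nu> \<or> a^2 <= \<nu> \<and> small_layer m P eps \<nu> (x - a) (x + c)"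
   show "eps * abs (divdiff2 a c (\<lambda>x. U x t) x + divdiff2 a c (\<lambda>x. V x t) x - (Uxx x t + Vxx x t))
    <= (C + D) * (\<nu> + k) * (1 + weight k d t)"
    using approx_okD(3)[OF U *(1,3) _ *(5-8)] approx_okD(3)[OF V *(1,3) _ *(5-8)] * ** 
     e3[of "divdiff2 a c (\<lambda>x. U x t) x" "divdiff2 a c (\<lambda>x. V x t) x" "Uxx x t" "Vxx x t"]
    by (simp add: distrib_right)
  next
   assume **: "small_layer m P eps \<nu> (x - a) (x + c) \<or> far_from P (x - a) (x + c)"
   show "eps * abs (divdiff2 a c (\<lambda>x. U x t) x + divdiff2 a c (\<lambda>x. V x t) x - (Uxx x t + Vxx x t))
    <= (C + D) * (\<nu> + k) * (1 + weight k d t) + (C + D) * eps * (a + c)"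
    using approx_okD(4)[OF U * **] approx_okD(4)[OF V * **]
     e3[of "divdiff2 a c (\<lambda>x. U x t) x" "divdiff2 a c (\<lambda>x. V x t) x" "Uxx x t" "Vxx x t"]
    unfolding distrib_right by linarith
  next
   assume **: "a * c <= eps * \<nu> \<or> a * c <= \<nu> \<and> small_layer m P eps \<nu> (x - a) (x + c)"
   have t: "0 < t" using * by simp
   show "abs (interp_err a c (\<lambda>x. U x t) x + interp_err a c (\<lambda>x. V x t) x) <= (C + D) * \<nu>"
    using approx_okD(5)[OF U *(1-4) t *(7,8) **] approx_okD(5)[OF V *(1-4) t *(7,8) **]
    unfolding distrib_right by linarith
  }
 qed
qed

lemma approx_ok_cmult:
 assumes U: "approx_ok T eps m P d C U Ut Uxx" and e: "0 < eps" and r: "abs r * C <= D"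
 shows "approx_ok T eps m P d D (\<lambda>x t. r * U x t) (\<lambda>x t. r * Ut x t) (\<lambda>x t. r * Uxx x t)"
proof -
 have m: "abs (r * u) <= D * s" if "abs u <= C * s" "0 <= s" for u s
 proof -
  have "abs (r * u) <= abs r * (C * s)" unfolding abs_mult using that(1) by (intro mult_left_mono) auto
  also have "\<dots> <= D * s" using mult_right_mono[OF r that(2)] by (simp add: mult.assoc)
  finally show ?thesis .
 qed
 show ?thesis
  unfolding approx_ok_def divdiff2_cmult interp_err_cmult
 proof (intro conjI ballI allI impI; (elim conjE)?)
  fix x s t :: real assume "x \<in> {0..1}" "s \<in> {0..T}" "t \<in> {0..T}"
  then show "abs (r * U x t - r * U x s) <= D * abs (t - s)"
   using m[OF approx_okD(1)[OF U, of x s t]] by (simp add: right_diff_distrib)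
 next
  fix x t k :: real assume *: "0 < x" "x < 1" "0 < k" "k <= t" "t <= T"
  have "(r * U x t - r * U x (t - k)) / k - r * Ut x t = r * ((U x t - U x (t - k)) / k - Ut x t)"
   by (simp add: diff_divide_distrib right_diff_distrib)
  then show "abs ((r * U x t - r * U x (t - k)) / k - r * Ut x t) <= D * k * (1 + weight k d t)"
   using m[of "(U x t - U x (t - k)) / k - Ut x t" "k * (1 + weight k d t)"] approx_okD(2)[OF U *] weight_nonneg[OF *(3), of d t] *
   by (simp add: mult.assoc)
 next
  fix x a c t k \<nu> :: real
  assume *: "0 < a" "0 < c" "0 <= x - a" "x + c <= 1" "0 < k" "k <= t" "t <= T" "0 <= \<nu>"
  have wn: "0 <= (\<nu> + k) * (1 + weight k d t)" using * weight_nonneg[OF *(5), of d t] by simp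
  have eq: "eps * abs (r * divdiff2 a c (\<lambda>x. U x t) x - r * Uxx x t)
    = abs (r * (eps * (divdiff2 a c (\<lambda>x. U x t) x - Uxx x t)))"
   using e by (simp add: abs_mult right_diff_distrib[symmetric])
  {
   assume **: "a = c" "a^2 <= eps * \<nu> \<or> a^2 <= \<nu> \<and> small_layer m P eps \<nu> (x - a) (x + c)"
   have "eps * abs (divdiff2 a c (\<lambda>x. U x t) x - Uxx x t) <= C * (\<nu> + k) * (1 + weight k d t)"
    using approx_okD(3)[OF U *(1,3) _ *(5-8)] * ** by simp
   then show "eps * abs (r * divdiff2 a c (\<lambda>x. U x t) x - r * Uxx x t) <= D * (\<nu> + k) * (1 + weight k d t)"
    unfolding eq using m[of "eps * (divdiff2 a c (\<lambda>x. U x t) x - Uxx x t)", OF _ wn] e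
    by (simp add: abs_mult mult.assoc)
  next
   assume **: "small_layer m P eps \<nu> (x - a) (x + c) \<or> far_from P (x - a) (x + c)"
   have "eps * abs (divdiff2 a c (\<lambda>x. U x t) x - Uxx x t) <= C * ((\<nu> + k) * (1 + weight k d t) + eps * (a + c))"
   proof -
    have "C * (\<nu> + k) * (1 + weight k d t) + C * eps * (a + c) = C * ((\<nu> + k) * (1 + weight k d t) + eps * (a + c))"
     by (simp add: algebra_simps)
    then show ?thesis using approx_okD(4)[OF U * **] by simp
   qed
   then show "eps * abs (r * divdiff2 a c (\<lambda>x. U x t) x - r * Uxx x t) <= D * (\<nu> + k) * (1 + weight k d t) + D * eps * (a + c)"
   proof -
    assume "eps * abs (divdiff2 a c (\<lambda>x. U x t) x - Uxx x t) <= C * ((\<nu> + k) * (1 + weight k d t) + eps * (a + c))"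
    then have "abs (r * (eps * (divdiff2 a c (\<lambda>x. U x t) x - Uxx x t))) <= D * ((\<nu> + k) * (1 + weight k d t) + eps * (a + c))"
     using e wn * by (intro m) (auto simp: abs_mult)
    also have "\<dots> = D * (\<nu> + k) * (1 + weight k d t) + D * eps * (a + c)" by (simp add: algebra_simps)
    finally show ?thesis unfolding eq .
   qed
  next
   assume **: "a * c <= eps * \<nu> \<or> a * c <= \<nu> \<and> small_layer m P eps \<nu> (x - a) (x + c)"
   have t: "0 < t" using * by simp
   show "abs (r * interp_err a c (\<lambda>x. U x t) x) <= D * \<nu>"
    by (rule m[OF approx_okD(5)[OF U *(1-4) t *(7,8) **] *(8)])
  }
 qed
qed

text \<open>Any power of \<open>eps\<close> is available here; the second one compensates the
  \<open>1 / eps^2\<close> in \<open>w_trans\<close>. The number 64 is 4 times 16, from writing the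
  exponential as a fourth power.\<close>

lemma exp_layer_le:
 assumes "0 < m" "0 < eps"
 shows "exp (- (m * (1 / 16 / sqrt eps))) <= (64 / m) ^ 4 * eps^2"
proof -
 define y where "y = 1 / sqrt eps"
 have y: "0 < y" "y ^ 4 * eps^2 = 1"
  using assms by (simp_all add: y_def power_divide) (simp add: power4_eq_xxxx power2_eq_square)
 have "m * y / 64 <= exp (m * y / 64)" using exp_ge_add_one_self[of "m * y / 64"] by linarith
 then have "(m * y / 64) ^ 4 <= exp (m * y / 64) ^ 4" using assms y by (intro power_mono) auto
 also have "\<dots> = exp (m * y / 16)" by (simp add: exp_of_nat_mult[symmetric])
 finally have "(m / 64) ^ 4 * y ^ 4 <= exp (m * y / 16)" by (simp add: power_mult_distrib power_divide)
 from mult_right_mono[OF this, of "eps^2"] have "(m / 64) ^ 4 <= exp (m * y / 16) * eps^2"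
  using y by (simp add: mult.assoc)
 then have "exp (- (m * y / 16)) * (m / 64) ^ 4 <= eps^2"
  by (simp add: exp_minus field_simps)
 then have "exp (- (m * y / 16)) <= (64 / m) ^ 4 * eps^2"
  using assms by (simp add: power_divide field_simps)
 then show ?thesis by (simp add: y_def mult.commute)
qed

context regular
begin

definition "cr m = c\<^sub>1 + c\<^sub>2 + c\<^sub>6 + K * (1 + T) + 3 * c\<^sub>3 * (2 * exp (m^2 * T)) + c\<^sub>3
  + 2 * c\<^sub>5 * (2 * exp (m^2 * T)) * (64 / m) ^ 4 + 2 * c\<^sub>0 * (2 * exp (m^2 * T))"

text \<open>Each regime balances powers of \<open>eps\<close>. On fine stencils
  \<open>a^2 <= eps * \<nu>\<close> offsets \<open>w_fine\<close>; outside the layers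
  \<open>w_outer\<close> is fed with \<open>w_crude\<close>, whose \<open>1 / eps\<close> meets the
  diffusion factor; at nonuniform stencils far from the poles it is fed with \<open>w_trans\<close>,
  whose \<open>1 / eps^2\<close> is cancelled by \<open>exp_layer_le\<close>.\<close>

lemma regular_approx_ok:
 assumes m: "0 < m" and P: "{0, 1} \<subseteq> P"
 shows "approx_ok T eps m P d (cr m) w wt wxx"
 unfolding approx_ok_def
proof (intro conjI ballI allI impI; (elim conjE)?)
 let ?X = "2 * exp (m^2 * T)"
 have nn: "0 <= K * (1 + T)" "0 <= 3 * c\<^sub>3 * ?X" "0 <= 2 * c\<^sub>5 * ?X * (64 / m) ^ 4" "0 <= 2 * c\<^sub>0 * ?X"
  using lip_nonneg c3 c5 c0 m by simp_all
 note nn = nn c1 c2 c3 c6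
 have cr: "c\<^sub>1 <= cr m" "c\<^sub>2 <= cr m" "c\<^sub>6 <= cr m" "K * (1 + T) + 3 * c\<^sub>3 * ?X <= cr m" "c\<^sub>3 <= cr m"
  "K * (1 + T) + 2 * c\<^sub>5 * ?X * (64 / m) ^ 4 <= cr m" "K * (1 + T) + 2 * c\<^sub>0 * ?X <= cr m"
  "K * (1 + T) <= cr m" "3 * c\<^sub>3 * ?X <= cr m"
  using nn unfolding cr_def by linarith+
 have cr0: "0 <= cr m" using cr(1) c1 by linarith
 {
  fix x s t :: real assume "x \<in> {0..1}" "s \<in> {0..T}" "t \<in> {0..T}"
  then have "abs (w x t - w x s) <= c\<^sub>1 * abs (t - s)" using w_lipschitz_t by auto
  also have "\<dots> <= cr m * abs (t - s)" using cr by (intro mult_right_mono) auto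
  finally show "abs (w x t - w x s) <= cr m * abs (t - s)" .
 next
  fix x t k :: real assume *: "0 < x" "x < 1" "0 < k" "k <= t" "t <= T"
  have "abs ((w x t - w x (t - k)) / k - wt x t) <= c\<^sub>2 * k * 1" using w_left_err[of x t k] * by simp
  also have "\<dots> <= cr m * k * (1 + weight k d t)"
   using cr cr0 * weight_nonneg[OF *(3), of d t] c2 by (intro mult_mono) auto
  finally show "abs ((w x t - w x (t - k)) / k - wt x t) <= cr m * k * (1 + weight k d t)" .
 next
  fix x a c t k \<nu> :: real
  assume *: "0 < a" "0 < c" "0 <= x - a" "x + c <= 1" "0 < k" "k <= t" "t <= T" "0 <= \<nu>"
  have t: "0 < t" "t <= T" using * by auto
  let ?E = "exp (m^2 * t - m * (x - a) / sqrt eps) + exp (m^2 * t - m * (1 - c - x) / sqrt eps)"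
  have E: "?E <= ?X * \<Lambda>" if "\<And>p z. p \<in> {0, 1} ==> z \<in> {x-a..x+c} ==> exp (- (m * (abs (z - p) / sqrt eps))) <= \<Lambda>" for \<Lambda>
  proof -
   have "exp (m^2 * t) <= exp (m^2 * T)" using t by (simp add: mult_left_mono)
   moreover have "exp (- (m * ((x - a) / sqrt eps))) <= \<Lambda>" "exp (- (m * ((1 - c - x) / sqrt eps))) <= \<Lambda>"
    using that[of 0 "x - a"] that[of 1 "x + c"] * by (auto simp: algebra_simps)
   ultimately have "exp (m^2 * t) * exp (- (m * ((x - a) / sqrt eps))) <= exp (m^2 * T) * \<Lambda>"
    "exp (m^2 * t) * exp (- (m * ((1 - c - x) / sqrt eps))) <= exp (m^2 * T) * \<Lambda>"
    by (intro mult_mono; simp)+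
   then show ?thesis by (simp add: exp_add[symmetric])
  qed
  have small: "?E <= ?X * \<nu>" if "small_layer m P eps \<nu> (x - a) (x + c)"
   by (rule E) (use that P in \<open>auto simp: small_layer_def\<close>)
  have fin: "cr m * \<nu> <= cr m * (\<nu> + k) * (1 + weight k d t)"
  proof -
   have "cr m * \<nu> * 1 <= cr m * (\<nu> + k) * (1 + weight k d t)"
    using cr0 * weight_nonneg[OF *(5), of d t] by (intro mult_mono) auto
   then show ?thesis by simp
  qed
  {
   assume **: "a = c" "a^2 <= eps * \<nu> \<or> a^2 <= \<nu> \<and> small_layer m P eps \<nu> (x - a) (x + c)"
   have "eps * abs (divdiff2 a c (\<lambda>x. w x t) x - wxx x t) <= cr m * \<nu>"
    using **(2)
   proof
    assume f: "a^2 <= eps * \<nu>"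
    have "eps * abs (divdiff2 a c (\<lambda>x. w x t) x - wxx x t) <= eps * (c\<^sub>6 / eps^2 * a^2)"
     using w_fine[of a x t] * ** t eps by (intro mult_left_mono) auto
    also have "\<dots> <= eps * (c\<^sub>6 / eps^2 * (eps * \<nu>))"
     using f eps c6 by (intro mult_left_mono) auto
    also have "\<dots> = c\<^sub>6 * \<nu>" using eps by (simp add: power2_eq_square)
    also have "\<dots> <= cr m * \<nu>" using cr * by (intro mult_right_mono) auto
    finally show ?thesis .
   next
    assume f: "a^2 <= \<nu> \<and> small_layer m P eps \<nu> (x - a) (x + c)"
    have "abs (divdiff2 a c (\<lambda>x. w x t) x - wxx x t) <= K * a^2 * (1 + T) + 3 * c\<^sub>3 / eps * ?E"
     by (rule w_outer[OF *(1-4) t]) (use ** * smooth_dataD(8) w_crude[OF *(1,2)] in auto)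
    from mult_left_mono[OF this, of eps]
    have "eps * abs (divdiff2 a c (\<lambda>x. w x t) x - wxx x t) <= eps * (K * (1 + T) * a^2) + 3 * c\<^sub>3 * ?E"
     using eps by (simp add: algebra_simps)
    also have "\<dots> <= 1 * (K * (1 + T) * \<nu>) + 3 * c\<^sub>3 * (?X * \<nu>)"
     using f small eps lip_nonneg c3 K T by (intro add_mono mult_mono) auto
    also have "\<dots> = (K * (1 + T) + 3 * c\<^sub>3 * ?X) * \<nu>" by (simp add: algebra_simps)
    also have "\<dots> <= cr m * \<nu>" using cr * by (intro mult_right_mono) auto
    finally show ?thesis .
   qed
   with fin show "eps * abs (divdiff2 a c (\<lambda>x. w x t) x - wxx x t) <= cr m * (\<nu> + k) * (1 + weight k d t)"
    by linarith
  next
   assume **: "small_layer m P eps \<nu> (x - a) (x + c) \<or> far_from P (x - a) (x + c)"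
   have "eps * abs (divdiff2 a c (\<lambda>x. w x t) x - wxx x t) <= cr m * \<nu> + cr m * eps * (a + c)"
    using **
   proof
    assume f: "small_layer m P eps \<nu> (x - a) (x + c)"
    have "abs (divdiff2 a c (\<lambda>x. w x t) x - wxx x t) <= K * (a + c) * (1 + T) + 3 * c\<^sub>3 / eps * ?E"
     by (rule w_outer[OF *(1-4) t]) (use smooth_dataD(7)[OF _ *(1,2)] w_crude[OF *(1,2)] in auto)
    from mult_left_mono[OF this, of eps]
    have "eps * abs (divdiff2 a c (\<lambda>x. w x t) x - wxx x t) <= K * (1 + T) * (eps * (a + c)) + 3 * c\<^sub>3 * ?E"
     using eps by (simp add: algebra_simps)
    also have "\<dots> <= cr m * (eps * (a + c)) + 3 * c\<^sub>3 * (?X * \<nu>)"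
     using cr small[OF f] eps c3 * by (intro add_mono mult_mono) auto
    also have "\<dots> <= cr m * (eps * (a + c)) + cr m * \<nu>"
     using mult_right_mono[OF cr(9) *(8)] by (simp add: mult.assoc)
    finally show ?thesis by (simp add: algebra_simps)
   next
    assume f: "far_from P (x - a) (x + c)"
    have E2: "?E <= ?X * ((64 / m) ^ 4 * eps^2)"
    proof (rule E)
     fix p z :: real assume p: "p \<in> {0, 1}" "z \<in> {x - a..x + c}"
     then have "1 / 16 <= abs (z - p)" using f P unfolding far_from_def by (meson subsetD)
     then have "m * (1 / 16 / sqrt eps) <= m * (abs (z - p) / sqrt eps)"
      using m eps by (intro mult_left_mono divide_right_mono) auto
     then have "exp (- (m * (abs (z - p) / sqrt eps))) <= exp (- (m * (1 / 16 / sqrt eps)))" by simp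
     also have "\<dots> <= (64 / m) ^ 4 * eps^2" by (rule exp_layer_le[OF m eps(1)])
     finally show "exp (- (m * (abs (z - p) / sqrt eps))) <= (64 / m) ^ 4 * eps^2" .
    qed
    have "abs (divdiff2 a c (\<lambda>x. w x t) x - wxx x t) <= K * (a + c) * (1 + T) + 2 * (c\<^sub>5 / eps^2) * (a + c) * ?E"
     by (rule w_outer[OF *(1-4) t]) (use smooth_dataD(7)[OF _ *(1,2)] w_trans[OF *(1,2)] in auto)
    also have "\<dots> <= K * (a + c) * (1 + T) + 2 * (c\<^sub>5 / eps^2) * (a + c) * (?X * ((64 / m) ^ 4 * eps^2))"
     using E2 c5 * by (intro add_left_mono mult_left_mono) auto
    also have "\<dots> = K * (1 + T) * (a + c) + 2 * (a + c) * (c\<^sub>5 / eps^2 * (?X * ((64 / m) ^ 4 * eps^2)))"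
     by (simp only: mult_ac)
    also have "c\<^sub>5 / eps^2 * (?X * ((64 / m) ^ 4 * eps^2)) = c\<^sub>5 * ?X * (64 / m) ^ 4" using eps by simp
    also have "K * (1 + T) * (a + c) + 2 * (a + c) * (c\<^sub>5 * ?X * (64 / m) ^ 4)
      = (K * (1 + T) + 2 * c\<^sub>5 * ?X * (64 / m) ^ 4) * (a + c)"
     by (simp add: algebra_simps)
    also have "\<dots> <= cr m * (a + c)" using cr * by (intro mult_right_mono) auto
    finally have "eps * abs (divdiff2 a c (\<lambda>x. w x t) x - wxx x t) <= eps * (cr m * (a + c))"
     using eps by (intro mult_left_mono) auto
    moreover have "0 <= cr m * \<nu>" using cr0 * by simp
    ultimately show ?thesis by (simp add: algebra_simps)
   qed
   with fin show "eps * abs (divdiff2 a c (\<lambda>x. w x t) x - wxx x t)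
     <= cr m * (\<nu> + k) * (1 + weight k d t) + cr m * eps * (a + c)"
    by linarith
  next
   assume "a * c <= eps * \<nu> \<or> a * c <= \<nu> \<and> small_layer m P eps \<nu> (x - a) (x + c)"
   then show "abs (interp_err a c (\<lambda>x. w x t) x) <= cr m * \<nu>"
   proof
    assume f: "a * c <= eps * \<nu>"
    have "abs (interp_err a c (\<lambda>x. w x t) x) <= c\<^sub>3 / eps * (a * c)" by (rule w_interp_err[OF *(1-4) t])
    also have "\<dots> <= c\<^sub>3 / eps * (eps * \<nu>)" using f c3 eps by (intro mult_left_mono) auto
    also have "\<dots> = c\<^sub>3 * \<nu>" using eps by simp
    also have "\<dots> <= cr m * \<nu>" using cr * by (intro mult_right_mono) auto
    finally show ?thesis .
   next
    assume f: "a * c <= \<nu> \<and> small_layer m P eps \<nu> (x - a) (x + c)"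
    have "abs (interp_err a c (\<lambda>x. w x t) x) <= K * (1 + T) * (a * c) + 2 * c\<^sub>0 * ?E"
     by (rule w_interp_outer) (use * t in auto)
    also have "\<dots> <= K * (1 + T) * \<nu> + 2 * c\<^sub>0 * (?X * \<nu>)"
     using f small lip_nonneg c0 by (intro add_mono mult_left_mono) auto
    also have "\<dots> = (K * (1 + T) + 2 * c\<^sub>0 * ?X) * \<nu>" by (simp add: algebra_simps)
    also have "\<dots> <= cr m * \<nu>" using cr * by (intro mult_right_mono) auto
    finally show ?thesis .
   qed
  }
 }
qed

end

section \<open>The singular parts\<close>

lemma abs_diff_le_of_derivative:
 fixes g :: "real => real"
 assumes "\<And>z. s <= z ==> z <= t ==> (g has_real_derivative g' z) (at z within S)" "{s..t} \<subseteq> S"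
  and "\<And>z. s <= z ==> z <= t ==> abs (g' z) <= B" and "x \<in> {s..t}" "y \<in> {s..t}"
 shows "abs (g x - g y) <= B * abs (x - y)"
 using field_differentiable_bound[of "{s..t}" g g' B x y] assms DERIV_subset[OF _ assms(2)]
 by auto

lemma divdiff2_equal_err_4:
 fixes g :: "real => real"
 assumes d1: "\<And>z. (g has_real_derivative g1 z) (at z)" and d2: "\<And>z. (g1 has_real_derivative g2 z) (at z)"
  and d3: "\<And>z. (g2 has_real_derivative g3 z) (at z)" and d4: "\<And>z. (g3 has_real_derivative g4 z) (at z)"
  and B: "\<And>z. x - h <= z ==> z <= x + h ==> abs (g4 z) <= B" and h: "0 < h"
 shows "abs (divdiff2 h h g x - g2 x) <= 2 * B * h^2"
proof (rule divdiff2_equal_err[where u="x-h" and v="x+h", OF _ d1 d2 _ h])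
 show "continuous_on {x-h..x+h} g" by (rule DERIV_continuous_on[OF has_field_derivative_at_within[OF d1]])
 show "0 <= 2 * B" using order_trans[OF abs_ge_zero B, of x] h by simp
 fix s assume s: "0 < s" "s < h"
 have "abs (interp_err s s g2 x) <= B * (s * s)"
  by (rule interp_err_le[where u="x-s" and v="x+s", OF DERIV_continuous_on[OF has_field_derivative_at_within[OF d3]] d3 d4])
   (use s B in auto)
 moreover have "g2 (x + s) + g2 (x - s) - 2 * g2 x = 2 * interp_err s s g2 x"
  using s by (simp add: interp_err_def field_simps)
 ultimately show "abs (g2 (x + s) + g2 (x - s) - 2 * g2 x) <= 2 * B * s^2"
  by (simp add: power2_eq_square abs_mult)
qed auto

lemma weight_ge:
 assumes "0 < k" "d < t" 
 shows "t - d < 2 * k ==> 1 <= 3 * k * weight k d t"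
  and "k <= t - d ==> 1 / (t - d) <= 2 * weight k d t"
 using assms by (auto simp: weight_def field_simps)

text \<open>Within two steps after \<open>d\<close> the quotient and the derivative are merely
  bounded, and \<open>k * weight k d t\<close> is at least 1/3 there. Later the second derivative on
  \<open>[t - k, t]\<close> is at most \<open>C / (t - k - d)\<close>, which is comparable with
  \<open>C / (t - d)\<close>.\<close>

lemma singular_in_time:
 fixes g :: "real => real"
 assumes d: "0 <= d" and C: "0 <= C"
  and before: "\<And>t. 0 <= t ==> t <= d ==> g t = g\<^sub>0" "\<And>t. 0 <= t ==> t <= d ==> g' t = 0"
  and start: "\<And>t. d < t ==> t <= T ==> abs (g t - g\<^sub>0) <= C * (t - d)"
  and d1: "\<And>t. d < t ==> t <= T ==> (g has_real_derivative g' t) (at t within {0..T})"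
  and d2: "\<And>t. d < t ==> t <= T ==> (g' has_real_derivative g'' t) (at t within {0..T})"
  and B1: "\<And>t. d < t ==> t <= T ==> abs (g' t) <= C"
  and B2: "\<And>t. d < t ==> t <= T ==> abs (g'' t) <= C / (t - d)"
 shows "s \<in> {0..T} ==> t \<in> {0..T} ==> abs (g t - g s) <= C * abs (t - s)"
  and "0 < k ==> k <= t ==> t <= T ==> abs ((g t - g (t - k)) / k - g' t) <= 6 * C * k * (1 + weight k d t)"
proof -
 have lip': "abs (g t - g s) <= C * abs (t - s)" if st: "0 <= s" "s <= t" "t <= T" for s t
 proof -
  consider "t <= d" | "s <= d" "d < t" | "d < s" by linarith
  then show ?thesis
  proof cases
   case 1 then show ?thesis using before(1)[of t] before(1)[of s] st C by simp
  next
   case 2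
   have "C * (t - d) <= C * abs (t - s)" using 2 C by (intro mult_left_mono) auto
   then show ?thesis using start[of t] before(1)[of s] 2 st by simp
  next
   case 3
   show ?thesis
    by (rule abs_diff_le_of_derivative[where s=s and t=t and S="{0..T}", OF d1]) (use 3 st B1 in auto)
  qed
 qed
 show lip: "abs (g t - g s) <= C * abs (t - s)" if "s \<in> {0..T}" "t \<in> {0..T}" for s t
  using lip'[of s t] lip'[of t s] that by (cases "s <= t") (auto simp: abs_minus_commute)
 assume k: "0 < k" "k <= t" "t <= T"
 have w: "0 <= weight k d t" using k by (simp add: weight_nonneg)
 consider "t <= d" | "d < t" "t - d < 2 * k" | "2 * k <= t - d" by linarith
 then show "abs ((g t - g (t - k)) / k - g' t) <= 6 * C * k * (1 + weight k d t)"
 proof cases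
  case 1
  then show ?thesis using before(1)[of t] before(1)[of "t - k"] before(2)[of t] k C w by simp
 next
  case 2
  have "abs (g t - g (t - k)) <= C * k" using lip[of "t - k" t] k by simp
  then have "abs ((g t - g (t - k)) / k) <= C" using k by (simp add: abs_divide pos_divide_le_eq)
  then have "abs ((g t - g (t - k)) / k - g' t) <= 2 * C * 1" using B1[of t] 2 k by linarith
  also have "\<dots> <= 2 * C * (3 * k * weight k d t)" using weight_ge(1)[OF k(1) 2] C by (intro mult_left_mono) auto
  also have "\<dots> <= 6 * C * k * (1 + weight k d t)" using C k by (simp add: algebra_simps)
  finally show ?thesis .
 next
  case 3
  let ?B = "C / (t - k - d) * k"
  have g1: "abs (g' z - g' t) <= ?B" if z: "t - k <= z" "z <= t" for z
  proof -
   have "abs (g' z - g' t) <= C / (t - k - d) * abs (z - t)"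
   proof (rule abs_diff_le_of_derivative[where s="t - k" and t=t and S="{0..T}", OF d2])
    fix y assume y: "t - k <= y" "y <= t"
    have "C / (y - d) <= C / (t - k - d)" using y 3 k C by (intro divide_left_mono) auto
    then show "abs (g'' y) <= C / (t - k - d)" using B2[of y] y 3 k by simp
   qed (use 3 k z in auto)
   also have "\<dots> <= ?B" using z 3 k C by (intro mult_left_mono) auto
   finally show ?thesis .
  qed
  have "abs ((g t - g' t * t) - (g (t - k) - g' t * (t - k))) <= ?B * abs (t - (t - k))"
  proof (rule abs_diff_le_of_derivative[where s="t - k" and t=t and S="{0..T}"])
   fix z assume z: "t - k <= z" "z <= t"
   show "((\<lambda>z. g z - g' t * z) has_real_derivative g' z - g' t) (at z within {0..T})"
    using DERIV_diff[OF d1 DERIV_cmult[OF DERIV_ident], of z "g' t"] z 3 k by simp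
  qed (use 3 k g1 in auto)
  moreover have "(g t - g' t * t) - (g (t - k) - g' t * (t - k)) = ((g t - g (t - k)) / k - g' t) * k"
   using k by (simp add: field_simps)
  ultimately have "abs (((g t - g (t - k)) / k - g' t) * k) <= ?B * k" using k by simp
  then have "abs ((g t - g (t - k)) / k - g' t) <= ?B"
   unfolding abs_mult abs_of_pos[OF k(1)] by (rule mult_right_le_imp_le) fact
  also have "?B <= C * k * (2 * (1 / (t - d)))"
  proof -
   have "1 / (t - k - d) <= 2 * (1 / (t - d))" using 3 k by (simp add: field_simps)
   from mult_left_mono[OF this, of "C * k"] C k show ?thesis by (simp add: field_simps)
  qed
  also have "\<dots> <= C * k * (2 * (2 * weight k d t))"
   using weight_ge(2)[of k d t] 3 k C by (intro mult_left_mono) auto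
  also have "\<dots> <= 6 * C * k * (1 + weight k d t)"
   using C k w mult_nonneg_nonneg[OF mult_nonneg_nonneg[OF C less_imp_le[OF k(1)]] w] by (simp add: algebra_simps)
  finally show ?thesis .
 qed
qed

section \<open>Layer functions described by their derivative bounds\<close>

text \<open>The function switches on at time \<open>d\<close> around the pole \<open>p\<close>, and
  \<open>A t\<close> and \<open>- A t\<close> are its values to the right and to the left of the
  layer. In \<open>B3\<close> the factor \<open>abs (x - p)\<close> admits kernels whose third
  derivative blows up at the pole as \<open>t\<close> decreases to \<open>d\<close>.\<close>

locale layer =
 fixes T eps m C p d :: real and U Ut Utt U1 U2 U3 U4 :: "real => real => real" and A :: "real => real"
 assumes T: "0 < T" and eps: "0 < eps" "eps <= 1" and m: "0 < m" and C: "0 <= C" and d: "0 <= d"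
  and before: "\<And>x t. t <= d ==> U x t = 0 \<and> Ut x t = 0 \<and> U2 x t = 0"
  and start: "\<And>x t. 0 <= x ==> x <= 1 ==> d < t ==> t <= T ==> abs (U x t) <= C * (t - d)"
  and der_t: "\<And>x t. d < t ==> t <= T ==> (U x has_real_derivative Ut x t) (at t within {0..T})"
  and der_tt: "\<And>x t. d < t ==> t <= T ==> (Ut x has_real_derivative Utt x t) (at t within {0..T})"
  and B_t: "\<And>x t. 0 <= x ==> x <= 1 ==> d < t ==> t <= T ==> abs (Ut x t) <= C"
  and B_tt: "\<And>x t. 0 <= x ==> x <= 1 ==> d < t ==> t <= T ==> abs (Utt x t) <= C / (t - d)"
  and der1: "\<And>x t. d < t ==> t <= T ==> ((\<lambda>x. U x t) has_real_derivative U1 x t) (at x)"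
  and der2: "\<And>x t. d < t ==> t <= T ==> ((\<lambda>x. U1 x t) has_real_derivative U2 x t) (at x)"
  and der3: "\<And>x t. d < t ==> t <= T ==> ((\<lambda>x. U2 x t) has_real_derivative U3 x t) (at x)"
  and der4: "\<And>x t. d < t ==> t <= T ==> ((\<lambda>x. U3 x t) has_real_derivative U4 x t) (at x)"
  and B2: "\<And>x t. 0 <= x ==> x <= 1 ==> d < t ==> t <= T ==>
    eps * abs (U2 x t) <= C * exp (- (m * (abs (x - p) / sqrt eps)))"
  and B3: "\<And>x t. 0 <= x ==> x <= 1 ==> d < t ==> t <= T ==>
    eps * (abs (x - p) * abs (U3 x t)) <= C * exp (- (m * (abs (x - p) / sqrt eps)))"
  and B4: "\<And>x t. 0 <= x ==> x <= 1 ==> d < t ==> t <= T ==> eps^2 * abs (U4 x t) <= C / (t - d)"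
  and decay: "\<And>x t. 0 <= x ==> x <= 1 ==> d < t ==> t <= T ==> x \<noteq> p ==>
    abs (U x t - A t * sgn (x - p)) <= C * exp (- (m * (abs (x - p) / sqrt eps)))"
begin

definition "cl = 6 * C + 32 * C * (64 / m) ^ 4 + 2 * C * (1 + T)"

lemma c_layer: "0 <= C * (64 / m) ^ 4" "0 <= C * T" using C m T by simp_all

lemma c_layer_ge: "6 * C <= cl" "3 * C <= cl" "C <= cl" "2 * C * (1 + T) <= cl" "32 * (C * (64 / m) ^ 4) <= cl" "0 <= cl"
proof -
 have e: "cl = 8 * C + 32 * (C * (64 / m) ^ 4) + 2 * (C * T)" "2 * C * (1 + T) = 2 * C + 2 * (C * T)"
  by (simp_all add: cl_def algebra_simps)
 show "6 * C <= cl" "3 * C <= cl" "C <= cl" "2 * C * (1 + T) <= cl" "32 * (C * (64 / m) ^ 4) <= cl" "0 <= cl"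
  using c_layer C unfolding e by linarith+
qed

lemma interp_crude:
 assumes ac: "0 < a" "0 < c" and x: "0 <= x - a" "x + c <= 1" and t: "d < t" "t <= T"
  and \<Lambda>: "\<And>z. x - a <= z ==> z <= x + c ==> exp (- (m * (abs (z - p) / sqrt eps))) <= \<Lambda>"
 shows "eps * abs (interp_err a c (\<lambda>x. U x t) x) <= C * \<Lambda> * (a * c)" 
  and "eps * abs (divdiff2 a c (\<lambda>x. U x t) x - U2 x t) <= 3 * C * \<Lambda>"
proof -
 have b: "abs (U2 z t) <= C * \<Lambda> / eps" if z: "x - a <= z" "z <= x + c" for z
 proof -
  have "eps * abs (U2 z t) <= C * exp (- (m * (abs (z - p) / sqrt eps)))" using B2[of z t] z x t by simp
  also have "\<dots> <= C * \<Lambda>" using \<Lambda>[OF z] C by (intro mult_left_mono) auto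
  finally show ?thesis using eps by (simp add: field_simps)
 qed
 have i: "abs (interp_err a c (\<lambda>x. U x t) x) <= C * \<Lambda> / eps * (a * c)"
  by (rule interp_err_le[where u="x-a" and v="x+c", OF DERIV_continuous_on[OF has_field_derivative_at_within[OF der1[OF t]]] der1[OF t] der2[OF t]])
   (use ac b in auto)
 then show "eps * abs (interp_err a c (\<lambda>x. U x t) x) <= C * \<Lambda> * (a * c)" using eps by (simp add: field_simps)
 have "abs (divdiff2 a c (\<lambda>x. U x t) x) <= 2 * (C * \<Lambda> / eps)" by (rule divdiff2_le[OF i ac])
 then have "abs (divdiff2 a c (\<lambda>x. U x t) x - U2 x t) <= 3 * (C * \<Lambda> / eps)" using b[of x] ac by simp
 from mult_left_mono[OF this, of eps] show "eps * abs (divdiff2 a c (\<lambda>x. U x t) x - U2 x t) <= 3 * C * \<Lambda>"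
  using eps by simp
qed

lemma layer_approx_ok:
 assumes P: "p \<in> P"
 shows "approx_ok T eps m P d cl U Ut U2"
 unfolding approx_ok_def
proof (intro conjI ballI allI impI; (elim conjE)?)
 note cl = c_layer_ge
 fix x s t :: real assume x: "x \<in> {0..1}" and st: "s \<in> {0..T}" "t \<in> {0..T}"
 have "abs (U x t - U x s) <= C * abs (t - s)"
  by (rule singular_in_time(1)[where g="U x" and g'="Ut x" and g''="Utt x" and g\<^sub>0=0 and d=d, OF d C])
   (use x st before start der_t der_tt B_t B_tt in auto)
 also have "\<dots> <= cl * abs (t - s)" using cl by (intro mult_right_mono) auto
 finally show "abs (U x t - U x s) <= cl * abs (t - s)" .
next
 note cl = c_layer_ge
 fix x t k :: real assume *: "0 < x" "x < 1" "0 < k" "k <= t" "t <= T"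
 have "abs ((U x t - U x (t - k)) / k - Ut x t) <= 6 * C * k * (1 + weight k d t)"
  by (rule singular_in_time(2)[where g="U x" and g'="Ut x" and g''="Utt x" and g\<^sub>0=0 and d=d and T=T, OF d C])
   (use * before start der_t der_tt B_t B_tt in auto)
 also have "\<dots> <= cl * k * (1 + weight k d t)"
  using cl * weight_nonneg[OF *(3), of d t] by (intro mult_right_mono) auto
 finally show "abs ((U x t - U x (t - k)) / k - Ut x t) <= cl * k * (1 + weight k d t)" .
next
 note cl = c_layer_ge
 fix x a c t k \<nu> :: real
 assume *: "0 < a" "0 < c" "0 <= x - a" "x + c <= 1" "0 < k" "k <= t" "t <= T" "0 <= \<nu>"
 have w: "0 <= weight k d t" using * by (simp add: weight_nonneg)
 have zero: "divdiff2 a c (\<lambda>x. U x t) x - U2 x t = 0" "interp_err a c (\<lambda>x. U x t) x = 0" if "t <= d"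
  using before[OF that] by (simp_all add: divdiff2_def interp_err_def)
 have e1: "exp (- (m * (abs (z - p) / sqrt eps))) <= 1" for z using m eps by simp
 have rhs: "0 <= cl * (\<nu> + k) * (1 + weight k d t)" using cl * w by simp
 have small: "eps * abs (divdiff2 a c (\<lambda>x. U x t) x - U2 x t) <= cl * (\<nu> + k) * (1 + weight k d t)"
  if "small_layer m P eps \<nu> (x - a) (x + c)" "d < t"
 proof -
  have "eps * abs (divdiff2 a c (\<lambda>x. U x t) x - U2 x t) <= 3 * C * \<nu> * 1"
   using interp_crude(2)[OF *(1-4) that(2) *(7), of \<nu>] that P by (auto simp: small_layer_def)
  also have "\<dots> <= cl * (\<nu> + k) * (1 + weight k d t)"
   using cl * w C by (intro mult_mono) auto
  finally show ?thesis .
 qed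
 {
  assume **: "a = c" "a^2 <= eps * \<nu> \<or> a^2 <= \<nu> \<and> small_layer m P eps \<nu> (x - a) (x + c)"
  show "eps * abs (divdiff2 a c (\<lambda>x. U x t) x - U2 x t) <= cl * (\<nu> + k) * (1 + weight k d t)"
  proof (cases "d < t")
   case False then show ?thesis using zero rhs by simp
  next
   case t: True
   from **(2) show ?thesis
   proof
    assume f: "a^2 <= eps * \<nu>"
    \<comment> \<open>At least one step after \<open>d\<close> the fourth derivative is integrable
      against the weight. Earlier the crude bound is enough, since then
      \<open>2 * k * weight k d t\<close> is at least 1.\<close>
    show ?thesis
    proof (cases "k <= t - d")
     case True
     have "abs (divdiff2 a a (\<lambda>x. U x t) x - U2 x t) <= 2 * (C / (t - d) / eps^2) * a^2"
     proof (rule divdiff2_equal_err_4[OF der1[OF t *(7)] der2[OF t *(7)] der3[OF t *(7)] der4[OF t *(7)] _ *(1)])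
      fix z assume "x - a <= z" "z <= x + a"
      then show "abs (U4 z t) <= C / (t - d) / eps^2"
       using B4[of z t] * ** t eps by (simp add: pos_le_divide_eq mult_ac)
     qed
     also have "\<dots> <= 2 * (C / (t - d) / eps^2) * (eps * \<nu>)"
      using f C t by (intro mult_left_mono) auto
     finally have "eps * abs (divdiff2 a a (\<lambda>x. U x t) x - U2 x t) <= eps * (2 * (C / (t - d) / eps^2) * (eps * \<nu>))"
      using eps by (intro mult_left_mono) auto
     also have "\<dots> = 2 * C * \<nu> * (1 / (t - d))" using eps by (simp add: power2_eq_square)
     also have "\<dots> <= 2 * C * \<nu> * (2 * weight k d t)"
      using weight_ge(2)[OF *(5) t True] C * by (intro mult_left_mono) auto
     also have "\<dots> = 4 * C * \<nu> * weight k d t" by simp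
     also have "\<dots> <= cl * (\<nu> + k) * (1 + weight k d t)"
      using cl * w C by (intro mult_mono) auto
     finally show ?thesis using **(1) by simp
    next
     case False
     have "eps * abs (divdiff2 a c (\<lambda>x. U x t) x - U2 x t) <= 3 * C * 1"
      by (rule interp_crude(2)[OF *(1-4) t *(7) e1])
     also have "\<dots> <= 3 * C * (2 * k * weight k d t)"
      using False * t C by (intro mult_left_mono) (auto simp: weight_def field_simps)
     also have "\<dots> = 6 * C * k * weight k d t" by simp
     also have "\<dots> <= cl * (\<nu> + k) * (1 + weight k d t)"
      using cl * w C by (intro mult_mono) auto
     finally show ?thesis .
    qed
   qed (use small t in blast)
  qed
 next
  assume **: "small_layer m P eps \<nu> (x - a) (x + c) \<or> far_from P (x - a) (x + c)"
  have ea: "0 <= cl * eps * (a + c)" using cl eps * by simp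
  show "eps * abs (divdiff2 a c (\<lambda>x. U x t) x - U2 x t) <= cl * (\<nu> + k) * (1 + weight k d t) + cl * eps * (a + c)"
  proof (cases "d < t")
   case False then show ?thesis using zero rhs ea by simp
  next
   case t: True
   from ** show ?thesis
   proof
    assume f: "far_from P (x - a) (x + c)"
    let ?L = "16 * C * (64 / m) ^ 4"
    have L0: "0 <= ?L" using c_layer by simp
    have U3: "abs (U3 z t) <= ?L" if z: "x - a <= z" "z <= x + c" for z
    proof -
     have zp: "1 / 16 <= abs (z - p)" using f P z by (auto simp: far_from_def)
     have "eps * (1 / 16 * abs (U3 z t)) <= eps * (abs (z - p) * abs (U3 z t))"
      using zp eps by (intro mult_left_mono mult_right_mono) auto
     also have "\<dots> <= C * exp (- (m * (abs (z - p) / sqrt eps)))" using B3[of z t] z * t by simp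
     also have "\<dots> <= C * exp (- (m * (1 / 16 / sqrt eps)))"
     proof -
      have "m * (1 / 16 / sqrt eps) <= m * (abs (z - p) / sqrt eps)"
       using m eps zp by (intro mult_left_mono divide_right_mono) auto
      then show ?thesis using C by (intro mult_left_mono) auto
     qed
     also have "\<dots> <= C * ((64 / m) ^ 4 * eps^2)" using exp_layer_le[OF m eps(1)] C by (intro mult_left_mono) auto
     also have "\<dots> = eps * (C * (64 / m) ^ 4 * eps)" by (simp add: power2_eq_square mult_ac)
     also have "\<dots> <= eps * (C * (64 / m) ^ 4 * 1)" using eps c_layer by (intro mult_left_mono) auto
     finally have "1 / 16 * abs (U3 z t) <= C * (64 / m) ^ 4 * 1" using eps by (simp only: mult_le_cancel_left_pos)
     then show ?thesis by linarith
    qed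
    have "abs (divdiff2 a c (\<lambda>x. U x t) x - U2 x t) <= 2 * ?L * (a + c)"
    proof (rule divdiff2_err[where u="x-a" and v="x+c", OF DERIV_continuous_on[OF has_field_derivative_at_within[OF der1[OF t *(7)]]] der1[OF t *(7)] der2[OF t *(7)]])
     fix z assume "x - a <= z" "z <= x + c"
     then show "abs (U2 z t - U2 x t) <= ?L * abs (z - x)"
      by (intro abs_diff_le_of_derivative[where s="x-a" and t="x+c" and S=UNIV, OF der3[OF t *(7)]])
       (use U3 * in auto)
    qed (use * L0 in auto)
    from mult_left_mono[OF this, of eps] have "eps * abs (divdiff2 a c (\<lambda>x. U x t) x - U2 x t) <= 32 * (C * (64 / m) ^ 4) * (eps * (a + c))"
     using eps by (simp add: mult_ac)
    also have "\<dots> <= cl * (eps * (a + c))" using cl eps * by (intro mult_right_mono) auto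
    finally show ?thesis using rhs by (simp add: mult.assoc)
   qed (use small[OF _ t] ea in linarith)
  qed
 next
  assume **: "a * c <= eps * \<nu> \<or> a * c <= \<nu> \<and> small_layer m P eps \<nu> (x - a) (x + c)"
  show "abs (interp_err a c (\<lambda>x. U x t) x) <= cl * \<nu>"
  proof (cases "d < t")
   case False then show ?thesis using zero cl * by simp
  next
   case t: True
   from ** show ?thesis
   proof
    assume f: "a * c <= eps * \<nu>"
    have "eps * abs (interp_err a c (\<lambda>x. U x t) x) <= C * 1 * (a * c)"
     by (rule interp_crude(1)[OF *(1-4) t *(7) e1])
    also have "\<dots> <= C * 1 * (eps * \<nu>)" using f C by (intro mult_left_mono) auto
    also have "\<dots> = eps * (C * \<nu>)" by simp
    finally have "abs (interp_err a c (\<lambda>x. U x t) x) <= C * \<nu>" using eps by (simp only: mult_le_cancel_left_pos)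
    also have "\<dots> <= cl * \<nu>" using cl * by (intro mult_right_mono) auto
    finally show ?thesis .
   next
    assume f: "a * c <= \<nu> \<and> small_layer m P eps \<nu> (x - a) (x + c)"
    have avg: "abs (interp_err a c g x) <= 2 * B" if "\<And>z. z \<in> {x - a, x, x + c} ==> abs (g z) <= B" for g B
    proof -
     have "abs (c * g (x - a) + a * g (x + c)) <= c * B + a * B"
      by (rule abs_lincomb_le) (use * that in auto)
     then have "abs ((c * g (x - a) + a * g (x + c)) / (a + c)) <= B"
      using * by (simp add: abs_divide pos_divide_le_eq algebra_simps)
     moreover have "abs (g x) <= B" using that by simp
     ultimately show ?thesis unfolding interp_err_def
      by (intro order_trans[OF abs_triangle_ineq4]) simp
    qed
    show ?thesis
    proof (cases "p \<in> {x - a..x + c}")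
     case True
     \<comment> \<open>At the pole the layer function equals 1, so a small layer around it makes the
       target error trivial.\<close>
     then have n1: "1 <= \<nu>" using f P unfolding small_layer_def by force
     have "abs (interp_err a c (\<lambda>x. U x t) x) <= 2 * (C * T)"
     proof (rule avg)
      fix z assume z: "z \<in> {x - a, x, x + c}"
      have "abs (U z t) <= C * (t - d)" using start[of z t] z * t by auto
      also have "\<dots> <= C * T" using * d C by (intro mult_left_mono) auto
      finally show "abs (U z t) <= C * T" .
     qed
     also have "\<dots> <= (2 * C * (1 + T)) * 1" using C by (simp add: algebra_simps)
     also have "\<dots> <= cl * \<nu>" using cl n1 by (intro mult_mono) auto
     finally show ?thesis .
    next
     case False
     define \<sigma> where "\<sigma> = (if p < x - a then 1 else -1 :: real)"
     have sg: "sgn (z - p) = \<sigma>" "z \<noteq> p" if "z \<in> {x - a, x, x + c}" for z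
      using that False * by (auto simp: \<sigma>_def)
     \<comment> \<open>Interpolation is exact on constants, so the one-sided limit value can be
       subtracted; on one side of the pole its sign is fixed, and what remains decays.\<close>
     have "interp_err a c (\<lambda>x. U x t) x = interp_err a c (\<lambda>x. U x t - A t * \<sigma>) x"
      using * by (simp add: interp_err_def field_simps)
     also have "abs \<dots> <= 2 * (C * \<nu>)"
     proof (rule avg)
      fix z assume z: "z \<in> {x - a, x, x + c}"
      have "abs (U z t - A t * \<sigma>) <= C * exp (- (m * (abs (z - p) / sqrt eps)))"
       using decay[of z t] sg[OF z] z * t by auto
      also have "\<dots> <= C * \<nu>"
       using f P z * C unfolding small_layer_def by (intro mult_left_mono) auto
      finally show "abs (U z t - A t * \<sigma>) <= C * \<nu>" .
     qed
     also have "\<dots> = (2 * C) * \<nu>" by simp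
     also have "\<dots> <= cl * \<nu>" using cl * C by (intro mult_right_mono) auto
     finally show ?thesis .
    qed
   qed
  qed
 }
qed

end

section \<open>Layers built from heat kernels with time-dependent coefficients\<close>

text \<open>The stretched variable is \<open>\<theta> * (x - p) / sqrt eps\<close>;
  \<open>\<theta> = -1\<close> reflects it, so that a kernel defined for a half line can sit at the
  right end \<open>x = 1\<close>.\<close>

definition kpart :: "(real => real => real) => (real => real) => real => real => real => real => real => real => real" where
 "kpart V e \<theta> eps p d x t = (if t <= d then 0 else e t * V (\<theta> * (x - p) / sqrt eps) (t - d))"

lemma kpart_t:
 assumes t: "d < t" "t \<in> S" and e: "(e has_real_derivative e' t) (at t within S)"
  and V: "(V (\<theta> * (x - p) / sqrt eps) has_real_derivative V' (\<theta> * (x - p) / sqrt eps) (t - d)) (at (t - d))"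
 shows "(kpart V e \<theta> eps p d x has_real_derivative kpart V e' \<theta> eps p d x t + kpart V' e \<theta> eps p d x t) (at t within S)"
proof (rule has_field_derivative_transform_within)
 let ?xi = "\<theta> * (x - p) / sqrt eps"
 have "((\<lambda>t. V ?xi (t - d)) has_real_derivative V' ?xi (t - d) * 1) (at t within S)"
  by (rule DERIV_chain2[where f="V ?xi" and g="\<lambda>t. t - d" and x=t, OF V]) (auto intro!: derivative_eq_intros)
 from DERIV_mult[OF e this]
 show "((\<lambda>t. e t * V ?xi (t - d)) has_real_derivative kpart V e' \<theta> eps p d x t + kpart V' e \<theta> eps p d x t) (at t within S)"
  using t by (simp add: kpart_def mult.commute add.commute)
 show "0 < t - d" using t by simp
 show "e s * V ?xi (s - d) = kpart V e \<theta> eps p d x s" if "s \<in> S" "dist s t < t - d" for s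
  using that by (auto simp: kpart_def dist_real_def)
qed (use t in auto)

lemma kpart_x:
 assumes t: "d < t" and V: "\<And>xi. ((\<lambda>xi. V xi (t - d)) has_real_derivative V' xi (t - d)) (at xi)"
 shows "((\<lambda>x. r * kpart V e \<theta> eps p d x t) has_real_derivative (r * (\<theta> / sqrt eps)) * kpart V' e \<theta> eps p d x t) (at x)"
proof -
 have "((\<lambda>x. \<theta> * (x - p) / sqrt eps) has_real_derivative \<theta> / sqrt eps) (at x)"
  by (rule DERIV_cong[OF DERIV_cdivide[OF DERIV_cmult[OF DERIV_diff[OF DERIV_ident DERIV_const]]]]) simp
 from DERIV_cmult[OF DERIV_chain2[OF V this], of "r * e t"]
 show ?thesis using t by (simp add: kpart_def mult_ac)
qed

text \<open>\<open>V1\<close> to \<open>V4\<close> are the space derivatives of a heat solution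
  \<open>V\<close>, so \<open>V2\<close> and \<open>V4\<close> are also the first two time
  derivatives. The list in \<open>bounds\<close> is what the product rule needs for
  \<open>layer\<close>; \<open>D\<close> restricts it to the arguments that occur for
  \<open>x\<close> in \<open>{0..1}\<close>.\<close>

locale heat_layer =
 fixes T eps m C p d \<theta> :: real and e e' e'' a :: "real => real" and V V1 V2 V3 V4 :: "real => real => real" and D :: "real set"
 assumes T: "0 < T" and eps: "0 < eps" "eps <= 1" and m: "0 < m" and C: "0 <= C" and d: "0 <= d"
  and \<theta>: "\<theta> = 1 \<or> \<theta> = -1"
  and D: "\<And>x. 0 <= x ==> x <= 1 ==> \<theta> * (x - p) / sqrt eps \<in> D"
  and e: "\<And>t. d < t ==> t <= T ==> (e has_real_derivative e' t) (at t within {0..T})"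
  and e': "\<And>t. d < t ==> t <= T ==> (e' has_real_derivative e'' t) (at t within {0..T})"
  and V_x: "\<And>xi \<tau>. 0 < \<tau> ==> ((\<lambda>xi. V xi \<tau>) has_real_derivative V1 xi \<tau>) (at xi)"
   "\<And>xi \<tau>. 0 < \<tau> ==> ((\<lambda>xi. V1 xi \<tau>) has_real_derivative V2 xi \<tau>) (at xi)"
   "\<And>xi \<tau>. 0 < \<tau> ==> ((\<lambda>xi. V2 xi \<tau>) has_real_derivative V3 xi \<tau>) (at xi)"
   "\<And>xi \<tau>. 0 < \<tau> ==> ((\<lambda>xi. V3 xi \<tau>) has_real_derivative V4 xi \<tau>) (at xi)"
  and V_t: "\<And>xi \<tau>. 0 < \<tau> ==> (V xi has_real_derivative V2 xi \<tau>) (at \<tau>)"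
   "\<And>xi \<tau>. 0 < \<tau> ==> (V2 xi has_real_derivative V4 xi \<tau>) (at \<tau>)"
  and bounds: "\<And>xi t. xi \<in> D ==> d < t ==> t <= T ==>
    abs (e t * V xi (t - d)) <= C * (t - d) \<and> abs (e' t * V xi (t - d)) <= C \<and>
    abs (e'' t * V xi (t - d)) <= C / (t - d) \<and> abs (e' t * V2 xi (t - d)) <= C / (t - d) \<and>
    abs (e t * V4 xi (t - d)) <= C / (t - d) \<and>
    abs (e t * V2 xi (t - d)) <= C * exp (- (m * abs xi)) \<and>
    abs xi * abs (e t * V3 xi (t - d)) <= C * exp (- (m * abs xi)) \<and>
    (xi \<noteq> 0 \<longrightarrow> abs (e t * V xi (t - d) - a t * sgn xi) <= C * exp (- (m * abs xi)))"
begin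

abbreviation "kp \<equiv> \<lambda>V e. kpart V e \<theta> eps p d"

text \<open>The factor 4 counts the terms of the second time derivative under the product rule. Each
  space derivative brings \<open>1 / sqrt eps\<close>, which the powers of \<open>eps\<close> in the
  layer bounds undo.\<close>

lemma kp_layer: "layer T eps m (4 * C) p d (kp V e) (\<lambda>x t. kp V e' x t + kp V2 e x t)
  (\<lambda>x t. (kp V e'' x t + kp V2 e' x t) + (kp V2 e' x t + kp V4 e x t))
  (\<lambda>x t. 1 * (\<theta> / sqrt eps) * kp V1 e x t) (\<lambda>x t. 1 / eps * kp V2 e x t)
  (\<lambda>x t. 1 / eps * (\<theta> / sqrt eps) * kp V3 e x t) (\<lambda>x t. 1 / eps^2 * kp V4 e x t) (\<lambda>t. a t * \<theta>)"
proof
 have th2: "\<theta> / sqrt eps * (\<theta> / sqrt eps) = 1 / eps" using \<theta> eps by auto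
 have C4: "C * y <= 4 * C * y" if "0 <= y" for y using C that by (simp add: mult_right_mono)
 {
  fix x t :: real assume t: "d < t" "t <= T"
  have tt: "t \<in> {0..T}" "0 < t - d" using t d by auto
  show "(kp V e x has_real_derivative kp V e' x t + kp V2 e x t) (at t within {0..T})"
   by (rule kpart_t, fact t(1), fact tt(1), rule e[OF t], rule V_t(1)[OF tt(2)])
  have "(kp V e' x has_real_derivative kp V e'' x t + kp V2 e' x t) (at t within {0..T})"
   by (rule kpart_t, fact t(1), fact tt(1), rule e'[OF t], rule V_t(1)[OF tt(2)])
  moreover have "(kp V2 e x has_real_derivative kp V2 e' x t + kp V4 e x t) (at t within {0..T})"
   by (rule kpart_t, fact t(1), fact tt(1), rule e[OF t], rule V_t(2)[OF tt(2)])
  ultimately show "((\<lambda>t. kp V e' x t + kp V2 e x t) has_real_derivative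
    (kp V e'' x t + kp V2 e' x t) + (kp V2 e' x t + kp V4 e x t)) (at t within {0..T})"
   by (rule DERIV_add)
  show "((\<lambda>x. kp V e x t) has_real_derivative 1 * (\<theta> / sqrt eps) * kp V1 e x t) (at x)"
   using kpart_x[where V=V and V'=V1, OF t(1) V_x(1)[OF tt(2)], of 1 e \<theta> eps p x] by simp
  show "((\<lambda>x. 1 * (\<theta> / sqrt eps) * kp V1 e x t) has_real_derivative 1 / eps * kp V2 e x t) (at x)"
   using kpart_x[where V=V1 and V'=V2, OF t(1) V_x(2)[OF tt(2)], of "\<theta> / sqrt eps" e \<theta> eps p x]
   unfolding th2 by simp
  show "((\<lambda>x. 1 / eps * kp V2 e x t) has_real_derivative 1 / eps * (\<theta> / sqrt eps) * kp V3 e x t) (at x)"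
   by (rule kpart_x[where V=V2 and V'=V3, OF t(1) V_x(3)[OF tt(2)]])
  have "1 / eps * (\<theta> / sqrt eps) * (\<theta> / sqrt eps) = 1 / eps^2"
   unfolding mult.assoc th2 by (simp add: power2_eq_square)
  then show "((\<lambda>x. 1 / eps * (\<theta> / sqrt eps) * kp V3 e x t) has_real_derivative 1 / eps^2 * kp V4 e x t) (at x)"
   using kpart_x[where V=V3 and V'=V4, OF t(1) V_x(4)[OF tt(2)], of "1 / eps * (\<theta> / sqrt eps)" e \<theta> eps p x] by simp
  assume x: "0 <= x" "x <= 1"
  define xi where "xi = \<theta> * (x - p) / sqrt eps"
  have ax: "abs xi = abs (x - p) / sqrt eps" using \<theta> eps by (auto simp: xi_def abs_mult)
  have kp: "kp W f x t = f t * W xi (t - d)" for W f using t by (simp add: kpart_def xi_def)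
  note B1 = bounds[OF D[OF x] t, folded xi_def]
  note B2 = conjunct2[OF B1] note B3 = conjunct2[OF B2] note B4 = conjunct2[OF B3] note B5 = conjunct2[OF B4]
  note B6 = conjunct2[OF B5] note B7 = conjunct2[OF B6] note B8 = conjunct2[OF B7]
  note B1 = conjunct1[OF B1] and B2 = conjunct1[OF B2] and B3 = conjunct1[OF B3] and B4 = conjunct1[OF B4]
   and B5 = conjunct1[OF B5] and B6 = conjunct1[OF B6] and B7 = conjunct1[OF B7]
  have L1: "C * exp (- (m * abs xi)) <= C" using m C by (intro mult_left_le) auto
  show "abs (kp V e x t) <= 4 * C * (t - d)" unfolding kp using B1 C4[of "t - d"] t by linarith
  show "abs (kp V e' x t + kp V2 e x t) <= 4 * C" unfolding kp using B2 B6 L1 C by linarith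
  have "4 * C / (t - d) = C / (t - d) + C / (t - d) + C / (t - d) + C / (t - d)" by simp
  then show "abs ((kp V e'' x t + kp V2 e' x t) + (kp V2 e' x t + kp V4 e x t)) <= 4 * C / (t - d)"
   unfolding kp using B3 B4 B5 by linarith
  have L4: "C * exp (- (m * abs xi)) <= 4 * C * exp (- (m * abs xi))" by (rule C4) simp
  have "eps * abs (1 / eps * kp V2 e x t) = abs (e t * V2 xi (t - d))" unfolding kp using eps by (simp add: abs_mult)
  then show "eps * abs (1 / eps * kp V2 e x t) <= 4 * C * exp (- (m * (abs (x - p) / sqrt eps)))"
   using B6 L4 unfolding ax[symmetric] by linarith
  have "eps * (abs (x - p) * abs (1 / eps * (\<theta> / sqrt eps) * kp V3 e x t)) = abs xi * abs (e t * V3 xi (t - d))"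
   unfolding kp ax using eps \<theta> by (auto simp: abs_mult)
  then show "eps * (abs (x - p) * abs (1 / eps * (\<theta> / sqrt eps) * kp V3 e x t)) <= 4 * C * exp (- (m * (abs (x - p) / sqrt eps)))"
   using B7 L4 unfolding ax[symmetric] by linarith
  have "eps^2 * abs (1 / eps^2 * kp V4 e x t) = abs (e t * V4 xi (t - d))" unfolding kp using eps by (simp add: abs_mult)
  moreover have "C / (t - d) <= 4 * C / (t - d)" using C t by (intro divide_right_mono) auto
  ultimately show "eps^2 * abs (1 / eps^2 * kp V4 e x t) <= 4 * C / (t - d)" using B5 by linarith
  assume xp: "x \<noteq> p"
  have "sgn xi = \<theta> * sgn (x - p)" "xi \<noteq> 0" using \<theta> eps xp by (auto simp: xi_def sgn_mult sgn_divide)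
  then have "abs (kp V e x t - a t * \<theta> * sgn (x - p)) <= C * exp (- (m * abs xi))"
   using B8 unfolding kp by (simp add: mult.assoc)
  then show "abs (kp V e x t - a t * \<theta> * sgn (x - p)) <= 4 * C * exp (- (m * (abs (x - p) / sqrt eps)))"
   using L4 unfolding ax[symmetric] by linarith
 }
 show "kp V e x t = 0 \<and> kp V e' x t + kp V2 e x t = 0 \<and> 1 / eps * kp V2 e x t = 0" if "t <= d" for x t
  using that by (simp add: kpart_def)
qed (use T eps m C d in auto)

end

text \<open>The derivatives \<open>km2\<close> and \<open>km4\<close> are as large as
  \<open>1 / \<tau>\<close> and \<open>1 / \<tau>^2\<close>, with \<open>\<tau>\<close> the time
  since \<open>d\<close>. Quadratic vanishing of the coefficient compensates exactly this; the limit
  values beside the layer are the coefficient and its negative.\<close>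

lemma erf_heat_layer:
 assumes T: "0 < T" and eps: "0 < eps" "eps <= 1" and m: "0 < m" and B: "0 <= B" and d: "0 <= d"
  and e: "\<And>t. d < t ==> t <= T ==> (e has_real_derivative e' t) (at t within {0..T})"
  and e': "\<And>t. d < t ==> t <= T ==> (e' has_real_derivative e'' t) (at t within {0..T})"
  and b: "\<And>t. d < t ==> t <= T ==> abs (e t) <= B * (t - d)^2 \<and> abs (e' t) <= B * (t - d) \<and> abs (e'' t) <= B"
 shows "heat_layer T eps m (B * kc m T * (1 + T)^2) p d 1 e e' e'' e k0 gk km2 km3 km4 UNIV"
proof
 fix xi t :: real assume t: "d < t" "t <= T"
 define \<tau> where "\<tau> = t - d"
 define k where "k = kc m T"
 define L where "L = exp (- (m * abs xi))"
 have tau: "0 < \<tau>" "\<tau> <= T" using t d by (auto simp: \<tau>_def)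
 have k1: "1 <= k" by (simp add: k_def kc_1)
 have L: "0 < L" "L <= 1" using m by (auto simp: L_def)
 let ?C = "B * k * (1 + T)^2"
 note b' = b[OF t, folded \<tau>_def]
 have T2: "1 <= (1 + T)^2" "T <= (1 + T)^2" "T^2 <= (1 + T)^2" using T by (auto simp: power2_eq_square algebra_simps)
 have s1: "B * 1 * s <= ?C" if "s <= (1 + T)^2" "0 <= s" for s using that B k1 by (intro mult_mono) auto
 have s2: "B * k * s <= ?C" if "s <= (1 + T)^2" for s using that B k1 by (intro mult_left_mono) auto
 have tau2: "\<tau>^2 <= T * \<tau>" "\<tau>^2 <= T^2" using tau by (auto simp: power2_eq_square intro: mult_right_mono mult_mono)
 have v0: "abs (k0 xi \<tau>) <= 1" by (rule k0_abs_le)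
 note v2 = km2_le[OF less_imp_le[OF m] tau, of xi, folded k_def L_def]
 note v3 = xi_km3_le[OF less_imp_le[OF m] tau, of xi, folded k_def L_def]
 note v4 = km4_le[OF less_imp_le[OF m] tau, of xi, folded k_def L_def]
 have "abs (e t * k0 xi \<tau>) <= ?C * \<tau>"
 proof -
  have "abs (e t * k0 xi \<tau>) <= (B * \<tau>^2) * 1" unfolding abs_mult using b' v0 B by (intro mult_mono) auto
  also have "\<dots> <= B * (T * \<tau>)" using tau2 B by (simp add: mult_left_mono)
  also have "\<dots> = B * 1 * T * \<tau>" by simp
  also have "\<dots> <= ?C * \<tau>" using s1[of T] T2 T tau by (intro mult_right_mono) auto
  finally show ?thesis .
 qed
 moreover have "abs (e' t * k0 xi \<tau>) <= ?C"
 proof -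
  have "abs (e' t * k0 xi \<tau>) <= (B * \<tau>) * 1" unfolding abs_mult using b' v0 B tau by (intro mult_mono) auto
  also have "\<dots> <= B * 1 * T" using tau B by (simp add: mult_left_mono)
  also have "\<dots> <= ?C" using s1[of T] T2 T by simp
  finally show ?thesis .
 qed
 moreover have "abs (e'' t * k0 xi \<tau>) <= ?C / \<tau>"
 proof -
  have "abs (e'' t * k0 xi \<tau>) * \<tau> <= (B * 1) * T" unfolding abs_mult using b' v0 B tau by (intro mult_mono) auto
  also have "\<dots> <= ?C" using s1[of T] T2 T by simp
  finally show ?thesis using tau by (simp add: pos_le_divide_eq)
 qed
 moreover have "abs (e' t * km2 xi \<tau>) <= ?C / \<tau>"
 proof -
  have "abs (e' t * km2 xi \<tau>) * \<tau> <= ((B * \<tau>) * (k / \<tau> * L)) * T"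
   unfolding abs_mult using b' v2 B tau k1 L by (intro mult_mono) auto
  also have "\<dots> = B * k * T * L" using tau by simp
  also have "\<dots> <= B * k * T * 1" using L B k1 T by (intro mult_left_mono) auto
  also have "\<dots> <= ?C" using s2[of T] T2 by simp
  finally show ?thesis using tau by (simp add: pos_le_divide_eq)
 qed
 moreover have "abs (e t * km4 xi \<tau>) <= ?C / \<tau>"
 proof -
  have "abs (e t * km4 xi \<tau>) * \<tau> <= ((B * \<tau>^2) * (k / \<tau>^2 * L)) * T"
   unfolding abs_mult using b' v4 B tau k1 L by (intro mult_mono) auto
  also have "\<dots> = B * k * T * L" using tau by simp
  also have "\<dots> <= B * k * T * 1" using L B k1 T by (intro mult_left_mono) auto
  also have "\<dots> <= ?C" using s2[of T] T2 by simp
  finally show ?thesis using tau by (simp add: pos_le_divide_eq)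
 qed
 moreover have "abs (e t * km2 xi \<tau>) <= ?C * L"
 proof -
  have "abs (e t * km2 xi \<tau>) <= (B * (T * \<tau>)) * (k / \<tau> * L)"
   unfolding abs_mult
  proof (rule mult_mono)
   show "abs (e t) <= B * (T * \<tau>)" using b' mult_left_mono[OF tau2(1) B] by linarith
  qed (use v2 B T tau k1 L in auto)
  also have "\<dots> = (B * k * T) * L" using tau by simp
  also have "\<dots> <= ?C * L" using s2[of T] T2 L by (intro mult_right_mono) auto
  finally show ?thesis .
 qed
 moreover have "abs xi * abs (e t * km3 xi \<tau>) <= ?C * L"
 proof -
  have "abs xi * abs (e t * km3 xi \<tau>) = abs (e t) * (abs xi * abs (km3 xi \<tau>))" by (simp add: abs_mult)
  also have "\<dots> <= (B * (T * \<tau>)) * (k / \<tau> * L)"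
  proof (rule mult_mono)
   show "abs (e t) <= B * (T * \<tau>)" using b' mult_left_mono[OF tau2(1) B] by linarith
  qed (use v3 B T tau k1 L in auto)
  also have "\<dots> = (B * k * T) * L" using tau by simp
  also have "\<dots> <= ?C * L" using s2[of T] T2 L by (intro mult_right_mono) auto
  finally show ?thesis .
 qed
 moreover have "abs (e t * k0 xi \<tau> - e t * sgn xi) <= ?C * L" if "xi \<noteq> 0"
 proof -
  have "abs (e t * k0 xi \<tau> - e t * sgn xi) = abs (e t) * abs (k0 xi \<tau> - sgn xi)"
   by (simp add: abs_mult[symmetric] right_diff_distrib)
  also have "\<dots> <= (B * T^2) * (k * L)"
  proof (rule mult_mono)
   show "abs (e t) <= B * T^2" using b' mult_left_mono[OF tau2(2) B] by linarith
   show "abs (k0 xi \<tau> - sgn xi) <= k * L"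
    using sgn_k0_le[OF less_imp_le[OF m] tau that] by (simp add: k_def L_def)
  qed (use B in auto)
  also have "\<dots> = (B * k * T^2) * L" by simp
  also have "\<dots> <= ?C * L" using s2[of "T^2"] T2 L by (intro mult_right_mono) auto
  finally show ?thesis .
 qed
 ultimately show "abs (e t * k0 xi (t - d)) <= B * kc m T * (1 + T)^2 * (t - d) \<and> abs (e' t * k0 xi (t - d)) <= B * kc m T * (1 + T)^2 \<and>
    abs (e'' t * k0 xi (t - d)) <= B * kc m T * (1 + T)^2 / (t - d) \<and> abs (e' t * km2 xi (t - d)) <= B * kc m T * (1 + T)^2 / (t - d) \<and>
    abs (e t * km4 xi (t - d)) <= B * kc m T * (1 + T)^2 / (t - d) \<and>
    abs (e t * km2 xi (t - d)) <= B * kc m T * (1 + T)^2 * exp (- (m * abs xi)) \<and>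
    abs xi * abs (e t * km3 xi (t - d)) <= B * kc m T * (1 + T)^2 * exp (- (m * abs xi)) \<and>
    (xi \<noteq> 0 \<longrightarrow> abs (e t * k0 xi (t - d) - e t * sgn xi) <= B * kc m T * (1 + T)^2 * exp (- (m * abs xi)))"
  unfolding \<tau>_def k_def L_def by blast
next
 show "0 <= B * kc m T * (1 + T)^2" using B kc_1[of m T] by simp
qed (use T eps m d e e' in \<open>auto intro: kernel_deriv_space kernel_deriv_time\<close>)

lemma rk_deriv:
 assumes t: "0 < t"
 shows "((\<lambda>xi. rk xi t) has_real_derivative xi - k1 xi t) (at xi)"
  and "((\<lambda>xi. xi - k1 xi t) has_real_derivative 1 - k0 xi t) (at xi)"
  and "((\<lambda>xi. 1 - k0 xi t) has_real_derivative - gk xi t) (at xi)"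
  and "((\<lambda>xi. - gk xi t) has_real_derivative - km2 xi t) (at xi)"
  and "((\<lambda>t. rk xi t) has_real_derivative 1 - k0 xi t) (at t within S)"
  and "((\<lambda>t. 1 - k0 xi t) has_real_derivative - km2 xi t) (at t within S)"
 using kernel_deriv_space[OF t] kernel_deriv_time[OF t] unfolding rk_def
 by (auto intro!: derivative_eq_intros)

text \<open>Here the kernel itself is \<open>O(\<tau>)\<close> with a bounded first time derivative,
  so a bounded coefficient suffices. Its second time derivative \<open>- km2\<close> has precisely
  the admissible size \<open>1 / \<tau>\<close>, and its limit value away from the pole is
  0.\<close>

lemma rk_heat_layer:
 assumes T: "0 < T" and eps: "0 < eps" "eps <= 1" and m: "0 < m" and B: "0 <= B" and d: "0 <= d"
  and e: "\<And>t. d < t ==> t <= T ==> (e has_real_derivative e' t) (at t within {0..T})"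
  and e': "\<And>t. d < t ==> t <= T ==> (e' has_real_derivative e'' t) (at t within {0..T})"
  and b: "\<And>t. d < t ==> t <= T ==> abs (e t) <= B \<and> abs (e' t) <= B \<and> abs (e'' t) <= B"
 shows "heat_layer T eps m (B * kc m T * (1 + T)^2) 1 d (-1) e e' e'' (\<lambda>t. 0) rk (\<lambda>xi t. xi - k1 xi t)
   (\<lambda>xi t. 1 - k0 xi t) (\<lambda>xi t. - gk xi t) (\<lambda>xi t. - km2 xi t) {0..}"
proof
 fix xi t :: real assume xi: "xi \<in> {0..}" and t: "d < t" "t <= T"
 define \<tau> where "\<tau> = t - d"
 define k where "k = kc m T"
 define L where "L = exp (- (m * abs xi))"
 have tau: "0 < \<tau>" "\<tau> <= T" using t d by (auto simp: \<tau>_def)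
 have k1: "1 <= k" by (simp add: k_def kc_1)
 have L: "0 < L" "L <= 1" using m by (auto simp: L_def)
 have x0: "0 <= xi" using xi by simp
 let ?C = "B * k * (1 + T)^2"
 note b' = b[OF t, folded \<tau>_def]
 have T2: "1 <= (1 + T)^2" "T <= (1 + T)^2" "T^2 <= (1 + T)^2" using T by (auto simp: power2_eq_square algebra_simps)
 have s2: "B * k * s <= ?C" if "s <= (1 + T)^2" for s using that B k1 by (intro mult_left_mono) auto
 have v: "abs (rk xi \<tau>) <= k * \<tau> * L" using rk_le[OF less_imp_le[OF m] tau x0] by (simp add: k_def L_def)
 have v1: "abs (rk xi \<tau>) <= k * \<tau>" using order_trans[OF v mult_left_le[of L "k * \<tau>"]] L k1 tau by simp
 have v': "k * \<tau> <= k * T" using tau k1 by simp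
 have v2: "abs (1 - k0 xi \<tau>) <= k * L"
 proof (cases "xi = 0")
  case True then show ?thesis using k1 by (simp add: k0_def L_def)
 next
  case False
  then show ?thesis using sgn_k0_le[OF less_imp_le[OF m] tau, of xi] x0 by (simp add: k_def L_def abs_minus_commute)
 qed
 have v3: "abs xi * abs (- gk xi \<tau>) <= k * L"
 proof -
  have "abs xi ^ 1 * gk xi \<tau> <= k / 2 * (sqrt \<tau> ^ 1 / sqrt \<tau>) * L"
   using gk_le[OF less_imp_le[OF m] tau, of 1 xi] by (simp add: k_def L_def)
  also have "\<dots> <= k * L" using tau k1 L by simp
  finally show ?thesis using gk_pos[OF tau(1), of xi] by simp
 qed
 note v4 = km2_le[OF less_imp_le[OF m] tau, of xi, folded k_def L_def]
 have BT: "B * (k * T) <= ?C" using s2[of T] T2 by (simp add: mult.assoc)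
 have "abs (e t * rk xi \<tau>) <= ?C * \<tau>"
 proof -
  have "abs (e t * rk xi \<tau>) <= B * (k * \<tau>)" unfolding abs_mult using b' v1 B by (intro mult_mono) auto
  also have "\<dots> = B * k * 1 * \<tau>" by simp
  also have "\<dots> <= ?C * \<tau>" using s2[of 1] T2 tau by (intro mult_right_mono) auto
  finally show ?thesis .
 qed
 moreover have "abs (e' t * rk xi \<tau>) <= ?C"
 proof -
  have "abs (e' t * rk xi \<tau>) <= B * (k * T)" unfolding abs_mult using b' order_trans[OF v1 v'] B by (intro mult_mono) auto
  then show ?thesis using BT by linarith
 qed
 moreover have "abs (e'' t * rk xi \<tau>) <= ?C / \<tau>"
 proof -
  have "abs (e'' t * rk xi \<tau>) * \<tau> <= (B * (k * T)) * T" unfolding abs_mult using b' order_trans[OF v1 v'] B tau k1 T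
   by (intro mult_mono) auto
  also have "\<dots> = B * k * T^2" by (simp add: power2_eq_square)
  also have "\<dots> <= ?C" using s2[of "T^2"] T2 by simp
  finally show ?thesis using tau by (simp add: pos_le_divide_eq)
 qed
 moreover have "abs (e' t * (1 - k0 xi \<tau>)) <= ?C / \<tau>"
 proof -
  have "abs (e' t * (1 - k0 xi \<tau>)) * \<tau> <= (B * (k * 1)) * T" unfolding abs_mult
  proof (intro mult_mono)
   show "abs (1 - k0 xi \<tau>) <= k * 1" using order_trans[OF v2 mult_left_mono[OF L(2), of k]] k1 by simp
  qed (use b' B tau k1 in auto)
  also have "\<dots> <= ?C" using BT by simp
  finally show ?thesis using tau by (simp add: pos_le_divide_eq)
 qed
 moreover have "abs (e t * - km2 xi \<tau>) <= ?C / \<tau>"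
 proof -
  have "abs (e t * - km2 xi \<tau>) <= B * (k / \<tau> * 1)" unfolding abs_mult
  proof (intro mult_mono)
   have "k / \<tau> * L <= k / \<tau> * 1" using L k1 tau by (intro mult_left_mono) auto
   then show "abs (- km2 xi \<tau>) <= k / \<tau> * 1" using v4 by simp
  qed (use b' B tau k1 in auto)
  also have "\<dots> = (B * k * 1) / \<tau>" by simp
  also have "\<dots> <= ?C / \<tau>" using s2[of 1] T2 tau by (intro divide_right_mono) auto
  finally show ?thesis .
 qed
 moreover have "abs (e t * (1 - k0 xi \<tau>)) <= ?C * L"
 proof -
  have "abs (e t * (1 - k0 xi \<tau>)) <= B * (k * L)" unfolding abs_mult using b' v2 B by (intro mult_mono) auto
  also have "\<dots> = B * k * 1 * L" by simp
  also have "\<dots> <= ?C * L" using s2[of 1] T2 L by (intro mult_right_mono) auto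
  finally show ?thesis .
 qed
 moreover have "abs xi * abs (e t * - gk xi \<tau>) <= ?C * L"
 proof -
  have "abs xi * abs (e t * - gk xi \<tau>) = abs (e t) * (abs xi * abs (- gk xi \<tau>))" by (simp add: abs_mult)
  also have "\<dots> <= B * (k * L)" using b' v3 B by (intro mult_mono[OF _ v3]) auto
  also have "\<dots> = B * k * 1 * L" by simp
  also have "\<dots> <= ?C * L" using s2[of 1] T2 L by (intro mult_right_mono) auto
  finally show ?thesis .
 qed
 moreover have "abs (e t * rk xi \<tau> - 0 * sgn xi) <= ?C * L"
 proof -
  have "abs (e t * rk xi \<tau>) <= B * (k * T * L)" unfolding abs_mult
  proof (intro mult_mono)
   show "abs (rk xi \<tau>) <= k * T * L" using v mult_right_mono[OF v', of L] L by simp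
  qed (use b' B in auto)
  also have "\<dots> = B * k * T * L" by simp
  also have "\<dots> <= ?C * L" using s2[of T] T2 L by (intro mult_right_mono) auto
  finally show ?thesis by simp
 qed
 ultimately show "abs (e t * rk xi (t - d)) <= B * kc m T * (1 + T)^2 * (t - d) \<and> abs (e' t * rk xi (t - d)) <= B * kc m T * (1 + T)^2 \<and>
    abs (e'' t * rk xi (t - d)) <= B * kc m T * (1 + T)^2 / (t - d) \<and> abs (e' t * (1 - k0 xi (t - d))) <= B * kc m T * (1 + T)^2 / (t - d) \<and>
    abs (e t * - km2 xi (t - d)) <= B * kc m T * (1 + T)^2 / (t - d) \<and>
    abs (e t * (1 - k0 xi (t - d))) <= B * kc m T * (1 + T)^2 * exp (- (m * abs xi)) \<and>
    abs xi * abs (e t * - gk xi (t - d)) <= B * kc m T * (1 + T)^2 * exp (- (m * abs xi)) \<and>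
    (xi \<noteq> 0 \<longrightarrow> abs (e t * rk xi (t - d) - 0 * sgn xi) <= B * kc m T * (1 + T)^2 * exp (- (m * abs xi)))"
  unfolding \<tau>_def k_def L_def by blast
next
 show "0 <= B * kc m T * (1 + T)^2" using B kc_1[of m T] by simp
 show "- 1 * (x - 1) / sqrt eps \<in> {0..}" if "0 <= x" "x <= 1" for x using that eps by simp
qed (use T eps m d e e' in \<open>auto intro: rk_deriv\<close>)

section \<open>The cubic singular function\<close>

text \<open>The factor \<open>eps * sqrt eps\<close> is the cube of the length scale and undoes the
  scaling of the argument, so the initial value \<open>abs (x - p)^3 / 6\<close> does not involve
  \<open>eps\<close>. Its third derivative jumps by 2 at \<open>p\<close>.\<close>

definition cubic :: "(real => real) => real => real => real => real => real" where
 "cubic e eps p x t = (if t <= 0 then (abs (x - p))^3 / 6 else eps * sqrt eps * (e t * k3 ((x - p) / sqrt eps) t))"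

lemma cubic_kpart: "0 < t ==> cubic e eps p x t = eps * sqrt eps * kpart k3 e 1 eps p 0 x t"
 by (simp add: cubic_def kpart_def)

text \<open>This function does not vanish initially and is not an instance of \<open>layer\<close>.
  Its space derivatives up to the third are bounded uniformly in \<open>eps\<close>, so the decay
  parameters play no part in its estimates.\<close>

locale cubic_part =
 fixes T eps B p :: real and e e' e'' :: "real => real"
 assumes T: "0 < T" and eps: "0 < eps" "eps <= 1" and B: "1 <= B" and p: "0 <= p" "p <= 1"
  and e: "\<And>t. 0 <= t ==> t <= T ==> (e has_real_derivative e' t) (at t within {0..T})"
  and e': "\<And>t. 0 <= t ==> t <= T ==> (e' has_real_derivative e'' t) (at t within {0..T})"
  and b: "\<And>t. 0 <= t ==> t <= T ==> abs (e t) <= B \<and> abs (e' t) <= B \<and> abs (e'' t) <= B"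
  and e0: "e 0 = 1"
begin

abbreviation "kq \<equiv> \<lambda>V e. kpart V e 1 eps p 0"

definition "Ut x t = eps * sqrt eps * (kq k3 e' x t + kq k1 e x t)"
definition "Utt x t = eps * sqrt eps * ((kq k3 e'' x t + kq k1 e' x t) + (kq k1 e' x t + kq gk e x t))"
definition "U1 x t = eps * kq k2 e x t"
definition "U2 x t = sqrt eps * kq k1 e x t"
definition "U3 x t = kq k0 e x t"
definition "U4 x t = 1 / sqrt eps * kq gk e x t"

lemma cubic_der:
 assumes t: "0 < t" "t <= T"
 shows "(cubic e eps p x has_real_derivative Ut x t) (at t within {0..T})"
  and "(Ut x has_real_derivative Utt x t) (at t within {0..T})"
  and "((\<lambda>x. cubic e eps p x t) has_real_derivative U1 x t) (at x)"
  and "((\<lambda>x. U1 x t) has_real_derivative U2 x t) (at x)"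
  and "((\<lambda>x. U2 x t) has_real_derivative U3 x t) (at x)"
  and "((\<lambda>x. U3 x t) has_real_derivative U4 x t) (at x)"
proof -
 have tt: "t \<in> {0..T}" "0 <= t" "0 < t - 0" using t by auto
 note kt = kernel_deriv_time[OF tt(3)]
 have 1: "(kq k3 e x has_real_derivative kq k3 e' x t + kq k1 e x t) (at t within {0..T})"
  by (rule kpart_t, fact t(1), fact tt(1), rule e[OF tt(2) t(2)], rule kt)
 have 2: "(kq k3 e' x has_real_derivative kq k3 e'' x t + kq k1 e' x t) (at t within {0..T})"
  by (rule kpart_t, fact t(1), fact tt(1), rule e'[OF tt(2) t(2)], rule kt)
 have 3: "(kq k1 e x has_real_derivative kq k1 e' x t + kq gk e x t) (at t within {0..T})"
  by (rule kpart_t, fact t(1), fact tt(1), rule e[OF tt(2) t(2)], rule kt)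
 show "(cubic e eps p x has_real_derivative Ut x t) (at t within {0..T})"
 proof (rule has_field_derivative_transform_within[OF _ t(1) tt(1)])
  show "((\<lambda>t. eps * sqrt eps * kq k3 e x t) has_real_derivative Ut x t) (at t within {0..T})"
   unfolding Ut_def by (rule DERIV_cmult[OF 1])
  show "eps * sqrt eps * kq k3 e x s = cubic e eps p x s" if "dist s t < t" for s
   using that by (subst cubic_kpart) (auto simp: dist_real_def)
 qed
 show "(Ut x has_real_derivative Utt x t) (at t within {0..T})"
  unfolding Ut_def[abs_def] Utt_def by (rule DERIV_cmult[OF DERIV_add[OF 2 3]])
 have s: "sqrt eps * (1 / sqrt eps) = 1" "eps * sqrt eps * (1 / sqrt eps) = eps" "eps * (1 / sqrt eps) = sqrt eps"
  using eps real_div_sqrt[of eps] by auto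
 note kx = kernel_deriv_space[OF tt(3)]
 show "((\<lambda>x. cubic e eps p x t) has_real_derivative U1 x t) (at x)"
  using kpart_x[where V=k3 and V'=k2, OF t(1) kx(7), of "eps * sqrt eps" e 1 eps p x]
  unfolding cubic_kpart[OF t(1)] U1_def s .
 show "((\<lambda>x. U1 x t) has_real_derivative U2 x t) (at x)"
  using kpart_x[where V=k2 and V'=k1, OF t(1) kx(6), of "eps" e 1 eps p x]
  unfolding U1_def U2_def s .
 show "((\<lambda>x. U2 x t) has_real_derivative U3 x t) (at x)"
  using kpart_x[where V=k1 and V'=k0, OF t(1) kx(5), of "sqrt eps" e 1 eps p x]
  unfolding U2_def U3_def s by simp
 show "((\<lambda>x. U3 x t) has_real_derivative U4 x t) (at x)"
  using kpart_x[where V=k0 and V'=gk, OF t(1) kx(4), of 1 e 1 eps p x]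
  unfolding U3_def U4_def by simp
qed

definition "M = 1 + 4 * (kc 0 T * sqrt T)"

lemma M_ge: "1 <= M" "kc 0 T * sqrt T <= M" "2 * (kc 0 T * sqrt T) + 1 <= M" "0 <= kc 0 T * sqrt T"
 using kc_1[of 0 T] T mult_nonneg_nonneg[of "kc 0 T" "sqrt T"] by (auto simp: M_def)

context
 fixes x t :: real
 assumes x: "0 <= x" "x <= 1" and t: "0 < t" "t <= T"
begin

lemma xp: "abs (x - p) <= 1" using x p by auto

lemma ct: "kc 0 T * sqrt t <= kc 0 T * sqrt T"
 using t kc_1[of 0 T] by (intro mult_left_mono) auto

lemma scaled_k1: "sqrt eps * abs (k1 ((x - p) / sqrt eps) t) <= M"
proof -
 have "sqrt eps * abs (k1 ((x - p) / sqrt eps) t) <= sqrt eps * (abs ((x - p) / sqrt eps) + 2 * kc 0 T * sqrt t)"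
  by (rule mult_left_mono[OF k1_le[of 0 t T]]) (use t eps in auto)
 also have "\<dots> = abs (x - p) + sqrt eps * (2 * (kc 0 T * sqrt t))" using eps by (simp add: abs_divide algebra_simps)
 also have "\<dots> <= 1 + 1 * (2 * (kc 0 T * sqrt T))"
  using xp ct eps t kc_1[of 0 T] by (intro add_mono mult_mono) auto
 also have "\<dots> <= M" using M_ge by linarith
 finally show ?thesis .
qed

lemma scaled_k3: "abs (eps * sqrt eps * k3 ((x - p) / sqrt eps) t - abs (x - p)^3 / 6) <= M * t"
 "abs (eps * sqrt eps * k3 ((x - p) / sqrt eps) t) <= 1 + M * T"
proof -
 let ?xi = "(x - p) / sqrt eps"
 have e: "eps * sqrt eps * (abs (?xi)^3 / 6) = abs (x - p)^3 / 6" "eps * sqrt eps * abs (?xi) = eps * abs (x - p)"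
  using eps by (simp_all add: abs_divide power_divide power3_eq_cube)
 have "eps * sqrt eps * abs (k3 ?xi t - abs (?xi)^3 / 6) <= eps * sqrt eps * (t * abs (?xi) + 4 * (kc 0 T * (t * sqrt t)))"
  by (rule mult_left_mono[OF k3_le[of 0 t T]]) (use t eps in auto)
 also have "\<dots> = t * (eps * sqrt eps * abs (?xi) + eps * sqrt eps * (4 * (kc 0 T * sqrt t)))" by (simp add: algebra_simps)
 also have "\<dots> <= t * (1 * 1 + 1 * 1 * (4 * (kc 0 T * sqrt T)))"
  unfolding e using xp ct eps t kc_1[of 0 T] by (intro mult_left_mono add_mono mult_mono) auto
 also have "\<dots> = M * t" by (simp add: M_def)
 finally have 1: "eps * sqrt eps * abs (k3 ?xi t - abs (?xi)^3 / 6) <= M * t" .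
 have "eps * sqrt eps * k3 ?xi t - abs (x - p)^3 / 6 = eps * sqrt eps * (k3 ?xi t - abs (?xi)^3 / 6)"
  unfolding right_diff_distrib[of "eps * sqrt eps" "k3 ?xi t"] e ..
 then show 2: "abs (eps * sqrt eps * k3 ?xi t - abs (x - p)^3 / 6) <= M * t"
  using 1 eps by (simp only: abs_mult) simp
 have "abs (x - p)^3 <= 1" using xp by (simp add: power_le_one)
 moreover have "M * t <= M * T" using t M_ge by (intro mult_left_mono) auto
 moreover have "0 <= abs (x - p)^3" by simp
 ultimately show "abs (eps * sqrt eps * k3 ?xi t) <= 1 + M * T" using 2 by linarith
qed

lemma scaled_gk: "sqrt eps * gk xi t <= M / t"
proof -
 have "t * gk xi t <= M" using t_gk_le[of 0 t T xi] t ct M_ge by linarith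
 then have "gk xi t <= M / t" using t by (simp add: field_simps)
 then have "sqrt eps * gk xi t <= 1 * (M / t)" using eps gk_pos[OF t(1), of xi] by (intro mult_mono) auto
 then show ?thesis by simp
qed

end

definition "C = 8 * B * M * (1 + T)^2"

lemma C_ge: "B * M + B <= C" "B * (1 + M * T) + B * M <= C" "(B * (1 + M * T) + 2 * (B * M)) * T + B * M <= C"
 "4 * (B * M) <= C" "2 * B <= C" "0 <= C"
proof -
 have BM: "B <= B * M" "0 <= B * M" using B M_ge by auto
 have c: "C = 8 * (B * M) + 16 * (B * M * T) + 8 * (B * M * T * T)"
  by (simp add: C_def power2_eq_square algebra_simps)
 have n: "0 <= B * M * T" "0 <= B * M * T * T" "B * T <= B * M * T" using BM T by (auto intro: mult_right_mono)
 show "B * M + B <= C" "4 * (B * M) <= C" "2 * B <= C" "0 <= C" using BM n B unfolding c by linarith+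
 have "B * (1 + M * T) = B + B * M * T" by (simp add: algebra_simps)
 then show "B * (1 + M * T) + B * M <= C" using BM n unfolding c by linarith
 have "(B * (1 + M * T) + 2 * (B * M)) * T + B * M = B * T + B * M * T * T + 2 * (B * M * T) + B * M"
  by (simp add: algebra_simps)
 then show "(B * (1 + M * T) + 2 * (B * M)) * T + B * M <= C" using BM n unfolding c by linarith
qed

lemma cubic_time:
 assumes x: "0 <= x" "x <= 1"
 shows "s \<in> {0..T} ==> t \<in> {0..T} ==> abs (cubic e eps p x t - cubic e eps p x s) <= C * abs (t - s)"
  and "0 < k ==> k <= t ==> t <= T ==>
   abs ((cubic e eps p x t - cubic e eps p x (t - k)) / k - Ut x t) <= 6 * C * k * (1 + weight k 0 t)"
proof -
 let ?xi = "(x - p) / sqrt eps"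
 have st: "abs (cubic e eps p x t - abs (x - p)^3 / 6) <= C * (t - 0)" if t: "0 < t" "t <= T" for t
 proof -
  have "abs (e t - e 0) <= B * abs (t - 0)"
   by (rule abs_diff_le_of_derivative[where s=0 and t=t and S="{0..T}", OF e]) (use t b in auto)
  then have 1: "abs ((e t - 1) * (abs (x - p)^3 / 6)) <= (B * t) * 1"
   unfolding abs_mult e0 using t B power_le_one[of "abs (x - p)" 3] xp[OF x] by (intro mult_mono) auto
  have 2: "abs (e t * (eps * sqrt eps * k3 ?xi t - abs (x - p)^3 / 6)) <= B * (M * t)"
   unfolding abs_mult using b[of t] scaled_k3(1)[OF x t] t B by (intro mult_mono) (auto simp: abs_mult)
  have "cubic e eps p x t - abs (x - p)^3 / 6 = e t * (eps * sqrt eps * k3 ?xi t - abs (x - p)^3 / 6) + (e t - 1) * (abs (x - p)^3 / 6)"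
   using t by (simp add: cubic_def field_simps)
  then have "abs (cubic e eps p x t - abs (x - p)^3 / 6) <= B * (M * t) + (B * t) * 1" using 1 2 by linarith
  also have "\<dots> = (B * M + B) * t" by (simp add: algebra_simps)
  also have "\<dots> <= C * t" using C_ge t by (intro mult_right_mono) auto
  finally show ?thesis by simp
 qed
 have m1: "abs (eps * sqrt eps * kq k3 f x t) <= B * (1 + M * T)" if t: "0 < t" "t <= T" "abs (f t) <= B" for f t
 proof -
  have "abs (eps * sqrt eps * kq k3 f x t) = abs (f t) * abs (eps * sqrt eps * k3 ?xi t)" using t by (simp add: kpart_def abs_mult)
  also have "\<dots> <= B * (1 + M * T)" using t(3) scaled_k3(2)[OF x t(1,2)] B by (intro mult_mono) auto
  finally show ?thesis .
 qed
 have m2: "abs (eps * sqrt eps * kq k1 f x t) <= B * M" if t: "0 < t" "t <= T" "abs (f t) <= B" for f t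
 proof -
  have "abs (eps * sqrt eps * kq k1 f x t) = abs (f t) * (eps * (sqrt eps * abs (k1 ?xi t)))" using t eps by (simp add: kpart_def abs_mult)
  also have "\<dots> <= B * (1 * M)" using t(3) scaled_k1[OF x t(1,2)] B eps by (intro mult_mono) auto
  finally show ?thesis by simp
 qed
 have m3: "abs (eps * sqrt eps * kq gk e x t) <= B * M / t" if t: "0 < t" "t <= T" for t
 proof -
  have "abs (eps * sqrt eps * kq gk e x t) = abs (e t) * (eps * (sqrt eps * gk ?xi t))"
   using t eps gk_pos[OF t(1), of ?xi] by (simp add: kpart_def abs_mult)
  also have "\<dots> <= B * (1 * (M / t))"
   using b[of t] t scaled_gk[OF x t] B eps M_ge gk_pos[OF t(1), of ?xi] by (intro mult_mono) auto
  finally show ?thesis by simp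
 qed
 have b1: "abs (Ut x t) <= C" if t: "0 < t" "t <= T" for t
  using m1[of t e'] m2[of t e] b[of t] t C_ge unfolding Ut_def distrib_left by auto
 have b2: "abs (Utt x t) <= C / (t - 0)" if t: "0 < t" "t <= T" for t
 proof -
  have bt: "abs (e' t) <= B" "abs (e'' t) <= B" using b[of t] t by auto
  have "abs (Utt x t) <= (B * (1 + M * T) + 2 * (B * M)) + B * M / t"
   using m1[of t e'', OF t bt(2)] m2[of t e', OF t bt(1)] m3[OF t] unfolding Utt_def distrib_left by linarith
  also have "\<dots> = ((B * (1 + M * T) + 2 * (B * M)) * t + B * M) / t" using t by (simp add: add_divide_distrib)
  also have "\<dots> <= ((B * (1 + M * T) + 2 * (B * M)) * T + B * M) / t"
   using t B M_ge T by (intro divide_right_mono add_right_mono mult_left_mono) auto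
  also have "\<dots> <= C / t" using C_ge t by (intro divide_right_mono) auto
  finally show ?thesis by simp
 qed
 have bf: "cubic e eps p x t = abs (x - p)^3 / 6" "Ut x t = 0" if "t <= 0" for t
  using that by (auto simp: cubic_def Ut_def kpart_def)
 show "s \<in> {0..T} ==> t \<in> {0..T} ==> abs (cubic e eps p x t - cubic e eps p x s) <= C * abs (t - s)"
  by (rule singular_in_time(1)[where d=0 and T=T, OF order_refl C_ge(6) bf _ cubic_der(1,2) b1 b2]) (use st in auto)
 show "0 < k ==> k <= t ==> t <= T ==>
   abs ((cubic e eps p x t - cubic e eps p x (t - k)) / k - Ut x t) <= 6 * C * k * (1 + weight k 0 t)"
  by (rule singular_in_time(2)[where d=0 and T=T, OF order_refl C_ge(6) bf _ cubic_der(1,2) b1 b2]) (use st in auto)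
qed

text \<open>Both alternatives for a uniform stencil imply \<open>a^2 <= \<nu>\<close>. Since
  \<open>eps * abs (U4 x t)\<close> is of order \<open>1 / t\<close> without further powers of
  \<open>1 / eps\<close>, that is enough.\<close>

lemma cubic_approx_ok: "approx_ok T eps m P 0 (6 * C) (cubic e eps p) Ut U2"
 unfolding approx_ok_def
proof (intro conjI ballI allI impI; (elim conjE)?)
 fix x s t :: real assume x: "x \<in> {0..1}" and st: "s \<in> {0..T}" "t \<in> {0..T}"
 have "abs (cubic e eps p x t - cubic e eps p x s) <= C * abs (t - s)" by (rule cubic_time(1)) (use x st in auto)
 also have "\<dots> <= 6 * C * abs (t - s)" using C_ge by (intro mult_right_mono) auto
 finally show "abs (cubic e eps p x t - cubic e eps p x s) <= 6 * C * abs (t - s)" .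
next
 fix x t k :: real assume *: "0 < x" "x < 1" "0 < k" "k <= t" "t <= T"
 show "abs ((cubic e eps p x t - cubic e eps p x (t - k)) / k - Ut x t) <= 6 * C * k * (1 + weight k 0 t)"
  by (rule cubic_time(2)) (use * in auto)
next
 fix x a c t k \<nu> :: real
 assume *: "0 < a" "0 < c" "0 <= x - a" "x + c <= 1" "0 < k" "k <= t" "t <= T" "0 <= \<nu>"
 have t: "0 < t" "t <= T" using * by auto
 have w: "0 <= weight k 0 t" using * by (simp add: weight_nonneg)
 have C0: "0 <= C" by (rule C_ge)
 have en: "eps * \<nu> <= \<nu>" using eps * by (simp add: mult_left_le_one_le)
 {
  assume **: "a = c" "a^2 <= eps * \<nu> \<or> a^2 <= \<nu> \<and> small_layer m P eps \<nu> (x - a) (x + c)"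
  then have a: "a^2 <= \<nu>" using en by auto
  have "abs (divdiff2 a a (\<lambda>x. cubic e eps p x t) x - U2 x t) <= 2 * (1 / eps * (B * (M / t))) * a^2"
  proof (rule divdiff2_equal_err_4[OF cubic_der(3)[OF t] cubic_der(4)[OF t] cubic_der(5)[OF t] cubic_der(6)[OF t] _ *(1)])
   fix z assume z: "x - a <= z" "z <= x + a"
   let ?xi = "(z - p) / sqrt eps"
   have "abs (U4 z t) = 1 / eps * (abs (e t) * (sqrt eps * gk ?xi t))"
    using t eps gk_pos[OF t(1), of ?xi] by (simp add: U4_def kpart_def abs_mult field_simps)
   also have "\<dots> <= 1 / eps * (B * (M / t))"
    using b[of t] t scaled_gk[of z t ?xi] B eps z * ** gk_pos[OF t(1), of ?xi] by (intro mult_left_mono mult_mono) auto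
   finally show "abs (U4 z t) <= 1 / eps * (B * (M / t))" .
  qed
  from mult_left_mono[OF this, of eps]
  have "eps * abs (divdiff2 a a (\<lambda>x. cubic e eps p x t) x - U2 x t) <= 2 * (B * M) * a^2 * (1 / (t - 0))"
   using eps by simp
  also have "\<dots> <= 2 * (B * M) * \<nu> * (2 * weight k 0 t)"
   using a B M_ge weight_ge(2)[of k 0 t] * t by (intro mult_mono) auto
  also have "\<dots> = 4 * (B * M) * \<nu> * weight k 0 t" by simp
  also have "\<dots> <= 6 * C * (\<nu> + k) * (1 + weight k 0 t)"
   using C_ge w * B M_ge by (intro mult_mono) auto
  finally show "eps * abs (divdiff2 a c (\<lambda>x. cubic e eps p x t) x - U2 x t) <= 6 * C * (\<nu> + k) * (1 + weight k 0 t)"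
   using **(1) by simp
 next
  have U3: "abs (U3 z t) <= B" for z
  proof -
   have "abs (U3 z t) = abs (e t) * abs (k0 ((z - p) / sqrt eps) t)" using t by (simp add: U3_def kpart_def abs_mult)
   also have "\<dots> <= B * 1" using t b[of t] B by (intro mult_mono k0_abs_le) auto
   finally show ?thesis by simp
  qed
  have "abs (divdiff2 a c (\<lambda>x. cubic e eps p x t) x - U2 x t) <= 2 * B * (a + c)"
  proof (rule divdiff2_err[where u="x-a" and v="x+c", OF DERIV_continuous_on[OF has_field_derivative_at_within[OF cubic_der(3)[OF t]]] cubic_der(3)[OF t] cubic_der(4)[OF t]])
   fix z assume "x - a <= z" "z <= x + c"
   then show "abs (U2 z t - U2 x t) <= B * abs (z - x)"
    by (intro abs_diff_le_of_derivative[where s="x-a" and t="x+c" and S=UNIV, OF cubic_der(5)[OF t]])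
     (use U3 * in auto)
  qed (use * B in auto)
  then have "eps * abs (divdiff2 a c (\<lambda>x. cubic e eps p x t) x - U2 x t) <= eps * (2 * B * (a + c))"
   using eps by (intro mult_left_mono) auto
  also have "\<dots> = 2 * B * (eps * (a + c))" by simp
  also have "\<dots> <= 6 * C * (eps * (a + c))" using C_ge eps * by (intro mult_right_mono) auto
  finally have "eps * abs (divdiff2 a c (\<lambda>x. cubic e eps p x t) x - U2 x t) <= 6 * C * eps * (a + c)" by (simp add: mult.assoc)
  moreover have "0 <= 6 * C * (\<nu> + k) * (1 + weight k 0 t)" using C0 * w by simp
  ultimately show "eps * abs (divdiff2 a c (\<lambda>x. cubic e eps p x t) x - U2 x t) <= 6 * C * (\<nu> + k) * (1 + weight k 0 t) + 6 * C * eps * (a + c)"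
   by linarith
 next
  assume "a * c <= eps * \<nu> \<or> a * c <= \<nu> \<and> small_layer m P eps \<nu> (x - a) (x + c)"
  then have ac: "a * c <= \<nu>" using en by auto
  have "abs (interp_err a c (\<lambda>x. cubic e eps p x t) x) <= (B * M) * (a * c)"
  proof (rule interp_err_le[where u="x-a" and v="x+c", OF DERIV_continuous_on[OF has_field_derivative_at_within[OF cubic_der(3)[OF t]]] cubic_der(3)[OF t] cubic_der(4)[OF t]])
   fix z assume z: "x - a <= z" "z <= x + c"
   have "abs (U2 z t) = abs (e t) * (sqrt eps * abs (k1 ((z - p) / sqrt eps) t))"
    using t eps by (simp add: U2_def kpart_def abs_mult)
   also have "\<dots> <= B * M" using b[of t] t scaled_k1[of z t] B eps z * by (intro mult_mono) auto
   finally show "abs (U2 z t) <= B * M" .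
  qed (use * in auto)
  also have "\<dots> <= (B * M) * \<nu>" using ac B M_ge by (intro mult_left_mono) auto
  also have "\<dots> <= 6 * C * \<nu>" 
  proof (rule mult_right_mono)
   have "0 <= B * M" using B M_ge by simp
   then show "B * M <= 6 * C" using C_ge by linarith
  qed (use * in simp)
  finally show "abs (interp_err a c (\<lambda>x. cubic e eps p x t) x) <= 6 * C * \<nu>" .
 }
qed

end

lemma continuous_on_of_lipschitz_time:
 fixes U :: "real => real => real"
 assumes lip: "\<And>x s t. x \<in> A ==> s \<in> B ==> t \<in> B ==> abs (U x t - U x s) <= C * abs (t - s)"
  and cont: "\<And>t. t \<in> B ==> continuous_on A (\<lambda>x. U x t)"
 shows "continuous_on (A \<times> B) (\<lambda>(x, t). U x t)"
 unfolding continuous_on_def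
proof (intro ballI, clarify)
 fix x t assume xt: "x \<in> A" "t \<in> B"
 let ?F = "at (x, t) within A \<times> B"
 have "((\<lambda>p. U (fst p) t) \<longlongrightarrow> U x t) ?F"
 proof -
  have "continuous_on (A \<times> B) (\<lambda>p. U (fst p) t)"
   by (rule continuous_on_compose2[OF cont[OF xt(2)] continuous_on_fst[OF continuous_on_id]]) auto
  then show ?thesis using xt unfolding continuous_on_def by auto
 qed
 moreover have "((\<lambda>p. U (fst p) (snd p) - U (fst p) t) \<longlongrightarrow> 0) ?F"
 proof (rule Lim_null_comparison)
  show "\<forall>\<^sub>F p in ?F. norm (U (fst p) (snd p) - U (fst p) t) <= C * abs (snd p - t)"
   using lip xt by (auto simp: eventually_at_filter intro!: always_eventually)
  have "((\<lambda>p. C * abs (snd p - t)) \<longlongrightarrow> C * abs (snd (x, t) - t)) ?F"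
   by (intro tendsto_intros)
  then show "((\<lambda>p. C * abs (snd p - t)) \<longlongrightarrow> 0) ?F" by simp
 qed
 ultimately have "((\<lambda>p. U (fst p) t + (U (fst p) (snd p) - U (fst p) t)) \<longlongrightarrow> U x t + 0) ?F"
  by (rule tendsto_add)
 then show "((\<lambda>(x, t). U x t) \<longlongrightarrow> U x t) ?F" by (simp add: case_prod_unfold)
qed

section \<open>Coefficients from a linear ordinary differential equation\<close>

lemma ode_homogeneous:
 assumes "continuous_on {0..T} b" "0 <= d" "d <= T"
 obtains e :: "real => real" where "e d = 1" "\<And>t. 0 < e t"
  "\<And>t. 0 <= t ==> t <= T ==> (e has_real_derivative - b t * e t) (at t within {0..T})"
proof
 let ?e = "\<lambda>t. exp (integral {0..d} b - integral {0..t} b)"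
 show "?e d = 1" "0 < ?e t" for t by simp_all
 fix t assume t: "0 <= t" "t <= T"
 have "((\<lambda>t. integral {0..t} b) has_real_derivative b t) (at t within {0..T})"
  by (rule integral_has_real_derivative) (use assms t in auto)
 then show "(?e has_real_derivative - b t * ?e t) (at t within {0..T})"
  by (auto intro!: derivative_eq_intros)
qed

lemma ode_inhomogeneous:
 assumes b: "continuous_on {0..T} b" and c: "continuous_on {0..T} c" and d: "0 <= d" "d <= T"
 obtains E :: "real => real" where "E d = 0"
  "\<And>t. 0 <= t ==> t <= T ==> (E has_real_derivative c t - b t * E t) (at t within {0..T})"
proof -
 obtain e where e: "e d = 1" "\<And>t. 0 < e t"
  "\<And>t. 0 <= t ==> t <= T ==> (e has_real_derivative - b t * e t) (at t within {0..T})"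
  using ode_homogeneous[OF b d] by blast
 have e0: "e t \<noteq> 0" for t using e(2)[of t] by simp
 have ec: "continuous_on {0..T} e" by (rule DERIV_continuous_on[OF e(3)]) auto
 have q: "continuous_on {0..T} (\<lambda>t. c t / e t)" by (intro continuous_intros c ec) (use e0 in auto)
 define I where "I t = integral {0..t} (\<lambda>t. c t / e t) - integral {0..d} (\<lambda>t. c t / e t)" for t
 have I: "(I has_real_derivative c t / e t) (at t within {0..T})" if "0 <= t" "t <= T" for t
 proof -
  have "((\<lambda>t. integral {0..t} (\<lambda>t. c t / e t)) has_real_derivative c t / e t) (at t within {0..T})"
   by (rule integral_has_real_derivative[OF q]) (use that in auto)
  from DERIV_diff[OF this DERIV_const] show ?thesis by (simp add: I_def[abs_def])
 qed
 show thesis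
 proof
  show "e d * I d = 0" by (simp add: I_def)
  show "((\<lambda>t. e t * I t) has_real_derivative c t - b t * (e t * I t)) (at t within {0..T})" if "0 <= t" "t <= T" for t
   using DERIV_mult[OF e(3)[OF that] I[OF that]] e0[of t] by (simp add: algebra_simps)
 qed
qed

text \<open>As \<open>c\<close> vanishes at \<open>d\<close>, the equation makes \<open>E'\<close>
  vanish there together with \<open>E\<close>. The second derivative is obtained by differentiating
  the equation once, which uses only first derivatives of \<open>b\<close> and \<open>c\<close>;
  integrating its bound twice from \<open>d\<close> gives the quadratic vanishing.\<close>

lemma coefficient_exists:
 assumes b: "\<And>t. 0 <= t ==> t <= T ==> (b has_real_derivative b' t) (at t within {0..T})"
  and b': "\<And>t. 0 <= t ==> t <= T ==> abs (b' t) <= K"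
  and c: "\<And>t. 0 <= t ==> t <= T ==> (c has_real_derivative c' t) (at t within {0..T})"
  and c': "\<And>t. 0 <= t ==> t <= T ==> abs (c' t) <= L" and cd: "c d = 0" and d: "0 <= d" "d <= T"
 obtains E E' E'' :: "real => real" and B :: real where "0 <= B" "E d = 0" "E' d = 0"
  "\<And>t. 0 <= t ==> t <= T ==> (E has_real_derivative E' t) (at t within {0..T})"
  "\<And>t. 0 <= t ==> t <= T ==> (E' has_real_derivative E'' t) (at t within {0..T})"
  "\<And>t. 0 <= t ==> t <= T ==> E' t + b t * E t = c t"
  "\<And>t. 0 <= t ==> t <= T ==> abs (E'' t) <= B"
  "\<And>t. d <= t ==> t <= T ==> abs (E t) <= B * (t - d)^2 \<and> abs (E' t) <= B * (t - d) \<and> abs (E'' t) <= B"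
proof -
 have bc: "continuous_on {0..T} b" "continuous_on {0..T} c"
  by (auto intro!: DERIV_continuous_on b c)
 obtain E where E: "E d = 0" "\<And>t. 0 <= t ==> t <= T ==> (E has_real_derivative c t - b t * E t) (at t within {0..T})"
  using ode_inhomogeneous[OF bc d] by blast
 define E' where "E' t = c t - b t * E t" for t
 define E'' where "E'' t = c' t - (b' t * E t + E' t * b t)" for t
 have E'd: "(E' has_real_derivative E'' t) (at t within {0..T})" if "0 <= t" "t <= T" for t
  unfolding E'_def[abs_def] E''_def
  by (rule DERIV_diff[OF c[OF that] DERIV_mult[OF b[OF that] E(2)[OF that]]])
 have Ec: "continuous_on {0..T} E" "continuous_on {0..T} E'"
  by (auto intro!: DERIV_continuous_on E(2) E'd)
 have bd: "\<exists>B. \<forall>t\<in>{0..T}. (abs (g t)) <= B" if "continuous_on {0..T} g" for g :: "real => real"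
  using compact_imp_bounded[OF compact_continuous_image[OF that compact_Icc]] unfolding bounded_iff by auto
 obtain B1 where B1: "\<And>t. t \<in> {0..T} ==> abs (E t) <= B1" using bd[OF Ec(1)] by blast
 obtain B2 where B2: "\<And>t. t \<in> {0..T} ==> abs (E' t * b t) <= B2" using bd[OF continuous_on_mult[OF Ec(2) bc(1)]] by blast
 define B where "B = L + K * B1 + B2"
 have EB: "abs (E'' t) <= B" if "0 <= t" "t <= T" for t
 proof -
  have "abs (b' t * E t) <= K * B1" unfolding abs_mult using b'[OF that] B1[of t] that by (intro mult_mono) auto
  then show ?thesis unfolding E''_def B_def using c'[OF that] B2[of t] that by auto
 qed
 have B0: "0 <= B" using EB[of d] d by linarith
 have E1: "abs (E' t) <= B * (t - d)" if "d <= t" "t <= T" for t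
 proof -
  have "abs (E' t - E' d) <= B * abs (t - d)"
   by (rule abs_diff_le_of_derivative[where s=d and t=t and S="{0..T}", OF E'd]) (use that d EB in auto)
  then show ?thesis using that E(1) cd by (simp add: E'_def)
 qed
 show thesis
 proof (rule that[of B E E' E''])
  show "0 <= B" "E d = 0" by fact+
  show "E' d = 0" using E(1) cd by (simp add: E'_def)
  show "(E has_real_derivative E' t) (at t within {0..T})" if "0 <= t" "t <= T" for t
   using E(2)[OF that] by (simp add: E'_def)
  show "abs (E t) <= B * (t - d)^2 \<and> abs (E' t) <= B * (t - d) \<and> abs (E'' t) <= B" if t: "d <= t" "t <= T" for t
  proof (intro conjI E1[OF t] EB)
   have "abs (E t - E d) <= B * (t - d) * abs (t - d)"
   proof (rule abs_diff_le_of_derivative[where s=d and t=t and S="{0..T}"])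
    fix z assume z: "d <= z" "z <= t"
    show "(E has_real_derivative E' z) (at z within {0..T})" using E(2)[of z] z t d by (simp add: E'_def)
    have "B * (z - d) <= B * (t - d)" using z B0 by (intro mult_left_mono) auto
    then show "abs (E' z) <= B * (t - d)" using E1[of z] z t by simp
   qed (use t d in auto)
   then show "abs (E t) <= B * (t - d)^2" using E(1) t by (simp add: power2_eq_square mult.assoc)
  qed (use t d in auto)
 qed (auto simp: E'd E'_def EB)
qed

section \<open>The discrete problem\<close>

lemma delta2_eq:
 fixes xs :: "nat => real"
 assumes "xs (i - 1) < xs i" "xs i < xs (i + 1)"
 defines "a \<equiv> xs i - xs (i - 1)" and "c \<equiv> xs (i + 1) - xs i"
 shows "delta2 xs U i j = 2 / (a * c) * ((c * U (i - 1) j + a * U (i + 1) j) / (a + c) - U i j)"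
proof -
 have ac: "0 < a" "0 < c" using assms by auto
 have e: "delta2 xs U i j = ((U (i + 1) j - U i j) / c - (U i j - U (i - 1) j) / a) / ((a + c) / 2)"
  by (simp add: delta2_def Dxp_def Dxm_def a_def c_def)
 have s: "a + c \<noteq> 0" "a \<noteq> 0" "c \<noteq> 0" using ac by auto
 show ?thesis unfolding e using s by (simp add: divide_simps) (simp add: algebra_simps)
qed

lemma delta2_node:
 fixes xs :: "nat => real"
 assumes "xs (i - 1) < xs i" "xs i < xs (i + 1)"
 shows "delta2 xs (\<lambda>i j. y (xs i) (ts j)) i j
  = divdiff2 (xs i - xs (i - 1)) (xs (i + 1) - xs i) (\<lambda>x. y x (ts j)) (xs i)"
 unfolding delta2_eq[OF assms] by (simp add: divdiff2_def interp_err_def)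

text \<open>Induction over the time levels. At a negative minimum of a new level the diffusion and
  potential terms are nonpositive, and the time quotient is strictly negative because the previous
  level is nonnegative.\<close>

lemma discrete_max_principle:
 fixes xs :: "nat => real" and V :: "nat => nat => real"
 assumes mono: "\<And>i. i < N ==> xs i < xs (Suc i)" and k: "\<And>j. 1 <= j ==> j <= M ==> ts (j - 1) < ts j"
  and b: "\<And>j. 1 <= j ==> j <= M ==> 0 <= b (ts j)" and eps: "0 < eps"
  and L: "\<And>i j. 1 <= i ==> i <= N - 1 ==> 1 <= j ==> j <= M ==>
    0 <= - eps * delta2 xs V i j + b (ts j) * V i j + Dtm ts V i j"
  and bd: "\<And>i j. i <= N ==> j <= M ==> i = 0 \<or> i = N \<or> j = 0 ==> 0 <= V i j"
 shows "i <= N ==> j <= M ==> 0 <= V i j"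
proof (induction j arbitrary: i)
 case 0 then show ?case using bd by simp
next
 case (Suc j)
 define mn where "mn = Min ((\<lambda>i. V i (Suc j)) ` {..N})"
 have "mn \<in> (\<lambda>i. V i (Suc j)) ` {..N}" unfolding mn_def by (intro Min_in) auto
 then obtain i0 where i0: "i0 <= N" "V i0 (Suc j) = mn" by auto
 have mn: "mn <= V i (Suc j)" if "i <= N" for i unfolding mn_def using that by (intro Min_le) auto
 have "0 <= mn"
 proof (rule ccontr)
  assume neg: "\<not> 0 <= mn"
  then have ii: "1 <= i0" "i0 <= N - 1" "i0 < N" using bd[OF i0(1) Suc.prems(2)] i0
   by (cases "i0 = 0"; cases "i0 = N"; auto)+
  define a where "a = xs i0 - xs (i0 - 1)"
  define c where "c = xs (i0 + 1) - xs i0"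
  have lt: "xs (i0 - 1) < xs i0" "xs i0 < xs (i0 + 1)" using mono[of "i0 - 1"] mono[of i0] ii by auto
  have ac: "0 < a" "0 < c" using lt by (auto simp: a_def c_def)
  have "c * mn + a * mn <= c * V (i0 - 1) (Suc j) + a * V (i0 + 1) (Suc j)"
   using mn[of "i0 - 1"] mn[of "i0 + 1"] ii ac by (intro add_mono mult_left_mono) auto
  then have "mn <= (c * V (i0 - 1) (Suc j) + a * V (i0 + 1) (Suc j)) / (a + c)"
   using ac by (simp add: pos_le_divide_eq algebra_simps)
  then have "0 <= delta2 xs V i0 (Suc j)"
   unfolding delta2_eq[OF lt] a_def[symmetric] c_def[symmetric] i0(2)
   using ac by (intro mult_nonneg_nonneg) auto
  then have "- eps * delta2 xs V i0 (Suc j) <= 0" using eps by simp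
  moreover have "b (ts (Suc j)) * V i0 (Suc j) <= 0"
   using b[of "Suc j"] Suc.prems neg i0 by (auto simp: mult_nonneg_nonpos)
  moreover have "Dtm ts V i0 (Suc j) < 0"
   unfolding Dtm_def using Suc.IH[of i0] Suc.prems i0 neg k[of "Suc j"]
   by (auto intro!: divide_neg_pos)
  ultimately show False using L[of i0 "Suc j"] ii Suc.prems by simp
 qed
 then show ?case using mn[OF Suc.prems(1)] by linarith
qed

lemma divdiff2_sum: "divdiff2 a c (\<lambda>x. \<Sum>p\<in>I. g p x) x = (\<Sum>p\<in>I. divdiff2 a c (g p) x)"
proof (induction I rule: infinite_finite_induct)
 case (insert p I)
 then show ?case by (simp add: divdiff2_add)
qed (simp_all add: divdiff2_def interp_err_def)

text \<open>Green's function of \<open>- d^2/dx^2\<close> with pole \<open>p\<close>: it absorbs a truncation error at the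
 single node \<open>p\<close> that is larger by one power of the mesh width than elsewhere.\<close>

definition hat :: "real => real => real" where
 "hat p x = min (x * (1 - p)) (p * (1 - x))"

lemma hat_bounds: "0 <= p ==> p <= 1 ==> 0 <= x ==> x <= 1 ==> 0 <= hat p x \<and> hat p x <= 1"
proof -
 assume *: "0 <= p" "p <= 1" "0 <= x" "x <= 1"
 have "x * (1 - p) <= 1 * 1" using * by (intro mult_mono) auto
 then show ?thesis using * by (auto simp: hat_def min_le_iff_disj)
qed

text \<open>As the minimum of two affine functions the hat lies below the one it touches at
  \<open>x\<close>, and that one is interpolated exactly. At the pole the slope drops by 1, which
  fixes the second divided difference.\<close>

lemma hat_concave:
 assumes ac: "0 < a" "0 < c"
 shows "divdiff2 a c (hat p) x <= 0" and "divdiff2 a c (hat p) p = - 2 / (a + c)"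
proof -
 have lin: "interp_err a c (\<lambda>x. r + s * x) x = 0" for r s
  using ac by (simp add: interp_err_def field_simps)
 have "interp_err a c (hat p) x <= 0"
 proof -
  have *: "interp_err a c (hat p) x <= interp_err a c l x" if "\<And>z. hat p z <= l z" "hat p x = l x" for l
  proof -
   have "c * hat p (x - a) + a * hat p (x + c) <= c * l (x - a) + a * l (x + c)"
    using that ac by (intro add_mono mult_left_mono) auto
   then show ?thesis unfolding interp_err_def that(2) using ac by (simp add: divide_right_mono)
  qed
  consider "hat p x = x * (1 - p)" | "hat p x = p * (1 - x)" unfolding hat_def by linarith
  then show ?thesis
  proof cases
   case 1
   have "interp_err a c (hat p) x <= interp_err a c (\<lambda>x. 0 + (1 - p) * x) x"
    by (rule *) (use 1 in \<open>auto simp: hat_def mult.commute\<close>)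
   then show ?thesis unfolding lin .
  next
   case 2
   have "interp_err a c (hat p) x <= interp_err a c (\<lambda>x. p + (- p) * x) x"
    by (rule *) (use 2 in \<open>auto simp: hat_def algebra_simps\<close>)
   then show ?thesis unfolding lin .
  qed
 qed
 then show "divdiff2 a c (hat p) x <= 0"
  unfolding divdiff2_def using ac by (intro mult_nonneg_nonpos) auto
 have h: "hat p z = (if z <= p then z * (1 - p) else p * (1 - z))" for z
 proof -
  have "z * (1 - p) <= p * (1 - z) \<longleftrightarrow> z <= p" by (simp add: algebra_simps)
  then show ?thesis by (simp add: hat_def min_def)
 qed
 have "interp_err a c (hat p) p = - (a * c / (a + c))"
  using ac by (simp add: interp_err_def h field_simps)
 then show "divdiff2 a c (hat p) p = - 2 / (a + c)" using ac by (simp add: divdiff2_def field_simps)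
qed

text \<open>Tailored to the three cases of \<open>approx_ok\<close>: \<open>I\<close> collects the
  nodes treated as transitions, at most one barrier hat is spent on each of them, and the last
  clause concerns single cells and serves interpolation. The bound 4 is the number of transition
  nodes of the mesh with an interior layer.\<close>

definition mesh_ok :: "real => real => real set => real => nat set => nat => (nat => real) => bool" where
 "mesh_ok eps m P \<nu> I N xs \<longleftrightarrow> xs 0 = 0 \<and> xs N = 1 \<and> (\<forall>i<N. xs i < xs (Suc i)) \<and>
   finite I \<and> card I <= 4 \<and> (\<forall>i\<in>I. i <= N) \<and>
   (\<forall>i. 0 < i \<and> i < N \<longrightarrow>
    (xs i - xs (i - 1) = xs (Suc i) - xs i \<and>
      ((xs i - xs (i - 1))^2 <= eps * \<nu> \<or>
      (xs i - xs (i - 1))^2 <= \<nu> \<and> small_layer m P eps \<nu> (xs (i - 1)) (xs (Suc i)))) \<or>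
    (i \<in> I \<and> (xs i - xs (i - 1))^2 <= \<nu> \<and> (xs (Suc i) - xs i)^2 <= \<nu> \<and>
      (small_layer m P eps \<nu> (xs (i - 1)) (xs (Suc i)) \<or> far_from P (xs (i - 1)) (xs (Suc i))))) \<and>
   (\<forall>i<N. (xs (Suc i) - xs i)^2 <= eps * \<nu> \<or>
    (xs (Suc i) - xs i)^2 <= \<nu> \<and> small_layer m P eps \<nu> (xs i) (xs (Suc i)))"

lemma harm_le: "0 < n ==> harm n <= 1 + ln (real n)"
 using decseqD[OF decseq_harm_diff_ln, of 0 "n - 1"] by (simp add: harm_def)

text \<open>Source of the logarithm: after \<open>d\<close> the weighted steps are dominated by the
  terms of a harmonic sum.\<close>

lemma weight_sum:
 fixes k d :: real
 assumes k: "0 < k" and d: "0 <= d" and M: "0 < M"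
 shows "(\<Sum>l=1..M. k * weight k d (real l * k)) <= 1 + ln (real M)"
proof -
 \<comment> \<open>The last time index not beyond \<open>d\<close>. The singular time may fall
   between two levels, and \<open>d / k < l0 + 1\<close> is what makes the comparison with
   \<open>1 / (l - l0)\<close> work.\<close>
 define l0 where "l0 = nat \<lfloor>d / k\<rfloor>"
 have l0: "real l0 <= d / k" "d / k < real l0 + 1"
  using k d by (auto simp: l0_def)
 have "(\<Sum>l=1..M. k * weight k d (real l * k)) = (\<Sum>l\<in>{l0+1..M}. k * weight k d (real l * k))"
 proof (rule sum.mono_neutral_right)
  show "\<forall>l\<in>{1..M} - {l0 + 1..M}. k * weight k d (real l * k) = 0"
  proof
   fix l assume "l \<in> {1..M} - {l0 + 1..M}"
   then have "real l <= d / k" using l0 by auto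
   then have "real l * k <= d" using k by (simp add: pos_le_divide_eq)
   then show "k * weight k d (real l * k) = 0" by (simp add: weight_def)
  qed
 qed auto
 also have "\<dots> <= (\<Sum>l\<in>{l0+1..M}. 1 / real (l - l0))"
 proof (rule sum_mono)
  fix l assume l: "l \<in> {l0+1..M}"
  have "d / k < real l" using l0 l by auto
  then have dl: "d < real l * k" using k by (simp add: pos_divide_less_eq)
  have "k * weight k d (real l * k) = 1 / (1 + (real l - d / k))"
   using dl k by (simp add: weight_def field_simps)
  also have "\<dots> <= 1 / real (l - l0)" using l l0 by (intro divide_left_mono) (auto simp: of_nat_diff)
  finally show "k * weight k d (real l * k) <= 1 / real (l - l0)" .
 qed
 also have "\<dots> = (\<Sum>i\<in>(\<lambda>l. l - l0) ` {l0+1..M}. 1 / real i)"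
  by (subst sum.reindex) (auto simp: inj_on_def)
 also have "\<dots> <= (\<Sum>i\<in>{1..M}. 1 / real i)" by (rule sum_mono2) auto
 also have "\<dots> = harm M" by (simp add: harm_def inverse_eq_divide)
 also have "\<dots> <= 1 + ln (real M)" by (rule harm_le[OF M])
 finally show ?thesis .
qed

lemma strict_mono_mesh:
 fixes xs :: "nat => real"
 assumes "\<And>i. i < N ==> xs i < xs (Suc i)" "i <= j" "j <= N"
 shows "xs i <= xs j"
 using assms(2,3)
proof (induction j)
 case (Suc j)
 then show ?case using assms(1)[of j] by (cases "i = Suc j") auto
qed simp

lemma cell_exists:
 fixes xs :: "nat => real"
 assumes "xs 0 <= x" "x <= xs N" "0 < N"
 defines "i \<equiv> LEAST i. 1 <= i \<and> x <= xs i"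
 shows "1 <= i" "i <= N" "xs (i - 1) <= x" "x <= xs i"
proof -
 have e: "1 <= N \<and> x <= xs N" using assms by auto
 have L: "1 <= i \<and> x <= xs i" unfolding i_def using LeastI[of "\<lambda>i. 1 <= i \<and> x <= xs i" N] e by blast
 then show "1 <= i" "x <= xs i" by auto
 show "i <= N" unfolding i_def using Least_le[of "\<lambda>i. 1 <= i \<and> x <= xs i" N] e by blast
 show "xs (i - 1) <= x"
 proof (cases "i = 1")
  case True then show ?thesis using assms by simp
 next
  case False
  then have "\<not> (1 <= i - 1 \<and> x <= xs (i - 1))"
   using L unfolding i_def by (intro not_less_Least) auto
  then show ?thesis using L False by auto
 qed
qed

section \<open>Error of the scheme and of its interpolant\<close>

locale scheme =
 fixes T eps m C d \<nu> :: real and b :: "real => real" and P :: "real set" and I :: "nat set" and N M :: nat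
  and xs :: "nat => real" and F y yt yxx :: "real => real => real" and Y :: "nat => nat => real"
 assumes T: "0 < T" and eps: "0 < eps" and C: "0 <= C" and d: "0 <= d" and nu: "0 <= \<nu>"
  and b: "\<And>t. 0 <= t ==> t <= T ==> 0 <= b t" and NM: "0 < N" "2 <= M"
  and mesh: "mesh_ok eps m P \<nu> I N xs"
  and y: "approx_ok T eps m P d C y yt yxx"
  and pde: "\<And>x t. 0 < x ==> x < 1 ==> 0 < t ==> t <= T ==> yt x t - eps * yxx x t + b t * y x t = F x t"
  and Y: "discrete_solution eps b N M xs (tmesh T M) F y Y"
begin

abbreviation "ts \<equiv> tmesh T M"

definition "k = T / real M"

lemma k: "0 < k" using T NM by (simp add: k_def)

lemma ts: "ts j = real j * k" "1 <= j ==> ts j - ts (j - 1) = k" "j <= M ==> ts j <= T" "0 <= ts j"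
proof -
 show 1: "ts j = real j * k" for j by (simp add: tmesh_def k_def)
 show "1 <= j ==> ts j - ts (j - 1) = k" unfolding 1 by (simp add: of_nat_diff algebra_simps)
 show "0 <= ts j" unfolding 1 using k by simp
 assume "j <= M"
 then have "real j * k <= real M * k" using k by (intro mult_right_mono) auto
 also have "\<dots> = T" using NM by (simp add: k_def)
 finally show "ts j <= T" unfolding 1 .
qed

lemma ts_ge: "1 <= j ==> k <= ts j"
 unfolding ts using k mult_right_mono[of 1 "real j" k] by simp

lemma xs: "xs 0 = 0" "xs N = 1" "i < N ==> xs i < xs (Suc i)" "i <= N ==> 0 <= xs i" "i <= N ==> xs i <= 1"
 using mesh strict_mono_mesh[of N xs 0 i] strict_mono_mesh[of N xs i N] unfolding mesh_ok_def by auto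

lemma mesh_inner: "0 < i ==> i < N ==>
  (xs i - xs (i - 1) = xs (Suc i) - xs i \<and>
   ((xs i - xs (i - 1))^2 <= eps * \<nu> \<or>
   (xs i - xs (i - 1))^2 <= \<nu> \<and> small_layer m P eps \<nu> (xs (i - 1)) (xs (Suc i)))) \<or>
  (i \<in> I \<and> (xs i - xs (i - 1))^2 <= \<nu> \<and> (xs (Suc i) - xs i)^2 <= \<nu> \<and>
   (small_layer m P eps \<nu> (xs (i - 1)) (xs (Suc i)) \<or> far_from P (xs (i - 1)) (xs (Suc i))))"
 and mesh_cell: "i < N ==> (xs (Suc i) - xs i)^2 <= eps * \<nu> \<or>
  (xs (Suc i) - xs i)^2 <= \<nu> \<and> small_layer m P eps \<nu> (xs i) (xs (Suc i))"
 using mesh unfolding mesh_ok_def by (elim conjE, simp only:)+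

lemma xs_inner: "0 < i ==> i < N ==> xs (i - 1) < xs i \<and> xs i < xs (Suc i) \<and> 0 < xs i \<and> xs i < 1"
proof -
 assume i: "0 < i" "i < N"
 then have "i - 1 < N" "i - 1 <= N" "Suc (i - 1) = i" "Suc i <= N" by auto
 then show ?thesis using xs(3)[of "i - 1"] xs(3)[of i] xs(4)[of "i - 1"] xs(5)[of "Suc i"] i by force
qed

text \<open>The factor 2 leaves one share for the truncation error in time and one for that in
  space.\<close>

definition "\<theta> j = 2 * C * (\<nu> + k) * (1 + weight k d (ts j))"

lemma theta_nonneg: "0 <= \<theta> j"
 using C nu k weight_nonneg[OF k, of d "ts j"] by (simp add: \<theta>_def)

definition "L V i j = - eps * delta2 xs V i j + b (ts j) * V i j + Dtm ts V i j"

text \<open>At a transition node the error may exceed \<open>\<theta> j\<close> by a term linear in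
  the stencil width. The second claim adds that in this case the stencil is at most
  \<open>2 * sqrt \<nu>\<close> wide, which relates the excess to the barrier.\<close>

lemma truncation:
 assumes i: "0 < i" "i < N" and j: "1 <= j" "j <= M"
 shows "abs (L (\<lambda>i j. Y i j - y (xs i) (ts j)) i j)
  <= \<theta> j + (if i \<in> I then C * eps * (xs (Suc i) - xs (i - 1)) else 0)"
  and "i \<in> I ==> abs (L (\<lambda>i j. Y i j - y (xs i) (ts j)) i j) <= \<theta> j \<or> (xs (Suc i) - xs (i - 1))^2 <= 4 * \<nu>"
proof -
 define x a c t where "x = xs i" and "a = xs i - xs (i - 1)" and "c = xs (Suc i) - xs i" and "t = ts j"
 note xi = xs_inner[OF i]
 have x: "0 < x" "x < 1" "0 < a" "0 < c" "0 <= x - a" "x + c <= 1" "x - a = xs (i - 1)" "x + c = xs (Suc i)"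
  using xi i xs(4)[of "i - 1"] xs(5)[of "Suc i"] by (auto simp: x_def a_def c_def)
 have t: "k <= t" "t <= T" "0 < t" using ts_ge[of j] ts(3)[of j] j k by (auto simp: t_def)
 have tk: "ts (j - 1) = t - k" using ts(2)[OF j(1)] by (simp add: t_def)
 have "L Y i j = F x t" using Y i j by (auto simp: discrete_solution_def L_def x_def t_def)
 moreover have "L (\<lambda>i j. Y i j - y (xs i) (ts j)) i j = L Y i j - L (\<lambda>i j. y (xs i) (ts j)) i j"
  using xi unfolding L_def by (simp add: delta2_eq Dtm_def algebra_simps diff_divide_distrib add_divide_distrib)
 moreover have "L (\<lambda>i j. y (xs i) (ts j)) i j
   = - eps * divdiff2 a c (\<lambda>x. y x t) x + b t * y x t + (y x t - y x (t - k)) / k"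
 proof -
  have "ts j - ts (j - 1) = k" by (rule ts(2)[OF j(1)])
  moreover have "xs (i - 1) < xs i" "xs i < xs (i + 1)" using xi by auto
  ultimately show ?thesis
   unfolding L_def delta2_node[OF \<open>xs (i - 1) < xs i\<close> \<open>xs i < xs (i + 1)\<close>] Dtm_def tk x_def a_def c_def
   unfolding t_def by simp
 qed
 moreover have "F x t = yt x t - eps * yxx x t + b t * y x t" using pde[OF x(1,2) t(3,2)] by simp
 ultimately have eq: "L (\<lambda>i j. Y i j - y (xs i) (ts j)) i j
   = eps * (divdiff2 a c (\<lambda>x. y x t) x - yxx x t) - ((y x t - y x (t - k)) / k - yt x t)"
  by (simp add: algebra_simps)
 define e where "e = eps * abs (divdiff2 a c (\<lambda>x. y x t) x - yxx x t)"
 have w: "0 <= weight k d t" by (rule weight_nonneg[OF k])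
 have "abs ((y x t - y x (t - k)) / k - yt x t) <= C * k * (1 + weight k d t)"
  by (rule approx_okD(2)[OF y x(1,2) k t(1,2)])
 also have "\<dots> <= C * (\<nu> + k) * (1 + weight k d t)"
  using C nu w by (intro mult_right_mono mult_left_mono) auto
 finally have tot: "abs (L (\<lambda>i j. Y i j - y (xs i) (ts j)) i j) <= e + C * (\<nu> + k) * (1 + weight k d t)"
  unfolding eq e_def using eps abs_triangle_ineq4[of "eps * (divdiff2 a c (\<lambda>x. y x t) x - yxx x t)" "(y x t - y x (t - k)) / k - yt x t"]
  by (simp add: abs_mult)
 have th: "\<theta> j = C * (\<nu> + k) * (1 + weight k d t) + C * (\<nu> + k) * (1 + weight k d t)"
  by (simp add: \<theta>_def t_def algebra_simps)
 have "(a = c \<and> (a^2 <= eps * \<nu> \<or> a^2 <= \<nu> \<and> small_layer m P eps \<nu> (x - a) (x + c))) \<or>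
   (i \<in> I \<and> a^2 <= \<nu> \<and> c^2 <= \<nu> \<and> (small_layer m P eps \<nu> (x - a) (x + c) \<or> far_from P (x - a) (x + c)))"
  unfolding x(7,8) unfolding a_def c_def by (rule mesh_inner[OF i])
 then have cs: "e <= C * (\<nu> + k) * (1 + weight k d t) \<or>
   (i \<in> I \<and> a^2 <= \<nu> \<and> c^2 <= \<nu> \<and> e <= C * (\<nu> + k) * (1 + weight k d t) + C * eps * (a + c))"
 proof
  assume *: "a = c \<and> (a^2 <= eps * \<nu> \<or> a^2 <= \<nu> \<and> small_layer m P eps \<nu> (x - a) (x + c))"
  then have "e <= C * (\<nu> + k) * (1 + weight k d t)"
   using approx_okD(3)[OF y x(3,5) _ k t(1,2) nu] x(6) unfolding e_def by auto
  then show ?thesis ..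
 next
  assume *: "i \<in> I \<and> a^2 <= \<nu> \<and> c^2 <= \<nu> \<and> (small_layer m P eps \<nu> (x - a) (x + c) \<or> far_from P (x - a) (x + c))"
  then have "e <= C * (\<nu> + k) * (1 + weight k d t) + C * eps * (a + c)"
   using approx_okD(4)[OF y x(3-6) k t(1,2) nu] unfolding e_def by blast
  then show ?thesis using * by blast
 qed
 have ac: "xs (Suc i) - xs (i - 1) = a + c" by (simp add: a_def c_def)
 have "0 <= C * eps * (a + c)" using C eps x by simp
 then show "abs (L (\<lambda>i j. Y i j - y (xs i) (ts j)) i j)
  <= \<theta> j + (if i \<in> I then C * eps * (xs (Suc i) - xs (i - 1)) else 0)"
  using cs tot unfolding th ac by auto
 have "(a + c)^2 <= 4 * \<nu>" if "a^2 <= \<nu>" "c^2 <= \<nu>"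
  using that sum_squares_bound[of a c] by (simp add: power2_sum)
 then show "abs (L (\<lambda>i j. Y i j - y (xs i) (ts j)) i j) <= \<theta> j \<or> (xs (Suc i) - xs (i - 1))^2 <= 4 * \<nu>"
  using cs tot unfolding th ac by auto
qed

text \<open>The barrier: a discrete time integral of \<open>\<theta>\<close>, plus a hat of height
  proportional to \<open>\<nu>\<close> at each node of \<open>I\<close>. Applied to such a hat,
  diffusion yields \<open>4 * C * \<nu> * eps\<close> over the stencil width, and this exceeds
  \<open>C * eps\<close> times the width as soon as the squared width is at most
  \<open>4 * \<nu>\<close>.\<close>

definition "W i j = (\<Sum>l=1..j. k * \<theta> l) + 2 * C * \<nu> * (\<Sum>p\<in>I. hat (xs p) (xs i))"

lemma I: "finite I" "card I <= 4" "p \<in> I ==> p <= N"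
 using mesh by (auto simp: mesh_ok_def)

lemma W_nonneg: "i <= N ==> 0 <= W i j"
 unfolding W_def using k theta_nonneg C nu hat_bounds xs I
 by (intro add_nonneg_nonneg sum_nonneg mult_nonneg_nonneg) auto

lemma L_W:
 assumes i: "0 < i" "i < N" and j: "1 <= j" "j <= M"
 shows "\<theta> j + (if i \<in> I then C * eps * (4 * \<nu> / (xs (Suc i) - xs (i - 1))) else 0) <= L W i j"
proof -
 define x a c where "x = xs i" and "a = xs i - xs (i - 1)" and "c = xs (Suc i) - xs i"
 note xi = xs_inner[OF i]
 have ac: "0 < a" "0 < c" "x - a = xs (i - 1)" "x + c = xs (i + 1)" using xi by (auto simp: x_def a_def c_def)
 have Dt: "Dtm ts W i j = \<theta> j"
 proof -
  have "{1..j} = insert j {1..j - 1}" using j by auto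
  then have "W i j - W i (j - 1) = k * \<theta> j" using j by (simp add: W_def)
  then show ?thesis using ts(2)[OF j(1)] k by (simp add: Dtm_def)
 qed
 have bW: "0 <= b (ts j) * W i j" using b[of "ts j"] ts(3,4)[of j] j W_nonneg[of i j] i by simp
 have d2: "delta2 xs W i j = 2 * C * \<nu> * (\<Sum>p\<in>I. divdiff2 a c (hat (xs p)) x)"
 proof -
  have lt: "xs (i - 1) < xs i" "xs i < xs (i + 1)" using xi by auto
  \<comment> \<open>The time sum is the same at all three nodes, so the second difference removes it
    and leaves the hats.\<close>
  have lin: "2 / (a * c) * ((c * (Z + q * s1) + a * (Z + q * s2)) / (a + c) - (Z + q * s0))
    = q * (2 / (a * c) * ((c * s1 + a * s2) / (a + c) - s0))" for Z q s0 s1 s2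
  proof -
   have "(c * (Z + q * s1) + a * (Z + q * s2)) / (a + c) = Z + q * ((c * s1 + a * s2) / (a + c))"
    using ac(1,2) by (simp add: field_simps)
   then have "(c * (Z + q * s1) + a * (Z + q * s2)) / (a + c) - (Z + q * s0) = q * ((c * s1 + a * s2) / (a + c) - s0)"
    by (simp add: right_diff_distrib)
   then show ?thesis by (simp only: mult.left_commute)
  qed
  define S where "S = (\<lambda>x. \<Sum>p\<in>I. hat (xs p) x)"
  have "(\<Sum>p\<in>I. divdiff2 a c (hat (xs p)) x) = divdiff2 a c S x"
   unfolding S_def by (rule divdiff2_sum[symmetric])
  then have S: "(\<Sum>p\<in>I. divdiff2 a c (hat (xs p)) x)
    = 2 / (a * c) * ((c * S (xs (i - 1)) + a * S (xs (i + 1))) / (a + c) - S (xs i))"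
   unfolding divdiff2_def interp_err_def ac(3,4) by (simp only: x_def)
  have cc: "xs (i + 1) - xs i = c" by (simp add: c_def)
  have W: "W i j = (\<Sum>l=1..j. k * \<theta> l) + 2 * C * \<nu> * S (xs i)" for i by (simp add: W_def S_def)
  show ?thesis
   unfolding delta2_eq[OF lt] W S a_def[symmetric] cc by (rule lin)
 qed
 have iI: "(if i \<in> I then C * eps * (4 * \<nu> / (a + c)) else 0) <= - eps * (2 * C * \<nu> * (\<Sum>p\<in>I. divdiff2 a c (hat (xs p)) x))"
 proof -
  have le: "(\<Sum>p\<in>I. divdiff2 a c (hat (xs p)) x) <= (if i \<in> I then - 2 / (a + c) else 0)"
  proof (cases "i \<in> I")
   case True
   have "(\<Sum>p\<in>I. divdiff2 a c (hat (xs p)) x) = divdiff2 a c (hat (xs i)) x + (\<Sum>p\<in>I - {i}. divdiff2 a c (hat (xs p)) x)"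
    by (rule sum.remove[OF I(1) True])
   also have "\<dots> <= - 2 / (a + c) + 0"
    using hat_concave[OF ac(1,2)] by (intro add_mono sum_nonpos) (auto simp: x_def)
   finally show ?thesis using True by simp
  next
   case False
   then show ?thesis using hat_concave(1)[OF ac(1,2)] by (simp add: sum_nonpos)
  qed
  have "2 * C * \<nu> * eps * (\<Sum>p\<in>I. divdiff2 a c (hat (xs p)) x) <= 2 * C * \<nu> * eps * (if i \<in> I then - 2 / (a + c) else 0)"
   using C nu eps by (intro mult_left_mono[OF le]) auto
  then show ?thesis by (auto simp: mult_ac split: if_splits)
 qed
 have ac': "xs (Suc i) - xs (i - 1) = a + c" by (simp add: a_def c_def)
 show ?thesis unfolding L_def Dt d2 ac' using bW iI by linarith
qed

lemma nodal_error:
 assumes "i <= N" "j <= M"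
 shows "abs (Y i j - y (xs i) (ts j)) <= W i j"
proof -
 have key: "0 <= W i j - s * (Y i j - y (xs i) (ts j))" if s: "s = 1 \<or> s = -1" for s
 proof (rule discrete_max_principle[where xs=xs and ts=ts and b=b and V="\<lambda>i j. W i j - s * (Y i j - y (xs i) (ts j))", OF _ _ _ eps _ _ assms])
  show "xs i < xs (Suc i)" if "i < N" for i using xs that by simp
  show "ts (j - 1) < ts j" if "1 <= j" "j <= M" for j using ts(2)[OF that(1)] k by linarith
  show "0 <= b (ts j)" if "1 <= j" "j <= M" for j using b ts that by simp
 next
  fix i j assume ij: "1 <= i" "i <= N - 1" "1 <= j" "j <= M"
  then have i: "0 < i" "i < N" by auto
  have xi: "xs (i - 1) < xs i" "xs i < xs (i + 1)" using xs_inner[OF i] by auto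
  have "L (\<lambda>i j. W i j - s * (Y i j - y (xs i) (ts j))) i j = L W i j - s * L (\<lambda>i j. Y i j - y (xs i) (ts j)) i j"
   unfolding L_def delta2_eq[OF xi] Dtm_def
   by (simp add: algebra_simps diff_divide_distrib add_divide_distrib)
  moreover have "s * L (\<lambda>i j. Y i j - y (xs i) (ts j)) i j <= L W i j"
  proof -
   have h: "0 < xs (Suc i) - xs (i - 1)" using xi by simp
   have "abs (L (\<lambda>i j. Y i j - y (xs i) (ts j)) i j) <= L W i j"
   proof (cases "i \<in> I")
    case False
    then show ?thesis using truncation(1)[OF i ij(3,4)] L_W[OF i ij(3,4)] by simp
   next
    case True
    have nn: "0 <= C * eps * (4 * \<nu> / (xs (Suc i) - xs (i - 1)))" using C eps nu h by simp
    from truncation(2)[OF i ij(3,4) True] show ?thesis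
    proof
     assume "abs (L (\<lambda>i j. Y i j - y (xs i) (ts j)) i j) <= \<theta> j"
     then show ?thesis using L_W[OF i ij(3,4)] nn True by simp
    next
     \<comment> \<open>Here the extra term linear in the stencil width is traded for the reciprocal
       width that the hat supplies.\<close>
     assume "(xs (Suc i) - xs (i - 1))^2 <= 4 * \<nu>"
     then have "xs (Suc i) - xs (i - 1) <= 4 * \<nu> / (xs (Suc i) - xs (i - 1))"
      using h by (simp add: pos_le_divide_eq power2_eq_square)
     then have "C * eps * (xs (Suc i) - xs (i - 1)) <= C * eps * (4 * \<nu> / (xs (Suc i) - xs (i - 1)))"
      using C eps by (intro mult_left_mono) auto
     then show ?thesis using truncation(1)[OF i ij(3,4)] L_W[OF i ij(3,4)] True by simp
    qed
   qed
   then show ?thesis using s by auto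
  qed
  ultimately show "0 <= - eps * delta2 xs (\<lambda>i j. W i j - s * (Y i j - y (xs i) (ts j))) i j
    + b (ts j) * (W i j - s * (Y i j - y (xs i) (ts j))) + Dtm ts (\<lambda>i j. W i j - s * (Y i j - y (xs i) (ts j))) i j"
   unfolding L_def by linarith
 next
  fix i j assume ij: "i <= N" "j <= M" "i = 0 \<or> i = N \<or> j = 0"
  then have "Y i j = y (xs i) (ts j)" using Y unfolding discrete_solution_def by blast
  then show "0 <= W i j - s * (Y i j - y (xs i) (ts j))" using W_nonneg[OF ij(1)] by simp
 qed
 show ?thesis using key[of 1] key[of "-1"] by auto
qed

text \<open>With at least two time steps, bounded contributions can be absorbed into the factor
  \<open>ln M\<close>.\<close>

lemma ln_M: "1 <= 2 * ln (real M)"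
proof -
 have "ln 2 <= ln (real M)" using NM by simp
 then show ?thesis using ln2_ge_two_thirds by linarith
qed

lemma W_le:
 assumes "i <= N" "j <= M"
 shows "W i j <= C * (4 * T + 22) * (\<nu> + k) * ln (real M)"
proof -
 have "(\<Sum>l=1..j. k * \<theta> l) <= (\<Sum>l=1..M. k * \<theta> l)"
  using assms k theta_nonneg by (intro sum_mono2) auto
 also have "\<dots> = 2 * C * (\<nu> + k) * (\<Sum>l=1..M. k + k * weight k d (real l * k))"
  unfolding \<theta>_def ts(1) sum_distrib_left by (intro sum.cong) (auto simp: algebra_simps)
 also have "(\<Sum>l=1..M. k + k * weight k d (real l * k)) = T + (\<Sum>l=1..M. k * weight k d (real l * k))"
  using NM by (simp add: sum.distrib k_def)
 also have "2 * C * (\<nu> + k) * (T + (\<Sum>l=1..M. k * weight k d (real l * k))) <= 2 * C * (\<nu> + k) * (T + (1 + ln (real M)))"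
  using weight_sum[OF k d, of M] NM C nu k by (intro mult_left_mono) auto
 also have "\<dots> <= 2 * C * (\<nu> + k) * ((2 * T + 3) * ln (real M))"
 proof (rule mult_left_mono)
  have "(T + 1) * 1 <= (T + 1) * (2 * ln (real M))" using ln_M T by (intro mult_left_mono) auto
  then show "T + (1 + ln (real M)) <= (2 * T + 3) * ln (real M)" by (simp add: algebra_simps)
 qed (use C nu k in auto)
 finally have 1: "(\<Sum>l=1..j. k * \<theta> l) <= C * (4 * T + 6) * (\<nu> + k) * ln (real M)" by (simp add: algebra_simps)
 have "(\<Sum>p\<in>I. hat (xs p) (xs i)) <= real (card I) * 1"
  using hat_bounds xs I assms by (intro sum_bounded_above) auto
 also have "\<dots> <= 4" using I(2) by simp
 finally have "2 * C * \<nu> * (\<Sum>p\<in>I. hat (xs p) (xs i)) <= 2 * C * \<nu> * 4" using C nu by (intro mult_left_mono) auto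
 also have "\<dots> <= 8 * C * (\<nu> + k) * 1" using C k by (simp add: mult_left_mono algebra_simps)
 also have "\<dots> <= 8 * C * (\<nu> + k) * (2 * ln (real M))" using ln_M C nu k by (intro mult_left_mono) auto
 finally have 2: "2 * C * \<nu> * (\<Sum>p\<in>I. hat (xs p) (xs i)) <= C * 16 * (\<nu> + k) * ln (real M)" by (simp add: algebra_simps)
 have "C * (4 * T + 22) * (\<nu> + k) * ln (real M) = C * (4 * T + 6) * (\<nu> + k) * ln (real M) + C * 16 * (\<nu> + k) * ln (real M)"
  by (simp add: algebra_simps)
 then show ?thesis using 1 2 unfolding W_def by linarith
qed

text \<open>Three contributions: the nodal errors, averaged with nonnegative weights summing to 1;
  the variation in time over one cell, by Lipschitz continuity; and linear interpolation in space at
  the upper level of the cell. The upper level is chosen because it lies at positive time, where the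
  spatial estimate is available.\<close>

lemma interpolation_error:
 assumes x: "0 <= x" "x <= 1" and t: "0 <= t" "t <= T"
 shows "abs (y x t - bilinear_interp xs ts Y x t) <= C * (4 * T + 26) * (\<nu> + k) * ln (real M)"
proof -
 define i where "i = (LEAST i. 1 <= i \<and> x <= xs i)"
 define j where "j = (LEAST j. 1 <= j \<and> t <= ts j)"
 have i: "1 <= i" "i <= N" "xs (i - 1) <= x" "x <= xs i"
  using cell_exists[of xs x N] xs(1,2) x NM unfolding i_def by auto
 have tM: "ts M = T" using NM by (simp add: tmesh_def)
 have j: "1 <= j" "j <= M" "ts (j - 1) <= t" "t <= ts j"
  using cell_exists[of ts t M] t NM tM unfolding j_def by (auto simp: tmesh_def)
 define p where "p = (x - xs (i - 1)) / (xs i - xs (i - 1))"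
 define q where "q = (t - ts (j - 1)) / (ts j - ts (j - 1))"
 define h where "h = xs i - xs (i - 1)"
 have h: "0 < h" using xs(3)[of "i - 1"] i by (simp add: h_def)
 have p: "0 <= p" "p <= 1" using i h by (auto simp: p_def h_def[symmetric] pos_divide_le_eq) (simp add: h_def)
 have q: "0 <= q" "q <= 1" using j k ts(2)[OF j(1)] by (auto simp: q_def pos_divide_le_eq)
 define B where "B U = (1 - p) * (1 - q) * U (i - 1) (j - 1) + p * (1 - q) * U i (j - 1)
     + (1 - p) * q * U (i - 1) j + p * q * U i j" for U :: "nat => nat => real"
 have Beq: "bilinear_interp xs ts U x t = B U" for U
  by (simp add: bilinear_interp_def Let_def B_def i_def j_def p_def q_def)
 have Bdiff: "B U - B V = B (\<lambda>i j. U i j - V i j)" for U V by (simp add: B_def algebra_simps)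
 have Bconst: "B (\<lambda>i j. r) = r" for r by (simp add: B_def algebra_simps)
 have Bmono: "abs (B U) <= r" if "\<And>i' j'. i' \<in> {i - 1, i} ==> j' \<in> {j - 1, j} ==> abs (U i' j') <= r" for U r
 proof -
  have w: "abs (v * u) <= v * r" if "0 <= v" "abs u <= r" for u v using that by (simp add: abs_mult mult_left_mono)
  have "abs ((1 - p) * (1 - q) * U (i - 1) (j - 1)) <= (1 - p) * (1 - q) * r" "abs (p * (1 - q) * U i (j - 1)) <= p * (1 - q) * r"
   "abs ((1 - p) * q * U (i - 1) j) <= (1 - p) * q * r" "abs (p * q * U i j) <= p * q * r"
   using p q that by (intro w; simp)+
  note r = add_mono[OF add_mono[OF add_mono[OF this(1) this(2)] this(3)] this(4)]
  have "abs (u1 + u2 + u3 + u4) <= abs u1 + abs u2 + abs u3 + abs u4" for u1 u2 u3 u4 :: real by linarith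
  then have "abs (B U) <= B (\<lambda>i j. r)" unfolding B_def by (rule order_trans[OF _ r])
  then show ?thesis unfolding Bconst .
 qed
 let ?E = "C * (4 * T + 22) * (\<nu> + k) * ln (real M)"
 have "abs (B (\<lambda>i j. y (xs i) (ts j)) - B Y) <= ?E"
  unfolding Bdiff
 proof (rule Bmono)
  fix i' j' assume "i' \<in> {i - 1, i}" "j' \<in> {j - 1, j}"
  then have "i' <= N" "j' <= M" using i j by auto
  from nodal_error[OF this] W_le[OF this] show "abs (y (xs i') (ts j') - Y i' j') <= ?E" by (simp add: abs_minus_commute)
 qed
 moreover have "abs (B (\<lambda>i j'. y (xs i) (ts j)) - B (\<lambda>i j. y (xs i) (ts j))) <= C * k"
  unfolding Bdiff
 proof (rule Bmono)
  fix i' j' assume ij: "i' \<in> {i - 1, i}" "j' \<in> {j - 1, j}"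
  have "abs (ts j - ts j') <= k" using ij(2) ts(2)[OF j(1)] k by auto
  then have "C * abs (ts j - ts j') <= C * k" using C by (rule mult_left_mono)
  moreover have "abs (y (xs i') (ts j) - y (xs i') (ts j')) <= C * abs (ts j - ts j')"
   using approx_okD(1)[OF y, of "xs i'" "ts j'" "ts j"] ij i j xs(4,5)[of i'] ts(3,4)[of j] ts(3,4)[of j'] by auto
  ultimately show "abs (y (xs i') (ts j) - y (xs i') (ts j')) <= C * k" by linarith
 qed
 moreover have "abs (y x t - y x (ts j)) <= C * k"
 proof -
  have "abs (y x t - y x (ts j)) <= C * abs (t - ts j)"
   using approx_okD(1)[OF y, of x "ts j" t] x t ts(3,4)[of j] j by auto
  also have "\<dots> <= C * k" using C j ts(2)[OF j(1)] by (intro mult_left_mono) auto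
  finally show ?thesis .
 qed
 moreover have "abs (y x (ts j) - B (\<lambda>i j'. y (xs i) (ts j))) <= C * \<nu>"
 proof -
  have Bx: "B (\<lambda>i j'. y (xs i) (ts j)) = (1 - p) * y (xs (i - 1)) (ts j) + p * y (xs i) (ts j)"
   by (simp add: B_def algebra_simps)
  define a c where "a = x - xs (i - 1)" and "c = xs i - x"
  have ac: "0 <= a" "0 <= c" "a + c = h" "p = a / h" "x - a = xs (i - 1)" "x + c = xs i"
   using i by (auto simp: a_def c_def h_def p_def)
  have tj: "0 < ts j" "ts j <= T" using ts_ge[OF j(1)] k ts(3)[OF j(2)] by auto
  show ?thesis
  proof (cases "0 < a \<and> 0 < c")
   case True
   have "1 - p = c / h" using ac h by (simp add: field_simps)
   then have "B (\<lambda>i j'. y (xs i) (ts j)) - y x (ts j) = interp_err a c (\<lambda>x. y x (ts j)) x"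
    unfolding Bx interp_err_def ac(3,5,6) by (simp add: ac(4) add_divide_distrib)
   moreover have "abs (interp_err a c (\<lambda>x. y x (ts j)) x) <= C * \<nu>"
   proof (rule approx_okD(5)[OF y _ _ _ _ tj nu])
    have "a * c <= h * h" using ac by (intro mult_mono) auto
    then have le: "a * c <= (xs i - xs (i - 1))^2" by (simp add: h_def power2_eq_square)
    have "(xs (Suc (i - 1)) - xs (i - 1))^2 <= eps * \<nu> \<or>
     (xs (Suc (i - 1)) - xs (i - 1))^2 <= \<nu> \<and> small_layer m P eps \<nu> (xs (i - 1)) (xs (Suc (i - 1)))"
     by (rule mesh_cell) (use i in simp)
    then show "a * c <= eps * \<nu> \<or> a * c <= \<nu> \<and> small_layer m P eps \<nu> (x - a) (x + c)"
     unfolding ac(5,6) using le i by auto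
   qed (use True ac xs(4)[of "i - 1"] xs(5)[of i] i in auto)
   ultimately show ?thesis by (simp add: abs_minus_commute)
  next
   case False
   then consider "x = xs (i - 1)" | "x = xs i" using ac by (auto simp: a_def c_def)
   then have "B (\<lambda>i j'. y (xs i) (ts j)) = y x (ts j)"
    unfolding Bx p_def using h by cases (auto simp: h_def)
   then show ?thesis using C nu by simp
  qed
 qed
 ultimately have "abs (y x t - B Y) <= ?E + C * k + C * k + C * \<nu>" by linarith
 also have "\<dots> <= ?E + 2 * C * (\<nu> + k) * 1" using C nu by (simp add: algebra_simps)
 also have "\<dots> <= ?E + 2 * C * (\<nu> + k) * (2 * ln (real M))" using ln_M C nu k by (intro add_left_mono mult_left_mono) auto
 also have "\<dots> = C * (4 * T + 26) * (\<nu> + k) * ln (real M)" by (simp add: algebra_simps)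
 finally show ?thesis unfolding Beq .
qed

end

section \<open>The meshes\<close>

lemma small_layer_append:
 "small_layer m P eps \<nu> l c ==> small_layer m P eps \<nu> c r ==> small_layer m P eps \<nu> l r"
 unfolding small_layer_def by (metis atLeastAtMost_iff nle_le)

text \<open>At a node with equal neighbouring cells the conditions on single cells suffice: either
  both cells are fine, or both lie where the layers are small and their union does too.\<close>

lemma mesh_okI:
 fixes xs :: "nat => real"
 assumes "xs 0 = 0" "xs N = 1" and mono: "\<And>i. i < N ==> xs i < xs (Suc i)"
  and I: "finite I" "card I <= 4" "\<And>i. i \<in> I ==> i <= N" and eps: "0 < eps" "eps <= 1" and nu: "0 <= \<nu>"
  and cell: "\<And>i. i < N ==> (xs (Suc i) - xs i)^2 <= eps * \<nu> \<or>
    (xs (Suc i) - xs i)^2 <= \<nu> \<and> small_layer m P eps \<nu> (xs i) (xs (Suc i))"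
  and inner: "\<And>i. 0 < i ==> i < N ==> i \<notin> I ==> xs i - xs (i - 1) = xs (Suc i) - xs i"
  and trans: "\<And>i. 0 < i ==> i < N ==> i \<in> I ==>
    small_layer m P eps \<nu> (xs (i - 1)) (xs (Suc i)) \<or> far_from P (xs (i - 1)) (xs (Suc i))"
 shows "mesh_ok eps m P \<nu> I N xs"
 unfolding mesh_ok_def
proof (intro conjI allI impI ballI; (elim conjE)?)
 have en: "eps * \<nu> <= \<nu>" using eps nu by (simp add: mult_left_le_one_le)
 have le: "(xs (Suc i) - xs i)^2 <= \<nu>" if "i < N" for i using cell[OF that] en by linarith
 fix i assume i: "0 < i" "i < N"
 have Si: "Suc (i - 1) = i" "i - 1 < N" using i by auto
 show "(xs i - xs (i - 1) = xs (Suc i) - xs i \<and>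
      ((xs i - xs (i - 1))^2 <= eps * \<nu> \<or>
      (xs i - xs (i - 1))^2 <= \<nu> \<and> small_layer m P eps \<nu> (xs (i - 1)) (xs (Suc i)))) \<or>
    (i \<in> I \<and> (xs i - xs (i - 1))^2 <= \<nu> \<and> (xs (Suc i) - xs i)^2 <= \<nu> \<and>
      (small_layer m P eps \<nu> (xs (i - 1)) (xs (Suc i)) \<or> far_from P (xs (i - 1)) (xs (Suc i))))"
 proof (cases "i \<in> I")
  case True
  then show ?thesis using trans[OF i True] le[of i] le[of "i - 1"] i Si by auto
 next
  case False
  have eq: "xs i - xs (i - 1) = xs (Suc i) - xs i" by (rule inner[OF i False])
  show ?thesis
  proof (cases "(xs i - xs (i - 1))^2 <= eps * \<nu>")
   case True then show ?thesis using eq by blast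
  next
   case False
   moreover from this have "\<not> (xs (Suc i) - xs i)^2 <= eps * \<nu>" unfolding eq .
   ultimately have "small_layer m P eps \<nu> (xs (i - 1)) (xs i)" "small_layer m P eps \<nu> (xs i) (xs (Suc i))"
    using cell[OF Si(2)] cell[OF i(2)] unfolding Si(1) by blast+
   then have "small_layer m P eps \<nu> (xs (i - 1)) (xs (Suc i))" by (rule small_layer_append)
   moreover have "(xs i - xs (i - 1))^2 <= \<nu>" using le[of "i - 1"] Si by simp
   ultimately show ?thesis using eq by blast
  qed
 qed
qed (use assms in auto)

definition rate :: "nat => real" where "rate N = (ln (real N) / real N)^2"

text \<open>The first summand serves the fine cells, including the case where the transition width
  is capped (16 times \<open>8^2\<close> times 16 is 16384); 64 comes from coarse cells of width at
  most \<open>8 / N\<close>; \<open>exp 16\<close> is the price of moving from the transition point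
  by one fine cell towards the layer.\<close>

definition mesh_const :: "real => real => real" where
 "mesh_const \<mu> T = 16384 * T / \<mu>^2 + 64 + exp 16"

section \<open>Transition widths and layer-adapted meshes\<close>

locale shishkin =
 fixes T \<mu> eps :: real and N :: nat
 assumes T: "0 < T" and mu: "0 < \<mu>" and eps: "0 < eps" "eps <= 1" and N: "4 <= N"
begin

text \<open>The decay rate for which the layer function at distance \<open>w\<close> is exactly
  \<open>N^(-2)\<close>, since \<open>m * w / sqrt eps = 2 * ln N\<close>.\<close>

definition "m = \<mu> / (2 * sqrt T)"
definition "w = 4 / \<mu> * sqrt (eps * T) * ln (real N)"
definition "\<nu> = mesh_const \<mu> T * rate N"

lemma ln_N: "1 <= ln (real N)"
proof -
 have "ln (2 * 2) <= ln (real N)" using N by simp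
 moreover have "ln (2 * 2 :: real) = ln 2 + ln 2" by (rule ln_mult_pos) auto
 ultimately show ?thesis using ln2_ge_two_thirds by linarith
qed

lemma rate_ge: "1 / (real N)^2 <= rate N" "0 <= rate N"
 using ln_N N by (auto simp: rate_def power_divide divide_right_mono)

lemma mesh_const: "exp 16 <= mesh_const \<mu> T" "64 <= mesh_const \<mu> T" "16384 * T / \<mu>^2 <= mesh_const \<mu> T"
 using T mu exp_ge_zero[of "16::real"] by (simp_all add: mesh_const_def)

lemma m_pos: "0 < m" using T mu by (simp add: m_def)

lemma w_pos: "0 < w" using T mu eps ln_N by (simp add: w_def)

lemma nu_nonneg: "0 <= \<nu>" using mesh_const rate_ge by (simp add: \<nu>_def)

lemma nu_ge: "64 / (real N)^2 <= \<nu>"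
proof -
 have "64 * (1 / (real N)^2) <= mesh_const \<mu> T * rate N" using mesh_const rate_ge by (intro mult_mono) auto
 then show ?thesis by (simp add: \<nu>_def)
qed

text \<open>The fine widths are \<open>4 * w / N\<close> and \<open>8 * w / N\<close> on the two
  kinds of mesh, a quarter and a half of the width used here; the factor 4 on the right is tuned to
  the larger one.\<close>

lemma fine_layer: "(16 * w / real N)^2 <= eps * \<nu> * 4"
proof -
 have "w^2 = 16 / \<mu>^2 * (eps * T) * (ln (real N))^2" using eps T by (simp add: w_def power_mult_distrib power_divide)
 then have "(16 * w / real N)^2 = 4096 * T / \<mu>^2 * eps * rate N"
  by (simp add: power_mult_distrib power_divide rate_def)
 also have "\<dots> <= 16384 * T / \<mu>^2 * eps * rate N"
  using T eps rate_ge by (intro mult_right_mono) (auto simp: divide_right_mono)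
 also have "\<dots> <= mesh_const \<mu> T * eps * rate N" using mesh_const eps rate_ge by (intro mult_right_mono) auto
 also have "\<dots> <= eps * \<nu> * 4" using nu_nonneg eps by (simp add: \<nu>_def mult_ac)
 finally show ?thesis .
qed

text \<open>If the uncapped width \<open>w\<close> reaches the cap, then
  \<open>eps * (ln N)^2\<close> is bounded below and any cell of width \<open>4 / N\<close> already
  counts as fine.\<close>

lemma fine_global: "c <= w ==> 1 / 8 <= c ==> (4 / real N)^2 <= eps * \<nu>"
proof -
 assume "c <= w" "1 / 8 <= c"
 then have "(1/8)^2 <= w^2" by (intro power_mono) auto
 moreover have "w^2 = 16 / \<mu>^2 * (eps * T) * (ln (real N))^2" using eps T by (simp add: w_def power_mult_distrib power_divide)
 moreover have "64 * (1/8 :: real)^2 = 1" by (simp add: power2_eq_square)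
 ultimately have "1 <= 64 * (16 / \<mu>^2 * (eps * T) * (ln (real N))^2)" by linarith
 also have "\<dots> = 1024 * T / \<mu>^2 * eps * (ln (real N))^2" by simp
 finally have "1 <= 1024 * T / \<mu>^2 * eps * (ln (real N))^2" .
 then have "16 / (real N)^2 * 1 <= 16 / (real N)^2 * (1024 * T / \<mu>^2 * eps * (ln (real N))^2)"
  by (intro mult_left_mono) auto
 also have "\<dots> = 16384 * T / \<mu>^2 * (eps * rate N)" by (simp add: rate_def power_divide mult_ac)
 also have "\<dots> <= mesh_const \<mu> T * (eps * rate N)" using mesh_const eps rate_ge by (intro mult_right_mono) auto
 finally show ?thesis by (simp add: \<nu>_def power_divide mult_ac)
qed

lemma coarse: "0 <= h ==> h <= 8 / real N ==> h^2 <= \<nu>"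
proof -
 assume "0 <= h" "h <= 8 / real N"
 then have "h^2 <= (8 / real N)^2" by (intro power_mono) auto
 then show ?thesis using nu_ge by (simp add: power_divide)
qed

text \<open>At distance \<open>w\<close> from a layer, the layer function is \<open>N^-2\<close>, and moving towards
 the layer by one fine mesh width costs only a constant factor.\<close>

lemma layer_small:
 assumes "w - s <= abs (z - p)" "s <= 8 * w / real N"
 shows "exp (- (m * (abs (z - p) / sqrt eps))) <= \<nu>"
proof -
 have mw: "m * (w / sqrt eps) = 2 * ln (real N)"
  using T mu eps by (simp add: m_def w_def real_sqrt_mult field_simps)
 have "w * (1 - 8 / real N) <= abs (z - p)" using assms by (simp add: algebra_simps)
 then have "m * (w * (1 - 8 / real N) / sqrt eps) <= m * (abs (z - p) / sqrt eps)"
  using m_pos eps by (intro mult_left_mono divide_right_mono) auto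
 moreover have "m * (w * (1 - 8 / real N) / sqrt eps) = m * (w / sqrt eps) * (1 - 8 / real N)" by simp
 moreover have "ln (real N) / real N <= 1" using ln_le_minus_one[of "real N"] N by simp
 moreover have "2 * ln (real N) * (1 - 8 / real N) = 2 * ln (real N) - 16 * (ln (real N) / real N)"
  by (simp add: algebra_simps)
 ultimately have "- (m * (abs (z - p) / sqrt eps)) <= 16 - 2 * ln (real N)" unfolding mw by linarith
 then have "exp (- (m * (abs (z - p) / sqrt eps))) <= exp (16 - 2 * ln (real N))" by simp
 also have "\<dots> = exp 16 * (1 / (real N)^2)"
 proof -
  have "exp (2 * ln (real N)) = (real N)^2" using N exp_of_nat_mult[of 2 "ln (real N)"] by simp
  then show ?thesis by (simp add: exp_diff)
 qed
 also have "\<dots> <= mesh_const \<mu> T * rate N" using mesh_const rate_ge by (intro mult_mono) auto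
 finally show ?thesis by (simp add: \<nu>_def)
qed

lemma small_layerI:
 assumes "\<And>p z. p \<in> P ==> l <= z ==> z <= r ==> w - s <= abs (z - p)" "s <= 8 * w / real N"
 shows "small_layer m P eps \<nu> l r"
 unfolding small_layer_def using layer_small[OF _ assms(2)] assms(1) by auto

lemma mesh13_ok:
 assumes dv: "4 dvd N"
 shows "\<exists>I. mesh_ok eps m {0, 1} \<nu> I N (mesh13 \<mu> T eps N)"
proof -
 obtain n where n: "N = 4 * n" using dv by auto
 then have n0: "0 < n" "N div 4 = n" "N div 2 = 2 * n" using N by auto
 define \<sigma> where "\<sigma> = min (1/4) w"
 have s: "0 < \<sigma>" "\<sigma> <= 1/4" using w_pos by (auto simp: \<sigma>_def)
 define xs where "xs = mesh13 \<mu> T eps N"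
 have xs_eq: "xs i = pw_mesh [(\<sigma>, n), (1 - \<sigma>, 2 * n), (1, n)] 0 i" for i
  by (simp add: xs_def mesh13_def Let_def n0 \<sigma>_def trans_width_def w_def)
 have x1: "xs i = \<sigma> * real i / real n" if "i <= n" for i using that by (simp add: xs_eq)
 have x2: "xs i = \<sigma> + (1 - 2 * \<sigma>) * (real i - real n) / (2 * real n)" if "n <= i" "i <= 3 * n" for i
  using that n0 by (cases "i = n") (auto simp: xs_eq of_nat_diff)
 have x3: "xs i = 1 - \<sigma> + \<sigma> * (real i - 3 * real n) / real n" if "3 * n <= i" "i <= N" for i
 proof (cases "i = 3 * n")
  case True then show ?thesis using n0 by (simp add: x2)
 next
  case False
  then show ?thesis using that n0 n by (auto simp: xs_eq of_nat_diff)
 qed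
 have h1: "xs (Suc i) - xs i = \<sigma> / real n" if "i < n \<or> 3 * n <= i \<and> i < N" for i
  using that n0 by (auto simp: x1 x3 field_simps)
 have h2: "xs (Suc i) - xs i = (1 - 2 * \<sigma>) / (2 * real n)" if "n <= i" "i < 3 * n" for i
  using that n0 by (simp add: x2 field_simps)
 have mid: "\<sigma> <= xs i" "xs i <= 1 - \<sigma>" if "n <= i" "i <= 3 * n" for i
 proof -
  have "0 <= (1 - 2 * \<sigma>) * (real i - real n) / (2 * real n)" using that s by simp
  moreover have "(1 - 2 * \<sigma>) * ((real i - real n) / (2 * real n)) <= (1 - 2 * \<sigma>) * 1"
   using that s n0 by (intro mult_left_mono) auto
  ultimately show "\<sigma> <= xs i" "xs i <= 1 - \<sigma>" unfolding x2[OF that] by auto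
 qed
 have hN: "\<sigma> / real n = 4 * \<sigma> / real N" "(1 - 2 * \<sigma>) / (2 * real n) = 2 * (1 - 2 * \<sigma>) / real N"
  using n n0 by (auto simp: field_simps)
 have pos: "0 < \<sigma> / real n" "0 < (1 - 2 * \<sigma>) / (2 * real n)" using s n0 by auto
 have mono: "xs i < xs (Suc i)" if "i < N" for i
  using h1[of i] h2[of i] pos that by (cases "n <= i \<and> i < 3 * n") auto
 have ends: "xs 0 = 0" "xs N = 1" using n0 n by (auto simp: x1 x3)
 show ?thesis
 proof (cases "w < 1 / 4")
  case False
  then have s4: "\<sigma> = 1/4" "1/4 <= w" by (auto simp: \<sigma>_def)
  \<comment> \<open>With the width capped at 1/4 the three pieces have the same spacing, the mesh is
    uniform and there are no transition nodes.\<close>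
  have hh: "xs (Suc i) - xs i = 1 / real N" if "i < N" for i
   using h1[of i] h2[of i] that s4 n by (cases "n <= i \<and> i < 3 * n") auto
  have N2: "(1 / real N)^2 <= (4 / real N)^2" by (intro power_mono divide_right_mono) auto
  have "mesh_ok eps m {0, 1} \<nu> {} N xs"
  proof (rule mesh_okI[OF ends mono _ _ _ eps nu_nonneg])
   show "(xs (Suc i) - xs i)^2 <= eps * \<nu> \<or> (xs (Suc i) - xs i)^2 <= \<nu> \<and> small_layer m {0, 1} eps \<nu> (xs i) (xs (Suc i))"
    if "i < N" for i
    unfolding hh[OF that] using order_trans[OF N2 fine_global[of "1/4"]] s4 by simp
   show "xs i - xs (i - 1) = xs (Suc i) - xs i" if "0 < i" "i < N" for i
    using hh[of i] hh[of "i - 1"] that by simp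
  qed auto
  then show ?thesis unfolding xs_def by blast
 next
  case True
  then have sw: "\<sigma> = w" by (simp add: \<sigma>_def)
  have fine: "(\<sigma> / real n)^2 <= eps * \<nu>"
  proof -
   have "(\<sigma> / real n)^2 = (16 * w / real N)^2 / 16" unfolding hN unfolding sw by (simp add: power_divide power_mult_distrib)
   moreover have "0 <= eps * \<nu>" using nu_nonneg eps by simp
   ultimately show ?thesis using fine_layer by linarith
  qed
  have out: "small_layer m {0, 1} eps \<nu> (xs i) (xs j)" if "n <= i" "i <= j" "j <= 3 * n" for i j
   by (rule small_layerI[of _ _ _ 0]) (use mid[of i] mid[of j] that sw w_pos in auto)
  have "mesh_ok eps m {0, 1} \<nu> {n, 3 * n} N xs"
  proof (rule mesh_okI[OF ends mono _ _ _ eps nu_nonneg])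
   show "card {n, 3 * n} <= 4" by (rule order_trans[OF card_insert_le_m1]) auto
   show "(xs (Suc i) - xs i)^2 <= eps * \<nu> \<or> (xs (Suc i) - xs i)^2 <= \<nu> \<and> small_layer m {0, 1} eps \<nu> (xs i) (xs (Suc i))"
    if i: "i < N" for i
   proof (cases "n <= i \<and> i < 3 * n")
    case True
    have "2 * (1 - 2 * \<sigma>) / real N <= 8 / real N" using s by (intro divide_right_mono) auto
    then show ?thesis using coarse[of "xs (Suc i) - xs i"] h2[of i] hN pos out[of i "Suc i"] True by auto
   next
    case False
    then show ?thesis using h1[of i] i fine by auto
   qed
   show "xs i - xs (i - 1) = xs (Suc i) - xs i" if "0 < i" "i < N" "i \<notin> {n, 3 * n}" for i
   proof -
    have e: "Suc (i - 1) = i" using that by simp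
    have neq: "i \<noteq> n" "i \<noteq> 3 * n" using that by auto
    consider "i < n" | "n < i" "i < 3 * n" | "3 * n < i" using neq by linarith
    then show ?thesis
    proof cases
     case 2
     then have "n <= i - 1" "i - 1 < 3 * n" by auto
     then show ?thesis using h2[of i] h2[of "i - 1"] 2 unfolding e by simp
    qed (use h1[of i] h1[of "i - 1"] that(2) e in \<open>auto simp: less_diff_conv2\<close>)
   qed
   show "small_layer m {0, 1} eps \<nu> (xs (i - 1)) (xs (Suc i)) \<or> far_from {0, 1} (xs (i - 1)) (xs (Suc i))"
    if "0 < i" "i < N" "i \<in> {n, 3 * n}" for i
   proof (rule disjI1, rule small_layerI[where s="\<sigma> / real n"])
    show "\<sigma> / real n <= 8 * w / real N" unfolding hN unfolding sw using w_pos by (simp add: divide_right_mono)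
    fix p z assume p: "p \<in> {0, 1 :: real}" and z: "xs (i - 1) <= z" "z <= xs (Suc i)"
    have "w - \<sigma> / real n <= z \<and> z <= 1 - w + \<sigma> / real n"
    proof (cases "i = n")
     case True
     have "Suc (n - 1) = n" using n0 by simp
     then have "xs n - xs (n - 1) = \<sigma> / real n" using h1[of "n - 1"] n0 by simp
     then show ?thesis using z True mid[of n] mid[of "Suc n"] n0 sw pos by auto
    next
     case False
     then have i3: "i = 3 * n" using that by simp
     have e: "Suc (3 * n - 1) = 3 * n" using n0 by simp
     have "xs (Suc (3 * n)) - xs (3 * n) = \<sigma> / real n" using h1[of "3 * n"] n n0 by simp
     moreover have "n <= 3 * n - 1" using n0(1) by linarith
     ultimately show ?thesis using z mid[of "3 * n"] mid[of "3 * n - 1"] n0(1) sw pos unfolding i3 by simp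
    qed
    then show "w - \<sigma> / real n <= abs (z - p)" using p by auto
   qed
  qed (use n0 n in auto)
  then show ?thesis unfolding xs_def by blast
 qed
qed

text \<open>Even with a capped width this mesh is in general not uniform, as \<open>d\<close> is
  arbitrary, so the four transition nodes stay. In that case all cells are fine, and the nodes are
  handled by their fixed distance from the poles.\<close>

lemma mesh2_ok:
 assumes dv: "8 dvd N" and d: "0 < d" "d < 1"
  and mono: "\<And>i. i < N ==> mesh2 \<mu> T d eps N i < mesh2 \<mu> T d eps N (Suc i)"
 shows "\<exists>I. mesh_ok eps m {0, d, 1} \<nu> I N (mesh2 \<mu> T d eps N)"
proof -
 obtain n where n: "N = 8 * n" using dv by auto
 then have n0: "0 < n" "N div 8 = n" "N div 4 = 2 * n" using N by auto
 define \<tau> where "\<tau> = min (1/8) w"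
 have s: "0 < \<tau>" "\<tau> <= 1/8" using w_pos by (auto simp: \<tau>_def)
 define xs where "xs = mesh2 \<mu> T d eps N"
 have xs_eq: "xs i = pw_mesh [(\<tau>, n), (d - \<tau>, 2 * n), (d + \<tau>, 2 * n), (1 - \<tau>, 2 * n), (1, n)] 0 i" for i
  by (simp add: xs_def mesh2_def Let_def n0 \<tau>_def trans_width_def w_def)
 have x1: "xs i = \<tau> * real i / real n" if "i <= n" for i using that by (simp add: xs_eq)
 have x2: "xs i = \<tau> + (d - 2 * \<tau>) * (real i - real n) / (2 * real n)" if "n <= i" "i <= 3 * n" for i
  using that n0 by (cases "i = n") (auto simp: xs_eq of_nat_diff)
 have x3: "xs i = d - \<tau> + \<tau> * (real i - 3 * real n) / real n" if "3 * n <= i" "i <= 5 * n" for i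
 proof (cases "i = 3 * n")
  case True then show ?thesis using n0 by (simp add: x2)
 next
  case False
  then have "\<not> i <= n" "\<not> i - n <= 2 * n" "i - n - 2 * n <= 2 * n" using that n0(1) by linarith+
  moreover have "real (i - n - 2 * n) = real i - 3 * real n" using that by (simp add: of_nat_diff)
  ultimately show ?thesis
   by (simp only: xs_eq pw_mesh.simps if_False if_True simp_thms) simp
 qed
 have x4: "xs i = d + \<tau> + (1 - d - 2 * \<tau>) * (real i - 5 * real n) / (2 * real n)" if "5 * n <= i" "i <= 7 * n" for i
 proof (cases "i = 5 * n")
  case True then show ?thesis using n0 by (simp add: x3)
 next
  case False
  then have "\<not> i <= n" "\<not> i - n <= 2 * n" "\<not> i - n - 2 * n <= 2 * n" "i - n - 2 * n - 2 * n <= 2 * n"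
   using that n0(1) by linarith+
  moreover have "real (i - n - 2 * n - 2 * n) = real i - 5 * real n" using that by (simp add: of_nat_diff)
  ultimately show ?thesis
   by (simp only: xs_eq pw_mesh.simps if_False if_True simp_thms) simp
 qed
 have x5: "xs i = 1 - \<tau> + \<tau> * (real i - 7 * real n) / real n" if "7 * n <= i" "i <= N" for i
 proof (cases "i = 7 * n")
  case True then show ?thesis using n0 by (simp add: x4)
 next
  case False
  then have "\<not> i <= n" "\<not> i - n <= 2 * n" "\<not> i - n - 2 * n <= 2 * n"
   "\<not> i - n - 2 * n - 2 * n <= 2 * n" "i - n - 2 * n - 2 * n - 2 * n <= n"
   using that n n0(1) by linarith+
  moreover have "real (i - n - 2 * n - 2 * n - 2 * n) = real i - 7 * real n" using that by (simp add: of_nat_diff)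
  ultimately show ?thesis
   by (simp only: xs_eq pw_mesh.simps if_False if_True simp_thms) simp
 qed
 have h1: "xs (Suc i) - xs i = \<tau> / real n" if "i < n \<or> 3 * n <= i \<and> i < 5 * n \<or> 7 * n <= i \<and> i < N" for i
  using that n0 by (auto simp: x1 x3 x5 field_simps)
 have h2: "xs (Suc i) - xs i = (d - 2 * \<tau>) / (2 * real n)" if "n <= i" "i < 3 * n" for i
  using that n0 by (simp add: x2 field_simps)
 have h4: "xs (Suc i) - xs i = (1 - d - 2 * \<tau>) / (2 * real n)" if "5 * n <= i" "i < 7 * n" for i
  using that n0 by (simp add: x4 field_simps)
 have mono': "xs i < xs (Suc i)" if "i < N" for i using mono[OF that] by (simp add: xs_def)
 have le: "xs i <= xs j" if "i <= j" "j <= N" for i j by (rule strict_mono_mesh[of N xs, OF mono' that])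
 \<comment> \<open>Increasing nodes mean that the coarse pieces have positive length, so the layer
   region around \<open>d\<close> overlaps neither boundary layer region.\<close>
 have "0 < (d - 2 * \<tau>) / (2 * real n)" using mono'[of n] h2[of n] n n0 by simp
 then have p2: "0 < d - 2 * \<tau>" using n0 by (simp add: zero_less_divide_iff)
 have "0 < (1 - d - 2 * \<tau>) / (2 * real n)" using mono'[of "5 * n"] h4[of "5 * n"] n n0 by simp
 then have p4: "0 < 1 - d - 2 * \<tau>" using n0 by (simp add: zero_less_divide_iff)
 have at: "xs n = \<tau>" "xs (3 * n) = d - \<tau>" "xs (5 * n) = d + \<tau>" "xs (7 * n) = 1 - \<tau>"
  using n0 x1[of n] x3[of "3 * n"] x4[of "5 * n"] x5[of "7 * n"] n by auto
 have mid2: "\<tau> <= xs i" "xs i <= d - \<tau>" if "n <= i" "i <= 3 * n" for i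
  using le[of n i] le[of i "3 * n"] at that n by auto
 have mid4: "d + \<tau> <= xs i" "xs i <= 1 - \<tau>" if "5 * n <= i" "i <= 7 * n" for i
  using le[of "5 * n" i] le[of i "7 * n"] at that n by auto
 have hN: "\<tau> / real n = 8 * \<tau> / real N" "(d - 2 * \<tau>) / (2 * real n) = 4 * (d - 2 * \<tau>) / real N"
  "(1 - d - 2 * \<tau>) / (2 * real n) = 4 * (1 - d - 2 * \<tau>) / real N"
  using n n0 by (auto simp: field_simps)
 have pos: "0 < \<tau> / real n" "0 < (d - 2 * \<tau>) / (2 * real n)" "0 < (1 - d - 2 * \<tau>) / (2 * real n)"
  using s n0 p2 p4 by auto
 have h24: "(d - 2 * \<tau>) / (2 * real n) <= 4 / real N" "(1 - d - 2 * \<tau>) / (2 * real n) <= 4 / real N"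
  unfolding hN using d s by (auto intro!: divide_right_mono)
 have ends: "xs 0 = 0" "xs N = 1" using n0 n by (auto simp: x1 x5)
 let ?I = "{n, 3 * n, 5 * n, 7 * n}"
 have cardI: "card ?I <= 4" using card_insert_le_m1[of 4] by (simp add: card_insert_if)
 have inner: "xs i - xs (i - 1) = xs (Suc i) - xs i" if "0 < i" "i < N" "i \<notin> ?I" for i
 proof -
  have e: "Suc (i - 1) = i" using that by simp
  have neq: "i \<noteq> n" "i \<noteq> 3 * n" "i \<noteq> 5 * n" "i \<noteq> 7 * n" using that by auto
  consider "i < n \<or> 3 * n < i \<and> i < 5 * n \<or> 7 * n < i" | "n < i" "i < 3 * n" | "5 * n < i" "i < 7 * n"
   using neq by linarith
  then show ?thesis
  proof cases
   case 1
   then have "xs (Suc (i - 1)) - xs (i - 1) = \<tau> / real n" "xs (Suc i) - xs i = \<tau> / real n"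
    using that by (intro h1; linarith)+
   then show ?thesis unfolding e by simp
  next
   case 2
   then have "n <= i - 1" "i - 1 < 3 * n" by auto
   then show ?thesis using h2[of i] h2[of "i - 1"] 2 unfolding e by simp
  next
   case 3
   then have "5 * n <= i - 1" "i - 1 < 7 * n" by auto
   then show ?thesis using h4[of i] h4[of "i - 1"] 3 unfolding e by simp
  qed
 qed
 have cell_cases: "i < n \<or> 3 * n <= i \<and> i < 5 * n \<or> 7 * n <= i \<and> i < N \<or> n <= i \<and> i < 3 * n \<or> 5 * n <= i \<and> i < 7 * n"
  if "i < N" for i using that n by linarith
 have step: "xs i - xs (i - 1) = \<tau> / real n" if "i = n \<or> i = 5 * n" for i
 proof -
  have e: "Suc (i - 1) = i" using that n0 by auto
  have "i - 1 < n \<or> 3 * n <= i - 1 \<and> i - 1 < 5 * n" using that n0(1) by linarith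
  then show ?thesis using h1[of "i - 1"] unfolding e by blast
 qed
 have step': "xs (Suc i) - xs i = \<tau> / real n" if "i = 3 * n \<or> i = 7 * n" for i
  using h1[of i] that n0 n by auto
 have dist: "\<tau> - \<tau> / real n <= abs (z - p)" if i: "i \<in> ?I" and z: "xs (i - 1) <= z" "z <= xs (Suc i)" and p: "p \<in> {0, d, 1}" for i z p
 proof -
  consider "i = n" | "i = 3 * n" | "i = 5 * n" | "i = 7 * n" using i by blast
  then have "(\<tau> - \<tau> / real n <= z \<and> z <= d - \<tau> + \<tau> / real n) \<or> (d + \<tau> - \<tau> / real n <= z \<and> z <= 1 - \<tau> + \<tau> / real n)"
  proof cases
   case 1
   have "Suc (n) <= 3 * n" using n0(1) by linarith
   then show ?thesis using z step[of i] at mid2[of "Suc n"] n0(1) pos unfolding 1 by simp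
  next
   case 2
   have "n <= 3 * n - 1" using n0(1) by linarith
   then show ?thesis using z step'[of i] at mid2[of "3 * n - 1"] n0(1) pos unfolding 2 by simp
  next
   case 3
   have "Suc (5 * n) <= 7 * n" using n0(1) by linarith
   then show ?thesis using z step[of i] at mid4[of "Suc (5 * n)"] n0(1) pos unfolding 3 by simp
  next
   case 4
   have "5 * n <= 7 * n - 1" using n0(1) by linarith
   then show ?thesis using z step'[of i] at mid4[of "7 * n - 1"] n0(1) pos unfolding 4 by simp
  qed
  moreover have "\<tau> / real n <= \<tau> / 1" using n0 s by (intro divide_left_mono) auto
  ultimately show ?thesis using p d p2 p4 s by auto
 qed
 show ?thesis
 proof (cases "w < 1 / 8")
  case False
  then have s8: "\<tau> = 1/8" "1/8 <= w" by (auto simp: \<tau>_def)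
  have hh: "0 <= xs (Suc i) - xs i \<and> xs (Suc i) - xs i <= 4 / real N" if i: "i < N" for i
  proof -
   have "\<tau> / real n <= 4 / real N" unfolding hN unfolding s8 by (intro divide_right_mono) auto
   then show ?thesis using cell_cases[OF i] h1[of i] h2[of i] h4[of i] h24 pos by auto
  qed
  have "mesh_ok eps m {0, d, 1} \<nu> ?I N xs"
  proof (rule mesh_okI[OF ends mono' _ cardI _ eps nu_nonneg _ inner])
   fix i assume i: "i < N"
   have "(xs (Suc i) - xs i)^2 <= (4 / real N)^2" using hh[OF i] by (intro power_mono) auto
   then show "(xs (Suc i) - xs i)^2 <= eps * \<nu> \<or> (xs (Suc i) - xs i)^2 <= \<nu> \<and> small_layer m {0, d, 1} eps \<nu> (xs i) (xs (Suc i))"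
    using fine_global[of "1/8"] s8 by auto
  next
   fix i assume i: "0 < i" "i < N" "i \<in> ?I"
   show "small_layer m {0, d, 1} eps \<nu> (xs (i - 1)) (xs (Suc i)) \<or> far_from {0, d, 1} (xs (i - 1)) (xs (Suc i))"
   proof (cases "n = 1")
    case True
    \<comment> \<open>For \<open>N = 8\<close> a fine piece at the boundary is a single cell and the
      stencil reaches a pole; but then \<open>\<nu>\<close> is at least \<open>64 / 8^2 = 1\<close>,
      and smallness of the layers is trivial.\<close>
    then have "1 <= \<nu>" using nu_ge n by simp
    moreover have "exp (- (m * (abs (z - p) / sqrt eps))) <= 1" for z p using m_pos eps by simp
    ultimately have "small_layer m {0, d, 1} eps \<nu> (xs (i - 1)) (xs (Suc i))"
     unfolding small_layer_def by (meson order_trans)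
    then show ?thesis ..
   next
    case False
    then have "\<tau> / real n <= \<tau> / 2" using n0 s by (intro divide_left_mono) auto
    then have "1 / 16 <= \<tau> - \<tau> / real n" using s8(1) by linarith
    then have "far_from {0, d, 1} (xs (i - 1)) (xs (Suc i))"
     unfolding far_from_def using dist[OF i(3)] by (meson atLeastAtMost_iff order_trans)
    then show ?thesis ..
   qed
  qed (use n0 n in auto)
  then show ?thesis unfolding xs_def by blast
 next
  case True
  then have sw: "\<tau> = w" by (simp add: \<tau>_def)
  have fine: "(\<tau> / real n)^2 <= eps * \<nu>"
  proof -
   have "(\<tau> / real n)^2 = (16 * w / real N)^2 / 4" unfolding hN unfolding sw by (simp add: power_divide power_mult_distrib)
   then show ?thesis using fine_layer by linarith
  qed
  have out: "small_layer m {0, d, 1} eps \<nu> (xs i) (xs (Suc i))" if "n <= i \<and> i < 3 * n \<or> 5 * n <= i \<and> i < 7 * n" for i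
  proof (rule small_layerI[where s=0])
   fix p z assume p: "p \<in> {0, d, 1}" and z: "xs i <= z" "z <= xs (Suc i)"
   have "(\<tau> <= z \<and> z <= d - \<tau>) \<or> (d + \<tau> <= z \<and> z <= 1 - \<tau>)"
    using mid2[of i] mid2[of "Suc i"] mid4[of i] mid4[of "Suc i"] that z by auto
   then show "w - 0 <= abs (z - p)" using p sw p2 p4 s by auto
  qed (use w_pos in simp)
  have "mesh_ok eps m {0, d, 1} \<nu> ?I N xs"
  proof (rule mesh_okI[OF ends mono' _ cardI _ eps nu_nonneg _ inner])
   fix i assume i: "i < N"
   have c: "h^2 <= \<nu>" if "0 < h" "h <= 4 / real N" for h
    using coarse[of h] that order_trans[OF that(2) divide_right_mono[of 4 8 "real N"]] by simp
   show "(xs (Suc i) - xs i)^2 <= eps * \<nu> \<or> (xs (Suc i) - xs i)^2 <= \<nu> \<and> small_layer m {0, d, 1} eps \<nu> (xs i) (xs (Suc i))"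
    using cell_cases[OF i] h1[of i] h2[of i] h4[of i] c[OF pos(2) h24(1)] c[OF pos(3) h24(2)] fine out[of i] by auto
  next
   fix i assume i: "0 < i" "i < N" "i \<in> ?I"
   have "small_layer m {0, d, 1} eps \<nu> (xs (i - 1)) (xs (Suc i))"
   proof (rule small_layerI[where s="\<tau> / real n"])
    show "\<tau> / real n <= 8 * w / real N" unfolding hN unfolding sw ..
   qed (use dist[OF i(3)] sw in auto)
   then show "small_layer m {0, d, 1} eps \<nu> (xs (i - 1)) (xs (Suc i)) \<or> far_from {0, d, 1} (xs (i - 1)) (xs (Suc i))" ..
  qed (use n0 n in auto)
  then show ?thesis unfolding xs_def by blast
 qed
qed

end

section \<open>Regularity of the data\<close>

lemma tay_of_derivatives:
 fixes g :: "real => real"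
 assumes c: "continuous_on {a..c} g" "continuous_on {a..c} g1"
  and d1: "\<And>z. a < z ==> z < c ==> (g has_real_derivative g1 z) (at z)"
  and d2: "\<And>z. a < z ==> z < c ==> (g1 has_real_derivative g2 z) (at z)"
  and B1: "\<And>z. a <= z ==> z <= c ==> abs (g1 z) <= K" and B2: "\<And>z. a < z ==> z < c ==> abs (g2 z) <= K"
 shows "tay K {a..c} g g1"
 unfolding tay_def
proof (intro ballI conjI)
 fix s assume s: "s \<in> {a..c}"
 show K: "abs (g1 s) <= K" using B1 s by auto
 fix t assume t: "t \<in> {a..c}"
 show "abs (g t - g s - (t - s) * g1 s) <= K * (t - s)^2"
 proof (cases "s = t")
  case False
  obtain z where z: "min s t < z" "z < max s t" "g t - g s = g1 z * (t - s)"
   by (rule mvt_between[OF False c(1) d1]) (use s t in auto)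
  have zs: "s \<noteq> z" and z_in: "a <= z" "z <= c" using z s t by auto
  obtain v where v: "min s z < v" "v < max s z" "g1 z - g1 s = g2 v * (z - s)"
   by (rule mvt_between[OF zs c(2) d2]) (use s z_in in auto)
  have "abs (g1 z - g1 s) <= K * abs (z - s)"
   unfolding v(3) abs_mult using B2[of v] v s z_in by (intro mult_right_mono) auto
  also have "\<dots> <= K * abs (t - s)" using z K by (intro mult_left_mono) auto
  finally have "abs (g1 z - g1 s) * abs (t - s) <= K * abs (t - s) * abs (t - s)" by (rule mult_right_mono) simp
  moreover have "g t - g s - (t - s) * g1 s = (g1 z - g1 s) * (t - s)" using z(3) by (simp add: algebra_simps)
  ultimately show ?thesis by (simp add: abs_mult power2_eq_square mult.assoc)
 qed simp
qed

lemma tay_has_derivative: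
 assumes "tay K {a..c} g g'" "a < s" "s < c"
 shows "(g has_real_derivative g' s) (at s)"
 unfolding has_field_derivative_iff
proof -
 have "((\<lambda>t. (g t - g s) / (t - s) - g' s) \<longlongrightarrow> 0) (at s)"
 proof (rule Lim_null_comparison)
  have "\<forall>\<^sub>F t in at s. t \<in> {a<..<c}" by (rule eventually_at_in_open') (use assms in auto)
  moreover have "\<forall>\<^sub>F t in at s. t \<noteq> s" by (simp add: eventually_at_filter)
  ultimately show "\<forall>\<^sub>F t in at s. norm ((g t - g s) / (t - s) - g' s) <= K * abs (t - s)"
  proof eventually_elim
   case (elim t)
   have "abs (g t - g s - (t - s) * g' s) <= K * (t - s)^2"
    by (rule tayD(2)[OF assms(1)]) (use assms elim in auto)
   moreover have sq: "(t - s)^2 = abs (t - s) * abs (t - s)" by (simp add: power2_eq_square)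
   ultimately have "abs (g t - g s - (t - s) * g' s) / abs (t - s) <= K * (t - s)^2 / abs (t - s)" by (intro divide_right_mono) auto
   moreover have "(g t - g s) / (t - s) - g' s = (g t - g s - (t - s) * g' s) / (t - s)"
    using elim(2) by (simp add: diff_divide_distrib)
   moreover have "K * (t - s)^2 / abs (t - s) = K * abs (t - s)"
    unfolding sq using elim(2) by (simp del: abs_mult_self_eq)
   ultimately show ?case by (simp add: abs_divide)
  qed
  have "((\<lambda>t. K * abs (t - s)) \<longlongrightarrow> K * abs (s - s)) (at s)" by (intro tendsto_intros)
  then show "((\<lambda>t. K * abs (t - s)) \<longlongrightarrow> 0) (at s)" by simp
 qed
 then show "((\<lambda>t. (g t - g s) / (t - s)) \<longlongrightarrow> g' s) (at s)" by (rule LIM_zero_cancel)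
qed

text \<open>The constant does not grow: expanding through \<open>d\<close>, the two quadratic
  remainders and the variation of the slope add up to
  \<open>(t - d)^2 + (d - s)^2 + 2 * (t - d) * (d - s)\<close>, which is
  \<open>(t - s)^2\<close>.\<close>

lemma tay_glue:
 assumes l: "tay K {a..d} g g'" and r: "tay K {d..c} g g'" and d: "a <= d" "d <= c"
 shows "tay K {a..c} g g'"
proof -
 have dist: "abs (g' d - g' s) <= 2 * K * abs (d - s)" if "tay K S g g'" "s \<in> S" "d \<in> S" for s S
 proof (cases "s = d")
  case False
  have sq: "(d - s)^2 = abs (d - s) * abs (d - s)" by (simp add: power2_eq_square)
  have "abs ((d - s) * (g' d - g' s)) <= 2 * K * (d - s)^2"
   using tayD(2)[OF that(1) that(2) that(3)] tayD(2)[OF that(1) that(3) that(2)]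
   by (simp add: power2_commute[of s d] algebra_simps)
  then have "abs (d - s) * abs (g' d - g' s) <= abs (d - s) * (2 * K * abs (d - s))"
   unfolding abs_mult sq by (simp add: mult_ac)
  then show ?thesis using False by (simp add: mult_le_cancel_left)
 qed simp
 have across: "abs (g t - g s - (t - s) * g' s) <= K * (t - s)^2"
  if st: "tay K S g g'" "tay K S' g g'" "s \<in> S" "d \<in> S" "t \<in> S'" "d \<in> S'" and pr: "0 <= (t - d) * (d - s)" for s t S S'
 proof -
  have "abs (g t - g d - (t - d) * g' d) <= K * (t - d)^2" by (rule tayD(2)[OF st(2,6,5)])
  moreover have "abs (g d - g s - (d - s) * g' s) <= K * (d - s)^2" by (rule tayD(2)[OF st(1,3,4)])
  moreover have "abs ((t - d) * (g' d - g' s)) <= 2 * K * ((t - d) * (d - s))"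
  proof -
   have "abs (t - d) * abs (g' d - g' s) <= abs (t - d) * (2 * K * abs (d - s))"
    by (rule mult_left_mono[OF dist[OF st(1,3,4)]]) simp
   also have "\<dots> = 2 * K * abs ((t - d) * (d - s))" by (simp only: abs_mult mult_ac)
   finally show ?thesis unfolding abs_mult[of "t - d" "g' d - g' s"] abs_of_nonneg[OF pr] .
  qed
  moreover have "g t - g s - (t - s) * g' s
    = (g t - g d - (t - d) * g' d) + (g d - g s - (d - s) * g' s) + (t - d) * (g' d - g' s)"
   by (simp add: algebra_simps)
  moreover have "K * (t - s)^2 = K * (t - d)^2 + K * (d - s)^2 + 2 * K * ((t - d) * (d - s))"
   by (simp add: power2_eq_square algebra_simps)
  ultimately show ?thesis by linarith
 qed
 show ?thesis
  unfolding tay_def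
 proof (intro ballI conjI)
  fix s assume s: "s \<in> {a..c}"
  show "abs (g' s) <= K" using tayD(1)[OF l, of s] tayD(1)[OF r, of s] s by (cases "s <= d") auto
  fix t assume t: "t \<in> {a..c}"
  consider "s <= d" "t <= d" | "d <= s" "d <= t" | "s <= d" "d <= t" | "d <= s" "t <= d" by linarith
  then show "abs (g t - g s - (t - s) * g' s) <= K * (t - s)^2"
  proof cases
   case 1 then show ?thesis using tayD(2)[OF l] s t by auto
  next
   case 2 then show ?thesis using tayD(2)[OF r] s t by auto
  next
   case 3 then show ?thesis by (intro across[OF l r]) (use s t d in auto)
  next
   case 4 then show ?thesis by (intro across[OF r l]) (use s t d in \<open>auto simp: mult_nonpos_nonpos\<close>)
  qed
 qed
qed

text \<open>Three consecutive Taylor bounds amount to a Lipschitz third derivative, which yields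
  second differences of \<open>g2\<close> of order \<open>h^2\<close>.\<close>

lemma smooth_dataI:
 assumes g: "tay K {0..1} g g1" and g1: "tay K {0..1} g1 g2" and g2: "tay K {0..1} g2 g3"
  and B: "\<And>x. 0 <= x ==> x <= 1 ==> abs (g x) <= K"
 shows "smooth_data (4 * K) g g2"
proof -
 have K: "0 <= K" using B[of 0] by simp
 have lip: "abs (h x - h y) <= 2 * K * abs (x - y)" if "tay K {0..1} h h'" "x \<in> {0..1}" "y \<in> {0..1}" for h h' x y
  using tay_lipschitz[OF that(1,3,2)] by simp
 have cont: "continuous_on {0..1} h" if "tay K {0..1} h h'" for h h'
  by (rule lipschitz_on_continuous_on[of "2 * K"], rule lipschitz_onI)
   (use lip[OF that] K in \<open>auto simp: dist_real_def\<close>)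
 have d1: "(g has_real_derivative g1 z) (at z)" and d2: "(g1 has_real_derivative g2 z) (at z)" if "0 < z" "z < 1" for z
  using tay_has_derivative[OF g that] tay_has_derivative[OF g1 that] by auto
 have sd: "abs (g2 (x + s) + g2 (x - s) - 2 * g2 x) <= 2 * K * s^2" if "0 < s" "0 <= x - s" "x + s <= 1" for x s
  using tay_second_difference[OF g2, of "x - s" s] that by (simp add: algebra_simps)
 show ?thesis
  unfolding smooth_data_def
 proof (intro conjI ballI allI impI; (elim conjE)?)
  show "continuous_on {0..1} g" "continuous_on {0..1} g2" using cont g g2 by blast+
 next
  fix x :: real assume x: "x \<in> {0..1}"
  show "abs (g x) <= 4 * K" "abs (g2 x) <= 4 * K" using B[of x] tayD(1)[OF g1, of x] x K by auto
  fix y :: real assume y: "y \<in> {0..1}"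
  have "2 * K * abs (x - y) <= 4 * K * abs (x - y)" using K by (intro mult_right_mono) auto
  then show "abs (g x - g y) <= 4 * K * abs (x - y)" using lip[OF g x y] by linarith
 next
  fix x a c :: real assume *: "0 < a" "0 < c" "0 <= x - a" "x + c <= 1"
  have "abs (interp_err a c g x) <= K * (a * c)"
   by (rule interp_err_bound[where D="g1 x"])
    (use tayD(2)[OF g, of x "x - a"] tayD(2)[OF g, of x "x + c"] * in \<open>auto simp: mult.commute\<close>)
  also have "\<dots> <= 4 * K * (a * c)" using K * by (intro mult_right_mono) auto
  finally show "abs (interp_err a c g x) <= 4 * K * (a * c)" .
  have "abs (divdiff2 a c g x - g2 x) <= 2 * (2 * K) * (a + c)"
   by (rule divdiff2_err[OF cont[OF g] d1 d2]) (use lip[OF g2] * K in auto)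
  then show "abs (divdiff2 a c g x - g2 x) <= 4 * K * (a + c)" by simp
 next
  fix x h :: real assume *: "0 < h" "0 <= x - h" "x + h <= 1"
  have "abs (divdiff2 h h g x - g2 x) <= 2 * K * h^2"
   by (rule divdiff2_equal_err[OF cont[OF g] d1 d2]) (use sd * K in auto)
  also have "\<dots> <= 4 * K * h^2" using K by (intro mult_right_mono) auto
  finally show "abs (divdiff2 h h g x - g2 x) <= 4 * K * h^2" .
  have "abs (divdiff2 h h g2 x) = abs (g2 (x + h) + g2 (x - h) - 2 * g2 x) / h^2"
   using * by (simp add: divdiff2_equal abs_divide)
  also have "\<dots> <= 2 * K" using sd[OF *] * by (simp add: pos_divide_le_eq)
  finally show "abs (divdiff2 h h g2 x) <= 4 * K" using K by linarith
 qed
qed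

lemma smooth_data_mono: "smooth_data K g g\<^sub>2 ==> K <= K' ==> smooth_data K' g g\<^sub>2"
 unfolding smooth_data_def
proof (elim conjE, intro conjI allI ballI impI; (elim conjE)?)
 note mono = order_trans[OF _ mult_right_mono[of K K']]
 assume KK: "K <= K'"
 assume b: "\<forall>x\<in>{0..1}. (abs (g x)) <= K \<and> abs (g\<^sub>2 x) <= K \<and> (\<forall>y\<in>{0..1}. (abs (g x - g y)) <= K * abs (x - y))"
 show "abs (g x) <= K'" "abs (g\<^sub>2 x) <= K'" if "x \<in> {0..1}" for x using b that KK by force+
 show "abs (g x - g y) <= K' * abs (x - y)" if "x \<in> {0..1}" "y \<in> {0..1}" for x y
  using mono[of _ "abs (x - y)"] b that KK by auto
 assume c: "\<forall>x a c. 0 < a \<and> 0 < c \<and> 0 <= x - a \<and> x + c <= 1 \<longrightarrow>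
   abs (interp_err a c g x) <= K * (a * c) \<and> abs (divdiff2 a c g x - g\<^sub>2 x) <= K * (a + c)"
 show "abs (interp_err a c g x) <= K' * (a * c)" "abs (divdiff2 a c g x - g\<^sub>2 x) <= K' * (a + c)"
  if "0 < a" "0 < c" "0 <= x - a" "x + c <= 1" for x a c
  using mono[of _ "a * c"] mono[of _ "a + c"] c that KK by auto
 assume d: "\<forall>x h. 0 < h \<and> 0 <= x - h \<and> x + h <= 1 \<longrightarrow>
   abs (divdiff2 h h g x - g\<^sub>2 x) <= K * h^2 \<and> abs (divdiff2 h h g\<^sub>2 x) <= K"
 show "abs (divdiff2 h h g x - g\<^sub>2 x) <= K' * h^2" "abs (divdiff2 h h g\<^sub>2 x) <= K'" if "0 < h" "0 <= x - h" "x + h <= 1" for x h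
  using mono[of _ "h^2"] d that KK order_trans[OF _ KK] by auto
qed

section \<open>The data classes in Taylor form\<close>

lemma pd_time:
 assumes h: "holder_space T n \<gamma> K z" and j: "2 * Suc j <= n" and x: "x \<in> {0..1}" "t \<in> {0..T}"
 shows "(pd T 0 j z x has_real_derivative pd T 0 (Suc j) z x t) (at t within {0..T})"
proof -
 have "(\<lambda>\<tau>. pd T 0 j z x \<tau>) differentiable (at t within {0..T})"
  using h j x unfolding holder_space_def Qbar_def by blast
 then show ?thesis
  unfolding has_real_derivative_iff_has_vector_derivative
  by (simp add: vector_derivative_works pd_def pdt_def)
qed

lemma pd_space:
 assumes h: "holder_space T n \<gamma> K z" and i: "Suc i <= n" and x: "x \<in> {0..1}" "t \<in> {0..T}"
 shows "((\<lambda>x. pd T i 0 z x t) has_real_derivative pd T (Suc i) 0 z x t) (at x within {0..1})"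
proof -
 have "Suc i + 2 * 0 <= n" using i by simp
 then have "(\<lambda>xi. pd T i 0 z xi t) differentiable (at x within {0..1})"
  using h x unfolding holder_space_def Qbar_def by blast
 then show ?thesis
  unfolding has_real_derivative_iff_has_vector_derivative
  by (simp add: vector_derivative_works pd_def pdx_def)
qed

lemma pd_bound: "holder_space T n \<gamma> K z ==> i + 2 * j <= n ==> x \<in> {0..1} ==> t \<in> {0..T} ==> abs (pd T i j z x t) <= K"
 unfolding holder_space_def Qbar_def by blast

lemma pd_0: "pd T 0 0 z = z" by (simp add: pd_def)

lemma holder_time:
 assumes h: "holder_space T 4 \<gamma> K z" and x: "x \<in> {0..1}"
 shows "tay K {0..T} (z x) (pd T 0 1 z x)"
proof (rule tay_of_derivatives)
 note d = pd_time[OF h _ x]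
 have d0: "(z x has_real_derivative pd T 0 1 z x t) (at t within {0..T})" if "t \<in> {0..T}" for t
  using d[of 0 t] that by (simp add: pd_0)
 have d1: "(pd T 0 1 z x has_real_derivative pd T 0 2 z x t) (at t within {0..T})" if "t \<in> {0..T}" for t
  using d[of 1 t] that by (simp add: numeral_2_eq_2)
 show "continuous_on {0..T} (z x)" "continuous_on {0..T} (pd T 0 1 z x)"
  by (rule DERIV_continuous_on, erule d0 d1)+
 fix t assume "0 < t" "t < T"
 then show "(z x has_real_derivative pd T 0 1 z x t) (at t)" "(pd T 0 1 z x has_real_derivative pd T 0 2 z x t) (at t)"
  using d0[of t] d1[of t] by (simp_all add: at_within_Icc_at)
qed (use pd_bound[OF h _ x] in auto)

lemma holder_space_data:
 assumes h: "holder_space T 4 \<gamma> K z" and t: "t \<in> {0..T}"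
 shows "smooth_data (4 * K) (\<lambda>x. z x t) (\<lambda>x. pd T 2 0 z x t)"
proof -
 have d: "((\<lambda>x. pd T i 0 z x t) has_real_derivative pd T (Suc i) 0 z x t) (at x within {0..1})"
  if "x \<in> {0..1}" "i < 4" for i x using pd_space[OF h _ that(1) t, of i] that by simp
 have ty: "tay K {0..1} (\<lambda>x. pd T i 0 z x t) (\<lambda>x. pd T (Suc i) 0 z x t)" if i: "i < 3" for i
 proof (rule tay_of_derivatives)
  show "continuous_on {0..1} (\<lambda>x. pd T i 0 z x t)" "continuous_on {0..1} (\<lambda>x. pd T (Suc i) 0 z x t)"
   by (rule DERIV_continuous_on, erule d, use i in simp)+
  fix x :: real assume "0 < x" "x < 1"
  then show "((\<lambda>x. pd T i 0 z x t) has_real_derivative pd T (Suc i) 0 z x t) (at x)"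
    "((\<lambda>x. pd T (Suc i) 0 z x t) has_real_derivative pd T (Suc (Suc i)) 0 z x t) (at x)"
   using d[of x i] d[of x "Suc i"] i by (simp_all add: at_within_Icc_at)
 qed (use pd_bound[OF h _ _ t, of _ 0] i in auto)
 show ?thesis
 proof (rule smooth_dataI)
  show "tay K {0..1} (\<lambda>x. z x t) (\<lambda>x. pd T 1 0 z x t)" using ty[of 0] by (simp add: pd_0)
  show "tay K {0..1} (\<lambda>x. pd T 1 0 z x t) (\<lambda>x. pd T 2 0 z x t)" using ty[of 1] by (simp add: numeral_2_eq_2)
  show "tay K {0..1} (\<lambda>x. pd T 2 0 z x t) (\<lambda>x. pd T 3 0 z x t)" using ty[of 2] by (simp add: numeral_3_eq_3 numeral_2_eq_2)
  show "abs (z x t) <= K" if "0 <= x" "x <= 1" for x using pd_bound[OF h, of 0 0 x t] that t by (simp add: pd_0)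
 qed
qed

lemma Cn_deriv:
 assumes C: "Cn_space n S K \<phi>" and k: "k < n" and z: "z \<in> S"
 shows "((deriv ^^ k) \<phi> has_real_derivative (deriv ^^ Suc k) \<phi> z) (at z)"
 using C k z unfolding Cn_space_def by (simp add: DERIV_deriv_iff_field_differentiable)

lemma Cn_bound: "Cn_space n S K \<phi> ==> k <= n ==> z \<in> S ==> abs ((deriv ^^ k) \<phi> z) <= K"
 unfolding Cn_space_def by blast

text \<open>A bound on the next derivative makes each derivative below the top one Lipschitz on the
  open interval, hence extendable to the closed one. The extension is what gives the one-sided
  limits at the ends a usable meaning, including those of the third derivative of initial
  data.\<close>

lemma Cn_extension:
 fixes \<phi> :: "real => real"
 assumes C: "Cn_space n {a<..<c} K \<phi>" and ac: "a < c"
 obtains h where "\<forall>k<n. \<forall>z\<in>{a<..<c}. h k z = (deriv ^^ k) \<phi> z"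
  "\<forall>k<n. \<forall>z\<in>{a..c}. (abs (h k z)) <= K" "\<forall>k<n. continuous_on {a..c} (h k)"
  "\<forall>k. Suc k < n \<longrightarrow> tay K {a..c} (h k) (h (Suc k))"
  "\<forall>k<n. rlim k \<phi> a = h k a" "\<forall>k<n. llim k \<phi> c = h k c"
proof -
 have cl: "closure {a<..<c} = {a..c}" using ac by (rule closure_greaterThanLessThan)
 have "\<exists>g. K-lipschitz_on {a..c} g \<and> (\<forall>z\<in>{a<..<c}. g z = (deriv ^^ k) \<phi> z)" if k: "k < n" for k
  unfolding cl[symmetric]
 proof (rule lipschitz_extend_closure, rule lipschitz_onI)
  show "0 <= K" using Cn_bound[OF C, of 0 "(a + c) / 2"] ac by auto
  fix y z assume yz: "y \<in> {a<..<c}" "z \<in> {a<..<c}"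
  have "norm ((deriv ^^ k) \<phi> y - (deriv ^^ k) \<phi> z) <= K * norm (y - z)"
   by (rule field_differentiable_bound[OF _ _ _ yz, where f'="(deriv ^^ Suc k) \<phi>"])
    (use Cn_deriv[OF C k] Cn_bound[OF C, of "Suc k"] k in \<open>auto intro: has_field_derivative_at_within\<close>)
  then show "dist ((deriv ^^ k) \<phi> y) ((deriv ^^ k) \<phi> z) <= K * dist y z" by (simp add: dist_norm)
 qed
 then obtain h where h: "\<And>k. k < n ==> K-lipschitz_on {a..c} (h k)"
  "\<And>k z. k < n ==> z \<in> {a<..<c} ==> h k z = (deriv ^^ k) \<phi> z" by metis
 have hc: "continuous_on {a..c} (h k)" if "k < n" for k using lipschitz_on_continuous_on[OF h(1)[OF that]] .
 have hb: "abs (h k z) <= K" if "k < n" "a <= z" "z <= c" for k z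
  using continuous_on_closure_norm_le[of "{a<..<c}" "h k" K z] hc[OF that(1)] h(2)[OF that(1)]
   Cn_bound[OF C, of k] that unfolding cl by auto
 have hd: "(h k has_real_derivative (deriv ^^ Suc k) \<phi> z) (at z)" if "k < n" "a < z" "z < c" for k z
  by (rule has_field_derivative_transform_within_open[OF Cn_deriv[OF C that(1)], where S="{a<..<c}"])
   (use that h(2)[OF that(1)] in auto)
 have ty: "tay K {a..c} (h k) (h (Suc k))" if k: "Suc k < n" for k
 proof (rule tay_of_derivatives)
  show "(h k has_real_derivative h (Suc k) z) (at z)" if "a < z" "z < c" for z
   using hd[of k z] h(2)[of "Suc k" z] k that by simp
  show "(h (Suc k) has_real_derivative (deriv ^^ Suc (Suc k)) \<phi> z) (at z)" if "a < z" "z < c" for z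
   using hd[OF k] that by simp
  show "abs ((deriv ^^ Suc (Suc k)) \<phi> z) <= K" if "a < z" "z < c" for z
   using Cn_bound[OF C, of "Suc (Suc k)" z] k that by simp
 qed (use hc hb k in auto)
 have rl: "rlim k \<phi> a = h k a" and ll: "llim k \<phi> c = h k c" if k: "k < n" for k
 proof -
  have "((deriv ^^ k) \<phi> \<longlongrightarrow> h k a) (at_right a)"
  proof (rule Lim_transform_eventually[OF continuous_on_Icc_at_rightD[OF hc[OF k] ac]])
   show "\<forall>\<^sub>F z in at_right a. h k z = (deriv ^^ k) \<phi> z"
    using h(2)[OF k] ac unfolding eventually_at_right_field by (intro exI[of _ c]) auto
  qed
  then show "rlim k \<phi> a = h k a" unfolding rlim_def by (intro tendsto_Lim) auto
  have "((deriv ^^ k) \<phi> \<longlongrightarrow> h k c) (at_left c)"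
  proof (rule Lim_transform_eventually[OF continuous_on_Icc_at_leftD[OF hc[OF k] ac]])
   show "\<forall>\<^sub>F z in at_left c. h k z = (deriv ^^ k) \<phi> z"
    using h(2)[OF k] ac unfolding eventually_at_left_field by (intro exI[of _ a]) auto
  qed
  then show "llim k \<phi> c = h k c" unfolding llim_def by (intro tendsto_Lim) auto
 qed
 show thesis by (rule that[of h]) (use h(2) hb hc ty rl ll in auto)
qed

section \<open>Traces of the singular parts\<close>

definition C2_bound where
 "C2_bound T A e e' e'' \<longleftrightarrow> (\<forall>t\<in>{0..T}. (e has_real_derivative e' t) (at t within {0..T}) \<and>
   (e' has_real_derivative e'' t) (at t within {0..T}) \<and> abs (e t) <= A \<and> abs (e' t) <= A \<and> abs (e'' t) <= A)"

lemma C2_boundD: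
 assumes "C2_bound T A e e' e''" "0 <= t" "t <= T"
 shows "(e has_real_derivative e' t) (at t within {0..T})" "(e' has_real_derivative e'' t) (at t within {0..T})"
  "abs (e t) <= A" "abs (e' t) <= A" "abs (e'' t) <= A" "0 <= A"
proof -
 have "t \<in> {0..T}" using assms by simp
 note * = assms(1)[unfolded C2_bound_def, rule_format, OF this]
 show "(e has_real_derivative e' t) (at t within {0..T})" "(e' has_real_derivative e'' t) (at t within {0..T})"
  "abs (e t) <= A" "abs (e' t) <= A" "abs (e'' t) <= A" "0 <= A" using * by auto
qed

lemma tay_C2: "C2_bound T A e e' e'' ==> tay A {0..T} e e'"
proof (rule tay_of_derivatives)
 assume e: "C2_bound T A e e' e''"
 show "continuous_on {0..T} e" "continuous_on {0..T} e'"
  by (rule DERIV_continuous_on, rule C2_boundD(1,2)[OF e]; simp)+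
 fix t assume t: "0 < t" "t < T"
 show "(e has_real_derivative e' t) (at t)" "(e' has_real_derivative e'' t) (at t)"
  using C2_boundD(1,2)[OF e, of t] t by (simp_all add: at_within_Icc_at)
qed (auto intro: C2_boundD)

definition flat_at where
 "flat_at T d L e e' e'' \<longleftrightarrow> (\<forall>t\<in>{0..T}. (e has_real_derivative e' t) (at t within {0..T}) \<and>
   (e' has_real_derivative e'' t) (at t within {0..T})) \<and>
   (\<forall>t\<in>{d..T}. (abs (e t)) <= L * (t - d)^2 \<and> abs (e' t) <= L * (t - d) \<and> abs (e'' t) <= L)"

lemma flat_atD:
 assumes "flat_at T d L e e' e''" "t <= T"
 shows "0 <= t ==> (e has_real_derivative e' t) (at t within {0..T})"
  "0 <= t ==> (e' has_real_derivative e'' t) (at t within {0..T})"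
  "d <= t ==> abs (e t) <= L * (t - d)^2 \<and> abs (e' t) <= L * (t - d) \<and> abs (e'' t) <= L"
  "d <= t ==> 0 <= L"
 using assms unfolding flat_at_def by fastforce+

text \<open>No derivative is available at \<open>d\<close> itself, so the increment is taken from a
  later time \<open>s\<close>, which then decreases to \<open>d\<close>. The rate \<open>A\<close>
  may be arbitrarily bad, because it only serves to show that \<open>G\<close> tends to 0.\<close>

lemma le_of_vanishing:
 assumes d: "\<And>z. d < z ==> z <= t ==> (G has_real_derivative G' z) (at z within S)" and S: "{d<..t} \<subseteq> S"
  and B: "\<And>z. d < z ==> z <= t ==> abs (G' z) <= L" and A: "\<And>z. d < z ==> z <= t ==> abs (G z) <= A * (z - d)"
  and t: "d < t"
 shows "abs (G t) <= L * (t - d)"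
proof (rule tendsto_lowerbound[where F="at_right d"])
 have L: "0 <= L" using B[of t] t by auto
 have "((\<lambda>s. L * (t - d) + A * (s - d)) \<longlongrightarrow> L * (t - d) + A * (d - d)) (at_right d)" by (intro tendsto_intros)
 then show "((\<lambda>s. L * (t - d) + A * (s - d)) \<longlongrightarrow> L * (t - d)) (at_right d)" by simp
 show "\<forall>\<^sub>F s in at_right d. (abs (G t)) <= L * (t - d) + A * (s - d)"
  unfolding eventually_at_right_field
 proof (intro exI[of _ t] conjI allI impI t)
  fix s assume s: "d < s" "s < t"
  have "abs (G t - G s) <= L * abs (t - s)"
   by (rule abs_diff_le_of_derivative[where s=s and t=t and S=S, OF d]) (use s B S in auto)
  also have "\<dots> <= L * (t - d)" using s L by (intro mult_left_mono) auto
  finally show "abs (G t) <= L * (t - d) + A * (s - d)" using A[of s] s by linarith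
 qed
qed simp

text \<open>Extension by zero across \<open>d\<close> preserves the class \<open>C^(1,1)\<close>
  when the function vanishes there together with its derivative. In the factor, \<open>T\<close>
  bounds the slope and 2 arises when a point after \<open>d\<close> is compared with one before
  it.\<close>

lemma tay_flat:
 fixes G G' G'' :: "real => real"
 assumes d: "0 <= d" "d <= T" and before: "\<And>t. t <= d ==> G t = 0" "\<And>t. t <= d ==> G' t = 0"
  and d1: "\<And>t. d < t ==> t <= T ==> (G has_real_derivative G' t) (at t within {0..T})"
  and d2: "\<And>t. d < t ==> t <= T ==> (G' has_real_derivative G'' t) (at t within {0..T})"
  and B: "\<And>t. d < t ==> t <= T ==> abs (G t) <= C * (t - d)^2 \<and> abs (G' t) <= C * (t - d) \<and> abs (G'' t) <= C"
  and C: "0 <= C"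
 shows "tay (C * (2 + T)) {0..T} G G'"
 unfolding tay_def
proof (intro ballI conjI)
 fix s assume s: "s \<in> {0..T}"
 have CT: "C * 2 <= C * (2 + T)" "C * T <= C * (2 + T)" "C <= C * (2 + T)" "0 <= C * (2 + T)"
  using C d mult_nonneg_nonneg[of C T] by (auto simp: algebra_simps)
 show "abs (G' s) <= C * (2 + T)"
 proof (cases "s <= d")
  case False
  then have "C * (s - d) <= C * T" using C s d by (intro mult_left_mono) auto
  then show ?thesis using B[of s] False s CT by auto
 qed (use before CT in auto)
 fix t assume t: "t \<in> {0..T}"
 have two: "abs (G t - G s - (t - s) * G' s) <= C * (t - s)^2" if ds: "d < s" "d < t"
 proof (cases "s = t")
  case False
  define l u where "l = min s t" and "u = max s t"
  have lu: "d < l" "u <= T" "{l..u} \<subseteq> {0..T}" "s \<in> {l..u}" "t \<in> {l..u}" "l < u"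
   using ds s t d False by (auto simp: l_def u_def)
  have dd: "abs (G' z - G' s) <= C * abs (z - s)" if "z \<in> {l..u}" for z
   by (rule abs_diff_le_of_derivative[where s=l and t=u and S="{0..T}", OF d2]) (use lu B that in auto)
  define H where "H z = G z - z * G' s" for z
  have H: "(H has_real_derivative G' z - G' s) (at z within {0..T})" if "z \<in> {l..u}" for z
   unfolding H_def using d1[of z] lu that by (auto intro!: derivative_eq_intros)
  have "abs (H t - H s) <= C * abs (t - s) * abs (t - s)"
  proof (rule abs_diff_le_of_derivative[where s=l and t=u and S="{0..T}"])
   fix z assume z: "l <= z" "z <= u"
   have "C * abs (z - s) <= C * abs (t - s)" using z C by (intro mult_left_mono) (auto simp: l_def u_def)
   then show "abs (G' z - G' s) <= C * abs (t - s)" using dd[of z] z by auto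
  qed (use H lu in auto)
  moreover have "H t - H s = G t - G s - (t - s) * G' s" by (simp add: H_def algebra_simps)
  moreover have "C * abs (t - s) * abs (t - s) = C * (t - s)^2" by (simp add: power2_eq_square mult.assoc)
  ultimately show ?thesis by linarith
 qed simp
 have mono: "C * r^2 <= C * (2 + T) * r^2" "C * 2 * r^2 <= C * (2 + T) * r^2" for r using CT by (auto intro!: mult_right_mono)
 consider "s <= d" "t <= d" | "s <= d" "d < t" | "d < s" "t <= d" | "d < s" "d < t" by linarith
 then show "abs (G t - G s - (t - s) * G' s) <= C * (2 + T) * (t - s)^2"
 proof cases
  case 1 then show ?thesis using before CT by simp
 next
  case 2
  have "abs (G t) <= C * (t - d)^2" using B[of t] 2 t by auto
  also have "\<dots> <= C * (t - s)^2" using 2 C by (intro mult_left_mono power_mono) auto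
  finally show ?thesis using 2 before mono(1)[of "t - s"] by simp
 next
  case 3
  have "abs (G s) <= C * (s - d)^2" using B[of s] 3 s by auto
  also have "\<dots> <= C * (s - t)^2" using 3 C by (intro mult_left_mono power_mono) auto
  finally have 1: "abs (G s) <= C * (t - s)^2" by (simp add: power2_commute)
  have "abs ((t - s) * G' s) <= (s - t) * (C * (s - t))"
   unfolding abs_mult
  proof (intro mult_mono)
   have "abs (G' s) <= C * (s - d)" using B[of s] 3 s by auto
   also have "\<dots> <= C * (s - t)" using 3 C by (intro mult_left_mono) auto
   finally show "abs (G' s) <= C * (s - t)" .
  qed (use 3 in auto)
  also have "\<dots> = C * (t - s)^2" by (simp add: power2_eq_square algebra_simps)
  finally have "abs (G t - G s - (t - s) * G' s) <= C * 2 * (t - s)^2" using 1 before(1)[OF 3(2)] by linarith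
  then show ?thesis using mono(2)[of "t - s"] by linarith
 next
  case 4 then show ?thesis using two mono(1)[of "t - s"] by linarith
 qed
qed

text \<open>The form in which singular functions appear on the boundary: a smooth coefficient times
  a flat function of the time elapsed since \<open>d\<close>.\<close>

lemma tay_flat_product:
 fixes e e' e'' v v' v'' :: "real => real"
 assumes d: "0 <= d" "d <= T" and C: "0 <= C" and E: "C2_bound T B e e' e''"
  and v: "\<And>\<tau>. 0 < \<tau> ==> (v has_real_derivative v' \<tau>) (at \<tau>)"
  and v': "\<And>\<tau>. 0 < \<tau> ==> (v' has_real_derivative v'' \<tau>) (at \<tau>)"
  and vC: "\<And>\<tau>. 0 < \<tau> ==> \<tau> <= T ==> abs (v \<tau>) <= C * \<tau>^2 \<and> abs (v' \<tau>) <= C * \<tau> \<and> abs (v'' \<tau>) <= C"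
 shows "tay (B * C * (1 + T)^2 * (2 + T)) {0..T} (\<lambda>t. if t <= d then 0 else e t * v (t - d))
  (\<lambda>t. if t <= d then 0 else e' t * v (t - d) + e t * v' (t - d))"
proof (rule tay_flat[OF d])
 have B: "0 <= B" using C2_boundD(6)[OF E, of d] d by simp
 then show "0 <= B * C * (1 + T)^2" using C by simp
 have prod: "((\<lambda>t. if t <= d then 0 else f t * k (t - d)) has_real_derivative f' * k (t - d) + f t * k') (at t within {0..T})"
  if "d < t" and f: "(f has_real_derivative f') (at t within {0..T})" and k: "(k has_real_derivative k') (at (t - d))" and "t <= T"
  for f k :: "real => real" and f' k' t
 proof (rule has_field_derivative_transform_within[where d="t - d"])
  have "((\<lambda>t. k (t - d)) has_real_derivative k' * 1) (at t within {0..T})"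
   by (rule DERIV_chain2[where f=k and g="\<lambda>t. t - d", OF k]) (auto intro!: derivative_eq_intros)
  from DERIV_mult[OF f this]
  show "((\<lambda>t. f t * k (t - d)) has_real_derivative f' * k (t - d) + f t * k') (at t within {0..T})" by (simp add: algebra_simps)
  show "f s * k (s - d) = (if s <= d then 0 else f s * k (s - d))" if "s \<in> {0..T}" "dist s t < t - d" for s
   using that by (auto simp: dist_real_def)
 qed (use that d in auto)
 fix t assume t: "d < t" "t <= T"
 then have tau: "0 < t - d" "t - d <= T" and t0: "0 <= t" using d by auto
 note e = C2_boundD(1,2)[OF E t0 t(2)]
 show "((\<lambda>t. if t <= d then 0 else e t * v (t - d)) has_real_derivative
   (if t <= d then 0 else e' t * v (t - d) + e t * v' (t - d))) (at t within {0..T})"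
  using prod[OF t(1) e(1) v[OF tau(1)] t(2)] t by simp
 have "((\<lambda>t. (if t <= d then 0 else e' t * v (t - d)) + (if t <= d then 0 else e t * v' (t - d))) has_real_derivative
   (e'' t * v (t - d) + e' t * v' (t - d)) + (e' t * v' (t - d) + e t * v'' (t - d))) (at t within {0..T})"
  by (rule DERIV_add[OF prod[OF t(1) e(2) v[OF tau(1)] t(2)] prod[OF t(1) e(1) v'[OF tau(1)] t(2)]])
 moreover have "(\<lambda>t. if t <= d then 0 else e' t * v (t - d) + e t * v' (t - d))
   = (\<lambda>t. (if t <= d then 0 else e' t * v (t - d)) + (if t <= d then 0 else e t * v' (t - d)))"
  by auto
 ultimately show "((\<lambda>t. if t <= d then 0 else e' t * v (t - d) + e t * v' (t - d)) has_real_derivative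
   (e'' t * v (t - d) + e' t * v' (t - d)) + (e' t * v' (t - d) + e t * v'' (t - d))) (at t within {0..T})"
  by simp
 define \<tau> where "\<tau> = t - d"
 have T: "0 <= T" using d by simp
 note vb = vC[OF tau, folded \<tau>_def]
 have tau': "0 < \<tau>" "\<tau> <= T" using tau by (auto simp: \<tau>_def)
 have m: "abs (x * y) <= B * Y" if "abs x <= B" "abs y <= Y" for x y Y unfolding abs_mult using that B by (intro mult_mono) auto
 have n: "0 <= B * C" "0 <= B * C * T" "0 <= B * C * T * T" using B C T by auto
 have BC: "B * C * (1 + T)^2 = B * C + 2 * (B * C * T) + B * C * T * T" by (simp add: power2_eq_square algebra_simps)
 have i1: "B * (C * \<tau>^2) <= B * C * (1 + T)^2 * \<tau>^2"
  unfolding mult.assoc[symmetric] by (rule mult_right_mono) (use n BC in auto)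
 have i2: "B * (C * \<tau>^2) + B * (C * \<tau>) <= B * C * (1 + T)^2 * \<tau>"
 proof -
  have "B * (C * \<tau>^2) + B * (C * \<tau>) = (B * C * \<tau> + B * C) * \<tau>" by (simp add: power2_eq_square algebra_simps)
  also have "\<dots> <= (B * C * T + B * C) * \<tau>" using tau' n by (intro mult_right_mono add_right_mono mult_left_mono) auto
  also have "\<dots> <= B * C * (1 + T)^2 * \<tau>" using tau' n(1) unfolding BC
   by (intro mult_right_mono) (use n in linarith, simp)
  finally show ?thesis .
 qed
 have i3: "B * (C * \<tau>^2) + B * (C * \<tau>) + (B * (C * \<tau>) + B * C) <= B * C * (1 + T)^2"
 proof -
  have "B * C * (\<tau> * \<tau>) <= B * C * (T * T)" "B * C * \<tau> <= B * C * T"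
   using tau' n by (auto intro!: mult_left_mono mult_mono)
  then show ?thesis unfolding BC by (simp add: power2_eq_square mult.assoc)
 qed
 note eb' = C2_boundD(3,4,5)[OF E t0 t(2)]
 have vb': "abs (v \<tau>) <= C * \<tau>^2" "abs (v' \<tau>) <= C * \<tau>" "abs (v'' \<tau>) <= C" using vb by auto
 have "abs (e t * v \<tau>) <= B * C * (1 + T)^2 * \<tau>^2" by (rule order_trans[OF m[OF eb'(1) vb'(1)] i1])
 moreover have "abs (e' t * v \<tau> + e t * v' \<tau>) <= B * C * (1 + T)^2 * \<tau>"
  by (rule order_trans[OF abs_triangle_ineq order_trans[OF add_mono[OF m[OF eb'(2) vb'(1)] m[OF eb'(1) vb'(2)]] i2]])
 moreover have "abs ((e'' t * v \<tau> + e' t * v' \<tau>) + (e' t * v' \<tau> + e t * v'' \<tau>)) <= B * C * (1 + T)^2"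
  by (rule order_trans[OF order_trans[OF abs_triangle_ineq add_mono[OF abs_triangle_ineq abs_triangle_ineq]]
    order_trans[OF add_mono[OF add_mono[OF m[OF eb'(3) vb'(1)] m[OF eb'(2) vb'(2)]]
     add_mono[OF m[OF eb'(2) vb'(2)] m[OF eb'(1) vb'(3)]]] i3]])
 ultimately show "abs (if t <= d then 0 else e t * v (t - d)) <= B * C * (1 + T)^2 * (t - d)^2 \<and>
   abs (if t <= d then 0 else e' t * v (t - d) + e t * v' (t - d)) <= B * C * (1 + T)^2 * (t - d) \<and>
   abs ((e'' t * v (t - d) + e' t * v' (t - d)) + (e' t * v' (t - d) + e t * v'' (t - d))) <= B * C * (1 + T)^2"
  using t by (simp add: \<tau>_def)
qed auto

text \<open>All kernels decay like \<open>exp (- abs xi / sqrt t)\<close>, and \<open>exp (- r) \<le> 256 / r\<^sup>4\<close>.\<close>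

lemma kernel_flat:
 assumes c: "0 < c" "c <= abs xi" and t: "0 < t"
 shows "abs (k0 xi t - sgn xi) <= 256 * exp 16 / c^4 * t^2" "abs (km2 xi t) <= 256 * exp 16 / c^4 * t"
  "abs (km4 xi t) <= 256 * exp 16 / c^4" "gk xi t <= exp 16 / c"
proof -
 define L where "L = exp (- (abs xi / sqrt t))"
 define r where "r = c / sqrt t"
 have r: "0 < r" "r <= abs xi / sqrt t" using c t by (auto simp: r_def divide_right_mono)
 have L0: "0 < L" "L <= 1" using t by (auto simp: L_def)
 have L4: "exp 16 * L <= 256 * exp 16 / c^4 * t^2"
 proof -
  have "r / 4 <= exp (r / 4)" using exp_ge_add_one_self[of "r / 4"] by linarith
  then have "(r / 4) ^ 4 <= exp (r / 4) ^ 4" using r by (intro power_mono) auto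
  also have "\<dots> = exp r" using exp_of_nat_mult[of 4 "r / 4"] by simp
  finally have "r ^ 4 / 256 <= exp r" by (simp add: power_divide)
  then have "exp (- r) <= 256 / r ^ 4" using r by (simp add: exp_minus field_simps)
  moreover have "L <= exp (- r)" using r by (simp add: L_def)
  moreover have "r ^ 4 = c ^ 4 / t^2"
   using t power_mult[of "sqrt t" 2 2] by (simp add: r_def power_divide)
  ultimately have "L <= 256 / c ^ 4 * t^2" by simp
  from mult_left_mono[OF this, of "exp 16"] show ?thesis by (simp add: mult_ac)
 qed
 have gk: "abs xi ^ n * gk xi t * sqrt t <= exp 16 * sqrt t ^ n * L" if "n <= 3" for n
 proof -
  have "(1 + real n)^2 <= 4^2" using that by (intro power_mono) auto
  then have "exp ((1 + real n)^2) * (sqrt t ^ n * L) <= exp 16 * (sqrt t ^ n * L)"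
   using t L0 by (intro mult_right_mono) auto
  then show ?thesis using gk_scaled[OF t, of 1 xi n] by (simp add: L_def mult.assoc)
 qed
 have s: "sqrt t ^ 3 = t * sqrt t" using t by (simp add: power3_eq_cube)
 have gk1: "abs xi * gk xi t <= exp 16 * L" using gk[of 1] t by simp
 have gk3: "abs xi^3 * gk xi t <= exp 16 * t * L" using gk[of 3] t unfolding s by (simp add: mult_ac)
 have "c * gk xi t <= abs xi * gk xi t" using c gk_pos[OF t, of xi] by (intro mult_right_mono) auto
 moreover have "exp 16 * L <= exp 16 * 1" using L0 by (intro mult_left_mono) auto
 ultimately have "c * gk xi t <= exp 16" using gk1 by linarith
 then show "gk xi t <= exp 16 / c" using c by (simp add: field_simps)
 have L40: "0 <= 256 * exp 16 / c ^ 4" using c by simp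
 have "abs (km2 xi t) = abs xi * gk xi t / (2 * t)" using t gk_pos[OF t, of xi] by (simp add: km2_def abs_mult)
 also have "\<dots> <= (256 * exp 16 / c^4 * t^2) / (2 * t)" using gk1 L4 t by (intro divide_right_mono) auto
 also have "\<dots> = 256 * exp 16 / c^4 * t / 2" using t by (simp add: power2_eq_square)
 also have "\<dots> <= 256 * exp 16 / c^4 * t"
 proof -
  have half: "y / 2 <= y" if "0 <= y" for y :: real using that by simp
  show ?thesis by (rule half) (use L40 t in simp)
 qed
 finally show "abs (km2 xi t) <= 256 * exp 16 / c^4 * t" .
 have "abs (3 * xi / (4 * t^2) - xi^3 / (8 * t^3)) <= 3 * abs xi / (4 * t^2) + abs xi^3 / (8 * t^3)"
  using t abs_triangle_ineq4[of "3 * xi / (4 * t^2)" "xi^3 / (8 * t^3)"] by (simp add: abs_mult power_abs)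
 then have "abs (km4 xi t) <= (3 * abs xi / (4 * t^2) + abs xi^3 / (8 * t^3)) * gk xi t"
  using t gk_pos[of t xi] unfolding km4_def abs_mult by (intro mult_mono) auto
 also have "\<dots> = 3 * (abs xi * gk xi t) / (4 * t^2) + (abs xi ^ 3 * gk xi t) / (8 * t^3)"
  by (simp add: algebra_simps)
 also have "\<dots> <= 3 * (exp 16 * L) / (4 * t^2) + (exp 16 * t * L) / (8 * t^3)"
  using gk1 gk3 t by (intro add_mono divide_right_mono mult_left_mono) auto
 also have "\<dots> = 7 / 8 * (exp 16 * L) / t^2" using t by (simp add: field_simps power3_eq_cube power2_eq_square)
 also have "\<dots> <= 1 * (256 * exp 16 / c^4 * t^2) / t^2"
  by (intro divide_right_mono mult_mono[OF _ L4]) (use L0 in auto)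
 also have "\<dots> = 256 * exp 16 / c^4" using t by simp
 finally show "abs (km4 xi t) <= 256 * exp 16 / c^4" .
 have *: "abs (k0 \<zeta> t - 1) <= exp 16 * L" if "0 <= \<zeta>" "\<zeta> = abs xi" for \<zeta>
 proof -
  have "exp ((1::real)^2) * L <= exp 16 * L" using L0 by (intro mult_right_mono) auto
  moreover have "0 <= 1 - k0 \<zeta> t" "1 - k0 \<zeta> t <= exp (1^2) * L"
   using erfc_scaled[OF t, of 1 \<zeta>] that by (simp_all add: L_def)
  ultimately show ?thesis by linarith
 qed
 have "abs (k0 xi t - sgn xi) <= exp 16 * L"
 proof (cases "0 < xi")
  case True then show ?thesis using *[of xi] by simp
 next
  case False
  then have n: "xi < 0" using c by auto
  have "abs (k0 (- xi) t - 1) <= exp 16 * L" by (rule *) (use n in auto)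
  then show ?thesis unfolding k0_minus sgn_neg[OF n] by linarith
 qed
 then show "abs (k0 xi t - sgn xi) <= 256 * exp 16 / c^4 * t^2" using L4 by linarith
qed

section \<open>The error of the remainder\<close>

definition solves ::
  "real => real => (real => real) => (real => real => real) => (real => real => real) =>
   (real => real => real) => (real => real => real) => bool" where
 "solves T eps b U Ut Uxx F \<longleftrightarrow> (\<exists>Ux. \<forall>x t. 0 < x \<and> x < 1 \<and> 0 < t \<and> t <= T \<longrightarrow>
   (U x has_real_derivative Ut x t) (at t within {0..T}) \<and>
   ((\<lambda>x. U x t) has_real_derivative Ux x t) (at x) \<and>
   ((\<lambda>x. Ux x t) has_real_derivative Uxx x t) (at x) \<and>
   Ut x t - eps * Uxx x t + b t * U x t = F x t)"

lemma solvesI: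
 assumes "\<And>x t. 0 < x ==> x < 1 ==> 0 < t ==> t <= T ==> (U x has_real_derivative Ut x t) (at t within {0..T})"
  and "\<And>x t. 0 < x ==> x < 1 ==> 0 < t ==> t <= T ==> ((\<lambda>x. U x t) has_real_derivative Ux x t) (at x)"
  and "\<And>x t. 0 < x ==> x < 1 ==> 0 < t ==> t <= T ==> ((\<lambda>x. Ux x t) has_real_derivative Uxx x t) (at x)"
  and "\<And>x t. 0 < x ==> x < 1 ==> 0 < t ==> t <= T ==> Ut x t - eps * Uxx x t + b t * U x t = F x t"
 shows "solves T eps b U Ut Uxx F"
 unfolding solves_def using assms by blast

lemma solves_add:
 assumes "solves T eps b U Ut Uxx F" "solves T eps b V Vt Vxx G"
 shows "solves T eps b (\<lambda>x t. U x t + V x t) (\<lambda>x t. Ut x t + Vt x t) (\<lambda>x t. Uxx x t + Vxx x t) (\<lambda>x t. F x t + G x t)"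
proof -
 obtain Ux where U: "\<forall>x t. 0 < x \<and> x < 1 \<and> 0 < t \<and> t <= T \<longrightarrow>
   (U x has_real_derivative Ut x t) (at t within {0..T}) \<and> ((\<lambda>x. U x t) has_real_derivative Ux x t) (at x) \<and>
   ((\<lambda>x. Ux x t) has_real_derivative Uxx x t) (at x) \<and> Ut x t - eps * Uxx x t + b t * U x t = F x t"
  using assms(1)[unfolded solves_def] by (rule exE) (rule that)
 obtain Vx where V: "\<forall>x t. 0 < x \<and> x < 1 \<and> 0 < t \<and> t <= T \<longrightarrow>
   (V x has_real_derivative Vt x t) (at t within {0..T}) \<and> ((\<lambda>x. V x t) has_real_derivative Vx x t) (at x) \<and>
   ((\<lambda>x. Vx x t) has_real_derivative Vxx x t) (at x) \<and> Vt x t - eps * Vxx x t + b t * V x t = G x t"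
  using assms(2)[unfolded solves_def] by (rule exE) (rule that)
 show ?thesis
 proof (rule solvesI[where Ux="\<lambda>x t. Ux x t + Vx x t"])
  fix x t :: real assume "0 < x" "x < 1" "0 < t" "t <= T"
  then have xt: "0 < x \<and> x < 1 \<and> 0 < t \<and> t <= T" by simp
  note u = U[rule_format, OF xt] and v = V[rule_format, OF xt]
  show "((\<lambda>t. U x t + V x t) has_real_derivative Ut x t + Vt x t) (at t within {0..T})"
   "((\<lambda>x. U x t + V x t) has_real_derivative Ux x t + Vx x t) (at x)"
   "((\<lambda>x. Ux x t + Vx x t) has_real_derivative Uxx x t + Vxx x t) (at x)"
   using u v by (auto intro: DERIV_add)
  show "Ut x t + Vt x t - eps * (Uxx x t + Vxx x t) + b t * (U x t + V x t) = F x t + G x t"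
   using u v by (simp add: algebra_simps)
 qed
qed

lemma solves_cmult:
 assumes "solves T eps b U Ut Uxx F"
 shows "solves T eps b (\<lambda>x t. r * U x t) (\<lambda>x t. r * Ut x t) (\<lambda>x t. r * Uxx x t) (\<lambda>x t. r * F x t)"
proof -
 obtain Ux where U: "\<forall>x t. 0 < x \<and> x < 1 \<and> 0 < t \<and> t <= T \<longrightarrow>
   (U x has_real_derivative Ut x t) (at t within {0..T}) \<and> ((\<lambda>x. U x t) has_real_derivative Ux x t) (at x) \<and>
   ((\<lambda>x. Ux x t) has_real_derivative Uxx x t) (at x) \<and> Ut x t - eps * Uxx x t + b t * U x t = F x t"
  using assms[unfolded solves_def] by (rule exE) (rule that)
 show ?thesis
 proof (rule solvesI[where Ux="\<lambda>x t. r * Ux x t"])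
  fix x t :: real assume "0 < x" "x < 1" "0 < t" "t <= T"
  then have "0 < x \<and> x < 1 \<and> 0 < t \<and> t <= T" by simp
  note u = U[rule_format, OF this]
  show "((\<lambda>t. r * U x t) has_real_derivative r * Ut x t) (at t within {0..T})"
   "((\<lambda>x. r * U x t) has_real_derivative r * Ux x t) (at x)"
   "((\<lambda>x. r * Ux x t) has_real_derivative r * Uxx x t) (at x)"
   using u by (auto intro: DERIV_cmult)
  have F: "F x t = Ut x t - eps * Uxx x t + b t * U x t" using u by simp
  show "r * Ut x t - eps * (r * Uxx x t) + b t * (r * U x t) = r * F x t" unfolding F by (simp add: algebra_simps)
 qed
qed

lemma solves_cong:
 assumes "solves T eps b U Ut Uxx F" "\<And>x t. 0 < x ==> x < 1 ==> 0 < t ==> t <= T ==> F x t = G x t"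
 shows "solves T eps b U Ut Uxx G"
 using assms unfolding solves_def by metis

text \<open>The derivatives in \<open>solves_pde\<close> are chosen separately at each point. Taking
  \<open>deriv\<close> in space makes them global functions; the time derivative, which is one-sided
  at \<open>T\<close>, is instead recovered from the equation.\<close>

lemma solves_of_solves_pde:
 assumes "solves_pde T eps b z F" and eps: "0 < eps"
 obtains Zt Zxx where "solves T eps b z Zt Zxx F"
proof -
 define Zx where "Zx x t = deriv (\<lambda>x. z x t) x" for x t
 define Zxx where "Zxx x t = deriv (\<lambda>x. Zx x t) x" for x t
 define Zt where "Zt x t = F x t + eps * Zxx x t - b t * z x t" for x t
 have main: "(z x has_real_derivative Zt x t) (at t within {0..T}) \<and> ((\<lambda>x. z x t) has_real_derivative Zx x t) (at x) \<and>
   ((\<lambda>x. Zx x t) has_real_derivative Zxx x t) (at x)" if xt: "0 < x" "x < 1" "0 < t" "t <= T" for x t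
 proof -
  have xt': "x \<in> {0<..<1}" "t \<in> {0<..T}" using xt by auto
  obtain zt zx zxx where *: "((\<lambda>\<tau>. z x \<tau>) has_real_derivative zt) (at t within {0..T})"
   "\<And>xi. xi \<in> {0<..<1} ==> ((\<lambda>\<eta>. z \<eta> t) has_real_derivative zx xi) (at xi)"
   "(zx has_real_derivative zxx) (at x)" "zt - eps * zxx + b t * z x t = F x t"
   using assms(1)[unfolded solves_pde_def, rule_format, OF xt'] by blast
  have zx: "Zx xi t = zx xi" if "xi \<in> {0<..<1}" for xi
   unfolding Zx_def by (rule DERIV_imp_deriv[OF *(2)[OF that]])
  have zxx: "((\<lambda>x. Zx x t) has_real_derivative zxx) (at x)"
   by (rule has_field_derivative_transform_within_open[OF *(3), where S="{0<..<1}"]) (use zx xt in auto)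
  then have "Zxx x t = zxx" unfolding Zxx_def by (rule DERIV_imp_deriv)
  then have "Zt x t = zt" using *(4) unfolding Zt_def by simp
  then show ?thesis using *(1) *(2)[of x] zx[of x] zxx \<open>Zxx x t = zxx\<close> xt by simp
 qed
 have "solves T eps b z Zt Zxx F"
 proof (rule solvesI[where Ux=Zx])
  show "Zt x t - eps * Zxx x t + b t * z x t = F x t" for x t by (simp add: Zt_def)
 qed (use main in blast)+
 then show thesis by (rule that)
qed

lemma approx_ok_nonneg:
 assumes "approx_ok T eps m P d C U Ut Uxx" "0 < T" shows "0 <= C"
proof -
 have "0 <= C * abs (T - 0)" by (rule order_trans[OF abs_ge_zero approx_okD(1)[OF assms(1), of 0 0 T]]) (use assms in auto)
 then show ?thesis using assms(2) by (simp add: zero_le_mult_iff)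
qed

context layer
begin

text \<open>The critical time is \<open>t = d\<close> when \<open>d\<close> is positive: the two
  pieces have a common time derivative 0 there because, at each interior \<open>x\<close>, the layer
  function vanishes quadratically at \<open>d\<close>.\<close>

lemma solves_layer:
 assumes pde: "\<And>x t. 0 < x ==> x < 1 ==> d < t ==> t <= T ==> Ut x t - eps * U2 x t + b t * U x t = G x t"
  and G: "\<And>x t. 0 < x ==> x < 1 ==> t <= d ==> G x t = 0"
  and quad: "\<And>x. 0 < x ==> x < 1 ==> 0 < d ==> \<exists>A. \<forall>t. d < t \<and> t <= T \<longrightarrow> abs (U x t) <= A * (t - d)^2"
 shows "solves T eps b U Ut U2 G"
proof (rule solvesI[where Ux="\<lambda>x t. if t <= d then 0 else U1 x t"])
 note z = before[THEN conjunct1] before[THEN conjunct2, THEN conjunct1] before[THEN conjunct2, THEN conjunct2]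
 fix x t :: real assume xt: "0 < x" "x < 1" "0 < t" "t <= T"
 show "Ut x t - eps * U2 x t + b t * U x t = G x t" using pde[of x t] G[of x t] z[of t x] xt by (cases "t <= d") auto
 show "((\<lambda>x. U x t) has_real_derivative (if t <= d then 0 else U1 x t)) (at x)"
  using der1[OF _ xt(4)] z(1) by (cases "t <= d") auto
 show "((\<lambda>x. if t <= d then 0 else U1 x t) has_real_derivative U2 x t) (at x)"
  using der2[OF _ xt(4)] z(3) by (cases "t <= d") auto
 show "(U x has_real_derivative Ut x t) (at t within {0..T})"
 proof (cases "d < t")
  case True then show ?thesis by (rule der_t[OF _ xt(4)])
 next
  case False
  then have d: "0 < d" "t <= d" using xt by auto
  obtain A where A: "\<And>t. d < t ==> t <= T ==> abs (U x t) <= A * (t - d)^2" using quad[OF xt(1,2) d(1)] by blast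
  have q: "abs (U x s) <= abs A * (s - t)^2" if "s \<in> {0..T}" for s
  proof (cases "s <= d")
   case False
   have "abs (U x s) <= A * (s - d)^2" by (rule A) (use False that in auto)
   also have "\<dots> <= abs A * (s - t)^2" using False d by (intro mult_mono power_mono) auto
   finally show ?thesis .
  qed (use z(1) in simp)
  have "((\<lambda>s. (U x s - U x t) / (s - t)) \<longlongrightarrow> 0) (at t within {0..T})"
  proof (rule Lim_null_comparison)
   show "\<forall>\<^sub>F s in at t within {0..T}. norm ((U x s - U x t) / (s - t)) <= abs A * abs (s - t)"
    unfolding eventually_at_filter
   proof (intro always_eventually allI impI)
    fix s assume s: "s \<noteq> t" "s \<in> {0..T}"
    have "abs (U x s) / abs (s - t) <= (abs A * (s - t)^2) / abs (s - t)" using q[OF s(2)] by (intro divide_right_mono) auto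
    then have "abs (U x s) / abs (s - t) <= abs A * ((s - t)^2 / abs (s - t))" by simp
    moreover have "(s - t)^2 = abs (s - t) * abs (s - t)" by (simp add: power2_eq_square)
    then have "(s - t)^2 / abs (s - t) = abs (s - t)" using s(1) by (simp del: abs_mult_self_eq)
    ultimately show "norm ((U x s - U x t) / (s - t)) <= abs A * abs (s - t)" using z(1)[OF d(2)] by (simp add: abs_divide)
   qed
   have "((\<lambda>s. (abs A) * abs (s - t)) \<longlongrightarrow> abs A * abs (t - t)) (at t within {0..T})" by (intro tendsto_intros)
   then show "((\<lambda>s. (abs A) * abs (s - t)) \<longlongrightarrow> 0) (at t within {0..T})" by simp
  qed
  then show ?thesis unfolding has_field_derivative_iff z(2)[OF d(2)] .
 qed
qed

lemma layer_continuous_x: "t <= T ==> continuous_on {0..1} (\<lambda>x. U x t)"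
 using before[of t] DERIV_continuous_on[OF has_field_derivative_at_within[OF der1[of t]], of "{0..1}"]
 by (cases "t <= d") auto

end

definition error_le where
 "error_le T C N M xs y Y \<longleftrightarrow>
   sup_norm (Qbar T) (\<lambda>(x, t). y x t - bilinear_interp xs (tmesh T M) Y x t)
   <= ereal ((C * (ln (real N))^2 / (real N)^2 + C / real M) * ln (real M))"

section \<open>Reduction of the remainder to its regular part\<close>

locale setting =
 fixes T \<mu> B :: real and b b' :: "real => real"
 assumes T: "0 < T" and mu: "0 < \<mu>" and B: "1 <= B"
  and b: "\<And>t. 0 <= t ==> t <= T ==> 0 <= b t \<and> b t <= B"
  and b_deriv: "\<And>t. 0 <= t ==> t <= T ==> (b has_real_derivative b' t) (at t within {0..T})"
  and b_bound: "\<And>t. 0 <= t ==> t <= T ==> abs (b' t) <= B" and b_tay: "tay B {0..T} b b'"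
begin

definition "m = \<mu> / (2 * sqrt T)"

lemma m_pos: "0 < m" using T mu by (simp add: m_def)

definition "Ce K D = (regular.cr T K m + D) * (4 * T + 26) * (mesh_const \<mu> T + T)"

text \<open>The singular part \<open>S\<close> is any sum of singular functions that absorbs the
  difference between \<open>F\<close> and the smooth source \<open>f\<close> and repairs the corner
  compatibility. The resulting constant is determined by \<open>K\<close>, \<open>D\<close> and the
  data fixed in \<open>setting\<close>, hence is uniform in \<open>eps\<close>, \<open>N\<close> and
  \<open>M\<close>.\<close>

lemma remainder_bound:
 assumes eps: "0 < eps" "eps <= 1" and K: "B <= K" and d: "0 <= d"
  and f_time: "\<And>x. 0 <= x ==> x <= 1 ==> tay K {0..T} (f x) (ft x)"
  and f_space: "\<And>t. 0 <= t ==> t <= T ==> smooth_data K (\<lambda>x. f x t) (\<lambda>x. f\<^sub>2 x t)"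
  and P: "{0, 1} \<subseteq> P" and S: "approx_ok T eps m P d D S St Sxx" "solves T eps b S St Sxx (\<lambda>x t. F x t - f x t)"
  "\<And>t. 0 <= t ==> t <= T ==> continuous_on {0..1} (\<lambda>x. S x t)"
  and y: "continuous_on (Qbar T) (\<lambda>(x, t). y x t)" "solves_pde T eps b y F"
  and psi: "smooth_data K (\<lambda>x. y x 0 - S x 0) \<psi>\<^sub>2"
  and bd0: "tay K {0..T} (\<lambda>t. y 0 t - S 0 t) g\<^sub>0" and bd1: "tay K {0..T} (\<lambda>t. y 1 t - S 1 t) g\<^sub>1"
  and compat0: "g\<^sub>0 0 = eps * \<psi>\<^sub>2 0 - b 0 * (y 0 0 - S 0 0) + f 0 0"
  and compat1: "g\<^sub>1 0 = eps * \<psi>\<^sub>2 1 - b 0 * (y 1 0 - S 1 0) + f 1 0"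
  and mesh: "mesh_ok eps m P (mesh_const \<mu> T * rate N) I N xs" and N: "0 < N" "2 <= M"
  and Y: "discrete_solution eps b N M xs (tmesh T M) F y Y"
 shows "error_le T (Ce K D) N M xs y Y"
proof -
 obtain yt yxx where ys: "solves T eps b y yt yxx F" by (rule solves_of_solves_pde[OF y(2) eps(1)])
 have "solves T eps b (\<lambda>x t. y x t + -1 * S x t) (\<lambda>x t. yt x t + -1 * St x t) (\<lambda>x t. yxx x t + -1 * Sxx x t) f"
  by (rule solves_cong[OF solves_add[OF ys solves_cmult[OF S(2), where r="-1"]]]) simp
 then have ws: "solves T eps b (\<lambda>x t. y x t - S x t) (\<lambda>x t. yt x t - St x t) (\<lambda>x t. yxx x t - Sxx x t) f" by simp
 obtain wx where wx: "\<forall>x t. 0 < x \<and> x < 1 \<and> 0 < t \<and> t <= T \<longrightarrow>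
   ((\<lambda>t. y x t - S x t) has_real_derivative yt x t - St x t) (at t within {0..T}) \<and>
   ((\<lambda>x. y x t - S x t) has_real_derivative wx x t) (at x) \<and>
   ((\<lambda>x. wx x t) has_real_derivative yxx x t - Sxx x t) (at x) \<and>
   yt x t - St x t - eps * (yxx x t - Sxx x t) + b t * (y x t - S x t) = f x t"
  using ws[unfolded solves_def] by (rule exE) (rule that)
 have w:
  "((\<lambda>t. y x t - S x t) has_real_derivative yt x t - St x t) (at t within {0..T})"
  "((\<lambda>x. y x t - S x t) has_real_derivative wx x t) (at x)"
  "((\<lambda>x. wx x t) has_real_derivative yxx x t - Sxx x t) (at x)"
  "yt x t - St x t - eps * (yxx x t - Sxx x t) + b t * (y x t - S x t) = f x t"
  if "0 < x" "x < 1" "0 < t" "t <= T" for x t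
  using wx[rule_format, OF conjI[OF that(1) conjI[OF that(2) conjI[OF that(3,4)]]]] by blast+
 have "regular T eps K b b' f f\<^sub>2 ft (\<lambda>x t. y x t - S x t) (\<lambda>x t. yt x t - St x t) wx (\<lambda>x t. yxx x t - Sxx x t)
   (\<lambda>x. y x 0 - S x 0) \<psi>\<^sub>2 g\<^sub>0 g\<^sub>1"
 proof (rule regular.intro)
  show "0 <= b t \<and> b t <= K" if "0 <= t" "t <= T" for t using b[OF that] K by auto
  show "tay K {0..T} b b'" by (rule tay_mono[OF b_tay K order_refl])
  have "continuous_on ({0..1} \<times> {0..T}) (\<lambda>(x, t). S x t)"
   by (rule continuous_on_of_lipschitz_time[OF approx_okD(1)[OF S(1)]]) (use S(3) in auto)
  from continuous_on_diff[OF y(1)[unfolded Qbar_def] this]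
  show "continuous_on ({0..1} \<times> {0..T}) (\<lambda>(x, t). y x t - S x t)" by (simp add: case_prod_unfold)
  show "y x 0 - S x 0 = y x 0 - S x 0" for x ..
  show "1 <= K" using B K by simp
 qed (fact T eps f_time f_space psi bd0 bd1 compat0 compat1 w)+
 then have "approx_ok T eps m P d (regular.cr T K m) (\<lambda>x t. y x t - S x t) (\<lambda>x t. yt x t - St x t) (\<lambda>x t. yxx x t - Sxx x t)"
  by (rule regular.regular_approx_ok[OF _ m_pos P])
 from approx_ok_add[OF this S(1) eps(1)]
 have ok: "approx_ok T eps m P d (regular.cr T K m + D) y yt yxx" by simp
 let ?C = "regular.cr T K m + D"
 have C0: "0 <= ?C" by (rule approx_ok_nonneg[OF ok T])
 have mc: "0 <= mesh_const \<mu> T" using T by (simp add: mesh_const_def)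
 interpret sch: scheme T eps m ?C d "mesh_const \<mu> T * rate N" b P I N M xs F y yt yxx Y
 proof
  show "yt x t - eps * yxx x t + b t * y x t = F x t" if "0 < x" "x < 1" "0 < t" "t <= T" for x t
   using ys that unfolding solves_def by blast
 qed (use T eps C0 d mc b N mesh ok Y in \<open>auto simp: rate_def\<close>)
 have "ln (real M) \<ge> 0" using N by simp
 have "?C * (4 * T + 26) * (mesh_const \<mu> T * rate N + sch.k) * ln (real M)
   <= (Ce K D * (ln (real N))^2 / (real N)^2 + Ce K D / real M) * ln (real M)"
 proof (rule mult_right_mono)
  have "mesh_const \<mu> T * rate N + sch.k <= (mesh_const \<mu> T + T) * rate N + (mesh_const \<mu> T + T) * (1 / real M)"
  proof (rule add_mono)
   show "mesh_const \<mu> T * rate N <= (mesh_const \<mu> T + T) * rate N" using T by (intro mult_right_mono) (auto simp: rate_def)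
   have "T * (1 / real M) <= (mesh_const \<mu> T + T) * (1 / real M)" using mc by (intro mult_right_mono) auto
   then show "sch.k <= (mesh_const \<mu> T + T) * (1 / real M)" by (simp add: sch.k_def)
  qed
  then have "?C * (4 * T + 26) * (mesh_const \<mu> T * rate N + sch.k)
   <= ?C * (4 * T + 26) * ((mesh_const \<mu> T + T) * rate N + (mesh_const \<mu> T + T) * (1 / real M))"
   using C0 T by (intro mult_left_mono) auto
  also have "\<dots> = Ce K D * (ln (real N))^2 / (real N)^2 + Ce K D / real M"
   by (simp add: Ce_def rate_def power_divide algebra_simps add_divide_distrib)
  finally show "?C * (4 * T + 26) * (mesh_const \<mu> T * rate N + sch.k)
   <= Ce K D * (ln (real N))^2 / (real N)^2 + Ce K D / real M" .
 qed fact
 note le = order_trans[OF sch.interpolation_error this]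
 show ?thesis
  unfolding error_le_def sup_norm_def
 proof (rule SUP_least)
  fix q assume "q \<in> Qbar T"
  then obtain x t where q: "q = (x, t)" "0 <= x" "x <= 1" "0 <= t" "t <= T" by (auto simp: Qbar_def)
  show "ereal (abs (case q of (x, t) => y x t - bilinear_interp xs (tmesh T M) Y x t))
    <= ereal ((Ce K D * (ln (real N))^2 / (real N)^2 + Ce K D / real M) * ln (real M))"
   using le[OF q(2-)] by (simp add: q(1))
 qed
qed

end

section \<open>Traces of the singular functions on the lateral boundary\<close>

lemma sing_k0: "0 < eps ==> 0 < t ==> sing eps \<beta> x t = exp (- \<beta> * t) * k0 (x / sqrt eps) t"
 by (simp add: sing_def k0_def real_sqrt_mult mult_ac)

lemma k0_0 [simp]: "k0 0 t = 0" by (simp add: k0_def)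

text \<open>Away from its pole the error function differs from its sign by a term that is flat at
  \<open>d\<close>, uniformly for arguments of size at least \<open>c\<close>, and therefore
  uniformly in \<open>eps\<close>. The sign part is left to the caller.\<close>

lemma trace_k0:
 assumes d: "0 <= d" "d <= T" and c: "0 < c" "c <= abs xi"
  and e: "C2_bound T B e e' e''"
 obtains g where "tay (B * (256 * exp 16 / c^4) * (1 + T)^2 * (2 + T)) {0..T}
  (\<lambda>t. if t <= d then 0 else e t * (k0 xi (t - d) - sgn xi)) g" "\<forall>t\<le>d. g t = 0"
proof (rule that, rule tay_flat_product[OF d _ e])
 show "((\<lambda>\<tau>. k0 xi \<tau> - sgn xi) has_real_derivative km2 xi \<tau>) (at \<tau>)" "(km2 xi has_real_derivative km4 xi \<tau>) (at \<tau>)"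
  if "0 < \<tau>" for \<tau>
  using DERIV_diff[OF k0_t[OF that] DERIV_const] km2_t[OF that] by simp_all
 show "abs (k0 xi \<tau> - sgn xi) <= 256 * exp 16 / c ^ 4 * \<tau>^2 \<and> abs (km2 xi \<tau>) <= 256 * exp 16 / c ^ 4 * \<tau> \<and>
   abs (km4 xi \<tau>) <= 256 * exp 16 / c ^ 4" if "0 < \<tau>" for \<tau>
  using kernel_flat[OF c that] by blast
qed (use c in auto)

text \<open>The time derivative of \<open>rk\<close> is the complementary error function, which is
  flat for \<open>xi\<close> bounded away from 0; integrating it from the initial value 0 gains one
  more power of \<open>t\<close>.\<close>

lemma rk_flat:
 assumes c: "0 < c" "c <= xi" and t: "0 < t" "t <= T"
 shows "abs (rk xi t) <= 256 * exp 16 / c^4 * (1 + T) * t^2" "abs (1 - k0 xi t) <= 256 * exp 16 / c^4 * (1 + T) * t"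
  "abs (km2 xi t) <= 256 * exp 16 / c^4 * (1 + T)"
proof -
 define L where "L = 256 * exp 16 / c^4"
 have L: "0 <= L" using c by (simp add: L_def)
 have kf: "abs (1 - k0 xi z) <= L * z^2" "abs (km2 xi z) <= L * z" if "0 < z" for z
  using kernel_flat(1,2)[of c xi z] c that by (auto simp: L_def abs_minus_commute)
 have k0: "abs (1 - k0 xi z) <= L * (1 + T) * z" if z: "0 < z" "z <= t" for z
 proof -
  have "L * z^2 = L * z * z" by (simp add: power2_eq_square)
  also have "\<dots> <= L * (1 + T) * z" using z t L by (intro mult_right_mono mult_left_mono) auto
  finally show ?thesis using kf(1)[OF z(1)] by linarith
 qed
 show "abs (1 - k0 xi t) <= 256 * exp 16 / c^4 * (1 + T) * t" using k0[of t] t by (simp add: L_def)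
 have "L * t <= L * (1 + T)" using t L by (intro mult_left_mono) auto
 then show "abs (km2 xi t) <= 256 * exp 16 / c^4 * (1 + T)" using kf(2)[OF t(1)] unfolding L_def by linarith
 have "abs (rk xi t) <= L * (1 + T) * t * (t - 0)"
 proof (rule le_of_vanishing[where S=UNIV])
  fix z assume z: "0 < z" "z <= t"
  show "(rk xi has_real_derivative 1 - k0 xi z) (at z within UNIV)" using rk_deriv(5)[OF z(1)] .
  have "L * (1 + T) * z <= L * (1 + T) * t" using z t L by (intro mult_left_mono) auto
  then show "abs (1 - k0 xi z) <= L * (1 + T) * t" using k0[OF z] by linarith
  show "abs (rk xi z) <= kc 0 t * (z - 0)" using rk_le[of 0 z t xi] z c by simp
 qed (use t in auto)
 then show "abs (rk xi t) <= 256 * exp 16 / c^4 * (1 + T) * t^2" by (simp add: L_def power2_eq_square mult.assoc)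
qed

lemma trace_rk:
 assumes d: "0 <= d" "d <= T" and c: "0 < c" "c <= xi"
  and e: "C2_bound T B e e' e''"
 obtains g where "tay (B * (256 * exp 16 / c^4 * (1 + T)) * (1 + T)^2 * (2 + T)) {0..T}
  (\<lambda>t. if t <= d then 0 else e t * rk xi (t - d)) g" "\<forall>t\<le>d. g t = 0"
proof (rule that, rule tay_flat_product[OF d _ e])
 show "abs (rk xi \<tau>) <= 256 * exp 16 / c^4 * (1 + T) * \<tau>^2 \<and> abs (1 - k0 xi \<tau>) <= 256 * exp 16 / c^4 * (1 + T) * \<tau> \<and>
   abs (- km2 xi \<tau>) <= 256 * exp 16 / c^4 * (1 + T)" if "0 < \<tau>" "\<tau> <= T" for \<tau>
  using rk_flat[OF c that] by simp
qed (use d c rk_deriv(5,6) in auto)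

text \<open>At distance \<open>abs a\<close> from the pole the scaled kernel is the polynomial
  \<open>abs a^3 / 6 + eps * abs a * t\<close> plus a flat remainder. The polynomial determines the
  initial slope of the trace, and its second term is \<open>eps\<close> times the second space
  derivative of the initial value.\<close>

lemma trace_cubic:
 assumes eps: "0 < eps" "eps <= 1" and T: "0 <= T" and c: "0 < c" "c <= abs a" "abs a <= 1"
  and e: "C2_bound T B e e' e''"
  and e0: "e 0 = 1"
 obtains g where "tay (4 * B * (1 + T) + B * (256 * exp 16 / c^4 * T + 2 * (exp 16 / c)) * (1 + T)^2 * (2 + T)) {0..T} (cubic e eps p (p + a)) g"
  "g 0 = e' 0 * (abs a^3 / 6) + eps * abs a"
proof -
 define xi where "xi = a / sqrt eps"
 define s where "s = eps * sqrt eps"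
 define C where "C = 256 * exp 16 / c^4 * T + 2 * (exp 16 / c)"
 have se: "0 < sqrt eps" "sqrt eps <= 1" using eps by auto
 have s: "0 < s" "s <= 1" using eps se by (auto simp: s_def mult_le_one)
 have C0: "0 <= C" using c T by (simp add: C_def)
 have xi: "c <= abs xi" 
 proof -
  have "abs a * sqrt eps <= abs a * 1" using se by (intro mult_left_mono) auto
  then have "abs a <= abs a / sqrt eps" using se by (simp add: pos_le_divide_eq)
  then show ?thesis using c se by (simp add: xi_def abs_divide)
 qed
 have sx: "s * abs xi = eps * abs a" "s * (abs xi^3 / 6) = abs a^3 / 6"
  using eps by (simp_all add: s_def xi_def abs_divide power_divide power3_eq_cube)
 have sx1: "s * abs xi <= 1" unfolding sx using eps c mult_mono[of eps 1 "abs a" 1] by simp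
 \<comment> \<open>The flat remainder after subtraction of the heat polynomial; \<open>q'\<close> is
   its time derivative, and the derivative of \<open>q'\<close> is \<open>s * gk\<close>.\<close>
 define q where "q \<tau> = s * (k3 xi \<tau> - abs xi^3 / 6 - \<tau> * abs xi)" for \<tau>
 define q' where "q' \<tau> = s * (k1 xi \<tau> - abs xi)" for \<tau>
 have dq: "(q has_real_derivative q' \<tau>) (at \<tau>)" "(q' has_real_derivative s * gk xi \<tau>) (at \<tau>)" if "0 < \<tau>" for \<tau>
  unfolding q_def[abs_def] q'_def[abs_def] using k3_t[OF that, of xi UNIV] k1_t[OF that, of xi UNIV]
  by (auto intro!: derivative_eq_intros)
 have q'b: "abs (q' \<tau>) <= C * \<tau>" if \<tau>: "0 < \<tau>" "\<tau> <= T" for \<tau>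
 proof -
  have g: "0 < gk xi \<tau>" "gk xi \<tau> <= exp 16 / c" using gk_pos[OF \<tau>(1)] kernel_flat(4)[OF c(1) xi \<tau>(1)] by auto
  have "xi * sgn xi = abs xi" by (simp add: sgn_if abs_if)
  then have k: "k1 xi \<tau> - abs xi = xi * (k0 xi \<tau> - sgn xi) + 2 * \<tau> * gk xi \<tau>" by (simp add: k1_def algebra_simps)
  have "q' \<tau> = s * xi * (k0 xi \<tau> - sgn xi) + s * (2 * \<tau> * gk xi \<tau>)" unfolding q'_def k by (simp add: algebra_simps)
  moreover have "abs (s * xi * (k0 xi \<tau> - sgn xi)) <= 1 * (256 * exp 16 / c^4 * \<tau>^2)"
   unfolding abs_mult[of "s * xi"] using sx1 s kernel_flat(1)[OF c(1) xi \<tau>(1)] by (intro mult_mono) (auto simp: abs_mult)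
  moreover have "abs (s * (2 * \<tau> * gk xi \<tau>)) <= 1 * (2 * \<tau> * (exp 16 / c))"
   unfolding abs_mult using s \<tau> g by (intro mult_mono) auto
  moreover have "256 * exp 16 / c^4 * \<tau>^2 <= 256 * exp 16 / c^4 * (T * \<tau>)"
   using \<tau> c by (intro mult_left_mono) (auto simp: power2_eq_square mult_right_mono)
  moreover have "C * \<tau> = 256 * exp 16 / c^4 * (T * \<tau>) + 2 * \<tau> * (exp 16 / c)" by (simp add: C_def algebra_simps)
  ultimately show ?thesis
   using abs_triangle_ineq[of "s * xi * (k0 xi \<tau> - sgn xi)" "s * (2 * \<tau> * gk xi \<tau>)"] by simp
 qed
 have qb: "abs (q \<tau>) <= C * \<tau>^2" if \<tau>: "0 < \<tau>" "\<tau> <= T" for \<tau>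
 proof -
  have "abs (q \<tau>) <= C * \<tau> * (\<tau> - 0)"
  proof (rule le_of_vanishing[where S=UNIV, OF dq(1)])
   fix z assume z: "0 < z" "z <= \<tau>"
   have "C * z <= C * \<tau>" using z C0 by (intro mult_left_mono) auto
   then show "abs (q' z) <= C * \<tau>" using q'b[of z] z \<tau> by simp
   have "abs (k3 xi z - abs xi^3 / 6) <= z * abs xi + 4 * (kc 0 \<tau> * (z * sqrt z))" by (rule k3_le) (use z in auto)
   moreover have "kc 0 \<tau> * (z * sqrt z) <= kc 0 \<tau> * (z * sqrt \<tau>)" using z kc_1[of 0 \<tau>] by (intro mult_left_mono) auto
   ultimately have "abs (k3 xi z - abs xi^3 / 6 - z * abs xi) <= 2 * (z * abs xi) + 4 * (kc 0 \<tau> * (z * sqrt \<tau>))"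
    using abs_triangle_ineq4[of "k3 xi z - abs xi^3 / 6" "z * abs xi"] z by (simp add: abs_mult)
   also have "\<dots> = (2 * abs xi + 4 * kc 0 \<tau> * sqrt \<tau>) * z" by (simp add: algebra_simps)
   finally have "s * abs (k3 xi z - abs xi^3 / 6 - z * abs xi) <= s * ((2 * abs xi + 4 * kc 0 \<tau> * sqrt \<tau>) * z)"
    using s by (intro mult_left_mono) auto
   then show "abs (q z) <= s * (2 * abs xi + 4 * kc 0 \<tau> * sqrt \<tau>) * (z - 0)" using s by (simp add: q_def abs_mult mult.assoc)
  qed (use \<tau> in auto)
  then show ?thesis by (simp add: power2_eq_square mult.assoc)
 qed
 have flat: "tay (B * C * (1 + T)^2 * (2 + T)) {0..T} (\<lambda>t. if t <= 0 then 0 else e t * q (t - 0))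
  (\<lambda>t. if t <= 0 then 0 else e' t * q (t - 0) + e t * q' (t - 0))"
 proof (rule tay_flat_product[OF order_refl T C0 e dq])
  show "abs (q \<tau>) <= C * \<tau>^2 \<and> abs (q' \<tau>) <= C * \<tau> \<and> abs (s * gk xi \<tau>) <= C" if "0 < \<tau>" "\<tau> <= T" for \<tau>
  proof -
   have "abs (s * gk xi \<tau>) <= 1 * (exp 16 / c)"
    unfolding abs_mult using s gk_pos[OF that(1), of xi] kernel_flat(4)[OF c(1) xi that(1)] by (intro mult_mono) auto
   also have "\<dots> <= C"
   proof -
    have "0 <= 256 * exp 16 / c^4 * T" "0 <= exp 16 / c" using c T by auto
    then show ?thesis unfolding C_def by linarith
   qed
   finally show ?thesis using qb[OF that] q'b[OF that] by blast
  qed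
 qed auto
 define r where "r t = abs a^3 / 6 + eps * abs a * t" for t
 have ea: "0 <= eps * abs a" "eps * abs a <= 1" using eps c mult_mono[of eps 1 "abs a" 1] by auto
 have rb: "abs (r t) <= 1 + T" if "0 <= t" "t <= T" for t
 proof -
  have "abs a^3 <= 1" "0 <= abs a^3" using c by (auto simp: power_le_one)
  moreover have "eps * abs a * t <= 1 * T" by (rule mult_mono) (use ea that in auto)
  moreover have "0 <= eps * abs a * t" using ea that by simp
  ultimately show ?thesis by (simp add: r_def)
 qed
 have dr: "(r has_real_derivative eps * abs a) (at t within S)" for t S
  unfolding r_def[abs_def] by (auto intro!: derivative_eq_intros)
 have "C2_bound T (4 * B * (1 + T)) (\<lambda>t. e t * r t) (\<lambda>t. e' t * r t + eps * abs a * e t)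
   (\<lambda>t. (e'' t * r t + eps * abs a * e' t) + eps * abs a * e' t)"
  unfolding C2_bound_def
 proof (intro ballI conjI)
  fix t assume "t \<in> {0..T}"
  then have t: "0 <= t" "t <= T" by auto
  note E = C2_boundD[OF e t]
  show "((\<lambda>t. e t * r t) has_real_derivative e' t * r t + eps * abs a * e t) (at t within {0..T})"
   by (rule DERIV_mult[OF E(1) dr])
  show "((\<lambda>t. e' t * r t + eps * abs a * e t) has_real_derivative (e'' t * r t + eps * abs a * e' t) + eps * abs a * e' t) (at t within {0..T})"
   by (rule DERIV_add[OF DERIV_mult[OF E(2) dr] DERIV_cmult[OF E(1)]])
  have m1: "abs (u * r t) <= B * (1 + T)" if "abs u <= B" for u unfolding abs_mult using that rb[OF t] E(6) by (intro mult_mono) auto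
  have m2: "abs (eps * abs a * u) <= 1 * B" if "abs u <= B" for u unfolding abs_mult[of "eps * abs a"] using that ea E(6) by (intro mult_mono) auto
  have BT: "4 * B * (1 + T) = 4 * (B * (1 + T))" "B <= B * (1 + T)" using E(6) T by (auto simp: algebra_simps)
  show "abs (e t * r t) <= 4 * B * (1 + T)" "abs (e' t * r t + eps * abs a * e t) <= 4 * B * (1 + T)"
    "abs ((e'' t * r t + eps * abs a * e' t) + eps * abs a * e' t) <= 4 * B * (1 + T)"
   using m1[OF E(3)] m1[OF E(4)] m1[OF E(5)] m2[OF E(3)] m2[OF E(4)] BT E(6) by linarith+
 qed
 from tay_add[OF tay_C2[OF this] flat]
 have "tay (4 * B * (1 + T) + B * C * (1 + T)^2 * (2 + T)) {0..T} (cubic e eps p (p + a))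
   (\<lambda>t. (e' t * r t + eps * abs a * e t) + (if t <= 0 then 0 else e' t * q (t - 0) + e t * q' (t - 0)))"
 proof (rule tay_cong)
  fix t assume t: "t \<in> {0..T}"
  show "cubic e eps p (p + a) t = e t * r t + (if t <= 0 then 0 else e t * q (t - 0))"
  proof (cases "t <= 0")
   case True
   then have "t = 0" using t by simp
   then show ?thesis by (simp add: cubic_def r_def e0)
  next
   case False
   have "r t + q t = s * k3 xi t"
    unfolding q_def r_def right_diff_distrib sx(2) using sx(1) by (simp add: algebra_simps)
   then have "e t * r t + e t * q t = e t * (s * k3 xi t)" by (simp add: distrib_left[symmetric])
   then show ?thesis using False by (simp add: cubic_def s_def xi_def)
  qed
 qed auto
 then show thesis
  by (rule that[unfolded C_def[symmetric]]) (simp add: r_def e0)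
qed

section \<open>The singular functions as solutions\<close>

context setting
begin

text \<open>Since \<open>k0\<close> solves the heat equation, only the coefficient produces a
  source, namely \<open>(e' + b * e) * k0\<close>. The coefficient is thus chosen by an ordinary
  differential equation whose right-hand side matches the unwanted source.\<close>

lemma erf_part:
 assumes eps: "0 < eps" "eps <= 1" and d: "0 <= d" and p: "p \<in> P" and L: "0 <= L" and e: "flat_at T d L e e' e''"
  and ode: "\<And>t. 0 <= t ==> t <= T ==> e' t + b t * e t = c t"
 obtains St Sxx where "approx_ok T eps m P d (layer.cl T m (4 * (L * kc m T * (1 + T)^2))) (kpart k0 e 1 eps p d) St Sxx"
  "solves T eps b (kpart k0 e 1 eps p d) St Sxx (\<lambda>x t. if t <= d then 0 else c t * k0 ((x - p) / sqrt eps) (t - d))"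
  "\<forall>t\<le>T. continuous_on {0..1} (\<lambda>x. kpart k0 e 1 eps p d x t)"
proof -
 have hl: "heat_layer T eps m (L * kc m T * (1 + T)^2) p d 1 e e' e'' e k0 gk km2 km3 km4 UNIV"
  by (rule erf_heat_layer) (use T eps m_pos L d flat_atD[OF e] in auto)
 note lay = heat_layer.kp_layer[OF hl]
 show thesis
 proof (rule that[OF layer.layer_approx_ok[OF lay p] layer.solves_layer[OF lay] allI[OF impI[OF layer.layer_continuous_x[OF lay]]]])
  fix x t assume t: "d < t" "t <= T"
  have "c t = e' t + b t * e t" using ode t d by simp
  then show "kpart k0 e' 1 eps p d x t + kpart km2 e 1 eps p d x t - eps * (1 / eps * kpart km2 e 1 eps p d x t) +
    b t * kpart k0 e 1 eps p d x t = (if t <= d then 0 else c t * k0 ((x - p) / sqrt eps) (t - d))"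
   using t eps by (simp add: kpart_def algebra_simps)
 next
  fix x show "\<exists>A. \<forall>t. d < t \<and> t <= T \<longrightarrow> abs (kpart k0 e 1 eps p d x t) <= A * (t - d)^2"
  proof (intro exI[of _ L] allI impI)
   fix t assume t: "d < t \<and> t <= T"
   have "abs (e t) * abs (k0 ((x - p) / sqrt eps) (t - d)) <= L * (t - d)^2 * 1"
    using flat_atD(3)[OF e, of t] t L k0_abs_le by (intro mult_mono) auto
   then show "abs (kpart k0 e 1 eps p d x t) <= L * (t - d)^2" using t by (simp add: kpart_def abs_mult)
  qed
 qed auto
qed

lemma rk_part:
 assumes eps: "0 < eps" "eps <= 1" and d: "0 <= d" and p: "1 \<in> P" and L: "0 <= L" and e: "C2_bound T L e e' e''"
  and ode: "\<And>t. 0 <= t ==> t <= T ==> e' t + b t * e t = 0"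
 obtains St Sxx where "approx_ok T eps m P d (layer.cl T m (4 * (L * kc m T * (1 + T)^2))) (kpart rk e (-1) eps 1 d) St Sxx"
  "solves T eps b (kpart rk e (-1) eps 1 d) St Sxx (\<lambda>x t. 0)"
  "\<forall>t\<le>T. continuous_on {0..1} (\<lambda>x. kpart rk e (-1) eps 1 d x t)"
proof -
 have hl: "heat_layer T eps m (L * kc m T * (1 + T)^2) 1 d (-1) e e' e'' (\<lambda>t. 0) rk (\<lambda>xi t. xi - k1 xi t)
   (\<lambda>xi t. 1 - k0 xi t) (\<lambda>xi t. - gk xi t) (\<lambda>xi t. - km2 xi t) {0..}"
  by (rule rk_heat_layer) (use T eps m_pos L d C2_boundD[OF e] in auto)
 note lay = heat_layer.kp_layer[OF hl]
 show thesis
 proof (rule that[OF layer.layer_approx_ok[OF lay p] layer.solves_layer[OF lay] allI[OF impI[OF layer.layer_continuous_x[OF lay]]]])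
  fix x t assume t: "d < t" "t <= T"
  have "e' t = - (b t * e t)" using ode[of t] t d by simp
  then show "kpart rk e' (-1) eps 1 d x t + kpart (\<lambda>xi t. 1 - k0 xi t) e (-1) eps 1 d x t -
    eps * (1 / eps * kpart (\<lambda>xi t. 1 - k0 xi t) e (-1) eps 1 d x t) + b t * kpart rk e (-1) eps 1 d x t = 0"
   using t eps by (simp add: kpart_def)
 next
  fix x :: real assume x: "0 < x" "x < 1"
  define xi where "xi = -1 * (x - 1) / sqrt eps"
  have xi: "0 < xi" using x eps by (simp add: xi_def)
  show "\<exists>A. \<forall>t. d < t \<and> t <= T \<longrightarrow> abs (kpart rk e (-1) eps 1 d x t) <= A * (t - d)^2"
  proof (intro exI[of _ "L * (256 * exp 16 / xi^4 * (1 + T))"] allI impI)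
   fix t assume t: "d < t \<and> t <= T"
   have "abs (e t) * abs (rk xi (t - d)) <= L * (256 * exp 16 / xi^4 * (1 + T) * (t - d)^2)"
    using C2_boundD(3)[OF e, of t] rk_flat(1)[OF xi order_refl, of "t - d" T] t d L by (intro mult_mono) auto
   then show "abs (kpart rk e (-1) eps 1 d x t) <= L * (256 * exp 16 / xi^4 * (1 + T)) * (t - d)^2"
    using t by (simp add: kpart_def abs_mult xi_def mult_ac)
  qed
 qed auto
qed

text \<open>Accounts for the constant 1 in \<open>1 - s\<close> when the boundary data jump: the
  corresponding source depends on time only, and so does its corrector. Space differences vanish and
  only the time truncation is estimated.\<close>

lemma time_part:
 assumes d: "0 <= d" "d < T" and L: "0 <= L" and eps: "0 < eps"
  and e: "flat_at T d L e e' e''"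
  and ode: "\<And>t. 0 <= t ==> t <= T ==> e' t + b t * e t = c t"
 shows "tay (L * (2 + T)) {0..T} (\<lambda>t. if t <= d then 0 else e t) (\<lambda>t. if t <= d then 0 else e' t)"
  and "approx_ok T eps m P d (6 * (L * (1 + T))) (\<lambda>x t. if t <= d then 0 else e t) (\<lambda>x t. if t <= d then 0 else e' t) (\<lambda>x t. 0)"
  and "solves T eps b (\<lambda>x t. if t <= d then 0 else e t) (\<lambda>x t. if t <= d then 0 else e' t) (\<lambda>x t. 0) (\<lambda>x t. if t <= d then 0 else c t)"
proof -
 let ?E = "\<lambda>t. if t <= d then 0 else e t" and ?E' = "\<lambda>t. if t <= d then 0 else e' t"
 have tr: "((\<lambda>t. if t <= d then 0 else f t) has_real_derivative f' t) (at t within {0..T})"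
  if "d < t" "t <= T" "(f has_real_derivative f' t) (at t within {0..T})" for f f' :: "real => real" and t
  by (rule has_field_derivative_transform_within[OF that(3), where d="t - d"]) (use that d in \<open>auto simp: dist_real_def\<close>)
 have d1: "(?E has_real_derivative ?E' t) (at t within {0..T})" "(?E' has_real_derivative e'' t) (at t within {0..T})"
  if "d < t" "t <= T" for t
  using tr[of t e e'] tr[of t e' e''] flat_atD(1,2)[OF e, of t] that d by auto
 show ty: "tay (L * (2 + T)) {0..T} ?E ?E'"
  by (rule tay_flat[where G''=e'', OF _ _ _ _ d1]) (use d flat_atD(3)[OF e] L in auto)
 show "solves T eps b (\<lambda>x. ?E) (\<lambda>x. ?E') (\<lambda>x t. 0) (\<lambda>x t. if t <= d then 0 else c t)"
 proof (rule solvesI[where Ux="\<lambda>x t. 0"])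
  fix t assume t: "0 < t" "t <= T"
  show "(?E has_real_derivative ?E' t) (at t within {0..T})"
  proof (cases "t = T")
   case True then show ?thesis using d1(1)[of t] d t by simp
  next
   case False
   show ?thesis by (rule has_field_derivative_at_within[OF tay_has_derivative[OF ty]]) (use False t in auto)
  qed
  show "?E' t - eps * 0 + b t * ?E t = (if t <= d then 0 else c t)" using ode[of t] t by simp
 qed auto
 let ?C = "L * (1 + T)"
 have C0: "0 <= ?C" using L T by simp
 have bd': "abs (?E t) <= ?C * (t - d)" "abs (?E' t) <= ?C" "abs (e'' t) <= ?C / (t - d)" if t: "d < t" "t <= T" for t
 proof -
  have td: "0 < t - d" "t - d <= T" using t d by auto
  have b3: "abs (e t) <= L * (t - d)^2" "abs (e' t) <= L * (t - d)" "abs (e'' t) <= L" using flat_atD(3)[OF e, of t] t by auto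
  have "L * (t - d) <= ?C" using td L by (intro mult_left_mono) auto
  moreover from this have "L * (t - d)^2 <= ?C * (t - d)"
   using mult_right_mono[of "L * (t - d)" ?C "t - d"] td by (simp add: power2_eq_square mult_ac)
  moreover have "L <= ?C / (t - d)" using \<open>L * (t - d) <= ?C\<close> td by (simp add: pos_le_divide_eq)
  ultimately show "abs (?E t) <= ?C * (t - d)" "abs (?E' t) <= ?C" "abs (e'' t) <= ?C / (t - d)"
   using b3 t by auto
 qed
 note st = singular_in_time[where g="?E" and g'="?E'" and g''=e'' and g\<^sub>0=0 and C="?C" and T=T and d=d, OF d(1) C0 _ _ _ d1]
 have lip: "abs (?E t - ?E s) <= ?C * abs (t - s)" if "s \<in> {0..T}" "t \<in> {0..T}" for s t
  by (rule st(1)) (use bd' that in auto)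
 have quot: "abs ((?E t - ?E (t - k)) / k - ?E' t) <= 6 * ?C * k * (1 + weight k d t)" if "0 < k" "k <= t" "t <= T" for k t
  by (rule st(2)) (use bd' that in auto)
 have const: "interp_err a c (\<lambda>x. q) x = 0" "divdiff2 a c (\<lambda>x. q) x = 0" if "0 < a" "0 < c" for a c q x :: real
  using that by (simp_all add: interp_err_def divdiff2_def field_simps)
 show "approx_ok T eps m P d (6 * ?C) (\<lambda>x. ?E) (\<lambda>x. ?E') (\<lambda>x t. 0)"
  unfolding approx_ok_def
 proof (intro conjI ballI allI impI; (elim conjE)?)
  fix s t assume st: "s \<in> {0..T}" "t \<in> {0..T}"
  have "?C * abs (t - s) <= 6 * ?C * abs (t - s)" using C0 by (intro mult_right_mono) auto
  then show "abs (?E t - ?E s) <= 6 * ?C * abs (t - s)" using lip[OF st] by (rule order_trans[rotated])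
 next
  fix t k assume "0 < k" "k <= t" "t <= T"
  then show "abs ((?E t - ?E (t - k)) / k - ?E' t) <= 6 * ?C * k * (1 + weight k d t)" by (rule quot)
 next
  fix x a c t k \<nu> :: real
  assume *: "0 < a" "0 < c" "0 < k" "0 <= \<nu>"
  have w: "0 <= 6 * ?C * (\<nu> + k) * (1 + weight k d t)" "0 <= 6 * ?C * eps * (a + c)"
   using weight_nonneg[of k d t] * L T eps by (auto intro!: mult_nonneg_nonneg)
  {
   show "eps * abs (divdiff2 a c (\<lambda>x. ?E t) x - 0) <= 6 * ?C * (\<nu> + k) * (1 + weight k d t)"
    using w(1) const(2)[OF *(1,2)] by simp
  next
   show "abs (interp_err a c (\<lambda>x. ?E t) x) <= 6 * ?C * \<nu>" using const(1)[OF *(1,2)] C0 * by simp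
  next
   show "eps * abs (divdiff2 a c (\<lambda>x. ?E t) x - 0) <= 6 * ?C * (\<nu> + k) * (1 + weight k d t) + 6 * ?C * eps * (a + c)"
    using w const(2)[OF *(1,2)] eps C0 * by simp
  }
 qed
qed

end

lemma setting_exists:
 assumes "0 < T" "0 < \<mu>" and h: "holder_space T 4 \<gamma> B (\<lambda>x t. b t)" and nn: "\<forall>t\<in>{0..T}. 0 <= b t"
 obtains B b' where "setting T \<mu> B b b'"
proof -
 let ?b' = "pd T 0 1 (\<lambda>x t. b t) 0"
 have "setting T \<mu> (max B 1) b ?b'"
 proof (rule setting.intro)
  fix t assume t: "0 <= t" "t <= T"
  then have t': "t \<in> {0..T}" "(0::real) \<in> {0..1}" by auto
  show "0 <= b t \<and> b t <= max B 1" using pd_bound[OF h, of 0 0 0 t] t' nn by (auto simp: pd_0)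
  show "(b has_real_derivative ?b' t) (at t within {0..T})" using pd_time[OF h _ t'(2,1), of 0] by (simp add: pd_0)
  show "abs (?b' t) <= max B 1" using pd_bound[OF h, of 0 1 0 t] t' by auto
 next
  show "tay (max B 1) {0..T} b ?b'" by (rule tay_mono[OF holder_time[OF h]]) auto
 qed (use assms in auto)
 then show thesis by (rule that)
qed

lemma bounded_continuous:
 fixes g :: "real => real"
 assumes "continuous_on {a..c} g"
 obtains B where "0 <= B" "\<forall>t\<in>{a..c}. (abs (g t)) <= B"
proof -
 obtain B where B: "\<And>t. t \<in> {a..c} ==> abs (g t) <= B"
  using compact_imp_bounded[OF compact_continuous_image[OF assms compact_Icc]] unfolding bounded_iff by force
 show thesis by (rule that[of "abs B"]) (use B in \<open>auto intro: order_trans[OF _ abs_ge_self]\<close>)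
qed

context setting
begin

lemma b_cont: "continuous_on {0..T} b"
 by (rule DERIV_continuous_on[OF b_deriv]) auto

lemma homogeneous:
 assumes d: "0 <= d" "d <= T"
 obtains k k' k'' L where "k d = 1" "1 <= L" "k' = (\<lambda>t. - b t * k t)"
  "C2_bound T L k k' k''"
proof -
 obtain k where k: "k d = 1" "\<And>t. 0 < k t"
  "\<And>t. 0 <= t ==> t <= T ==> (k has_real_derivative - b t * k t) (at t within {0..T})"
  using ode_homogeneous[OF b_cont d] by blast
 define k' where "k' t = - b t * k t" for t
 define k'' where "k'' t = - b' t * k t + - b t * k' t" for t
 have kc: "continuous_on {0..T} k" by (rule DERIV_continuous_on[OF k(3)]) auto
 obtain L where L: "0 <= L" "\<forall>t\<in>{0..T}. (abs (k t)) <= L" by (rule bounded_continuous[OF kc])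
 have kd: "(k' has_real_derivative k'' t) (at t within {0..T})" if "0 <= t" "t <= T" for t
  unfolding k'_def[abs_def] k''_def using DERIV_mult[OF DERIV_minus[OF b_deriv[OF that]] k(3)[OF that]]
  by (simp add: algebra_simps)
 define A where "A = 1 + L + B * L + (B * L + B * (B * L))"
 have n: "0 <= B * L" "0 <= B * (B * L)" using B L(1) by auto
 have A: "abs (k t) <= A \<and> abs (k' t) <= A \<and> abs (k'' t) <= A" if t: "0 <= t" "t <= T" for t
 proof -
  have bt: "abs (b t) <= B" "abs (b' t) <= B" "abs (k t) <= L" using b[OF t] b_bound[OF t] L(2) t by auto
  have k'L: "abs (k' t) <= B * L" unfolding k'_def abs_mult using bt B by (intro mult_mono) auto
  have "abs (- b' t * k t) <= B * L" unfolding abs_mult using bt B by (intro mult_mono) auto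
  moreover have "abs (- b t * k' t) <= B * (B * L)" unfolding abs_mult using bt k'L B by (intro mult_mono) auto
  ultimately have "abs (k'' t) <= B * L + B * (B * L)" unfolding k''_def by linarith
  then show ?thesis using bt(3) k'L n L(1) unfolding A_def by linarith
 qed
 have "1 <= A" using n L(1) unfolding A_def by linarith
 moreover have "k' = (\<lambda>t. - b t * k t)" by (simp add: k'_def[abs_def])
 moreover have "(k has_real_derivative k' t) (at t within {0..T})" if "0 <= t" "t <= T" for t
  using k(3)[OF that] by (simp add: k'_def)
 ultimately show thesis using that[of k A k' k''] k(1) kd A unfolding C2_bound_def by simp
qed

text \<open>The coefficient of the leading singular function; adding the explicit exponential of the
 problem makes it regular up to time \<open>d\<close>.\<close>

lemma coefficient:
 assumes d: "0 <= d" "d <= T" and \<beta>: "0 <= \<beta>"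
 obtains E E' E'' e e' e'' L A where "0 <= L" "E d = 0" "E' d = 0" "flat_at T d L E E' E''"
  "\<forall>t\<in>{0..T}. E' t + b t * E t = (b d - b t) * exp (- \<beta> * (t - d))"
  "e = (\<lambda>t. exp (- \<beta> * (t - d)) + E t)" "e' d = - \<beta>" "C2_bound T A e e' e''"
proof -
 define x where "x t = exp (- \<beta> * (t - d))" for t
 have x: "(x has_real_derivative - \<beta> * x t) (at t within {0..T})" for t
  unfolding x_def[abs_def] by (auto intro!: derivative_eq_intros)
 have xb: "abs (x t) <= exp (\<beta> * T)" if "0 <= t" for t
 proof -
  have "- (\<beta> * (t - d)) <= \<beta> * T" using \<beta> d that mult_left_mono[of "d - t" T \<beta>] by (simp add: algebra_simps)
  then show ?thesis by (simp add: x_def)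
 qed
 have xd: "x d = 1" by (simp add: x_def)
 define c where "c t = (b d - b t) * x t" for t
 define c' where "c' t = - b' t * x t + (b d - b t) * (- \<beta> * x t)" for t
 have c: "(c has_real_derivative c' t) (at t within {0..T})" if "0 <= t" "t <= T" for t
  unfolding c_def[abs_def] c'_def
  using DERIV_mult[OF DERIV_diff[OF DERIV_const b_deriv[OF that]] x, of "b d"] by (simp add: algebra_simps)
 have c'b: "abs (c' t) <= B * exp (\<beta> * T) + B * (\<beta> * exp (\<beta> * T))" if t: "0 <= t" "t <= T" for t
 proof -
  have "abs (- b' t * x t) <= B * exp (\<beta> * T)" unfolding abs_mult using b_bound[OF t] xb[OF t(1)] B by (intro mult_mono) auto
  moreover have "abs ((b d - b t) * (- \<beta> * x t)) <= B * (\<beta> * exp (\<beta> * T))"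
   unfolding abs_mult using b[OF t] b[OF d] xb[OF t(1)] B \<beta> by (intro mult_mono) auto
  ultimately show ?thesis unfolding c'_def by linarith
 qed
 have cd: "c d = 0" by (simp add: c_def)
 show thesis
 proof (rule coefficient_exists[OF b_deriv b_bound c c'b cd d])
  fix E E' E'' L
  assume E: "0 <= L" "E d = 0" "E' d = 0"
   "\<And>t. 0 <= t ==> t <= T ==> (E has_real_derivative E' t) (at t within {0..T})"
   "\<And>t. 0 <= t ==> t <= T ==> (E' has_real_derivative E'' t) (at t within {0..T})"
   "\<And>t. 0 <= t ==> t <= T ==> E' t + b t * E t = c t"
   "\<And>t. 0 <= t ==> t <= T ==> abs (E'' t) <= L"
   "\<And>t. d <= t ==> t <= T ==> abs (E t) <= L * (t - d)^2 \<and> abs (E' t) <= L * (t - d) \<and> abs (E'' t) <= L"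
  define e where "e t = x t + E t" for t
  define e' where "e' t = - \<beta> * x t + E' t" for t
  define e'' where "e'' t = - \<beta> * (- \<beta> * x t) + E'' t" for t
  have e: "(e has_real_derivative e' t) (at t within {0..T})" "(e' has_real_derivative e'' t) (at t within {0..T})"
   if "0 <= t" "t <= T" for t
   unfolding e_def[abs_def] e'_def[abs_def] e''_def
   by (rule DERIV_add[OF x E(4)[OF that]], rule DERIV_add[OF DERIV_cmult[OF x] E(5)[OF that]])
  have ec: "continuous_on {0..T} e" "continuous_on {0..T} e'" by (rule DERIV_continuous_on, rule e; simp)+
  obtain A1 where A1: "0 <= A1" "\<forall>t\<in>{0..T}. (abs (e t)) <= A1" by (rule bounded_continuous[OF ec(1)])
  obtain A2 where A2: "0 <= A2" "\<forall>t\<in>{0..T}. (abs (e' t)) <= A2" by (rule bounded_continuous[OF ec(2)])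
  define A where "A = A1 + A2 + (\<beta> * (\<beta> * exp (\<beta> * T)) + L)"
  have nn: "0 <= \<beta> * (\<beta> * exp (\<beta> * T))" using \<beta> by simp
  have AA: "abs (e t) <= A \<and> abs (e' t) <= A \<and> abs (e'' t) <= A" if t: "0 <= t" "t <= T" for t
  proof -
   have "abs (- \<beta> * (- \<beta> * x t)) <= \<beta> * (\<beta> * exp (\<beta> * T))"
    unfolding abs_mult using xb[OF t(1)] \<beta> by (intro mult_mono) auto
   then have "abs (e'' t) <= \<beta> * (\<beta> * exp (\<beta> * T)) + L" using E(7)[OF t] unfolding e''_def by linarith
   moreover have "abs (e t) <= A1" "abs (e' t) <= A2" using A1(2) A2(2) t by auto
   ultimately show ?thesis using A1(1) A2(1) nn E(1) unfolding A_def by linarith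
  qed
  have e'd: "e' d = - \<beta>" using E(3) by (simp add: e'_def xd)
  have ee: "e = (\<lambda>t. exp (- \<beta> * (t - d)) + E t)" by (simp add: e_def[abs_def] x_def)
  have ode: "E' t + b t * E t = (b d - b t) * exp (- \<beta> * (t - d))" if "0 <= t" "t <= T" for t
   using E(6)[OF that] by (simp add: c_def x_def)
  have "flat_at T d L E E' E''" "C2_bound T A e e' e''"
   unfolding flat_at_def C2_bound_def using E(4,5,8) e AA by auto
  then show thesis using that[of L E E' E'' e e' A e''] E(1-3) ode ee e'd by simp
 qed
qed

lemma mesh13:
 assumes "0 < eps" "eps <= 1" "0 < N" "4 dvd N"
 obtains I where "mesh_ok eps m {0, 1} (mesh_const \<mu> T * rate N) I N (mesh13 \<mu> T eps N)"
proof -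
 have "4 <= N" using assms by (auto elim!: dvdE)
 then interpret sh: shishkin T \<mu> eps N by unfold_locales (use T mu assms in auto)
 show thesis using sh.mesh13_ok[OF assms(4)] that unfolding sh.m_def sh.\<nu>_def m_def by blast
qed

lemma mesh2:
 assumes "0 < eps" "eps <= 1" "0 < N" "8 dvd N" "0 < d" "d < 1" "\<And>i. i < N ==> mesh2 \<mu> T d eps N i < mesh2 \<mu> T d eps N (Suc i)"
 obtains I where "mesh_ok eps m {0, d, 1} (mesh_const \<mu> T * rate N) I N (mesh2 \<mu> T d eps N)"
proof -
 have "4 <= N" using assms by (auto elim!: dvdE)
 then interpret sh: shishkin T \<mu> eps N by unfold_locales (use T mu assms in auto)
 show thesis using sh.mesh2_ok[OF assms(4-7)] that unfolding sh.m_def sh.\<nu>_def m_def by blast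
qed

lemma source_time: "holder_space T 4 \<gamma> K f ==> K <= K' ==> 0 <= x ==> x <= 1 ==> tay K' {0..T} (f x) (pd T 0 1 f x)"
 by (rule tay_mono[OF holder_time]) auto

lemma source_space:
 "holder_space T 4 \<gamma> K f ==> 4 * K <= K' ==> 0 <= t ==> t <= T ==> smooth_data K' (\<lambda>x. f x t) (\<lambda>x. pd T 2 0 f x t)"
 by (rule smooth_data_mono[OF holder_space_data]) auto

end

section \<open>The problem classes\<close>

lemma Cn_mono: "Cn_space n S K \<phi> ==> S' \<subseteq> S ==> Cn_space n S' K \<phi>"
 unfolding Cn_space_def by (meson continuous_on_subset subsetD)

lemma tay_cubic_poly:
 assumes s: "abs s <= 1" and i: "p - 1 <= a" "c <= p + 1"
 shows "tay 1 {a..c} (\<lambda>x. s * (x - p)^3 / 6) (\<lambda>x. s * (x - p)^2 / 2)"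
  and "tay 1 {a..c} (\<lambda>x. s * (x - p)^2 / 2) (\<lambda>x. s * (x - p))"
  and "tay 1 {a..c} (\<lambda>x. s * (x - p)) (\<lambda>x. s)"
proof -
 have b: "abs (s * (x - p)) <= 1" "abs (s * (x - p)^2 / 2) <= 1" if "a <= x" "x <= c" for x
 proof -
  have x: "abs (x - p) <= 1" using that i by auto
  show "abs (s * (x - p)) <= 1" unfolding abs_mult using s x by (simp add: mult_le_one)
  have "(x - p)^2 <= 1" using power_le_one[of "abs (x - p)" 2] x by simp
  then have "abs s * (x - p)^2 <= 1" using s by (simp add: mult_le_one)
  then show "abs (s * (x - p)^2 / 2) <= 1" by (simp add: abs_mult)
 qed
 show "tay 1 {a..c} (\<lambda>x. s * (x - p)^3 / 6) (\<lambda>x. s * (x - p)^2 / 2)"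
  by (rule tay_of_derivatives[where ?g2.0="\<lambda>x. s * (x - p)"])
   (auto intro!: continuous_intros derivative_eq_intros b[simplified])
 show "tay 1 {a..c} (\<lambda>x. s * (x - p)^2 / 2) (\<lambda>x. s * (x - p))"
  by (rule tay_of_derivatives[where ?g2.0="\<lambda>x. s"])
   (use s in \<open>auto intro!: continuous_intros derivative_eq_intros b[simplified]\<close>)
 show "tay 1 {a..c} (\<lambda>x. s * (x - p)) (\<lambda>x. s)"
  by (rule tay_of_derivatives[where ?g2.0="\<lambda>x. 0"])
   (use s in \<open>auto intro!: continuous_intros derivative_eq_intros\<close>)
qed

lemma tay_diff_const: "tay K S g g' ==> tay K S (\<lambda>t. g t - q) g'"
 by (simp add: tay_def)

context setting
begin

lemma cubic_solution:
 assumes eps: "0 < eps" "eps <= 1" and p: "0 <= p" "p <= 1" and L: "1 <= L" and k0: "k 0 = 1"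
  and k': "k' = (\<lambda>t. - b t * k t)"
  and k: "C2_bound T L k k' k''"
 obtains St Sxx where "approx_ok T eps m P 0 (6 * cubic_part.C T L) (cubic k eps p) St Sxx"
  "solves T eps b (cubic k eps p) St Sxx (\<lambda>x t. 0)"
  "\<forall>t\<in>{0..T}. continuous_on {0..1} (\<lambda>x. cubic k eps p x t)"
proof -
 interpret cp: cubic_part T eps L p k k' k''
  by unfold_locales (use T eps L p C2_boundD[OF k] k0 in auto)
 show thesis
 proof (rule that[OF cp.cubic_approx_ok])
  show "solves T eps b (cubic k eps p) cp.Ut cp.U2 (\<lambda>x t. 0)"
  proof (rule solvesI[where Ux=cp.U1])
   fix x t assume t: "0 < t" "t <= T"
   show "(cubic k eps p x has_real_derivative cp.Ut x t) (at t within {0..T})"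
    "((\<lambda>x. cubic k eps p x t) has_real_derivative cp.U1 x t) (at x)"
    "((\<lambda>x. cp.U1 x t) has_real_derivative cp.U2 x t) (at x)" by (rule cp.cubic_der[OF t])+
   show "cp.Ut x t - eps * cp.U2 x t + b t * cubic k eps p x t = 0"
    using t unfolding cp.Ut_def cp.U2_def cubic_kpart[OF t(1)] kpart_def unfolding k' by (simp add: algebra_simps)
  qed
  show "\<forall>t\<in>{0..T}. continuous_on {0..1} (\<lambda>x. cubic k eps p x t)"
  proof
   fix t assume t: "t \<in> {0..T}"
   show "continuous_on {0..1} (\<lambda>x. cubic k eps p x t)"
   proof (cases "t <= 0")
    case True
    then show ?thesis by (auto simp: cubic_def intro!: continuous_intros)
   next
    case False
    then show ?thesis
     using DERIV_continuous_on[OF has_field_derivative_at_within[OF cp.cubic_der(3)[of t]], of "{0..1}"] t by auto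
   qed
  qed
 qed
qed

text \<open>Classes 1 and 2 together: the initial values jump by \<open>2 * J\<close> at \<open>p\<close>, their third derivative by
 \<open>2 * J3\<close>.  In class 1 the jump at \<open>p = 0\<close> arises by odd reflection.\<close>

definition jump_problem where
 "jump_problem p K K\<^sub>0 \<gamma> eps J J3 f G2 y F \<longleftrightarrow>
   abs J <= K \<and> abs J3 <= K \<and> (p = 0 \<or> p = 1 \<longrightarrow> J3 = 0) \<and> holder_space T 4 \<gamma> K\<^sub>0 f \<and>
   smooth_data K (\<lambda>x. y x 0 - J3 * (abs (x - p)^3 / 6)) G2 \<and>
   (\<forall>x\<in>{0, 1}. f x 0 = - eps * (G2 x + J3 * abs (x - p))) \<and>
   (\<forall>x\<in>{0, 1}. \<forall>t\<in>{0..T}. y x t = - J * sing eps (b 0) (x - p) t) \<and>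
   (\<forall>x t. F x t = f x t - (b t - b 0) * J * sing eps (b 0) (x - p) t) \<and>
   continuous_on (Qbar T) (\<lambda>(x, t). y x t) \<and> solves_pde T eps b y F"

text \<open>The singular part is \<open>J\<close> times the error function layer with coefficient
  \<open>E\<close>, plus \<open>J3\<close> times the cubic function. The first absorbs the
  discontinuous source, the second makes the initial values smooth across \<open>p\<close>; the task
  is then to check traces and compatibility at both ends.\<close>

lemma initial_jump:
 assumes p: "0 <= p" "p <= 1"
 shows "\<exists>C. \<forall>eps\<in>{0<..1}. \<forall>J J3 f G2 y N M xs Y I F.
   jump_problem p K K\<^sub>0 \<gamma> eps J J3 f G2 y F \<and> 0 < N \<and> 2 <= M \<and>
   mesh_ok eps m {0, p, 1} (mesh_const \<mu> T * rate N) I N xs \<and>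
   discrete_solution eps b N M xs (tmesh T M) F y Y \<longrightarrow> error_le T C N M xs y Y"
proof -
 have T0: "0 <= (0::real)" "0 <= T" "0 <= b 0" using T b[of 0] by auto
 obtain E E' E'' e e' e'' L A where E: "0 <= L" "E 0 = 0" "E' 0 = 0" "flat_at T 0 L E E' E''"
  "\<forall>t\<in>{0..T}. E' t + b t * E t = (b 0 - b t) * exp (- b 0 * (t - 0))"
  "e = (\<lambda>t. exp (- b 0 * (t - 0)) + E t)" "e' 0 = - b 0" "C2_bound T A e e' e''"
  by (rule coefficient[OF T0])
 obtain k k' k'' Lk where k: "k 0 = 1" "1 <= Lk" "k' = (\<lambda>t. - b t * k t)" "C2_bound T Lk k k' k''"
  by (rule homogeneous[OF T0(1,2)])
 have A: "0 <= A" using C2_boundD(6)[OF E(8), of 0] T by simp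
 \<comment> \<open>A lower bound for the distance from \<open>p\<close> to those ends of the
   interval that differ from \<open>p\<close>; the trace estimates depend on it.\<close>
 define c where "c = (if p = 0 \<or> p = 1 then 1 else min p (1 - p))"
 have c: "0 < c" "x = 0 \<or> x = 1 ==> x \<noteq> p ==> c <= abs (x - p)" for x using p by (auto simp: c_def)
 define K' where "K' = abs K"
 define R where "R = A + A * (256 * exp 16 / c^4) * (1 + T)^2 * (2 + T)"
 define R3 where "R3 = 4 * Lk * (1 + T) + Lk * (256 * exp 16 / c^4 * T + 2 * (exp 16 / c)) * (1 + T)^2 * (2 + T)"
 define Kr where "Kr = B + 4 * abs (K\<^sub>0) + K' + (K' * R + K' * R3)"
 define D1 where "D1 = layer.cl T m (4 * (L * kc m T * (1 + T)^2))"
 define D2 where "D2 = 6 * cubic_part.C T Lk"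
 have R: "0 <= R" "0 <= R3" unfolding R_def R3_def using A T k(2) c(1) by simp_all
 have K': "0 <= K'" "0 <= K' * R" "0 <= K' * R3" using R by (auto simp: K'_def)
 then have KK: "K\<^sub>0 <= Kr" "4 * K\<^sub>0 <= Kr" "B <= Kr" "K <= Kr" "K' * R + K' * R3 <= Kr" "0 <= Kr"
  using B abs_ge_self[of K] unfolding Kr_def K'_def by linarith+
 show ?thesis
 proof (intro exI[of _ "Ce Kr (K' * D1 + K' * D2)"] ballI allI impI, elim conjE)
  fix eps J J3 f G2 y N M xs Y I F
  assume "eps \<in> {0<..1}" and jp: "jump_problem p K K\<^sub>0 \<gamma> eps J J3 f G2 y F" and N: "0 < N" "2 <= M"
   and I: "mesh_ok eps m {0, p, 1} (mesh_const \<mu> T * rate N) I N xs" and Y: "discrete_solution eps b N M xs (tmesh T M) F y Y"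
  then have eps: "0 < eps" "eps <= 1" by auto
  have JK: "abs J <= K" "abs J3 <= K" and J3: "p = 0 \<or> p = 1 \<longrightarrow> J3 = 0" and f: "holder_space T 4 \<gamma> K\<^sub>0 f"
   and psi: "smooth_data K (\<lambda>x. y x 0 - J3 * (abs (x - p)^3 / 6)) G2" and f0: "\<forall>x\<in>{0, 1}. f x 0 = - eps * (G2 x + J3 * abs (x - p))"
   and yb: "\<forall>x\<in>{0, 1}. \<forall>t\<in>{0..T}. y x t = - J * sing eps (b 0) (x - p) t"
   and F: "\<forall>x t. F x t = f x t - (b t - b 0) * J * sing eps (b 0) (x - p) t"
   and yc: "continuous_on (Qbar T) (\<lambda>(x, t). y x t)" "solves_pde T eps b y F"
   using jp unfolding jump_problem_def by blast+
  have JK': "abs J <= K'" "abs J3 <= K'" using JK unfolding K'_def by linarith+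
  let ?U = "kpart k0 E 1 eps p 0" and ?V = "cubic k eps p" and ?P = "{0, p, 1}"
  obtain Ut Uxx where U: "approx_ok T eps m ?P 0 D1 ?U Ut Uxx"
   "solves T eps b ?U Ut Uxx (\<lambda>x t. if t <= 0 then 0 else (b 0 - b t) * exp (- b 0 * (t - 0)) * k0 ((x - p) / sqrt eps) (t - 0))"
   "\<forall>t\<le>T. continuous_on {0..1} (\<lambda>x. ?U x t)"
   unfolding D1_def
   by (rule erf_part[where P="?P" and p=p and c="\<lambda>t. (b 0 - b t) * exp (- b 0 * (t - 0))", OF eps order_refl _ E(1,4)])
    (use E(5) in auto)
  obtain Vt Vxx where V: "approx_ok T eps m ?P 0 D2 ?V Vt Vxx" "solves T eps b ?V Vt Vxx (\<lambda>x t. 0)"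
   "\<forall>t\<in>{0..T}. continuous_on {0..1} (\<lambda>x. ?V x t)"
   unfolding D2_def by (rule cubic_solution[OF eps p k(2,1,3,4), where P="?P"])
  have D: "0 <= D1" "0 <= D2" using approx_ok_nonneg[OF U(1) T] approx_ok_nonneg[OF V(1) T] .
  let ?S = "\<lambda>x t. J * ?U x t + J3 * ?V x t"
  have S0: "?S x 0 = J3 * (abs (x - p)^3 / 6)" for x by (simp add: kpart_def cubic_def)
  have bd: "\<exists>g. tay Kr {0..T} (\<lambda>t. y x0 t - ?S x0 t) g \<and> g 0 = eps * G2 x0 - b 0 * (y x0 0 - ?S x0 0) + f x0 0"
   if x0: "x0 \<in> {0, 1}" for x0
  proof (cases "x0 = p")
   \<comment> \<open>The pole lies on this side: the error function is odd and vanishes at 0, there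
     is no cubic part, and the trace is identically zero.\<close>
   case True
   then have "J3 = 0" using J3 x0 by auto
   moreover have "y x0 t = 0" if "t \<in> {0..T}" for t using yb x0 that True by (auto simp: sing_def)
   moreover have "?U x0 t = 0" for t using True by (simp add: kpart_def)
   ultimately show ?thesis using KK(6) f0 x0 T by (intro exI[of _ "\<lambda>t. 0"]) (auto simp: tay_def)
  next
   case False
   define a where "a = x0 - p"
   have a: "c <= abs a" "abs a <= 1" "p + a = x0" using x0 c(2)[of x0] False p by (auto simp: a_def)
   define xi where "xi = 1 * (x0 - p) / sqrt eps"
   have "abs a * sqrt eps <= abs a * 1" using eps by (intro mult_left_mono) auto
   then have "abs a <= abs a / sqrt eps" using eps by (simp add: pos_le_divide_eq)
   then have xi: "c <= abs xi" "sgn xi = sgn a" using a eps by (auto simp: xi_def a_def abs_divide sgn_divide)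
   \<comment> \<open>The explicit exponential in the boundary value and \<open>E\<close> add up to
     \<open>e\<close>, so the trace is governed by \<open>e * k0\<close>; it is split into
     \<open>sgn a * e\<close> and the flat term below.\<close>
   let ?G = "\<lambda>t. if t <= 0 then 0 else e t * (k0 xi (t - 0) - sgn xi)"
   obtain G' where 1: "tay (A * (256 * exp 16 / c^4) * (1 + T)^2 * (2 + T)) {0..T} ?G G'" "\<forall>t\<le>0. G' t = 0"
    by (rule trace_k0[OF T0(1,2) c(1) xi(1) E(8)])
   have 2: "tay A {0..T} (\<lambda>t. sgn a * e t) (\<lambda>t. sgn a * e' t)"
    by (rule tay_mono[OF tay_cmult[OF tay_C2[OF E(8)]]]) (use A in \<open>auto simp: sgn_if\<close>)
   obtain g where g: "tay R3 {0..T} (cubic k eps p (p + a)) g" "g 0 = k' 0 * (abs a^3 / 6) + eps * abs a"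
    unfolding R3_def by (rule trace_cubic[OF eps T0(2) c(1) a(1,2) k(4,1)])
   let ?g = "\<lambda>t. - J * (sgn a * e' t + G' t) + - J3 * g t"
   have "tay (abs (- J) * R + abs (- J3) * R3) {0..T} (\<lambda>t. - J * (sgn a * e t + ?G t) + - J3 * cubic k eps p (p + a) t) ?g"
    unfolding R_def by (rule tay_add[OF tay_cmult[OF tay_add[OF 2 1(1)]] tay_cmult[OF g(1)]])
   moreover have "abs (- J) * R <= K' * R" "abs (- J3) * R3 <= K' * R3" using JK' K' R by (auto intro!: mult_right_mono)
   then have "abs (- J) * R + abs (- J3) * R3 <= Kr" using KK(5) by linarith
   ultimately have "tay Kr {0..T} (\<lambda>t. - J * (sgn a * e t + ?G t) + - J3 * cubic k eps p (p + a) t) ?g" by (rule tay_mono) simp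
   moreover have "y x0 t - ?S x0 t = - J * (sgn a * e t + ?G t) + - J3 * cubic k eps p (p + a) t" if t: "t \<in> {0..T}" for t
   proof -
    have y1: "y x0 t = - J * sing eps (b 0) a t" using yb t x0 by (auto simp: a_def)
    show ?thesis
    proof (cases "t <= 0")
     case True
     then show ?thesis unfolding y1 a(3) using t E(2,6) by (simp add: sing_def kpart_def)
    next
     case False
     then have "sing eps (b 0) a t = exp (- b 0 * t) * k0 xi t" using sing_k0[OF eps(1), of t "b 0" a] by (simp add: xi_def a_def)
     moreover have "?U x0 t = E t * k0 xi t" using False by (simp add: kpart_def xi_def)
     ultimately show ?thesis unfolding y1 a(3) using False E(6) xi(2) by (simp add: algebra_simps)
    qed
   qed
   ultimately have "tay Kr {0..T} (\<lambda>t. y x0 t - ?S x0 t) ?g" by (rule tay_cong) auto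
   moreover have "?g 0 = eps * G2 x0 - b 0 * (y x0 0 - ?S x0 0) + f x0 0"
   proof -
    \<comment> \<open>Subtracting the cubic function removes \<open>J3 * abs a\<close> from the
      second derivative of the initial values; the slope \<open>eps * abs a\<close> of its trace
      restores the balance.\<close>
    have GF: "f x0 0 = - eps * (G2 x0 + J3 * abs a)" using f0 x0 by (auto simp: a_def)
    have y1: "y x0 0 = - J * sgn a" using yb x0 T by (auto simp: sing_def a_def)
    have S1: "?S x0 0 = J3 * (abs a^3 / 6)" using S0[of x0] by (simp add: a_def)
    show ?thesis unfolding GF y1 S1 g(2) using E(7) k(1,3) 1(2) by (simp add: algebra_simps)
   qed
   ultimately show ?thesis by blast
  qed
  obtain g0 where g0: "tay Kr {0..T} (\<lambda>t. y 0 t - ?S 0 t) g0" "g0 0 = eps * G2 0 - b 0 * (y 0 0 - ?S 0 0) + f 0 0"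
   using bd[of 0] by blast
  obtain g1 where g1: "tay Kr {0..T} (\<lambda>t. y 1 t - ?S 1 t) g1" "g1 0 = eps * G2 1 - b 0 * (y 1 0 - ?S 1 0) + f 1 0"
   using bd[of 1] by blast
  show "error_le T (Ce Kr (K' * D1 + K' * D2)) N M xs y Y"
  proof (rule remainder_bound[where S="?S" and \<psi>\<^sub>2=G2 and P="?P",
    OF eps KK(3) order_refl source_time[OF f KK(1)] source_space[OF f KK(2)] _ _ _ _ yc _ g0(1) g1(1) g0(2) g1(2) I N Y])
   show "{0, 1} \<subseteq> ?P" by simp
   have 1: "approx_ok T eps m ?P 0 (K' * D1) (\<lambda>x t. J * ?U x t) (\<lambda>x t. J * Ut x t) (\<lambda>x t. J * Uxx x t)"
    by (rule approx_ok_cmult[OF U(1) eps(1)]) (use JK' D in \<open>auto intro!: mult_right_mono\<close>)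
   have 2: "approx_ok T eps m ?P 0 (K' * D2) (\<lambda>x t. J3 * ?V x t) (\<lambda>x t. J3 * Vt x t) (\<lambda>x t. J3 * Vxx x t)"
    by (rule approx_ok_cmult[OF V(1) eps(1)]) (use JK' D in \<open>auto intro!: mult_right_mono\<close>)
   show "approx_ok T eps m ?P 0 (K' * D1 + K' * D2) ?S (\<lambda>x t. J * Ut x t + J3 * Vt x t) (\<lambda>x t. J * Uxx x t + J3 * Vxx x t)"
    by (rule approx_ok_add[OF 1 2 eps(1)])
   show "solves T eps b ?S (\<lambda>x t. J * Ut x t + J3 * Vt x t) (\<lambda>x t. J * Uxx x t + J3 * Vxx x t) (\<lambda>x t. F x t - f x t)"
    by (rule solves_cong[OF solves_add[OF solves_cmult[OF U(2)] solves_cmult[OF V(2)]]])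
     (simp add: F sing_k0[OF eps(1)] algebra_simps)
   show "continuous_on {0..1} (\<lambda>x. ?S x t)" if "0 <= t" "t <= T" for t using U(3) V(3) that by (intro continuous_intros) auto
   show "smooth_data Kr (\<lambda>x. y x 0 - ?S x 0) G2" unfolding S0 by (rule smooth_data_mono[OF psi KK(4)])
  qed
 qed
qed

end

section \<open>Jumps in the initial data: at a corner and in the interior\<close>

context setting
begin

text \<open>The case \<open>p = 0\<close> with \<open>J\<close> the corner value of the initial data
  and no cubic part. The initial values of \<open>y\<close> are bounded by \<open>2 * K\<close>, and
  \<open>smooth_dataI\<close> contributes the factor 4, hence \<open>8 * K\<close>.\<close>

lemma class1:
 "\<exists>C. \<forall>eps\<in>{0<..1}. \<forall>f \<phi> u y N M Y.
   problem_class1 T b \<gamma> K eps f \<phi> \<and> remainder1 T b eps f \<phi> u y \<and> 0 < N \<and> 4 dvd N \<and> 2 <= M \<and>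
   discrete_solution eps b N M (mesh13 \<mu> T eps N) (tmesh T M) (rhs1 b eps f \<phi>) y Y \<longrightarrow>
   error_le T C N M (mesh13 \<mu> T eps N) y Y"
proof (rule ex_forward[OF initial_jump[where p=0 and K="8 * K" and K\<^sub>0=K and \<gamma>=\<gamma>, OF order_refl zero_le_one]],
  intro ballI allI impI, elim conjE)
 fix C eps f \<phi> u y N M Y
 assume e: "eps \<in> {0<..1}" and pc: "problem_class1 T b \<gamma> K eps f \<phi>" and rm: "remainder1 T b eps f \<phi> u y"
  and N: "0 < N" "4 dvd N" "2 <= M"
  and Y: "discrete_solution eps b N M (mesh13 \<mu> T eps N) (tmesh T M) (rhs1 b eps f \<phi>) y Y"
  and main: "\<forall>eps\<in>{0<..1}. \<forall>J J3 f G2 y N M xs Y I F.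
   jump_problem 0 (8 * K) K \<gamma> eps J J3 f G2 y F \<and> 0 < N \<and> 2 <= M \<and>
   mesh_ok eps m {0, 0, 1} (mesh_const \<mu> T * rate N) I N xs \<and>
   discrete_solution eps b N M xs (tmesh T M) F y Y \<longrightarrow> error_le T C N M xs y Y"
 have f: "holder_space T 4 \<gamma> K f" and Cn: "Cn_space 4 {0<..<1} K \<phi>" using pc unfolding problem_class1_def by blast+
 obtain h where h: "\<forall>k<4. \<forall>z\<in>{0<..<1}. h k z = (deriv ^^ k) \<phi> z"
  "\<forall>k<4. \<forall>z\<in>{0..1}. (abs (h k z)) <= K" "\<forall>k<4. continuous_on {0..1} (h k)"
  "\<forall>k. Suc k < 4 \<longrightarrow> tay K {0..1} (h k) (h (Suc k))"
  "\<forall>k<4. rlim k \<phi> 0 = h k 0" "\<forall>k<4. llim k \<phi> 1 = h k 1"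
  by (rule Cn_extension[OF Cn zero_less_one])
 define q where "q = h 0 0"
 have lims: "rlim 0 \<phi> 0 = q" "rlim 2 \<phi> 0 = h 2 0" "llim 0 \<phi> 1 = h 0 1" "llim 2 \<phi> 1 = h 2 1"
  using h(5,6) by (auto simp: q_def)
 have cond: "h 0 1 = 0" "f 1 0 = - eps * h 2 1" "f 0 0 = - eps * h 2 0"
  using pc unfolding problem_class1_def lims by auto
 have yx: "y x t = u x t - q * sing eps (b 0) x t" if "0 <= x" "x <= 1" "0 <= t" "t <= T" for x t
  using rm that unfolding remainder1_def lims Qbar_def by auto
 have ub: "u 0 t = 0" "u 1 t = 0" if "0 <= t" "t <= T" for t using rm that unfolding remainder1_def by auto
 have ui: "u x 0 = \<phi> x" if "0 < x" "x < 1" for x using rm that unfolding remainder1_def by auto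
 have y0: "y x 0 = h 0 x - q" if x: "0 <= x" "x <= 1" for x
 proof -
  consider "x = 0" | "x = 1" | "0 < x" "x < 1" using x by fastforce
  then show ?thesis
   using yx[of x 0] ub[of 0] ui[of x] h(1) T cond(1) by cases (auto simp: sing_def q_def)
 qed
 have hb: "abs (h 0 x) <= K" if "0 <= x" "x <= 1" for x using h(2) that by auto
 have K: "0 <= K" "K <= 2 * K" "abs q <= K" using hb[of 0] by (auto simp: q_def)
 have psi: "smooth_data (4 * (2 * K)) (\<lambda>x. y x 0 - 0 * (abs (x - 0)^3 / 6)) (h 2)"
 proof (rule smooth_dataI)
  note ty = tay_mono[OF h(4)[rule_format] K(2) order_refl]
  show "tay (2 * K) {0..1} (\<lambda>x. y x 0 - 0 * (abs (x - 0)^3 / 6)) (h 1)"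
   by (rule tay_cong[OF tay_diff_const[OF ty[of 0], of q]]) (use y0 in auto)
  show "tay (2 * K) {0..1} (h 1) (h 2)" "tay (2 * K) {0..1} (h 2) (h 3)"
   using ty[of 1] ty[of 2] by (simp_all add: numeral_2_eq_2 numeral_3_eq_3)
  show "abs (y x 0 - 0 * (abs (x - 0)^3 / 6)) <= 2 * K" if "0 <= x" "x <= 1" for x
   using hb[OF that] K(3) that by (simp add: y0 abs_le_iff)
 qed
 obtain I where I: "mesh_ok eps m {0, 1} (mesh_const \<mu> T * rate N) I N (mesh13 \<mu> T eps N)"
  by (rule mesh13[OF _ _ N(1,2)]) (use e in auto)
 have "jump_problem 0 (8 * K) K \<gamma> eps q 0 f (h 2) y (rhs1 b eps f \<phi>)"
  unfolding jump_problem_def using f psi K cond rm yx[of 0] yx[of 1] ub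
  by (auto simp: remainder1_def rhs1_def lims sing_def)
 then show "error_le T C N M (mesh13 \<mu> T eps N) y Y"
  using main[rule_format, OF e, of q 0 f "h 2" y "rhs1 b eps f \<phi>" N M I] N I Y by simp
qed

text \<open>The case \<open>p = d\<close>, where \<open>J\<close> and \<open>J3\<close> are half the
  jumps of the initial function and of its third derivative. Subtraction leaves pieces matching up
  to the third derivative, since the first and second derivatives agree by assumption. They are
  bounded by \<open>3 * K\<close>, whence \<open>12 * K\<close>.\<close>

lemma class2:
 assumes d: "0 < d" "d < 1"
 shows "\<exists>C. \<forall>eps\<in>{0<..1}. \<forall>f \<phi> u y N M Y.
   problem_class2 T b \<gamma> K d eps f \<phi> \<and> remainder2 T b d eps f \<phi> u y \<and> 0 < N \<and> 8 dvd N \<and> 2 <= M \<and>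
   (\<forall>i<N. mesh2 \<mu> T d eps N i < mesh2 \<mu> T d eps N (Suc i)) \<and>
   discrete_solution eps b N M (mesh2 \<mu> T d eps N) (tmesh T M) (rhs2 b d eps f \<phi>) y Y \<longrightarrow>
   error_le T C N M (mesh2 \<mu> T d eps N) y Y"
proof (rule ex_forward[OF initial_jump[where p=d and K="12 * K" and K\<^sub>0=K and \<gamma>=\<gamma>, OF less_imp_le[OF d(1)] less_imp_le[OF d(2)]]],
  intro ballI allI impI, elim conjE)
 fix C eps f \<phi> u y N M Y
 assume e: "eps \<in> {0<..1}" and pc: "problem_class2 T b \<gamma> K d eps f \<phi>" and rm: "remainder2 T b d eps f \<phi> u y"
  and N: "0 < N" "8 dvd N" "2 <= M" and mono: "\<forall>i<N. mesh2 \<mu> T d eps N i < mesh2 \<mu> T d eps N (Suc i)"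
  and Y: "discrete_solution eps b N M (mesh2 \<mu> T d eps N) (tmesh T M) (rhs2 b d eps f \<phi>) y Y"
  and main: "\<forall>eps\<in>{0<..1}. \<forall>J J3 f G2 y N M xs Y I F.
   jump_problem d (12 * K) K \<gamma> eps J J3 f G2 y F \<and> 0 < N \<and> 2 <= M \<and>
   mesh_ok eps m {0, d, 1} (mesh_const \<mu> T * rate N) I N xs \<and>
   discrete_solution eps b N M xs (tmesh T M) F y Y \<longrightarrow> error_le T C N M xs y Y"
 have f: "holder_space T 4 \<gamma> K f" and Cn: "Cn_space 4 ({0<..<1} - {d}) K \<phi>" using pc unfolding problem_class2_def by blast+
 have "Cn_space 4 {0<..<d} K \<phi>" "Cn_space 4 {d<..<1} K \<phi>" using d by (auto intro: Cn_mono[OF Cn])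
 note Cl = this(1) and Cr = this(2)
 obtain hl where hl: "\<forall>k<4. \<forall>z\<in>{0<..<d}. hl k z = (deriv ^^ k) \<phi> z"
  "\<forall>k<4. \<forall>z\<in>{0..d}. (abs (hl k z)) <= K" "\<forall>k<4. continuous_on {0..d} (hl k)"
  "\<forall>k. Suc k < 4 \<longrightarrow> tay K {0..d} (hl k) (hl (Suc k))"
  "\<forall>k<4. rlim k \<phi> 0 = hl k 0" "\<forall>k<4. llim k \<phi> d = hl k d"
  by (rule Cn_extension[OF Cl d(1)])
 obtain hr where hr: "\<forall>k<4. \<forall>z\<in>{d<..<1}. hr k z = (deriv ^^ k) \<phi> z"
  "\<forall>k<4. \<forall>z\<in>{d..1}. (abs (hr k z)) <= K" "\<forall>k<4. continuous_on {d..1} (hr k)"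
  "\<forall>k. Suc k < 4 \<longrightarrow> tay K {d..1} (hr k) (hr (Suc k))"
  "\<forall>k<4. rlim k \<phi> d = hr k d" "\<forall>k<4. llim k \<phi> 1 = hr k 1"
  by (rule Cn_extension[OF Cr d(2)])
 define J where "J = (hr 0 d - hl 0 d) / 2"
 define J3 where "J3 = (hr 3 d - hl 3 d) / 2"
 have bl: "abs (hl j z) <= K" if "j < 4" "0 <= z" "z <= d" for j z using hl(2) that by auto
 have br: "abs (hr j z) <= K" if "j < 4" "d <= z" "z <= 1" for j z using hr(2) that by auto
 have "abs (hl 0 d) <= K" "abs (hr 0 d) <= K" "abs (hl 3 d) <= K" "abs (hr 3 d) <= K"
  using bl[of _ d] br[of _ d] d by auto
 then have JK: "abs J <= K" "abs J3 <= K" by (simp_all add: J_def J3_def abs_le_iff)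
 have K0: "0 <= K" using JK(1) by linarith
 have lims: "rlim 0 \<phi> 0 = hl 0 0" "rlim 2 \<phi> 0 = hl 2 0" "llim 0 \<phi> 1 = hr 0 1" "llim 2 \<phi> 1 = hr 2 1"
  "llim 0 \<phi> d = hl 0 d" "rlim 0 \<phi> d = hr 0 d" "llim 1 \<phi> d = hl 1 d" "rlim 1 \<phi> d = hr 1 d" "llim 2 \<phi> d = hl 2 d" "rlim 2 \<phi> d = hr 2 d"
  using hl(5,6) hr(5,6) by auto
 have jump: "jump2 \<phi> d / 2 = J" by (simp add: jump2_def lims J_def)
 have cond: "hl 0 0 = 0" "hr 0 1 = 0" "hl 1 d = hr 1 d" "hl 2 d = hr 2 d" "f 0 0 = - eps * hl 2 0" "f 1 0 = - eps * hr 2 1"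
  using pc unfolding problem_class2_def lims by auto
 have yx: "y x t = u x t - J * sing eps (b 0) (x - d) t" if "0 <= x" "x <= 1" "0 <= t" "t <= T" for x t
  using rm that unfolding remainder2_def jump Qbar_def by auto
 have yd: "y d 0 = (hr 0 d + hl 0 d) / 2" using rm unfolding remainder2_def lims by auto
 have ub: "u 0 t = 0" "u 1 t = 0" if "0 <= t" "t <= T" for t using rm that unfolding remainder2_def by auto
 have ui: "u x 0 = \<phi> x" if "0 < x" "x < 1" "x \<noteq> d" for x using rm that unfolding remainder2_def by auto
 have yl: "y x 0 = hl 0 x + J" if x: "0 <= x" "x <= d" for x
 proof -
  consider "x = 0" | "x = d" | "0 < x" "x < d" using x by fastforce
  then show ?thesis
  proof cases
   case 1 then show ?thesis using yx[of 0 0] ub[of 0] T d cond(1) by (simp add: sing_def)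
  next
   case 2 then show ?thesis using yd by (simp add: J_def field_simps)
  next
   case 3 then show ?thesis using yx[of x 0] ui[of x] T d hl(1) by (auto simp: sing_def)
  qed
 qed
 have yr: "y x 0 = hr 0 x - J" if x: "d <= x" "x <= 1" for x
 proof -
  consider "x = 1" | "x = d" | "d < x" "x < 1" using x by fastforce
  then show ?thesis
  proof cases
   case 1 then show ?thesis using yx[of 1 0] ub[of 0] T d cond(2) by (simp add: sing_def)
  next
   case 2 then show ?thesis using yd by (simp add: J_def field_simps)
  next
   case 3 then show ?thesis using yx[of x 0] ui[of x] T d hr(1) by (auto simp: sing_def)
  qed
 qed
 \<comment> \<open>The cubic correction has opposite signs on the two sides of \<open>d\<close>. It
   vanishes at \<open>d\<close> in value, slope and curvature, so it changes only the third
   derivative, which becomes the mean of its two limits there.\<close>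
 define G2 where "G2 x = (if x <= d then hl 2 x - J3 * (-1 * (x - d)) else hr 2 x - J3 * (1 * (x - d)))" for x
 define G1 where "G1 x = (if x <= d then hl 1 x - J3 * (-1 * (x - d)^2 / 2) else hr 1 x - J3 * (1 * (x - d)^2 / 2))" for x
 define G3 where "G3 x = (if x <= d then hl 3 x - J3 * (-1) else hr 3 x - J3 * 1)" for x
 have psi: "smooth_data (4 * (3 * K)) (\<lambda>x. y x 0 - J3 * (abs (x - d)^3 / 6)) G2"
 proof (rule smooth_dataI)
  have tl: "tay (3 * K) {0..d} (\<lambda>x. hl j x - J3 * q x) (\<lambda>x. hl (Suc j) x - J3 * q' x)"
   if "Suc j < 4" "tay 1 {0..d} q q'" for j q q'
  proof (rule tay_cong[OF tay_mono[OF tay_add[OF hl(4)[rule_format, OF that(1)] tay_cmult[OF that(2), of "- J3"]] _ order_refl]])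
   show "K + abs (- J3) * 1 <= 3 * K" using JK K0 by simp
  qed auto
  have tr: "tay (3 * K) {d..1} (\<lambda>x. hr j x - J3 * q x) (\<lambda>x. hr (Suc j) x - J3 * q' x)"
   if "Suc j < 4" "tay 1 {d..1} q q'" for j q q'
  proof (rule tay_cong[OF tay_mono[OF tay_add[OF hr(4)[rule_format, OF that(1)] tay_cmult[OF that(2), of "- J3"]] _ order_refl]])
   show "K + abs (- J3) * 1 <= 3 * K" using JK K0 by simp
  qed auto
  have pl: "abs (-1::real) <= 1" "d - 1 <= 0" "d <= d + 1" and pr: "abs (1::real) <= 1" "d - 1 <= d" "1 <= d + 1" using d by auto
  note ql = tay_cubic_poly[OF pl] and qr = tay_cubic_poly[OF pr]
  have cub: "abs (x - d)^3 = (if x <= d then -1 * (x - d)^3 else 1 * (x - d)^3)" for x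
   by (simp add: abs_if power3_eq_cube algebra_simps)
  show "tay (3 * K) {0..1} (\<lambda>x. y x 0 - J3 * (abs (x - d)^3 / 6)) G1"
  proof (rule tay_glue[OF _ _ less_imp_le[OF d(1)] less_imp_le[OF d(2)]])
   show "tay (3 * K) {0..d} (\<lambda>x. y x 0 - J3 * (abs (x - d)^3 / 6)) G1"
   proof (rule tay_cong[OF tay_diff_const[OF tl[OF _ ql(1), of 0], of "- J"]])
    fix x assume x: "x \<in> {0..d}"
    show "y x 0 - J3 * (abs (x - d)^3 / 6) = hl 0 x - J3 * (-1 * (x - d)^3 / 6) - - J" unfolding cub using yl[of x] x by simp
   qed (simp_all add: G1_def)
   show "tay (3 * K) {d..1} (\<lambda>x. y x 0 - J3 * (abs (x - d)^3 / 6)) G1"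
   proof (rule tay_cong[OF tay_diff_const[OF tr[OF _ qr(1), of 0], of J]])
    fix x assume x: "x \<in> {d..1}"
    show "y x 0 - J3 * (abs (x - d)^3 / 6) = hr 0 x - J3 * (1 * (x - d)^3 / 6) - J" unfolding cub using yr[of x] x by auto
   qed (use cond(3) in \<open>auto simp: G1_def\<close>)
  qed
  show "tay (3 * K) {0..1} G1 G2"
  proof (rule tay_glue[OF _ _ less_imp_le[OF d(1)] less_imp_le[OF d(2)]])
   show "tay (3 * K) {0..d} G1 G2"
    by (rule tay_cong[OF tl[OF _ ql(2), of 1]]) (simp_all add: G1_def G2_def numeral_2_eq_2)
   show "tay (3 * K) {d..1} G1 G2"
    by (rule tay_cong[OF tr[OF _ qr(2), of 1]]) (use cond(3,4) in \<open>auto simp: G1_def G2_def numeral_2_eq_2\<close>)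
  qed
  show "tay (3 * K) {0..1} G2 G3"
  proof (rule tay_glue[OF _ _ less_imp_le[OF d(1)] less_imp_le[OF d(2)]])
   show "tay (3 * K) {0..d} G2 G3"
    by (rule tay_cong[OF tl[OF _ ql(3), of 2]]) (simp_all add: G2_def G3_def numeral_3_eq_3 numeral_2_eq_2)
   show "tay (3 * K) {d..1} G2 G3"
    by (rule tay_cong[OF tr[OF _ qr(3), of 2]])
     (use cond(4) in \<open>auto simp: G2_def G3_def J3_def numeral_3_eq_3 numeral_2_eq_2 field_simps\<close>)
  qed
  fix x :: real assume x: "0 <= x" "x <= 1"
  have "abs (x - d)^3 <= 1" using x d by (intro power_le_one) auto
  then have "abs (J3 * (abs (x - d)^3 / 6)) <= K * 1" unfolding abs_mult using JK(2) by (intro mult_mono) auto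
  moreover have "abs (y x 0) <= 2 * K"
   using yl[of x] yr[of x] bl[of 0 x] br[of 0 x] x JK(1) by (cases "x <= d") (auto simp: abs_le_iff)
  ultimately show "abs (y x 0 - J3 * (abs (x - d)^3 / 6)) <= 3 * K" by linarith
 qed
 obtain I where I: "mesh_ok eps m {0, d, 1} (mesh_const \<mu> T * rate N) I N (mesh2 \<mu> T d eps N)"
  using mesh2[OF _ _ N(1,2) d, of eps] e mono by auto
 have "jump_problem d (12 * K) K \<gamma> eps J J3 f G2 y (rhs2 b d eps f \<phi>)"
  unfolding jump_problem_def using f psi K0 JK cond rm yx[of 0] yx[of 1] ub d
  by (auto simp: remainder2_def rhs2_def jump G2_def algebra_simps)
 then show "error_le T C N M (mesh2 \<mu> T d eps N) y Y"
  using main[rule_format, OF e, of J J3 f G2 y "rhs2 b d eps f \<phi>" N M I] N I Y by simp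
qed

end

lemma tay_continuous:
 assumes t: "tay K {0..T} g g'" shows "continuous_on {0..T} g"
proof (cases "0 <= T")
 case True
 then have "0 <= K" using tayD(1)[OF t, of 0] by auto
 then show ?thesis
  by (intro lipschitz_on_continuous_on[of "K * (1 + T)"] lipschitz_onI)
   (use True in \<open>auto simp: dist_real_def intro!: tay_lipschitz[OF t]\<close>)
qed simp

section \<open>Jump in the boundary data\<close>

context setting
begin

text \<open>Three singular functions are subtracted. The source
  \<open>J * (b(d) - b(t)) * (1 - s)\<close> after time \<open>d\<close> splits into a part
  depending on time only and an error function layer at \<open>x = 0\<close>. The factor
  \<open>exp (- b(0) (t - d))\<close> keeps \<open>1 - s\<close> from being flat at
  \<open>x = 1\<close>; the kink of its trace there is removed by \<open>rk\<close> with its pole at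
  1.\<close>

lemma class3:
 assumes d: "0 < d" "d < T"
 shows "\<exists>C. \<forall>eps\<in>{0<..1}. \<forall>f \<phi>\<^sub>1 \<phi>\<^sub>2 y N M Y.
   problem_class3 T b \<gamma> K d f \<phi>\<^sub>1 \<phi>\<^sub>2 \<and> remainder3 T b d eps f \<phi>\<^sub>1 \<phi>\<^sub>2 y \<and> 0 < N \<and> 4 dvd N \<and> 2 <= M \<and>
   discrete_solution eps b N M (mesh13 \<mu> T eps N) (tmesh T M) (rhs3 b d eps f \<phi>\<^sub>1 \<phi>\<^sub>2) y Y \<longrightarrow>
   error_le T C N M (mesh13 \<mu> T eps N) y Y"
proof -
 define \<beta> where "\<beta> = b 0"
 have beta: "0 <= \<beta>" "\<beta> <= B" using T b[of 0] by (auto simp: \<beta>_def)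
 have dT: "0 <= d" "d <= T" using d by auto
 obtain E E' E'' e e' e'' L A where E: "0 <= L" "E d = 0" "E' d = 0" "flat_at T d L E E' E''"
  "\<forall>t\<in>{0..T}. E' t + b t * E t = (b d - b t) * exp (- \<beta> * (t - d))"
  "e = (\<lambda>t. exp (- \<beta> * (t - d)) + E t)" "e' d = - \<beta>" "C2_bound T A e e' e''"
  by (rule coefficient[OF dT beta(1)])
 \<comment> \<open>With rate 0 the exponential is 1, and \<open>H\<close> solves the equation with
   right-hand side \<open>b(d) - b(t)\<close>.\<close>
 obtain H H' H'' i i' i'' L4 A4 where H: "0 <= L4" "H d = 0" "H' d = 0" "flat_at T d L4 H H' H''"
  "\<forall>t\<in>{0..T}. H' t + b t * H t = (b d - b t) * exp (- 0 * (t - d))"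
  "i = (\<lambda>t. exp (- 0 * (t - d)) + H t)" "i' d = - 0" "C2_bound T A4 i i' i''"
  by (rule coefficient[OF dT order_refl])
 obtain k k' k'' Lk where k: "k d = 1" "1 <= Lk" "k' = (\<lambda>t. - b t * k t)" "C2_bound T Lk k k' k''"
  by (rule homogeneous[OF dT])
 note Hd = flat_atD[OF H(4)] and ed = C2_boundD[OF E(8)] and kd = C2_boundD[OF k(4)]
 have A: "0 <= A" using ed(6)[of 0] T by simp
 \<comment> \<open>The part of the trace at \<open>x = 1\<close> that is left when the error
   function is replaced by its limit 1. Both \<open>q\<close> and \<open>q'\<close> vanish at
   \<open>d\<close>: the slope \<open>- \<beta>\<close> of \<open>e\<close> there is met by the term
   from \<open>rk\<close>.\<close>
 define q where "q t = 1 + H t - e t - \<beta> * (k t * (t - d))" for t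
 define q' where "q' t = H' t - e' t - \<beta> * (k' t * (t - d) + k t)" for t
 define q'' where "q'' t = H'' t - e'' t - \<beta> * (k'' t * (t - d) + k' t + k' t)" for t
 define Q where "Q = L4 + A + B * (Lk * T + 2 * Lk)"
 have Q: "0 <= Q" using H(1) A B k(2) T by (simp add: Q_def)
 have qd: "(q has_real_derivative q' t) (at t within {0..T})" "(q' has_real_derivative q'' t) (at t within {0..T})"
  if t: "0 <= t" "t <= T" for t
  unfolding q_def[abs_def] q'_def[abs_def] q''_def
  by (auto intro!: derivative_eq_intros Hd(1,2)[OF t(2,1)] ed(1,2)[OF t] kd(1,2)[OF t] simp: algebra_simps)
 have q0: "q d = 0" "q' d = 0" using H(2,3) E(2,6,7) k(1) by (auto simp: q_def q'_def)
 have qb: "abs (q t) <= Q * (t - d)^2 \<and> abs (q' t) <= Q * (t - d) \<and> abs (q'' t) <= Q" if t: "d <= t" "t <= T" for t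
 proof -
  have b2: "abs (q'' z) <= Q" if z: "d <= z" "z <= t" for z
  proof -
   have zz: "0 <= z" "z <= T" using z t d by auto
   note kb = kd(3-5)[OF zz]
   have "abs (k'' z * (z - d)) <= Lk * T" unfolding abs_mult using kb k(2) z t d by (intro mult_mono) auto
   then have "abs (k'' z * (z - d) + k' z + k' z) <= Lk * T + 2 * Lk" using kb by linarith
   then have "abs (\<beta> * (k'' z * (z - d) + k' z + k' z)) <= B * (Lk * T + 2 * Lk)"
    unfolding abs_mult using beta by (intro mult_mono) auto
   moreover have "abs (H'' z) <= L4" "abs (e'' z) <= A" using Hd(3)[OF zz(2) z(1)] ed(5)[OF zz] by auto
   ultimately show ?thesis unfolding q''_def Q_def by linarith
  qed
  have b1: "abs (q' z) <= Q * (z - d)" if z: "d <= z" "z <= t" for z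
  proof -
   have "abs (q' z - q' d) <= Q * abs (z - d)"
    by (rule abs_diff_le_of_derivative[where s=d and t=t and S="{0..T}", OF qd(2)]) (use b2 z t d in auto)
   then show ?thesis using q0 z by simp
  qed
  have "abs (q t - q d) <= Q * (t - d) * abs (t - d)"
  proof (rule abs_diff_le_of_derivative[where s=d and t=t and S="{0..T}", OF qd(1)])
   fix z assume z: "d <= z" "z <= t"
   have "Q * (z - d) <= Q * (t - d)" using z Q by (intro mult_left_mono) auto
   then show "abs (q' z) <= Q * (t - d)" using b1[OF z] by linarith
  qed (use t d in auto)
  then have "abs (q t) <= Q * (t - d)^2" using q0 t by (simp add: power2_eq_square mult.assoc)
  then show ?thesis using b1[of t] b2[of t] t by simp
 qed
 let ?q = "\<lambda>t. if t <= d then 0 else q t" and ?q' = "\<lambda>t. if t <= d then 0 else q' t"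
 have trq: "tay (Q * (2 + T)) {0..T} ?q ?q'"
 proof (rule tay_flat[where G''=q'', OF dT])
  have tr: "((\<lambda>t. if t <= d then 0 else g t) has_real_derivative g' t) (at t within {0..T})"
   if "d < t" "t <= T" "(g has_real_derivative g' t) (at t within {0..T})" for g g' :: "real => real" and t
   by (rule has_field_derivative_transform_within[OF that(3), where d="t - d"]) (use that d in \<open>auto simp: dist_real_def\<close>)
  fix t assume t: "d < t" "t <= T"
  then have t': "0 <= t" using d by auto
  show "(?q has_real_derivative ?q' t) (at t within {0..T})" "(?q' has_real_derivative q'' t) (at t within {0..T})"
   using tr[of t q q', OF t qd(1)[OF t' t(2)]] tr[of t q' q'', OF t qd(2)[OF t' t(2)]] t by auto
  show "abs (?q t) <= Q * (t - d)^2 \<and> abs (?q' t) <= Q * (t - d) \<and> abs (q'' t) <= Q" using qb[of t] t by simp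
 qed (use Q in auto)
 define K' where "K' = 2 * abs K + 1"
 define RH where "RH = L4 * (2 + T)"
 define Rk where "Rk = Lk * (256 * exp 16 / 1^4 * (1 + T)) * (1 + T)^2 * (2 + T)"
 define Re where "Re = A * (256 * exp 16 / 1^4) * (1 + T)^2 * (2 + T)"
 define Rq where "Rq = Q * (2 + T)"
 define Kr where "Kr = B + 4 * K' + (K' * RH + K' * B * Rk) + (K' * Rq + K' * Re)"
 define D1 where "D1 = 6 * (L4 * (1 + T))"
 define D2 where "D2 = layer.cl T m (4 * (L * kc m T * (1 + T)^2))"
 define D3 where "D3 = layer.cl T m (4 * (Lk * kc m T * (1 + T)^2))"
 define D where "D = K' * D1 + K' * D2 + K' * B * D3"
 have R: "0 <= RH" "0 <= Rk" "0 <= Re" "0 <= Rq" unfolding RH_def Rk_def Re_def Rq_def using H(1) k(2) A Q T by simp_all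
 show ?thesis
 proof (intro exI[of _ "Ce Kr D"] ballI allI impI, elim conjE)
  fix eps f \<phi>\<^sub>1 \<phi>\<^sub>2 y N M Y
  assume "eps \<in> {0<..1}" and pc: "problem_class3 T b \<gamma> K d f \<phi>\<^sub>1 \<phi>\<^sub>2" and rm: "remainder3 T b d eps f \<phi>\<^sub>1 \<phi>\<^sub>2 y"
   and N: "0 < N" "4 dvd N" "2 <= M"
   and Y: "discrete_solution eps b N M (mesh13 \<mu> T eps N) (tmesh T M) (rhs3 b d eps f \<phi>\<^sub>1 \<phi>\<^sub>2) y Y"
  then have eps: "0 < eps" "eps <= 1" by auto
  have f: "holder_space T 4 \<gamma> K f" and C1: "Cn_space 2 {0<..<d} K \<phi>\<^sub>1" and C2: "Cn_space 2 {d<..<T} K \<phi>\<^sub>2"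
   using pc unfolding problem_class3_def by blast+
  have K': "2 * abs K <= K'" "0 <= K'" "0 <= K' * RH" "0 <= K' * B * Rk" "0 <= K' * Re" "0 <= K' * Rq"
   using R B by (auto simp: K'_def)
  have KK: "4 * K <= Kr" "B <= Kr" "K <= Kr" "0 <= Kr" "K + (K' * RH + K' * B * Rk) <= Kr" "K' * Rq + K' * Re <= Kr"
   using B K' unfolding Kr_def by linarith+
  obtain h1 where h1: "\<forall>k<2. \<forall>z\<in>{0<..<d}. h1 k z = (deriv ^^ k) \<phi>\<^sub>1 z"
   "\<forall>k<2. \<forall>z\<in>{0..d}. (abs (h1 k z)) <= K" "\<forall>k<2. continuous_on {0..d} (h1 k)"
   "\<forall>k. Suc k < 2 \<longrightarrow> tay K {0..d} (h1 k) (h1 (Suc k))"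
   "\<forall>k<2. rlim k \<phi>\<^sub>1 0 = h1 k 0" "\<forall>k<2. llim k \<phi>\<^sub>1 d = h1 k d"
   by (rule Cn_extension[OF C1 d(1)])
  obtain h2 where h2: "\<forall>k<2. \<forall>z\<in>{d<..<T}. h2 k z = (deriv ^^ k) \<phi>\<^sub>2 z"
   "\<forall>k<2. \<forall>z\<in>{d..T}. (abs (h2 k z)) <= K" "\<forall>k<2. continuous_on {d..T} (h2 k)"
   "\<forall>k. Suc k < 2 \<longrightarrow> tay K {d..T} (h2 k) (h2 (Suc k))"
   "\<forall>k<2. rlim k \<phi>\<^sub>2 d = h2 k d" "\<forall>k<2. llim k \<phi>\<^sub>2 T = h2 k T"
   by (rule Cn_extension[OF C2 d(2)])
  define J where "J = h2 0 d - h1 0 d"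
  have lims: "rlim 0 \<phi>\<^sub>2 d = h2 0 d" "llim 0 \<phi>\<^sub>1 d = h1 0 d" "rlim 1 \<phi>\<^sub>1 0 = h1 1 0" "llim 1 \<phi>\<^sub>1 d = h1 1 d" "rlim 1 \<phi>\<^sub>2 d = h2 1 d"
   using h1(5,6) h2(5) by auto
  have jump: "jump3 \<phi>\<^sub>1 \<phi>\<^sub>2 d = J" by (simp add: jump3_def lims J_def)
  have cond: "h1 1 d = h2 1 d" "\<phi>\<^sub>1 0 = 0" "f 0 0 = h1 1 0" "f 1 0 = 0"
   using pc unfolding problem_class3_def lims by auto
  have "abs (h1 0 d) <= K" "abs (h2 0 d) <= K" using h1(2) h2(2) d by auto
  then have JK: "abs J <= K'" using K' unfolding J_def by linarith
  have J\<beta>: "abs (J * \<beta>) <= K' * B" unfolding abs_mult using JK beta K' by (intro mult_mono) auto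
  define g where "g t = (if t <= d then h1 0 t else h2 0 t - J)" for t
  define g' where "g' t = (if t <= d then h1 1 t else h2 1 t)" for t
  have tg: "tay K {0..T} g g'"
  proof (rule tay_glue[OF _ _ dT])
   show "tay K {0..d} g g'"
    by (rule tay_cong[of _ _ "h1 0" "h1 1"]) (use h1(4)[rule_format, of 0] in \<open>auto simp: g_def g'_def\<close>)
   show "tay K {d..T} g g'"
    by (rule tay_cong[OF tay_diff_const[of _ _ "h2 0" "h2 1" J]])
     (use h2(4)[rule_format, of 0] cond(1) in \<open>auto simp: g_def g'_def J_def\<close>)
  qed
  have Hv: "Heav (t - d) = (if t < d then 0 else 1)" for t by (simp add: Heav_def)
  have y0: "y 0 t = (if t <= d then \<phi>\<^sub>1 t else \<phi>\<^sub>2 t - J)" if "0 <= t" "t <= T" for t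
   using rm that unfolding remainder3_def jump Hv by (auto simp: csing_def sing_def)
  have y1: "y 1 t = (if t <= d then 0 else - J * (1 - sing eps \<beta> 1 (t - d)))" if "0 <= t" "t <= T" for t
   using rm that unfolding remainder3_def jump Hv \<beta>_def by (auto simp: csing_def)
  have yi: "y x 0 = 0" if x: "0 <= x" "x <= 1" for x
  proof -
   consider "x = 0" | "x = 1" | "0 < x" "x < 1" using x by fastforce
   then show ?thesis using y0[of 0] y1[of 0] cond(2) d T rm unfolding remainder3_def by cases auto
  qed
  have yc: "continuous_on (Qbar T) (\<lambda>(x, t). y x t)" "solves_pde T eps b y (rhs3 b d eps f \<phi>\<^sub>1 \<phi>\<^sub>2)"
   using rm unfolding remainder3_def by blast+
  \<comment> \<open>The given functions enter through their point values at 0, \<open>d\<close> and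
    \<open>T\<close>, the extensions through limits. Both descriptions agree on the open pieces,
    which are dense, and \<open>y\<close> and \<open>g\<close> are continuous.\<close>
  have yg: "y 0 t = g t" if t: "0 <= t" "t <= T" for t
  proof -
   let ?S = "{0<..<d} \<union> {d<..<T}"
   have cl: "closure ?S = {0..T}" using d by (auto simp: closure_Un)
   have "continuous_on {0..T} (\<lambda>t. (\<lambda>(x, t). y x t) (0, t))"
    by (rule continuous_on_compose2[OF yc(1)]) (auto simp: Qbar_def intro!: continuous_intros)
   then have "continuous_on (closure ?S) (\<lambda>t. y 0 t - g t)"
    unfolding cl by (intro continuous_on_diff tay_continuous[OF tg]) simp
   moreover have "y 0 s - g s = 0" if "s \<in> ?S" for s
    using y0[of s] h1(1) h2(1) that d by (auto simp: g_def)
   ultimately have "y 0 t - g t = 0"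
    by (rule continuous_constant_on_closure) (use t cl in auto)
   then show ?thesis by simp
  qed
  let ?W = "\<lambda>(x::real) t. if t <= d then 0 else H t" and ?U = "kpart k0 E 1 eps 0 d" and ?V = "kpart rk k (-1) eps 1 d"
  let ?Wt = "\<lambda>(x::real) t. if t <= d then 0 else H' t"
  have W: "tay RH {0..T} (\<lambda>t. if t <= d then 0 else H t) (\<lambda>t. if t <= d then 0 else H' t)"
   "approx_ok T eps m {0, 1} d D1 ?W ?Wt (\<lambda>x t. 0)"
   "solves T eps b ?W ?Wt (\<lambda>x t. 0) (\<lambda>x t. if t <= d then 0 else b d - b t)"
   unfolding RH_def D1_def
   by (rule time_part[where c="\<lambda>t. b d - b t", OF dT(1) d(2) H(1) eps(1) H(4)]; use H(5) in simp)+
  obtain Ut Uxx where U: "approx_ok T eps m {0, 1} d D2 ?U Ut Uxx"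
   "solves T eps b ?U Ut Uxx (\<lambda>x t. if t <= d then 0 else (b d - b t) * exp (- \<beta> * (t - d)) * k0 ((x - 0) / sqrt eps) (t - d))"
   "\<forall>t\<le>T. continuous_on {0..1} (\<lambda>x. ?U x t)"
   unfolding D2_def
   by (rule erf_part[where P="{0, 1}" and p=0 and c="\<lambda>t. (b d - b t) * exp (- \<beta> * (t - d))", OF eps dT(1) _ E(1,4)])
    (use E(5) in auto)
  obtain Vt Vxx where V: "approx_ok T eps m {0, 1} d D3 ?V Vt Vxx" "solves T eps b ?V Vt Vxx (\<lambda>x t. 0)"
   "\<forall>t\<le>T. continuous_on {0..1} (\<lambda>x. ?V x t)"
   unfolding D3_def by (rule rk_part[where P="{0, 1}", OF eps dT(1) _ _ k(4)]) (use k(2,3) in auto)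
  have D0: "0 <= D1" "0 <= D2" "0 <= D3"
   using approx_ok_nonneg[OF W(2) T] approx_ok_nonneg[OF U(1) T] approx_ok_nonneg[OF V(1) T] .
  \<comment> \<open>The first two terms carry the source, with opposite signs for 1 and for
    \<open>s\<close>; the third solves the homogeneous equation and acts on the trace at
    \<open>x = 1\<close>.\<close>
  let ?S = "\<lambda>x t. (J * ?W x t + - J * ?U x t) + - (J * \<beta>) * ?V x t"
  let ?St = "\<lambda>x t. (J * ?Wt x t + - J * Ut x t) + - (J * \<beta>) * Vt x t"
  let ?Sxx = "\<lambda>x t. (J * 0 + - J * Uxx x t) + - (J * \<beta>) * Vxx x t"
  have S0: "?S x t = 0" if "t <= d" for x t using that by (simp add: kpart_def)
  define xi where "xi = 1 / sqrt eps"
  have xi: "1 <= abs xi" "1 <= xi" "sgn xi = 1" using eps by (auto simp: xi_def)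
  let ?G = "\<lambda>t. if t <= d then 0 else e t * (k0 xi (t - d) - sgn xi)"
  let ?Z = "\<lambda>t. if t <= d then 0 else k t * rk xi (t - d)"
  obtain G' where trG: "tay Re {0..T} ?G G'" "\<forall>t\<le>d. G' t = 0"
   unfolding Re_def by (rule trace_k0[OF dT zero_less_one xi(1) E(8)])
  obtain Z' where trZ: "tay Rk {0..T} ?Z Z'" "\<forall>t\<le>d. Z' t = 0"
   unfolding Rk_def by (rule trace_rk[OF dT zero_less_one xi(2) k(4)])
  \<comment> \<open>At \<open>x = 0\<close> the error function vanishes and \<open>rk\<close> is
    evaluated far from its pole, so its trace is flat. At \<open>x = 1\<close> the roles differ:
    \<open>rk\<close> equals the elapsed time there, and the error function is flat up to its limit
    1.\<close>
  let ?g0 = "\<lambda>t. g' t + (- J * ?Wt 0 t + (J * \<beta>) * Z' t)" and ?g1 = "\<lambda>t. - J * ?q' t + J * G' t"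
  have bd0: "tay Kr {0..T} (\<lambda>t. y 0 t - ?S 0 t) ?g0"
  proof (rule tay_cong[OF tay_mono[OF tay_add[OF tg tay_add[OF tay_cmult[OF W(1), of "- J"] tay_cmult[OF trZ(1), of "J * \<beta>"]]] _ order_refl]])
   have "abs (- J) * RH <= K' * RH" "abs (J * \<beta>) * Rk <= K' * B * Rk" using JK J\<beta> R by (auto intro!: mult_right_mono)
   then show "K + (abs (- J) * RH + abs (J * \<beta>) * Rk) <= Kr" using KK(5) by linarith
   fix t assume t: "t \<in> {0..T}"
   show "y 0 t - ?S 0 t = g t + (- J * (if t <= d then 0 else H t) + J * \<beta> * ?Z t)"
    using yg[of t] t by (auto simp: kpart_def xi_def algebra_simps)
  qed auto
  have bd1: "tay Kr {0..T} (\<lambda>t. y 1 t - ?S 1 t) ?g1"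
  proof (rule tay_cong[OF tay_mono[OF tay_add[OF tay_cmult[OF trq, of "- J", folded Rq_def] tay_cmult[OF trG(1), of J]] _ order_refl]])
   have "abs (- J) * Rq <= K' * Rq" "abs J * Re <= K' * Re" using JK R by (auto intro!: mult_right_mono)
   then show "abs (- J) * Rq + abs J * Re <= Kr" using KK(6) by linarith
   fix t assume t: "t \<in> {0..T}"
   show "y 1 t - ?S 1 t = - J * ?q t + J * ?G t"
   proof (cases "t <= d")
    case True then show ?thesis using y1[of t] t S0[of t 1] by simp
   next
    case False
    have "sing eps \<beta> 1 (t - d) = exp (- \<beta> * (t - d)) * k0 xi (t - d)"
     using sing_k0[OF eps(1), of "t - d" \<beta> 1] False by (simp add: xi_def)
    then have y: "y 1 t = - J * (1 - exp (- \<beta> * (t - d)) * k0 xi (t - d))" using y1[of t] t False by simp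
    have U1: "?U 1 t = E t * k0 xi (t - d)" and V1: "?V 1 t = k t * (t - d)"
     using False by (auto simp: kpart_def xi_def rk_0)
    show ?thesis
     unfolding y U1 V1 xi(3) q_def E(6) using False by (simp add: algebra_simps)
   qed
  qed auto
  obtain I where I: "mesh_ok eps m {0, 1} (mesh_const \<mu> T * rate N) I N (mesh13 \<mu> T eps N)"
   by (rule mesh13[OF eps N(1,2)])
  show "error_le T (Ce Kr D) N M (mesh13 \<mu> T eps N) y Y"
  proof (rule remainder_bound[where S="?S" and \<psi>\<^sub>2="\<lambda>x. 0",
    OF eps KK(2) dT(1) source_time[OF f KK(3)] source_space[OF f KK(1)] order_refl _ _ _ yc _ bd0 bd1 _ _ I N(1,3) Y])
   have 1: "approx_ok T eps m {0, 1} d (K' * D1) (\<lambda>x t. J * ?W x t) (\<lambda>x t. J * ?Wt x t) (\<lambda>x t. J * 0)"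
    by (rule approx_ok_cmult[OF W(2) eps(1)]) (use JK D0 in \<open>auto intro!: mult_right_mono\<close>)
   have 2: "approx_ok T eps m {0, 1} d (K' * D2) (\<lambda>x t. - J * ?U x t) (\<lambda>x t. - J * Ut x t) (\<lambda>x t. - J * Uxx x t)"
    by (rule approx_ok_cmult[OF U(1) eps(1)]) (use JK D0 in \<open>auto intro!: mult_right_mono\<close>)
   have 3: "approx_ok T eps m {0, 1} d (K' * B * D3) (\<lambda>x t. - (J * \<beta>) * ?V x t) (\<lambda>x t. - (J * \<beta>) * Vt x t) (\<lambda>x t. - (J * \<beta>) * Vxx x t)"
    by (rule approx_ok_cmult[OF V(1) eps(1)]) (use J\<beta> D0 in \<open>auto intro!: mult_right_mono\<close>)
   show "approx_ok T eps m {0, 1} d D ?S ?St ?Sxx"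
    unfolding D_def by (rule approx_ok_add[OF approx_ok_add[OF 1 2 eps(1)] 3 eps(1)])
   show "solves T eps b ?S ?St ?Sxx (\<lambda>x t. rhs3 b d eps f \<phi>\<^sub>1 \<phi>\<^sub>2 x t - f x t)"
   proof (rule solves_cong[OF solves_add[OF solves_add[OF solves_cmult[OF W(3)] solves_cmult[OF U(2)]] solves_cmult[OF V(2)]]])
    fix x t :: real
    show "(J * (if t <= d then 0 else b d - b t) +
      - J * (if t <= d then 0 else (b d - b t) * exp (- \<beta> * (t - d)) * k0 ((x - 0) / sqrt eps) (t - d))) + - (J * \<beta>) * 0
      = rhs3 b d eps f \<phi>\<^sub>1 \<phi>\<^sub>2 x t - f x t"
     using sing_k0[OF eps(1), of "t - d" \<beta> x]
     by (auto simp: rhs3_def jump Hv csing_def \<beta>_def[symmetric] algebra_simps)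
   qed
   show "continuous_on {0..1} (\<lambda>x. ?S x t)" if "t <= T" for t using U(3) V(3) that by (intro continuous_intros) auto
   show "smooth_data Kr (\<lambda>x. y x 0 - ?S x 0) (\<lambda>x. 0)"
   proof (rule smooth_data_mono[OF smooth_dataI[of 0]])
    show "tay 0 {0..1} (\<lambda>x. y x 0 - ?S x 0) (\<lambda>x. 0)" using yi S0[OF dT(1)] by (simp add: tay_def)
    show "abs (y x 0 - ?S x 0) <= 0" if "0 <= x" "x <= 1" for x using yi[OF that] S0[OF dT(1), of x] by simp
   qed (use KK in \<open>auto simp: tay_def\<close>)
   show "?g0 0 = eps * 0 - b 0 * (y 0 0 - ?S 0 0) + f 0 0"
    using yi[of 0] S0[OF dT(1), of 0] dT cond(3) trZ(2) by (simp add: g'_def)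
   show "?g1 0 = eps * 0 - b 0 * (y 1 0 - ?S 1 0) + f 1 0"
    using yi[of 1] S0[OF dT(1), of 1] dT cond(4) trG(2) by simp
  qed
 qed
qed

end

text \<open>The constants from the class lemmas are chosen before the data, for fixed
  \<open>K\<close> and, where it occurs, fixed \<open>d\<close>; they therefore serve every family
  of data indexed by the perturbation parameter.\<close>

theorem theorem3:
  fixes T \<mu> \<gamma> :: real and b :: "real \<Rightarrow> real"
  assumes "0 < T" and "0 < \<mu>" and "\<mu> < 1" and "0 < \<gamma>"
    and "\<exists>B. holder_space T 4 \<gamma> B (\<lambda>x t. b t)"
    and "\<forall>t\<in>{0..T}. 0 \<le> b t"
  shows
    "(\<forall>K f \<phi>. \<exists>C. \<forall>\<epsilon>\<in>{0<..1}. \<forall>u y N M Y.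
       problem_class1 T b \<gamma> K \<epsilon> (f \<epsilon>) (\<phi> \<epsilon>) \<and>
       remainder1 T b \<epsilon> (f \<epsilon>) (\<phi> \<epsilon>) u y \<and>
       0 < N \<and> 4 dvd N \<and> 2 \<le> M \<and>
       discrete_solution \<epsilon> b N M (mesh13 \<mu> T \<epsilon> N) (tmesh T M) (rhs1 b \<epsilon> (f \<epsilon>) (\<phi> \<epsilon>)) y Y
       \<longrightarrow>
         sup_norm (Qbar T) (\<lambda>(x, t). y x t - bilinear_interp (mesh13 \<mu> T \<epsilon> N) (tmesh T M) Y x t)
         \<le> ereal ((C * (ln (real N))\<^sup>2 / (real N)\<^sup>2 + C / real M) * ln (real M))) \<and>
     (\<forall>d K f \<phi>. 0 < d \<and> d < 1 \<longrightarrow> (\<exists>C. \<forall>\<epsilon>\<in>{0<..1}. \<forall>u y N M Y.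
       problem_class2 T b \<gamma> K d \<epsilon> (f \<epsilon>) (\<phi> \<epsilon>) \<and>
       remainder2 T b d \<epsilon> (f \<epsilon>) (\<phi> \<epsilon>) u y \<and>
       0 < N \<and> 8 dvd N \<and> 2 \<le> M \<and> (\<forall>i<N. mesh2 \<mu> T d \<epsilon> N i < mesh2 \<mu> T d \<epsilon> N (Suc i)) \<and>
       discrete_solution \<epsilon> b N M (mesh2 \<mu> T d \<epsilon> N) (tmesh T M) (rhs2 b d \<epsilon> (f \<epsilon>) (\<phi> \<epsilon>)) y Y
       \<longrightarrow>
         sup_norm (Qbar T) (\<lambda>(x, t). y x t - bilinear_interp (mesh2 \<mu> T d \<epsilon> N) (tmesh T M) Y x t)
         \<le> ereal ((C * (ln (real N))\<^sup>2 / (real N)\<^sup>2 + C / real M) * ln (real M)))) \<and>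
     (\<forall>d K f \<phi>\<^sub>1 \<phi>\<^sub>2. 0 < d \<and> d < T \<longrightarrow> (\<exists>C. \<forall>\<epsilon>\<in>{0<..1}. \<forall>y N M Y.
       problem_class3 T b \<gamma> K d (f \<epsilon>) (\<phi>\<^sub>1 \<epsilon>) (\<phi>\<^sub>2 \<epsilon>) \<and>
       remainder3 T b d \<epsilon> (f \<epsilon>) (\<phi>\<^sub>1 \<epsilon>) (\<phi>\<^sub>2 \<epsilon>) y \<and>
       0 < N \<and> 4 dvd N \<and> 2 \<le> M \<and>
       discrete_solution \<epsilon> b N M (mesh13 \<mu> T \<epsilon> N) (tmesh T M)
         (rhs3 b d \<epsilon> (f \<epsilon>) (\<phi>\<^sub>1 \<epsilon>) (\<phi>\<^sub>2 \<epsilon>)) y Y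
       \<longrightarrow>
         sup_norm (Qbar T) (\<lambda>(x, t). y x t - bilinear_interp (mesh13 \<mu> T \<epsilon> N) (tmesh T M) Y x t)
         \<le> ereal ((C * (ln (real N))\<^sup>2 / (real N)\<^sup>2 + C / real M) * ln (real M))))"
proof -
  obtain B\<^sub>0 where h: "holder_space T 4 \<gamma> B\<^sub>0 (\<lambda>x t. b t)" using assms(5) by blast
  obtain B b' where "setting T \<mu> B b b'" by (rule setting_exists[OF assms(1,2) h assms(6)])
  then interpret setting T \<mu> B b b' .
  show ?thesis
  proof (intro conjI allI impI, goal_cases)
    case (1 K)
    show ?case by (rule ex_forward[OF class1[of \<gamma> K, unfolded error_le_def]]) blast
  next
    case (2 d K)
    then show ?case using class2[of d \<gamma> K, unfolded error_le_def] by (elim conjE meta_mp ex_forward) blast+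
  next
    case (3 d K)
    then show ?case using class3[of d \<gamma> K, unfolded error_le_def] by (elim conjE meta_mp ex_forward) blast+
  qed
qed

end
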